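(* Let $q\in L_1[0,1]$ be complex-valued with $\int_0^1 q(x)\,dx=0$, let $\alpha\in\mathbb{C}$, $\alpha\neq\pm1$, and let $T_4$ be the operator in $L_2[0,1]$ generated by $-y''+q(x)y$ and the boundary conditions $y'(0)+y'(1)=0$, $y(0)+\alpha y(1)=0$. Put $s_k=\int_0^1 q(x)\sin 2\pi kx\,dx$ and $\gamma_4=\dfrac{8\pi(1-\alpha)}{1+\alpha}$. If $$\lim_{n\to\infty}\frac{\ln|n|}{n\,s_{2n+1}}=0,$$ then the large eigenvalues $\lambda_{n,j,4}$ of $T_4$ are simple and satisfy the asymptotic formulas $$\lambda_{n,j,4}=((2n+1)\pi)^2+(-1)^j\frac{\sqrt{2\gamma_4}}{2}\sqrt{(2n+1)s_{2n+1}}\,(1+o(1))$$ for $j=1,2$. The normalized eigenfunctions $\Psi_{n,j,4}$ corresponding to $\lambda_{n,j,4}$ obey (up to multiplication by a constant of modulus one) $$\Psi_{n,j,4}(x)=\sqrt{2}\sin (2n+1)\pi x+O(n^{-1/2}).$$ Moreover, if there exists a sequence $\{n_k\}$ of positive integers with $n_k\to\infty$ such that $\lim_{k\to\infty}\dfrac{\ln|n_k|}{n_k\,s_{2n_k+1}}=0$, then the root functions of $T_4$ do not form a Riesz basis in $L_2[0,1]$.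
   Context: The eigenvalues of $T_4$ consist of two sequences $\{\lambda_{n,1,4}\},\{\lambda_{n,2,4}\}$ (counted with algebraic multiplicity) with $\lambda_{n,j,4}=(2n\pi+\pi)^2+O(n^{1/2})$, $j=1,2$. "Large eigenvalues are simple" means that there is $N$ such that $\lambda_{n,j,4}$ is simple for all $n>N$, $j=1,2$. For each large $n$ the labels $j=1,2$ are assigned suitably, with a fixed choice of branch of the square roots. Eigenfunctions are normalized by $\|\Psi_{n,j,4}\|_{L_2[0,1]}=1$, and the $O$-term is uniform in $x\in[0,1]$ as $n\to\infty$. The root functions of an operator are its eigenfunctions and associated functions. *)

theory Defs
  imports "HOL-Analysis.Analysis" "HOL-Library.Landau_Symbols" "HOL-Library.Function_Algebras"
begin

text \<open>
  Elements of the spaces \<open>L\<^sub>1[0,1]\<close> and \<open>L\<^sub>2[0,1]\<close> are represented by functions on the real line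
  that are only inspected on \<open>[0,1]\<close>; equality in these spaces is equality almost everywhere
  with respect to \<open>I01\<close>.
\<close>

abbreviation I01 :: "real measure" where
  "I01 \<equiv> lebesgue_on {0..1}"

definition L2_01 :: "(real \<Rightarrow> complex) set" where
  "L2_01 = {f. f \<in> borel_measurable I01 \<and> integrable I01 (\<lambda>x. (cmod (f x))\<^sup>2)}"

definition L2_inner :: "(real \<Rightarrow> complex) \<Rightarrow> (real \<Rightarrow> complex) \<Rightarrow> complex" where
  "L2_inner f g = (LINT x|I01. f x * cnj (g x))"

definition L2_norm :: "(real \<Rightarrow> complex) \<Rightarrow> real" where
  "L2_norm f = sqrt (LINT x|I01. (cmod (f x))\<^sup>2)"

definition L2_eq :: "(real \<Rightarrow> complex) \<Rightarrow> (real \<Rightarrow> complex) \<Rightarrow> bool" where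
  "L2_eq f g \<longleftrightarrow> (AE x in I01. f x = g x)"


subsection \<open>Riesz bases\<close>

definition L2_orthonormal_basis :: "(nat \<Rightarrow> real \<Rightarrow> complex) \<Rightarrow> bool" where
  "L2_orthonormal_basis e \<longleftrightarrow>
     (\<forall>i. e i \<in> L2_01) \<and>
     (\<forall>i j. L2_inner (e i) (e j) = (if i = j then 1 else 0)) \<and>
     (\<forall>f\<in>L2_01. \<forall>\<epsilon>>0. \<exists>(N::nat) c. L2_norm (\<lambda>x. f x - (\<Sum>i<N. c i * e i x)) < \<epsilon>)"

text \<open>
  Linearity is required up to equality almost everywhere. Together with the norm bound it forces
  the operator to respect \<^const>\<open>L2_eq\<close>, so it is an operator on equivalence classes.
\<close>

definition L2_bounded_linear :: "((real \<Rightarrow> complex) \<Rightarrow> (real \<Rightarrow> complex)) \<Rightarrow> bool" where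
  "L2_bounded_linear A \<longleftrightarrow>
     (\<forall>f\<in>L2_01. A f \<in> L2_01) \<and>
     (\<forall>f\<in>L2_01. \<forall>g\<in>L2_01. L2_eq (A (\<lambda>x. f x + g x)) (\<lambda>x. A f x + A g x)) \<and>
     (\<forall>f\<in>L2_01. \<forall>c. L2_eq (A (\<lambda>x. c * f x)) (\<lambda>x. c * A f x)) \<and>
     (\<exists>K. \<forall>f\<in>L2_01. L2_norm (A f) \<le> K * L2_norm f)"

text \<open>A Riesz basis is the image of an orthonormal basis under a bounded operator with bounded
  inverse.\<close>

definition L2_riesz_basis :: "(nat \<Rightarrow> real \<Rightarrow> complex) \<Rightarrow> bool" where
  "L2_riesz_basis \<phi> \<longleftrightarrow>
     (\<exists>e A B. L2_orthonormal_basis e \<and> L2_bounded_linear A \<and> L2_bounded_linear B \<and>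
        (\<forall>f\<in>L2_01. L2_eq (A (B f)) f \<and> L2_eq (B (A f)) f) \<and>
        (\<forall>i. L2_eq (\<phi> i) (A (e i))))"


subsection \<open>The differential operator\<close>

definition absolutely_continuous_on :: "real \<Rightarrow> real \<Rightarrow> (real \<Rightarrow> complex) \<Rightarrow> bool" where
  "absolutely_continuous_on a b g \<longleftrightarrow>
     (\<forall>\<epsilon>>0. \<exists>\<delta>>0. \<forall>(n::nat) u v.
        (\<forall>i<n. a \<le> u i \<and> u i \<le> v i \<and> v i \<le> b) \<and>
        (\<forall>i<n. \<forall>j<n. i \<noteq> j \<longrightarrow> {u i<..<v i} \<inter> {u j<..<v j} = {}) \<and>
        (\<Sum>i<n. v i - u i) < \<delta>
        \<longrightarrow> (\<Sum>i<n. cmod (g (v i) - g (u i))) < \<epsilon>)"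

definition D01 :: "(real \<Rightarrow> complex) \<Rightarrow> real \<Rightarrow> complex" where
  "D01 y x = vector_derivative y (at x within {0..1})"

text \<open>For \<open>y\<close> in the operator domain below, the second derivative exists almost everywhere only;
  at the remaining points of \<open>[0,1]\<close> the value of the following expression is irrelevant.\<close>

definition sl_expr :: "(real \<Rightarrow> complex) \<Rightarrow> (real \<Rightarrow> complex) \<Rightarrow> real \<Rightarrow> complex" where
  "sl_expr q y x = - D01 (D01 y) x + q x * y x"

text \<open>
  Each class in the domain of the operator has exactly one continuously differentiable
  representative on \<open>[0,1]\<close>; extending it by zero makes the representative unique as a function
  on the real line, so that linear dimensions can be computed in the function space.
\<close>

definition T4_dom :: "(real \<Rightarrow> complex) \<Rightarrow> complex \<Rightarrow> (real \<Rightarrow> complex) set" where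
  "T4_dom q \<alpha> = {y.
     (\<forall>x. x \<notin> {0..1} \<longrightarrow> y x = 0) \<and>
     (\<forall>x\<in>{0..1}. y differentiable (at x within {0..1})) \<and>
     absolutely_continuous_on 0 1 (D01 y) \<and>
     sl_expr q y \<in> L2_01 \<and>
     D01 y 0 + D01 y 1 = 0 \<and>
     y 0 + \<alpha> * y 1 = 0}"

definition T4_eigenfunction ::
  "(real \<Rightarrow> complex) \<Rightarrow> complex \<Rightarrow> complex \<Rightarrow> (real \<Rightarrow> complex) \<Rightarrow> bool" where
  "T4_eigenfunction q \<alpha> \<mu> y \<longleftrightarrow>
     y \<in> T4_dom q \<alpha> \<and> y \<noteq> 0 \<and> L2_eq (sl_expr q y) (\<lambda>x. \<mu> * y x)"

definition T4_eigenvalues :: "(real \<Rightarrow> complex) \<Rightarrow> complex \<Rightarrow> complex set" where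
  "T4_eigenvalues q \<alpha> = {\<mu>. \<exists>y. T4_eigenfunction q \<alpha> \<mu> y}"

text \<open>The kernel of the \<open>k\<close>-th power of \<open>T\<^sub>4 - \<mu>\<close>.\<close>

primrec T4_kernel_power ::
  "(real \<Rightarrow> complex) \<Rightarrow> complex \<Rightarrow> complex \<Rightarrow> nat \<Rightarrow> (real \<Rightarrow> complex) set" where
  "T4_kernel_power q \<alpha> \<mu> 0 = {0}"
| "T4_kernel_power q \<alpha> \<mu> (Suc k) =
     {y \<in> T4_dom q \<alpha>. \<exists>z\<in>T4_kernel_power q \<alpha> \<mu> k.
        L2_eq (\<lambda>x. sl_expr q y x - \<mu> * y x) z}"

definition T4_root_space ::
  "(real \<Rightarrow> complex) \<Rightarrow> complex \<Rightarrow> complex \<Rightarrow> (real \<Rightarrow> complex) set" where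
  "T4_root_space q \<alpha> \<mu> = (\<Union>k. T4_kernel_power q \<alpha> \<mu> k)"

text \<open>The nonzero elements of the root spaces are exactly the eigenfunctions and the associated
  functions.\<close>

definition T4_root_functions :: "(real \<Rightarrow> complex) \<Rightarrow> complex \<Rightarrow> (real \<Rightarrow> complex) set" where
  "T4_root_functions q \<alpha> = (\<Union>\<mu>. T4_root_space q \<alpha> \<mu>) - {0}"

interpretation cfun: vector_space "\<lambda>(c::complex) (f::real \<Rightarrow> complex) x. c * f x"
  by unfold_locales (auto simp: fun_eq_iff algebra_simps)

text \<open>Note that \<open>cfun.dim\<close> is \<open>0\<close> on infinite-dimensional spaces.\<close>

definition T4_alg_mult :: "(real \<Rightarrow> complex) \<Rightarrow> complex \<Rightarrow> complex \<Rightarrow> nat" where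
  "T4_alg_mult q \<alpha> \<mu> = cfun.dim (T4_root_space q \<alpha> \<mu>)"

definition T4_simple_eigenvalue :: "(real \<Rightarrow> complex) \<Rightarrow> complex \<Rightarrow> complex \<Rightarrow> bool" where
  "T4_simple_eigenvalue q \<alpha> \<mu> \<longleftrightarrow> \<mu> \<in> T4_eigenvalues q \<alpha> \<and> T4_alg_mult q \<alpha> \<mu> = 1"

text \<open>
  The eigenvalues, counted with algebraic multiplicity, consist of the two sequences
  \<open>ev n 1\<close> and \<open>ev n 2\<close>, \<open>n = 0, 1, 2, \<dots>\<close>. Since the fibre of an eigenvalue is finite and nonempty,
  the second condition also entails that its root space is finite-dimensional.
\<close>

definition T4_eigenvalue_sequences ::
  "(real \<Rightarrow> complex) \<Rightarrow> complex \<Rightarrow> (nat \<Rightarrow> nat \<Rightarrow> complex) \<Rightarrow> bool" where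
  "T4_eigenvalue_sequences q \<alpha> ev \<longleftrightarrow>
     {ev n j | n j. j \<in> {1,2}} = T4_eigenvalues q \<alpha> \<and>
     (\<forall>\<mu>\<in>T4_eigenvalues q \<alpha>.
        finite {(n, j). j \<in> {1,2} \<and> ev n j = \<mu>} \<and>
        card {(n, j). j \<in> {1,2} \<and> ev n j = \<mu>} = T4_alg_mult q \<alpha> \<mu>) \<and>
     (\<forall>j\<in>{1,2}. (\<lambda>n. ev n j - of_real ((2 * real n * pi + pi)\<^sup>2))
                   \<in> O(\<lambda>n. of_real (sqrt (real n))))"

definition sin_coeff01 :: "(real \<Rightarrow> complex) \<Rightarrow> nat \<Rightarrow> complex" where
  "sin_coeff01 q k = (LINT x|I01. q x * of_real (sin (2 * pi * real k * x)))"

definition gamma4 :: "complex \<Rightarrow> complex" where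
  "gamma4 \<alpha> = 8 * of_real pi * (1 - \<alpha>) / (1 + \<alpha>)"

end

theory Submission
  imports Defs "HOL-Complex_Analysis.Complex_Analysis"
begin

text \<open>
  The eigenvalues are the zeros of an entire function. Let \<open>c\<close> and \<open>s\<close> be the solutions of
  \<open>-y'' + q y = \<mu> y\<close> with \<open>c(0) = 1, c'(0) = 0\<close> and \<open>s(0) = 0, s'(0) = 1\<close>. The boundary conditions
  admit a nontrivial solution iff \<open>\<Delta>(\<mu>) = 1 + \<alpha> + s'(1) + \<alpha> c(1)\<close> vanishes (\<open>eigenvalue_iff\<close>), and the
  order of the zero is the algebraic multiplicity (\<open>alg_mult_zorder\<close>): expanding the solutions in
  powers of the spectral parameter produces the Jordan chain of \<open>\<mu>\<close>.

  Variation of constants, iterated twice, gives for large \<open>\<rho>\<close>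
    \<open>\<Delta>(\<rho>\<^sup>2) = (1 + \<alpha>) (1 + cos \<rho>) + (1 - \<alpha>)/(2 \<rho>) I(\<rho>) + O(exp \<bar>Im \<rho>\<bar> / \<bar>\<rho>\<bar>\<^sup>2)\<close>
  with \<open>I(\<rho>) = \<integral>\<^sub>0\<^sup>1 q(t) sin (\<rho>(2t - 1)) dt\<close> (\<open>\<Delta>_asymptotics\<close>); the vanishing mean of \<open>q\<close> removes the
  remaining first order term. The leading part has double zeros at \<open>r\<^sub>n = (2n+1)\<pi>\<close>, and Rouche's
  theorem on the circles \<open>\<bar>\<mu>\<bar> = (2\<pi>n)\<^sup>2\<close> puts exactly two zeros of \<open>\<Delta>\<close> between consecutive large circles.
  At \<open>r\<^sub>n\<close> the integral equals \<open>-s\<^sub>2\<^sub>n\<^sub>+\<^sub>1\<close>, while \<open>1 + cos \<rho>\<close> is quadratic there. Rescaling by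
  \<open>\<rho> = r\<^sub>n + \<kappa>\<^sub>n w\<close> with \<open>\<kappa>\<^sub>n\<^sup>2 = (1-\<alpha>)/(1+\<alpha>) s\<^sub>2\<^sub>n\<^sub>+\<^sub>1 / r\<^sub>n\<close> turns the equation into \<open>w\<^sup>2 - 1 = o(1)\<close>, as
  soon as \<open>r\<^sub>n \<bar>s\<^sub>2\<^sub>n\<^sub>+\<^sub>1\<bar>\<close> is large (\<open>scaled_estimate\<close>); so there is one simple zero near each of
  \<open>w = -1\<close> and \<open>w = 1\<close>. Squaring \<open>r\<^sub>n \<plusminus> \<kappa>\<^sub>n\<close> gives the asymptotic formula, and the fixed square roots
  entering \<open>\<kappa>\<^sub>n\<close> determine the labels.

  An eigenfunction for one of these zeros satisfies \<open>y(0) = O(n\<^sup>-\<^sup>1\<^sup>/\<^sup>2) y'(0)/\<rho>\<close>, because the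
  condition \<open>y(0) + \<alpha> y(1) = 0\<close> has the coefficient \<open>1 + \<alpha> c(1)\<close>, close to \<open>1 - \<alpha> \<noteq> 0\<close>, in front of \<open>y(0)\<close>.
  Hence it is a multiple of \<open>sin r\<^sub>n x\<close> up to a relative error \<open>O(n\<^sup>-\<^sup>1\<^sup>/\<^sup>2)\<close> (\<open>eigenfunction_shape\<close>). In
  particular the two eigenfunctions of a pair are asymptotically parallel. A Riesz basis of root
  functions is complete, and root functions for other eigenvalues are orthogonal to the solution of the
  adjoint problem, so the basis has to contain both of them; but two elements of a Riesz basis
  cannot be arbitrarily close to parallel (\<open>no_riesz_basis\<close>).

  As \<open>q\<close> is merely integrable, solutions have absolutely continuous derivatives only. The first part
  therefore proves, by Vitali coverings, that indefinite Lebesgue integrals have the expected derivative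
  almost everywhere and that an absolutely continuous function is determined up to a constant by its
  almost everywhere derivative; the differential equation is then treated as a first order system of
  integral identities.
\<close>

section \<open>Disjoint families of intervals and Vitali coverings\<close>

definition opn :: "(real \<times> real) set \<Rightarrow> real set" where
  "opn D = (\<Union>I\<in>D. {fst I<..<snd I})"

definition len :: "(real \<times> real) set \<Rightarrow> real" where
  "len D = (\<Sum>I\<in>D. snd I - fst I)"

definition incr :: "(real \<Rightarrow> 'a::real_normed_vector) \<Rightarrow> (real \<times> real) set \<Rightarrow> 'a" where
  "incr F D = (\<Sum>I\<in>D. F (snd I) - F (fst I))"

text \<open>
  Families are sets of pairs instead of indexed families, so that subfamilies, unions and
  complements are set operations; nonempty open intervals make distinct members distinct as sets.
\<close>

definition dfam :: "real \<Rightarrow> real \<Rightarrow> (real \<times> real) set \<Rightarrow> bool" where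
  "dfam a b D \<longleftrightarrow> finite D \<and> (\<forall>I\<in>D. a \<le> fst I \<and> fst I < snd I \<and> snd I \<le> b) \<and>
     pairwise (\<lambda>I J. disjnt {fst I<..<snd I} {fst J<..<snd J}) D"

lemma dfam_subset: "dfam a b D \<Longrightarrow> E \<subseteq> D \<Longrightarrow> dfam a b E"
  unfolding dfam_def by (meson finite_subset pairwise_subset subsetD)

lemma dfam_Un:
  assumes "dfam a b D" "dfam a b E" "opn D \<inter> opn E = {}"
  shows "dfam a b (D \<union> E)" "D \<inter> E = {}"
proof -
  have 1: "disjnt {fst I<..<snd I} {fst J<..<snd J}" if "I \<in> D" "J \<in> E" for I J
    using assms(3) that unfolding opn_def disjnt_def by blast
  show "dfam a b (D \<union> E)"
    unfolding dfam_def pairwise_def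
  proof (intro conjI ballI impI)
    show "finite (D \<union> E)" using assms(1,2) by (auto simp: dfam_def)
    fix I assume I: "I \<in> D \<union> E"
    show "a \<le> fst I" "fst I < snd I" "snd I \<le> b" using I assms(1,2) by (auto simp: dfam_def)
    fix J assume J: "J \<in> D \<union> E" "I \<noteq> J"
    show "disjnt {fst I<..<snd I} {fst J<..<snd J}"
      using I J 1[of I J] 1[of J I, THEN disjnt_sym] assms(1,2) unfolding dfam_def pairwise_def by blast
  qed
  show "D \<inter> E = {}"
  proof (rule ccontr)
    assume "D \<inter> E \<noteq> {}"
    then obtain I where "I \<in> D" "I \<in> E" by blast
    then have "{fst I<..<snd I} = {}" "fst I < snd I" using 1[of I I] assms(1) by (auto simp: disjnt_def dfam_def)
    then show False by simp
  qed
qed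

lemma open_opn: "open (opn D)"
  unfolding opn_def by auto

lemma opn_lmeasurable: "dfam a b D \<Longrightarrow> opn D \<in> lmeasurable"
  unfolding opn_def dfam_def by (intro fmeasurable.finite_UN) auto

lemma opn_Un: "opn (D \<union> E) = opn D \<union> opn E"
  unfolding opn_def by auto

lemma measure_opn:
  assumes "dfam a b D" shows "measure lebesgue (opn D) = len D"
proof -
  have "measure lebesgue (opn D) = (\<Sum>I\<in>D. measure lebesgue {fst I<..<snd I})"
    unfolding opn_def using assms
    by (intro measure_finite_Union) (auto simp: dfam_def disjoint_family_on_def pairwise_def disjnt_def emeasure_lborel_Ioo)
  also have "\<dots> = len D"
    unfolding len_def using assms by (intro sum.cong) (auto simp: dfam_def)
  finally show ?thesis .
qed

text \<open>
  The gaps of the family inside \<open>[a,b]\<close> form a family of the same kind, and the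
  increments of any function telescope over both together.
\<close>

lemma dfam_complement:
  assumes "dfam a b D" "a \<le> b"
  shows "\<exists>R. dfam a b R \<and> opn D \<inter> opn R = {} \<and> (\<forall>F::real \<Rightarrow> 'a::real_normed_vector. F b - F a = incr F D + incr F R) \<and> b - a = len D + len R"
  using assms
proof (induction "card D" arbitrary: D b)
  case 0
  then have D: "D = {}" by (auto simp: dfam_def)
  show ?case
  proof (cases "a = b")
    case True then show ?thesis using D by (intro exI[of _ "{}"]) (auto simp: dfam_def incr_def len_def opn_def)
  next
    case False then show ?thesis using D 0 by (intro exI[of _ "{(a,b)}"]) (auto simp: dfam_def incr_def opn_def len_def)
  qed
next
  case (Suc k)
  then have fin: "finite D" and ne: "D \<noteq> {}" by (auto simp: dfam_def)
  define M where "M = Max (snd ` D)"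
  have "M \<in> snd ` D" unfolding M_def using fin ne by (intro Max_in) auto
  then obtain u where uM: "(u, M) \<in> D" by auto
  have le: "snd I \<le> M" if "I \<in> D" for I unfolding M_def using fin that by auto
  define D' where "D' = D - {(u,M)}"
  have D: "D = insert (u,M) D'" "(u,M) \<notin> D'" using uM by (auto simp: D'_def)
  have uM': "a \<le> u" "u < M" "M \<le> b" using uM Suc.prems(1) by (auto simp: dfam_def)
  have su: "snd I \<le> u" if "I \<in> D'" for I
  proof (rule ccontr)
    assume h: "\<not> snd I \<le> u"
    have "disjnt {fst I<..<snd I} {u<..<M}" "fst I < snd I"
      using Suc.prems(1) that D uM unfolding dfam_def pairwise_def by force+
    moreover have "snd I \<le> M" using le that D by auto
    define c where "c = (max (fst I) u + snd I) / 2"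
    have "c \<in> {fst I<..<snd I}" "c \<in> {u<..<M}" using h \<open>fst I < snd I\<close> \<open>snd I \<le> M\<close> by (auto simp: c_def)
    ultimately show False by (auto simp: disjnt_def)
  qed
  have dD': "dfam a u D'" using dfam_subset[OF Suc.prems(1), of D'] su D by (auto simp: dfam_def)
  have "k = card D'" using Suc.hyps(2) D fin by simp
  from Suc.hyps(1)[OF this dD' uM'(1)] obtain R where R: "dfam a u R" "opn D' \<inter> opn R = {}"
    "\<forall>F::real \<Rightarrow> 'a. F u - F a = incr F D' + incr F R" "u - a = len D' + len R" by auto
  have finD': "finite D'" using fin D by auto
  have incD: "incr F D = F M - F u + incr F D'" for F :: "real \<Rightarrow> 'a" unfolding D(1) incr_def using D(2) finD' by simp
  have lenD: "len D = M - u + len D'" unfolding D(1) len_def using D(2) finD' by simp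
  have Ru: "x < u" if "x \<in> opn R" for x using that R(1) by (force simp: opn_def dfam_def)
  have D'u: "x < u" if "x \<in> opn D'" for x using that dD' by (force simp: opn_def dfam_def)
  have opnD: "opn D = {u<..<M} \<union> opn D'" unfolding D(1) opn_def by simp
  show ?case
  proof (cases "M = b")
    case True
    have "dfam a b R" using R(1) uM' unfolding dfam_def by (meson order_trans less_imp_le)
    moreover have "opn D \<inter> opn R = {}" using opnD R(2) Ru by force
    moreover have "F b - F a = incr F D + incr F R" for F :: "real \<Rightarrow> 'a"
      using spec[OF R(3), of F] incD[of F] True by (simp add: algebra_simps)
    moreover have "b - a = len D + len R" using R(4) lenD True by simp
    ultimately show ?thesis by blast
  next
    case False
    have d1: "dfam a b R" using R(1) uM' unfolding dfam_def by (meson order_trans less_imp_le)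
    moreover have "dfam a b {(M,b)}" using uM' False by (auto simp: dfam_def)
    ultimately have d1: "dfam a b R" "dfam a b {(M,b)}" .
    have DR: "opn D \<inter> opn R = {}" using opnD R(2) Ru by force
    have Mb: "opn {(M,b)} = {M<..<b}" by (simp add: opn_def)
    have "opn R \<inter> opn {(M,b)} = {}" using Ru uM' unfolding Mb by force
    note un = dfam_Un[OF d1 this]
    have "opn D \<inter> opn (R \<union> {(M,b)}) = {}" using DR Mb opnD D'u uM' unfolding opn_Un by force
    moreover have iR: "incr F (R \<union> {(M,b)}) = incr F R + (F b - F M)" for F :: "real \<Rightarrow> 'a"
      unfolding incr_def using un(2) d1 by (subst sum.union_disjoint) (auto simp: dfam_def)
    moreover have "len (R \<union> {(M,b)}) = len R + (b - M)"
      unfolding len_def using un(2) d1 by (subst sum.union_disjoint) (auto simp: dfam_def)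
    moreover have "F b - F a = incr F D + incr F (R \<union> {(M,b)})" for F :: "real \<Rightarrow> 'a"
    proof -
      have "F b - F a = (F u - F a) + (F M - F u) + (F b - F M)" by simp
      also have "\<dots> = incr F D + incr F (R \<union> {(M,b)})"
        unfolding spec[OF R(3), of F] incD iR by simp
      finally show ?thesis .
    qed
    moreover have "b - a = len D + len (R \<union> {(M,b)})" using R(4) lenD calculation(3) by simp
    ultimately show ?thesis using un(1) by blast
  qed
qed

text \<open>
  The gaps of \<open>D\<close> together with \<open>E\<close> form a disjoint family, and
  \<open>R\<close> consists of its gaps.
\<close>

lemma dfam_diff:
  assumes "dfam a b D" "dfam a b E" "a \<le> b" "opn E \<subseteq> opn D"
  obtains R where "dfam a b R" "\<And>F::real \<Rightarrow> 'a::real_normed_vector. incr F D = incr F E + incr F R" "len D = len E + len R"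
proof -
  obtain R1 where R1: "dfam a b R1" "opn D \<inter> opn R1 = {}" "\<And>F::real \<Rightarrow> 'a. F b - F a = incr F D + incr F R1" "b - a = len D + len R1"
    using dfam_complement[OF assms(1,3), where 'a='a] by blast
  have "opn E \<inter> opn R1 = {}" using R1(2) assms(4) by blast
  note un = dfam_Un[OF assms(2) R1(1) this]
  obtain R where R: "dfam a b R" "\<And>F::real \<Rightarrow> 'a. F b - F a = incr F (E \<union> R1) + incr F R" "b - a = len (E \<union> R1) + len R"
    using dfam_complement[OF un(1) assms(3), where 'a='a] by blast
  have "incr F (E \<union> R1) = incr F E + incr F R1" for F :: "real \<Rightarrow> 'a"
    unfolding incr_def using un(2) assms(2) R1(1) by (subst sum.union_disjoint) (auto simp: dfam_def)
  moreover have "len (E \<union> R1) = len E + len R1"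
    unfolding len_def using un(2) assms(2) R1(1) by (subst sum.union_disjoint) (auto simp: dfam_def)
  moreover have "incr F D = incr F E + incr F R" for F :: "real \<Rightarrow> 'a"
    using R(2)[of F] R1(3)[of F] calculation(1)[of F] by (simp add: algebra_simps)
  ultimately show ?thesis using R(3) R1(4) that[OF R(1)] by simp
qed

text \<open>
  Intervals are balls around their midpoints, so Vitali's covering theorem for balls applies.
  Passing to open intervals loses only countably many end points, and finitely many intervals
  suffice by continuity of the measure.
\<close>

lemma vitali_family:
  fixes S U :: "real set"
  assumes S: "S \<in> lmeasurable" "S \<subseteq> U" and U: "open U" "U \<subseteq> {a<..<b}"
    and fine: "\<And>x d. x \<in> S \<Longrightarrow> 0 < d \<Longrightarrow> \<exists>u v. u < x \<and> x < v \<and> v - u < d \<and> Pr u v"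
    and "0 < \<epsilon>"
  obtains D where "dfam a b D" "opn D \<subseteq> U" "\<And>I. I \<in> D \<Longrightarrow> Pr (fst I) (snd I)"
    "measure lebesgue (S - opn D) < \<epsilon>"
proof -
  define K where "K = {I. fst I < snd I \<and> {fst I..snd I} \<subseteq> U \<and> Pr (fst I) (snd I)}"
  define c where "c = (\<lambda>I::real\<times>real. (fst I + snd I) / 2)"
  define r where "r = (\<lambda>I::real\<times>real. (snd I - fst I) / 2)"
  have cb: "cball (c I) (r I) = {fst I..snd I}" for I
    unfolding c_def r_def cball_eq_atLeastAtMost by (auto simp: field_simps)
  have rK: "0 < r I" if "I \<in> K" for I using that by (auto simp: K_def r_def)
  have cov: "\<exists>I. I \<in> K \<and> x \<in> cball (c I) (r I) \<and> r I < d" if x: "x \<in> S" and d: "0 < d" for x d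
  proof -
    obtain e where e: "e > 0" "cball x e \<subseteq> U" using x S U open_contains_cball by blast
    obtain u v where uv: "u < x" "x < v" "v - u < min d e" "Pr u v" using fine[OF x, of "min d e"] d e by auto
    have "{u..v} \<subseteq> cball x e" using uv by (auto simp: dist_real_def)
    then have "(u,v) \<in> K" using uv e by (auto simp: K_def)
    then show ?thesis using uv cb[of "(u,v)"] by (intro exI[of _ "(u,v)"]) (auto simp: r_def)
  qed
  obtain C where C: "countable C" "C \<subseteq> K" "pairwise (\<lambda>i j. disjnt (cball (c i) (r i)) (cball (c j) (r j))) C"
      "negligible (S - (\<Union>i\<in>C. cball (c i) (r i)))"
    by (rule Vitali_covering_theorem_cballs[of K r S c, OF rK cov]) blast+
  define op where "op = (\<lambda>I::real\<times>real. {fst I<..<snd I})"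
  have negE: "negligible (\<Union>i\<in>C. {fst i, snd i})" using C(1) by (intro negligible_countable_Union) auto
  have neg: "negligible (S - (\<Union>i\<in>C. op i))"
    by (rule negligible_subset[OF negligible_Un[OF C(4) negE]]) (fastforce simp: cb op_def less_le)
  obtain D where D: "finite D" "D \<subseteq> C" "measure lebesgue (S - (\<Union>i\<in>D. op i)) < \<epsilon>"
  proof (cases "finite C")
    case True
    then show ?thesis using that[of C] negligible_imp_measure0[OF neg] \<open>0 < \<epsilon>\<close> by auto
  next
    case False
    define A where "A = (\<lambda>n. S - (\<Union>i\<in>from_nat_into C ` {..<n}. op i))"
    have Am: "A n \<in> lmeasurable" for n unfolding A_def op_def
      using S(1) by (intro fmeasurable_Diff) (auto intro!: sets.finite_UN)
    have "(\<lambda>n. measure lebesgue (A n)) \<longlonglongrightarrow> measure lebesgue (\<Inter>n. A n)"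
    proof (rule Lim_measure_decseq)
      show "range A \<subseteq> sets lebesgue" using Am by (auto simp: fmeasurable_def)
      show "decseq A" unfolding A_def decseq_def by (auto intro: le_less_trans less_le_trans)
      show "emeasure lebesgue (A i) \<noteq> \<infinity>" for i using Am[of i] by (auto simp: fmeasurable_def)
    qed
    moreover have "(\<Inter>n. A n) = S - (\<Union>i\<in>C. op i)"
    proof -
      have 1: "\<exists>n. i \<in> from_nat_into C ` {..<n}" if "i \<in> C" for i
        using from_nat_into_surj[OF C(1) that] by (metis image_eqI lessThan_iff lessI)
      have 2: "from_nat_into C n \<in> C" for n using False by (metis finite.emptyI from_nat_into)
      show ?thesis
      proof (intro set_eqI iffI)
        fix x assume x: "x \<in> (\<Inter>n. A n)"
        have "x \<notin> op i" if iC: "i \<in> C" for i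
        proof -
          obtain n where "i \<in> from_nat_into C ` {..<n}" using 1[OF iC] by blast
          moreover have "x \<in> A n" using x by blast
          ultimately show ?thesis unfolding A_def by blast
        qed
        moreover have "x \<in> S" using x by (auto simp: A_def)
        ultimately show "x \<in> S - (\<Union>i\<in>C. op i)" by blast
      next
        fix x assume "x \<in> S - (\<Union>i\<in>C. op i)"
        then show "x \<in> (\<Inter>n. A n)" using 2 by (auto simp: A_def)
      qed
    qed
    ultimately have "(\<lambda>n. measure lebesgue (A n)) \<longlonglongrightarrow> 0" using negligible_imp_measure0[OF neg] by simp
    then have "\<forall>\<^sub>F n in sequentially. measure lebesgue (A n) < \<epsilon>" using \<open>0 < \<epsilon>\<close> by (simp add: order_tendstoD(2))
    then obtain n where "measure lebesgue (A n) < \<epsilon>" by (auto simp: eventually_sequentially)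
    moreover have "from_nat_into C ` {..<n} \<subseteq> C" using False by (metis finite.emptyI from_nat_into image_subsetI)
    ultimately show ?thesis using that[of "from_nat_into C ` {..<n}"] by (simp add: A_def)
  qed
  have DK: "D \<subseteq> K" using D C by auto
  show ?thesis
  proof (rule that[of D])
    show "dfam a b D" unfolding dfam_def
    proof (intro conjI ballI)
      show "finite D" by fact
      fix I assume "I \<in> D"
      then have "fst I < snd I" "{fst I..snd I} \<subseteq> U" using DK by (auto simp: K_def)
      moreover have "fst I \<in> U" "snd I \<in> U" using calculation by auto
      ultimately show "a \<le> fst I" "fst I < snd I" "snd I \<le> b" using U by (auto simp: subset_iff less_imp_le)
    next
      show "pairwise (\<lambda>I J. disjnt {fst I<..<snd I} {fst J<..<snd J}) D"
      proof (rule pairwiseI)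
        fix I J assume "I \<in> D" "J \<in> D" "I \<noteq> J"
        then have "disjnt {fst I..snd I} {fst J..snd J}" using C(3) D(2) unfolding pairwise_def cb by blast
        then show "disjnt {fst I<..<snd I} {fst J<..<snd J}"
          by (rule disjnt_subset1[OF disjnt_subset2]) auto
      qed
    qed
    have "{fst I<..<snd I} \<subseteq> U" if "I \<in> D" for I
    proof -
      have "{fst I..snd I} \<subseteq> U" using DK that by (auto simp: K_def)
      then show ?thesis using greaterThanLessThan_subseteq_atLeastAtMost_iff by blast
    qed
    then show "opn D \<subseteq> U" unfolding opn_def by blast
    show "Pr (fst I) (snd I)" if "I \<in> D" for I using DK that by (auto simp: K_def)
    show "measure lebesgue (S - opn D) < \<epsilon>" using D(3) by (simp add: opn_def op_def)
  qed
qed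

section \<open>Points of steep increase and Lebesgue's differentiation theorem\<close>

text \<open>
  Points around which \<open>G\<close> increases with slope more than \<open>b\<close> on
  arbitrarily short straddling intervals. Intervals are required to straddle the point, and not to
  begin there, because this makes the set a countable intersection of open sets.
\<close>

definition steep :: "(real \<Rightarrow> real) \<Rightarrow> real \<Rightarrow> real set" where
  "steep G b = {x. \<forall>d>0. \<exists>u v. 0 < u \<and> u < x \<and> x < v \<and> v < 1 \<and> v - u < d \<and> b * (v - u) < G v - G u}"

lemma steep_subset: "steep G b \<subseteq> {0<..<1}"
  unfolding steep_def by (auto dest: spec[of _ 1])

text \<open>For each \<open>d = 1/k\<close> the defining condition describes a union of open intervals.\<close>

lemma steep_lmeasurable: "steep G b \<in> lmeasurable"
proof -
  define W where "W = (\<lambda>n::nat. \<Union>I\<in>{(u,v). 0 < u \<and> v < 1 \<and> v - u < 1 / real (Suc n) \<and> b * (v - u) < G v - G u}. {fst I<..<snd I})"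
  have "x \<in> steep G b" if x: "x \<in> (\<Inter>n. W n)" for x
    unfolding steep_def
  proof (intro CollectI allI impI)
    fix d :: real assume "0 < d"
    then obtain n where n: "1 / real (Suc n) < d" using reals_Archimedean by (auto simp: inverse_eq_divide)
    have "x \<in> W n" using x by blast
    then show "\<exists>u v. 0 < u \<and> u < x \<and> x < v \<and> v < 1 \<and> v - u < d \<and> b * (v - u) < G v - G u"
      unfolding W_def using n by fastforce
  qed
  moreover have "x \<in> W n" if x: "x \<in> steep G b" for x n
  proof -
    have "0 < 1 / real (Suc n)" by simp
    then obtain u v where "0 < u \<and> u < x \<and> x < v \<and> v < 1 \<and> v - u < 1 / real (Suc n) \<and> b * (v - u) < G v - G u"
      using x unfolding steep_def by blast
    then show ?thesis unfolding W_def by (intro UN_I[of "(u,v)"]) auto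
  qed
  ultimately have "steep G b = (\<Inter>n. W n)" by blast
  moreover have "open (W n)" for n unfolding W_def by auto
  ultimately have "steep G b \<in> sets lebesgue" by (auto intro!: sets.countable_INT')
  then show ?thesis
    using steep_subset by (intro fmeasurableI2[OF _ steep_subset]) auto
qed

lemma absolute_continuity_integral:
  fixes h :: "real \<Rightarrow> 'a::euclidean_space"
  assumes h: "h absolutely_integrable_on {0..1}" and "0 < \<eta>"
  obtains \<delta> where "0 < \<delta>"
    "\<And>T. T \<in> sets lebesgue \<Longrightarrow> T \<subseteq> {0..1} \<Longrightarrow> measure lebesgue T < \<delta> \<Longrightarrow> integral T (\<lambda>x. norm (h x)) < \<eta>"
proof -
  let ?n = "\<lambda>x. norm (h x)"
  have nh: "?n absolutely_integrable_on {0..1}" using absolutely_integrable_norm[OF h] by (simp add: o_def)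
  have sub: "?n absolutely_integrable_on T" if "T \<in> sets lebesgue" "T \<subseteq> {0..1}" for T
    using set_integrable_subset[OF nh that] .
  have subi: "?n integrable_on T" if "T \<in> sets lebesgue" "T \<subseteq> {0..1}" for T
    using sub[OF that] by (rule set_lebesgue_integral_eq_integral(1))
  define T where "T = (\<lambda>n::nat. {x\<in>{0..1}. real n < ?n x})"
  have Tm: "T n \<in> sets lebesgue" for n
  proof -
    have "?n \<in> borel_measurable (lebesgue_on {0..1})"
      using nh by (rule absolutely_integrable_imp_borel_measurable) auto
    then have "{x \<in> space (lebesgue_on {0..1}). real n < ?n x} \<in> sets (lebesgue_on {0..1})"
      by (rule borel_measurable_less[rotated]) auto
    then have "T n \<in> sets (lebesgue_on {0..1})" by (simp add: T_def)
    then show ?thesis by (simp add: sets_restrict_space_iff)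
  qed
  have Ts: "T n \<subseteq> {0..1}" for n by (auto simp: T_def)
  have "(\<lambda>n. integral {0..1} (\<lambda>x. if x \<in> T n then ?n x else 0)) \<longlonglongrightarrow> integral {0..1} (\<lambda>x::real. 0::real)"
  proof (rule dominated_convergence(2)[where h="?n"])
    show "(\<lambda>x. if x \<in> T n then ?n x else 0) integrable_on {0..1}" for n
      using subi[OF Tm Ts, of n] integrable_restrict_Int[of "T n" ?n "{0..1}"] Ts[of n] by (simp add: Int_absorb1 Int_absorb2)
    show "?n integrable_on {0..1}" using subi[of "{0..1}"] by simp
    show "norm (if x \<in> T n then ?n x else 0) \<le> ?n x" for n x by simp
    show "(\<lambda>n. if x \<in> T n then ?n x else 0) \<longlonglongrightarrow> 0" for x
    proof (rule tendsto_eventually)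
      obtain N where "?n x < real N" using reals_Archimedean2 by blast
      then have "x \<notin> T n" if "n \<ge> N" for n using that by (auto simp: T_def)
      then show "\<forall>\<^sub>F n in sequentially. (if x \<in> T n then ?n x else 0) = 0"
        by (auto simp: eventually_sequentially)
    qed
  qed
  moreover have "integral {0..1} (\<lambda>x. if x \<in> T n then ?n x else 0) = integral (T n) ?n" for n
    using integral_restrict_Int[of "{0..1}" "T n" ?n] Ts[of n] by (simp add: Int_absorb1 Int_absorb2)
  ultimately have "(\<lambda>n. integral (T n) ?n) \<longlonglongrightarrow> 0" by simp
  then have "\<forall>\<^sub>F n in sequentially. integral (T n) ?n < \<eta> / 2" by (rule order_tendstoD(2)) (use \<open>0 < \<eta>\<close> in simp)
  then obtain n where n: "integral (T n) ?n < \<eta> / 2" by (auto simp: eventually_sequentially)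
  define \<delta> where "\<delta> = \<eta> / (2 * (real n + 1))"
  show ?thesis
  proof (rule that[of \<delta>])
    show "0 < \<delta>" using \<open>0 < \<eta>\<close> by (simp add: \<delta>_def)
    fix S :: "real set" assume S: "S \<in> sets lebesgue" "S \<subseteq> {0..1}" "measure lebesgue S < \<delta>"
    have Sl: "S \<in> lmeasurable" using fmeasurableI2[of "{0..1}" lebesgue S] S(1,2) by simp
    have "integral S ?n \<le> integral S (\<lambda>x. (if x \<in> T n then ?n x else 0) + real n)"
    proof (rule integral_le)
      show "?n integrable_on S" using subi S by blast
      have "(\<lambda>x. if x \<in> T n then ?n x else 0) integrable_on S"
        using subi[of "T n \<inter> S"] Tm[of n] S by (subst integrable_restrict_Int) auto
      moreover have "(\<lambda>x. real n) integrable_on S" using Sl integrable_on_const by blast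
      ultimately show "(\<lambda>x. (if x \<in> T n then ?n x else 0) + real n) integrable_on S" by (rule integrable_add)
      show "?n x \<le> (if x \<in> T n then ?n x else 0) + real n" if "x \<in> S" for x
        using that S(2) by (auto simp: T_def not_less)
    qed
    also have "\<dots> = integral (S \<inter> T n) ?n + real n * measure lebesgue S"
    proof -
      have "(\<lambda>x. if x \<in> T n then ?n x else 0) integrable_on S"
        using subi[of "T n \<inter> S"] Tm[of n] S by (subst integrable_restrict_Int) auto
      moreover have "(\<lambda>x. real n) integrable_on S" using Sl integrable_on_const by blast
      moreover have "integral S (\<lambda>x. real n) = real n * measure lebesgue S"
        using lmeasure_integral[OF Sl] integral_mult_right[of S "real n" "\<lambda>x. 1"] by simp
      ultimately show ?thesis by (simp add: integral_add integral_restrict_Int Int_commute)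
    qed
    also have "integral (S \<inter> T n) ?n \<le> integral (T n) ?n"
      using subi[of "S \<inter> T n"] subi[of "T n"] Tm[of n] S Ts by (intro integral_subset_le) auto
    also have "real n * measure lebesgue S \<le> (real n + 1) * \<delta>" using S(3) by (intro mult_mono) auto
    also have "(real n + 1) * \<delta> = \<eta> / 2" by (simp add: \<delta>_def divide_simps)
    finally show "integral S ?n < \<eta>" using n by simp
  qed
qed

lemma incr_integral:
  fixes h :: "real \<Rightarrow> 'a::euclidean_space"
  assumes h: "h absolutely_integrable_on {0..1}" and D: "dfam 0 1 D"
  shows "h absolutely_integrable_on opn D" "integral (opn D) h = incr (\<lambda>x. integral {0..x} h) D"
proof -
  have D01: "opn D \<subseteq> {0..1}" using D by (force simp: opn_def dfam_def)
  show "h absolutely_integrable_on opn D"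
    using set_integrable_subset[OF h _ D01] open_opn by auto
  have hi: "h integrable_on {u..v}" if "0 \<le> u" "v \<le> 1" for u v
    using absolutely_integrable_on_subinterval[OF h, of u v] that set_lebesgue_integral_eq_integral(1) by auto
  have "(h has_integral (\<Sum>I\<in>D. integral {0..snd I} h - integral {0..fst I} h)) (\<Union>I\<in>D. {fst I<..<snd I})"
  proof (rule has_integral_UN)
    show "finite D" using D by (simp add: dfam_def)
    fix I assume "I \<in> D"
    then have I: "0 \<le> fst I" "fst I < snd I" "snd I \<le> 1" using D by (auto simp: dfam_def)
    have "integral {0..fst I} h + integral {fst I..snd I} h = integral {0..snd I} h"
      using I hi by (intro Henstock_Kurzweil_Integration.integral_combine) auto
    then have "integral {0..snd I} h - integral {0..fst I} h = integral {fst I..snd I} h" by (simp add: algebra_simps)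
    moreover have "(h has_integral integral {fst I..snd I} h) {fst I..snd I}" using hi I by (simp add: integrable_integral)
    ultimately show "(h has_integral integral {0..snd I} h - integral {0..fst I} h) {fst I<..<snd I}"
      by (simp add: has_integral_Icc_iff_Ioo)
  next
    show "pairwise (\<lambda>i i'. negligible ({fst i<..<snd i} \<inter> {fst i'<..<snd i'})) D"
      using D by (auto simp: dfam_def pairwise_def disjnt_def)
  qed
  then show "integral (opn D) h = incr (\<lambda>x. integral {0..x} h) D"
    unfolding opn_def incr_def by (rule integral_unique)
qed

text \<open>
  Choosing the open set \<open>U\<close> of the covering lemma close to \<open>S\<close> also
  bounds the excess of the family.
\<close>

lemma tight_vitali_family:
  assumes S: "S \<in> lmeasurable" "S \<subseteq> {0<..<1}" and "0 < \<epsilon>"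
    and fine: "\<And>x d. x \<in> S \<Longrightarrow> 0 < d \<Longrightarrow> \<exists>u v. u < x \<and> x < v \<and> v - u < d \<and> Pr u v"
  obtains D where "dfam 0 1 D" "\<And>I. I \<in> D \<Longrightarrow> Pr (fst I) (snd I)"
    "measure lebesgue (S - opn D) < \<epsilon>" "measure lebesgue (opn D - S) < \<epsilon>"
proof -
  obtain U where U: "open U" "S \<subseteq> U" "U - S \<in> lmeasurable" "measure lebesgue (U - S) < \<epsilon>"
    using sets_lebesgue_outer_open[of S \<epsilon>] S \<open>0 < \<epsilon>\<close>
    by (metis emeasure_eq_measure2 ennreal_less_iff fmeasurableD measure_nonneg)
  obtain D where D: "dfam 0 1 D" "opn D \<subseteq> U \<inter> {0<..<1}" "\<And>I. I \<in> D \<Longrightarrow> Pr (fst I) (snd I)"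
      "measure lebesgue (S - opn D) < \<epsilon>"
    by (rule vitali_family[of S "U \<inter> {0<..<1}" 0 1 Pr \<epsilon>]) (use S U fine \<open>0 < \<epsilon>\<close> in auto)
  have "measure lebesgue (opn D - S) \<le> measure lebesgue (U - S)"
    using D(1,2) S U opn_lmeasurable[OF D(1)] by (intro measure_mono_fmeasurable) auto
  then show ?thesis using that D U by fastforce
qed

lemma measure_diff_le:
  assumes "A \<in> lmeasurable" "B \<in> lmeasurable" "measure lebesgue (A - B) < \<epsilon>" "measure lebesgue (B - A) < \<epsilon>"
  shows "\<bar>measure lebesgue A - measure lebesgue B\<bar> < \<epsilon>"
proof -
  have *: "measure lebesgue A = measure lebesgue (A - B) + measure lebesgue (A \<inter> B)"
    if "A \<in> lmeasurable" "B \<in> lmeasurable" for A B :: "'a set"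
  proof -
    have "measure lebesgue ((A - B) \<union> (A \<inter> B)) = measure lebesgue (A - B) + measure lebesgue (A \<inter> B)"
      using that by (intro measure_Un2[THEN trans]) (auto simp: Diff_Int_distrib2 intro: fmeasurable.Int arg_cong[where f="measure lebesgue"])
    moreover have "(A - B) \<union> (A \<inter> B) = A" by blast
    ultimately show ?thesis by simp
  qed
  have "\<bar>x - y\<bar> < \<epsilon>" if "x = p + r" "y = s + r" "p < \<epsilon>" "s < \<epsilon>" "0 \<le> p" "0 \<le> s" for x y p r s :: real
    using that by linarith
  from this[OF *[OF assms(1,2)] *[OF assms(2,1), unfolded Int_commute[of B]] assms(3,4)] show ?thesis by simp
qed

text \<open>
  Cover \<open>S\<close> by intervals on which the indefinite integral grows by more than
  \<open>b\<close> times the length, and sum; the part of the family outside \<open>S\<close> and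
  the uncovered part of \<open>S\<close> contribute little by absolute continuity of the integral.
\<close>

lemma steep_integral:
  fixes h :: "real \<Rightarrow> real"
  assumes h: "h absolutely_integrable_on {0..1}" and S: "S \<in> lmeasurable" "S \<subseteq> steep (\<lambda>x. integral {0..x} h) b"
  shows "b * measure lebesgue S \<le> integral S h"
proof (rule field_le_epsilon)
  fix e :: real assume e: "0 < e"
  let ?H = "\<lambda>x. integral {0..x} h"
  have S01: "S \<subseteq> {0<..<1}" using S(2) steep_subset by blast
  then have S01': "S \<subseteq> {0..1}" by auto
  obtain \<delta> where \<delta>: "0 < \<delta>" "\<And>T. T \<in> sets lebesgue \<Longrightarrow> T \<subseteq> {0..1} \<Longrightarrow> measure lebesgue T < \<delta> \<Longrightarrow> integral T (\<lambda>x. norm (h x)) < e/3"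
    using absolute_continuity_integral[OF h, of "e/3"] e by auto
  \<comment> \<open>The three errors are the integrals over the two difference sets and \<open>b\<close> times the difference of the measures; each gets \<open>e/3\<close>.\<close>
  define \<epsilon> where "\<epsilon> = min \<delta> (e / (3 * (\<bar>b\<bar> + 1)))"
  have "0 < \<epsilon>" using \<delta> e by (simp add: \<epsilon>_def)
  obtain D where D: "dfam 0 1 D" "\<And>I. I \<in> D \<Longrightarrow> b * (snd I - fst I) < ?H (snd I) - ?H (fst I)"
    "measure lebesgue (S - opn D) < \<epsilon>" "measure lebesgue (opn D - S) < \<epsilon>"
    by (rule tight_vitali_family[OF S(1) S01 \<open>0 < \<epsilon>\<close>, of "\<lambda>u v. b * (v - u) < ?H v - ?H u"])
       (use S(2) in \<open>auto simp: steep_def subset_iff\<close>, meson)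
  have Dm: "opn D \<in> lmeasurable" using opn_lmeasurable[OF D(1)] .
  have D01: "opn D \<subseteq> {0..1}" using D by (force simp: opn_def dfam_def)
  have hi: "h absolutely_integrable_on T" "h integrable_on T" if "T \<in> sets lebesgue" "T \<subseteq> {0..1}" for T
    using set_integrable_subset[OF h that] set_lebesgue_integral_eq_integral(1) by auto
  have small: "\<bar>integral T h\<bar> < e/3" if "T \<in> sets lebesgue" "T \<subseteq> {0..1}" "measure lebesgue T < \<epsilon>" for T
  proof -
    have "norm (integral T h) \<le> integral T (\<lambda>x. norm (h x))"
      using hi[OF that(1,2)] set_lebesgue_integral_eq_integral(1)[OF absolutely_integrable_norm[OF hi(1)[OF that(1,2)]]]
      by (intro integral_norm_bound_integral) (auto simp: o_def)
    then show ?thesis using \<delta>(2)[of T] that by (simp add: \<epsilon>_def)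
  qed
  have split: "integral A h = integral (A - B) h + integral (A \<inter> B) h" if "A \<in> sets lebesgue" "B \<in> sets lebesgue" "A \<subseteq> {0..1}" for A B
  proof -
    have "integral ((A - B) \<union> (A \<inter> B)) h = integral (A - B) h + integral (A \<inter> B) h"
      using that by (intro integral_Un hi(2)) (auto simp: Int_assoc Diff_Int_distrib2)
    moreover have "(A - B) \<union> (A \<inter> B) = A" by blast
    ultimately show ?thesis by simp
  qed
  have "b * len D \<le> incr ?H D"
    unfolding len_def incr_def sum_distrib_left using D(2) by (intro sum_mono) (simp add: less_imp_le)
  also have "\<dots> = integral (opn D) h" using incr_integral(2)[OF h D(1)] by simp
  also have "\<dots> = integral (opn D - S) h + integral (opn D \<inter> S) h"
    using Dm S D01 by (intro split) auto
  also have "integral (opn D \<inter> S) h = integral S h - integral (S - opn D) h"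
    using split[of S "opn D"] Dm S S01' by (simp add: Int_commute)
  finally have 1: "b * len D \<le> integral (opn D - S) h - integral (S - opn D) h + integral S h" by simp
  have "\<bar>integral (opn D - S) h\<bar> < e/3" "\<bar>integral (S - opn D) h\<bar> < e/3"
    using small[of "opn D - S"] small[of "S - opn D"] D(3,4) Dm S D01 S01' by (auto simp: subset_iff)
  moreover have "\<bar>measure lebesgue S - len D\<bar> < \<epsilon>"
    using measure_diff_le[OF S(1) Dm D(3,4)] measure_opn[OF D(1)] by simp
  then have "\<bar>b\<bar> * \<bar>measure lebesgue S - len D\<bar> \<le> (\<bar>b\<bar> + 1) * \<epsilon>" by (intro mult_mono) auto
  moreover have "(\<bar>b\<bar> + 1) * \<epsilon> \<le> e/3"
  proof -
    have "(\<bar>b\<bar> + 1) * \<epsilon> \<le> (\<bar>b\<bar> + 1) * (e / (3 * (\<bar>b\<bar> + 1)))" unfolding \<epsilon>_def by (intro mult_left_mono) auto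
    also have "\<dots> = e/3" by (simp add: divide_simps)
    finally show ?thesis .
  qed
  ultimately have "\<bar>b * (measure lebesgue S - len D)\<bar> \<le> e/3" by (simp add: abs_mult)
  then have "b * measure lebesgue S - b * len D \<le> e/3" by (metis abs_le_D1 right_diff_distrib)
  then show "b * measure lebesgue S \<le> integral S h + e"
    using 1 \<open>\<bar>integral (opn D - S) h\<bar> < e/3\<close> \<open>\<bar>integral (S - opn D) h\<bar> < e/3\<close> by linarith
qed

lemma steep_antimono: "b \<le> c \<Longrightarrow> steep G c \<subseteq> steep G b"
  unfolding steep_def
proof safe
  fix x d :: real
  assume bc: "b \<le> c" and "0 < d" and *: "\<forall>d>0. \<exists>u v. 0 < u \<and> u < x \<and> x < v \<and> v < 1 \<and> v - u < d \<and> c * (v - u) < G v - G u"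
  then obtain u v where uv: "0 < u \<and> u < x \<and> x < v \<and> v < 1 \<and> v - u < d \<and> c * (v - u) < G v - G u" by blast
  then have "b * (v - u) \<le> c * (v - u)" using bc by (intro mult_right_mono) auto
  then have "b * (v - u) < G v - G u" using uv by linarith
  then show "\<exists>u v. 0 < u \<and> u < x \<and> x < v \<and> v < 1 \<and> v - u < d \<and> b * (v - u) < G v - G u"
    using uv by blast
qed

lemma not_steepD:
  assumes G: "continuous_on {0..1} G" and x: "x \<notin> steep G b"
  obtains d where "0 < d" "\<And>u v. 0 < u \<Longrightarrow> u \<le> x \<Longrightarrow> x \<le> v \<Longrightarrow> v < 1 \<Longrightarrow> v - u < d \<Longrightarrow> G v - G u \<le> b * (v - u)"
proof -
  obtain d where d: "0 < d" and "\<not> (\<exists>u v. 0 < u \<and> u < x \<and> x < v \<and> v < 1 \<and> v - u < d \<and> b * (v - u) < G v - G u)"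
    using x unfolding steep_def by blast
  then have *: "G v - G u \<le> b * (v - u)" if "0 < u" "u < x" "x < v" "v < 1" "v - u < d" for u v
    using that by (meson not_less)
  have "G v - G u \<le> b * (v - u)" if uv: "0 < u" "u \<le> x" "x \<le> v" "v < 1" "v - u < d" for u v
  proof (rule tendsto_upperbound)
    define t0 where "t0 = min (min u (1 - v)) ((d - (v - u)) / 2)"
    have t0: "0 < t0" using uv by (auto simp: t0_def)
    have cv: "isCont G v" "isCont G u" using G uv by (auto simp: continuous_on_eq_continuous_at continuous_on_interior)
    have "((\<lambda>t. G (v + t)) \<longlongrightarrow> G v) (at_right 0)" "((\<lambda>t. G (u - t)) \<longlongrightarrow> G u) (at_right 0)"
      by (rule isCont_tendsto_compose[OF cv(1)] isCont_tendsto_compose[OF cv(2)], (rule tendsto_eq_intros | simp)+)+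
    then show "((\<lambda>t. G (v + t) - G (u - t) - 2 * b * t) \<longlongrightarrow> G v - G u) (at_right 0)"
      by (auto intro!: tendsto_eq_intros)
    have "\<forall>\<^sub>F t in at_right 0. t < t0" using order_tendstoD(2)[OF tendsto_ident_at t0] .
    then show "\<forall>\<^sub>F t in at_right 0. G (v + t) - G (u - t) - 2 * b * t \<le> b * (v - u)"
      using eventually_at_right_less[of 0]
    proof eventually_elim
      case (elim t)
      have "G (v + t) - G (u - t) \<le> b * ((v + t) - (u - t))"
        using elim uv by (intro *) (auto simp: t0_def field_simps)
      then show ?case by (simp add: algebra_simps)
    qed
  qed simp
  then show ?thesis using d that by blast
qed

text \<open>
  A continuous function whose two-sided difference quotients exceed no \<open>b > D\<close> and
  fall below no \<open>a < D\<close> on short intervals has derivative \<open>D\<close>;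
  degenerate intervals with the point as an end are reached by continuity.
\<close>

lemma derivative_from_steep:
  assumes G: "continuous_on {0..1} G" and x: "x \<in> {0<..<1}"
    and up: "\<And>b. D < b \<Longrightarrow> x \<notin> steep G b" and low: "\<And>a. a < D \<Longrightarrow> x \<notin> steep (\<lambda>x. - G x) (- a)"
  shows "(G has_real_derivative D) (at x)"
  unfolding has_field_derivative_iff
proof (rule tendstoI)
  fix e :: real assume e: "0 < e"
  obtain d1 where d1: "0 < d1" "\<And>u v. 0 < u \<Longrightarrow> u \<le> x \<Longrightarrow> x \<le> v \<Longrightarrow> v < 1 \<Longrightarrow> v - u < d1 \<Longrightarrow> G v - G u \<le> (D + e/2) * (v - u)"
    using not_steepD[OF G up[of "D + e/2"]] e by auto
  have G': "continuous_on {0..1} (\<lambda>x. - G x)" using G by (intro continuous_intros)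
  obtain d2 where d2: "0 < d2" "\<And>u v. 0 < u \<Longrightarrow> u \<le> x \<Longrightarrow> x \<le> v \<Longrightarrow> v < 1 \<Longrightarrow> v - u < d2 \<Longrightarrow> - G v - - G u \<le> - (D - e/2) * (v - u)"
    using not_steepD[OF G' low[of "D - e/2"]] e by auto
  define d where "d = min (min d1 d2) (min x (1 - x))"
  have d: "0 < d" using d1 d2 x by (auto simp: d_def)
  have *: "\<bar>(G v - G u) / (v - u) - D\<bar> < e" if "0 < u" "u \<le> x" "x \<le> v" "v < 1" "v - u < d" "u < v" for u v
  proof -
    have "G v - G u \<le> (D + e/2) * (v - u)" "(D - e/2) * (v - u) \<le> G v - G u"
      using d1(2)[of u v] d2(2)[of u v] that by (auto simp: d_def algebra_simps)
    then have "(G v - G u) / (v - u) \<le> D + e/2" "D - e/2 \<le> (G v - G u) / (v - u)"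
      using that by (simp_all add: pos_divide_le_eq pos_le_divide_eq)
    then show ?thesis using e by (simp add: abs_less_iff)
  qed
  show "\<forall>\<^sub>F y in at x. dist ((G y - G x) / (y - x)) D < e"
    unfolding eventually_at
  proof (intro exI[of _ d] conjI ballI impI)
    fix y assume y: "y \<noteq> x \<and> dist y x < d"
    show "dist ((G y - G x) / (y - x)) D < e"
    proof (cases "x < y")
      case True
      then show ?thesis using *[of x y] x y by (auto simp: dist_real_def d_def)
    next
      case False
      have "(G y - G x) / (y - x) = (G x - G y) / (x - y)" by (metis minus_diff_eq minus_divide_divide)
      then show ?thesis using *[of y x] False x y by (auto simp: dist_real_def d_def)
    qed
  qed (fact d)
qed

lemma continuous_on_integral:
  fixes h :: "real \<Rightarrow> 'a::euclidean_space"
  shows "h absolutely_integrable_on {0..1} \<Longrightarrow> continuous_on {0..1} (\<lambda>x. integral {0..x} h)"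
  by (intro indefinite_integral_continuous_1) (simp add: set_lebesgue_integral_eq_integral(1))

text \<open>
  On such a set \<open>S\<close> one has \<open>b \<bar>S\<bar> \<le> \<integral>\<^sub>S h \<le>
  a \<bar>S\<bar>\<close>.
\<close>

lemma null_steep_less:
  fixes h :: "real \<Rightarrow> real"
  assumes h: "h absolutely_integrable_on {0..1}" and "a < b"
  shows "negligible {x \<in> steep (\<lambda>x. integral {0..x} h) b. h x < a}"
proof -
  define S where "S = {x \<in> steep (\<lambda>x. integral {0..x} h) b. h x < a}"
  have S01: "S \<subseteq> {0..1}" using steep_subset by (force simp: S_def)
  have "{x \<in> space (lebesgue_on {0..1}). h x < a} \<in> sets (lebesgue_on {0..1})"
    by (rule borel_measurable_less[OF absolutely_integrable_imp_borel_measurable[OF h]]) auto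
  then have "{x \<in> {0..1}. h x < a} \<in> sets lebesgue" by (simp add: sets_restrict_space_iff)
  moreover have "S = steep (\<lambda>x. integral {0..x} h) b \<inter> {x \<in> {0..1}. h x < a}"
    using steep_subset by (force simp: S_def)
  ultimately have S: "S \<in> lmeasurable" using steep_lmeasurable by (simp add: fmeasurable_Int_fmeasurable)
  have "b * measure lebesgue S \<le> integral S h"
    using steep_integral[OF h S] by (auto simp: S_def)
  also have "\<dots> \<le> integral S (\<lambda>x. a)"
    using set_integrable_subset[OF h _ S01] S set_lebesgue_integral_eq_integral(1) integrable_on_const[OF S]
    by (intro integral_le) (auto simp: S_def)
  also have "\<dots> = a * measure lebesgue S"
    using lmeasure_integral[OF S] integral_mult_right[of S a "\<lambda>x. 1"] by simp
  finally have "(b - a) * measure lebesgue S \<le> 0" by (simp add: algebra_simps)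
  then have "measure lebesgue S \<le> 0" using \<open>a < b\<close> by (simp add: mult_le_0_iff)
  then have "measure lebesgue S = 0" by (simp add: measure_le_0_iff)
  then show ?thesis using S by (simp add: S_def[symmetric] negligible_iff_measure)
qed

text \<open>
  The exceptional points lie, for some rational \<open>a < b\<close>, in a null set of the
  preceding kind for \<open>h\<close> or for \<open>-h\<close>.
\<close>

lemma lebesgue_differentiation_real:
  fixes h :: "real \<Rightarrow> real"
  assumes h: "h absolutely_integrable_on {0..1}"
  obtains N where "negligible N" "\<And>x. x \<in> {0..1} - N \<Longrightarrow> x \<in> {0<..<1} \<and> ((\<lambda>x. integral {0..x} h) has_real_derivative h x) (at x)"
proof -
  let ?H = "\<lambda>x. integral {0..x} h"
  have h': "(\<lambda>x. - h x) absolutely_integrable_on {0..1}" using absolutely_integrable_scaleR_left[OF h, of "-1"] by simp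
  have eq: "(\<lambda>x. integral {0..x} (\<lambda>x. - h x)) = (\<lambda>x. - ?H x)" by simp
  define N where "N = {0,1} \<union> (\<Union>p\<in>{p \<in> \<rat> \<times> \<rat>. fst p < snd p}. {x \<in> steep ?H (snd p). h x < fst p} \<union>
      {x \<in> steep (\<lambda>x. - ?H x) (snd p). - h x < fst p})"
  have "negligible N" unfolding N_def
    using null_steep_less[OF h] null_steep_less[OF h'] unfolding eq
    by (intro negligible_Un negligible_countable_Union) (auto intro!: countable_image countable_Collect countable_SIGMA countable_rat)
  moreover have "x \<in> {0<..<1} \<and> (?H has_real_derivative h x) (at x)" if x: "x \<in> {0..1} - N" for x
  proof
    show x01: "x \<in> {0<..<1}" using x by (auto simp: N_def less_le)
    have rats: "\<exists>p q. p \<in> \<rat> \<and> q \<in> \<rat> \<and> c < p \<and> p < q \<and> q < d" if cd: "c < d" for c d :: real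
    proof -
      obtain p where "p \<in> \<rat>" "c < p" "p < d" using Rats_dense_in_real[OF cd] by blast
      moreover obtain q where "q \<in> \<rat>" "p < q" "q < d" using Rats_dense_in_real[OF \<open>p < d\<close>] by blast
      ultimately show ?thesis by blast
    qed
    show "(?H has_real_derivative h x) (at x)"
    proof (rule derivative_from_steep[OF continuous_on_integral[OF h] x01])
      fix b assume "h x < b"
      then obtain p q where "p \<in> \<rat>" "q \<in> \<rat>" "h x < p" "p < q" "q < b" using rats by blast
      then have "x \<notin> steep ?H q" using x by (auto simp: N_def)
      then show "x \<notin> steep ?H b" using steep_antimono[of q b] \<open>q < b\<close> by auto
    next
      fix a assume "a < h x"
      then obtain p q where "p \<in> \<rat>" "q \<in> \<rat>" "- h x < p" "p < q" "q < - a" using rats[of "- h x" "- a"] by auto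
      then have "x \<notin> steep (\<lambda>x. - ?H x) q" using x by (auto simp: N_def)
      then show "x \<notin> steep (\<lambda>x. - ?H x) (- a)" using steep_antimono[of q "- a"] \<open>q < - a\<close> by auto
    qed
  qed
  ultimately show ?thesis using that by blast
qed

section \<open>Absolute continuity\<close>

text \<open>
  Absolute continuity on \<open>[0,1]\<close>, phrased with sets of intervals so that the covering
  lemmas apply.
\<close>

definition acf :: "(real \<Rightarrow> 'a::real_normed_vector) \<Rightarrow> bool" where
  "acf g \<longleftrightarrow> (\<forall>\<epsilon>>0. \<exists>\<delta>>0. \<forall>D. dfam 0 1 D \<longrightarrow> len D < \<delta> \<longrightarrow> (\<Sum>I\<in>D. norm (g (snd I) - g (fst I))) < \<epsilon>)"

lemma acfD:
  assumes "acf g" "0 < \<epsilon>"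
  obtains \<delta> where "0 < \<delta>" "\<And>D. dfam 0 1 D \<Longrightarrow> len D < \<delta> \<Longrightarrow> (\<Sum>I\<in>D. norm (g (snd I) - g (fst I))) < \<epsilon>"
  using assms unfolding acf_def by blast

lemma norm_incr_le: "norm (incr g D) \<le> (\<Sum>I\<in>D. norm (g (snd I) - g (fst I)))"
  unfolding incr_def by (rule norm_sum)

lemma len_nonneg: "dfam a b D \<Longrightarrow> 0 \<le> len D"
  by (metis measure_opn measure_nonneg)

lemma absolutely_continuous_on_iff_acf: "absolutely_continuous_on 0 1 g \<longleftrightarrow> acf g"
proof
  assume *: "absolutely_continuous_on 0 1 g"
  show "acf g" unfolding acf_def
  proof (intro allI impI)
    fix \<epsilon> :: real assume "0 < \<epsilon>"
    from *[unfolded absolutely_continuous_on_def, THEN spec, THEN mp, OF this]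
    obtain \<delta> where \<delta>: "0 < \<delta>" and ac: "\<forall>(n::nat) u v. (\<forall>i<n. 0 \<le> u i \<and> u i \<le> v i \<and> v i \<le> 1) \<and>
        (\<forall>i<n. \<forall>j<n. i \<noteq> j \<longrightarrow> {u i<..<v i} \<inter> {u j<..<v j} = {}) \<and>
        (\<Sum>i<n. v i - u i) < \<delta> \<longrightarrow> (\<Sum>i<n. cmod (g (v i) - g (u i))) < \<epsilon>"
      by (elim exE conjE)
    have "(\<Sum>I\<in>D. norm (g (snd I) - g (fst I))) < \<epsilon>" if D: "dfam 0 1 D" "len D < \<delta>" for D
    proof -
      have "finite D" using D by (simp add: dfam_def)
      then obtain f where f: "bij_betw f {..<card D} D"
        using ex_bij_betw_nat_finite[of D] by (auto simp: atLeast0LessThan)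
      have fD: "f i \<in> D" if "i < card D" for i using f that by (auto simp: bij_betw_def)
      have "(\<Sum>i<card D. cmod (g (snd (f i)) - g (fst (f i)))) < \<epsilon>"
      proof (rule ac[THEN spec, THEN spec, THEN spec, THEN mp], intro conjI allI impI)
        fix i assume i: "i < card D"
        show "0 \<le> fst (f i)" "fst (f i) \<le> snd (f i)" "snd (f i) \<le> 1"
          using fD[OF i] D by (auto simp: dfam_def less_imp_le)
        fix j assume j: "j < card D" "i \<noteq> j"
        then have "f i \<noteq> f j" using f i by (auto simp: bij_betw_def inj_on_def)
        then show "{fst (f i)<..<snd (f i)} \<inter> {fst (f j)<..<snd (f j)} = {}"
          using D fD[OF i] fD[OF j(1)] by (auto simp: dfam_def pairwise_def disjnt_def)
      next
        show "(\<Sum>i<card D. snd (f i) - fst (f i)) < \<delta>"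
          using D(2) sum.reindex_bij_betw[OF f, of "\<lambda>I. snd I - fst I"] by (simp add: len_def)
      qed
      then show ?thesis using sum.reindex_bij_betw[OF f, of "\<lambda>I. norm (g (snd I) - g (fst I))"] by simp
    qed
    then show "\<exists>\<delta>>0. \<forall>D. dfam 0 1 D \<longrightarrow> len D < \<delta> \<longrightarrow> (\<Sum>I\<in>D. norm (g (snd I) - g (fst I))) < \<epsilon>"
      using \<delta> by blast
  qed
next
  assume *: "acf g"
  show "absolutely_continuous_on 0 1 g" unfolding absolutely_continuous_on_def
  proof (intro allI impI)
    fix \<epsilon> :: real assume "0 < \<epsilon>"
    with * obtain \<delta> where \<delta>: "0 < \<delta>" "\<And>D. dfam 0 1 D \<Longrightarrow> len D < \<delta> \<Longrightarrow> (\<Sum>I\<in>D. norm (g (snd I) - g (fst I))) < \<epsilon>"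
      by (rule acfD) blast
    have key: "(\<Sum>i<n. cmod (g (v i) - g (u i))) < \<epsilon>"
      if uv: "\<forall>i<n. 0 \<le> u i \<and> u i \<le> v i \<and> v i \<le> 1" and dj: "\<forall>i<n. \<forall>j<n. i \<noteq> j \<longrightarrow> {u i<..<v i} \<inter> {u j<..<v j} = {}"
        and sm: "(\<Sum>i<n. v i - u i) < \<delta>" for n :: nat and u v :: "nat \<Rightarrow> real"
    proof -
      define A where "A = {i. i < n \<and> u i < v i}"
      define p where "p = (\<lambda>i. (u i, v i))"
      have inj: "inj_on p A"
      proof (rule inj_onI, rule ccontr)
        fix i j assume ij: "i \<in> A" "j \<in> A" "p i = p j" "i \<noteq> j"
        then have "{u i<..<v i} \<inter> {u j<..<v j} = {}" using dj by (auto simp: A_def)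
        then show False using ij by (auto simp: p_def A_def)
      qed
      have D: "dfam 0 1 (p ` A)" unfolding dfam_def
      proof (intro conjI ballI)
        show "finite (p ` A)" by (simp add: A_def)
        show "pairwise (\<lambda>I J. disjnt {fst I<..<snd I} {fst J<..<snd J}) (p ` A)"
          unfolding pairwise_def
        proof (intro ballI impI)
          fix I J assume "I \<in> p ` A" "J \<in> p ` A" "I \<noteq> J"
          then obtain i j where ij: "i \<in> A" "j \<in> A" "I = p i" "J = p j" "i \<noteq> j" by auto
          then have "{u i<..<v i} \<inter> {u j<..<v j} = {}" using dj by (simp add: A_def)
          then show "disjnt {fst I<..<snd I} {fst J<..<snd J}" using ij by (simp add: p_def disjnt_def)
        qed
      qed (use uv in \<open>auto simp: A_def p_def\<close>)
      have "len (p ` A) = (\<Sum>i\<in>A. v i - u i)" unfolding len_def by (subst sum.reindex[OF inj]) (simp add: p_def)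
      also have "\<dots> = (\<Sum>i<n. v i - u i)" unfolding A_def using uv by (intro sum.mono_neutral_left) auto
      finally have "len (p ` A) < \<delta>" using sm by simp
      from \<delta>(2)[OF D this] have "(\<Sum>i\<in>A. cmod (g (v i) - g (u i))) < \<epsilon>"
        by (subst (asm) sum.reindex[OF inj]) (simp add: p_def)
      moreover have "(\<Sum>i\<in>A. cmod (g (v i) - g (u i))) = (\<Sum>i<n. cmod (g (v i) - g (u i)))"
        unfolding A_def using uv by (intro sum.mono_neutral_left) (auto simp: le_less)
      ultimately show ?thesis by simp
    qed
    show "\<exists>\<delta>>0. \<forall>(n::nat) u v. (\<forall>i<n. 0 \<le> u i \<and> u i \<le> v i \<and> v i \<le> 1) \<and>
        (\<forall>i<n. \<forall>j<n. i \<noteq> j \<longrightarrow> {u i<..<v i} \<inter> {u j<..<v j} = {}) \<and>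
        (\<Sum>i<n. v i - u i) < \<delta> \<longrightarrow> (\<Sum>i<n. cmod (g (v i) - g (u i))) < \<epsilon>"
    proof (intro exI[of _ \<delta>] conjI allI impI)
      show "0 < \<delta>" by fact
      fix n :: nat and u v :: "nat \<Rightarrow> real"
      assume "(\<forall>i<n. 0 \<le> u i \<and> u i \<le> v i \<and> v i \<le> 1) \<and>
        (\<forall>i<n. \<forall>j<n. i \<noteq> j \<longrightarrow> {u i<..<v i} \<inter> {u j<..<v j} = {}) \<and>
        (\<Sum>i<n. v i - u i) < \<delta>"
      then show "(\<Sum>i<n. cmod (g (v i) - g (u i))) < \<epsilon>"
        by (elim conjE) (rule key)
    qed
  qed
qed

lemma acf_continuous:
  fixes g :: "real \<Rightarrow> 'a::real_normed_vector"
  assumes "acf g" shows "continuous_on {0..1} g"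
  unfolding continuous_on_iff
proof (intro ballI allI impI)
  fix x \<epsilon> :: real assume x: "x \<in> {0..1}" and "0 < \<epsilon>"
  with assms obtain \<delta> where \<delta>: "0 < \<delta>" "\<And>D. dfam 0 1 D \<Longrightarrow> len D < \<delta> \<Longrightarrow> (\<Sum>I\<in>D. norm (g (snd I) - g (fst I))) < \<epsilon>"
    by (metis acfD)
  have *: "norm (g v - g u) < \<epsilon>" if "0 \<le> u" "u < v" "v \<le> 1" "v - u < \<delta>" for u v
    using \<delta>(2)[of "{(u,v)}"] that by (simp add: dfam_def len_def)
  have "dist (g y) (g x) < \<epsilon>" if y: "y \<in> {0..1}" "dist y x < \<delta>" for y
  proof (cases y x rule: linorder_cases)
    case less
    have "norm (g x - g y) < \<epsilon>" by (rule *) (use less x y in \<open>auto simp: dist_real_def\<close>)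
    then show ?thesis by (simp add: dist_norm norm_minus_commute)
  next
    case equal
    then show ?thesis using \<open>0 < \<epsilon>\<close> by simp
  next
    case greater
    have "norm (g y - g x) < \<epsilon>" by (rule *) (use greater x y in \<open>auto simp: dist_real_def\<close>)
    then show ?thesis by (simp add: dist_norm)
  qed
  then show "\<exists>d>0. \<forall>x'\<in>{0..1}. dist x' x < d \<longrightarrow> dist (g x') (g x) < \<epsilon>" using \<delta>(1) by blast
qed

text \<open>
  The common source of the closure properties: differences, products and components all satisfy
  such a bound on increments.
\<close>

lemma acf_bound:
  assumes g: "acf g" and h: "acf h" and K: "0 \<le> K"
    and le: "\<And>u v. 0 \<le> u \<Longrightarrow> u \<le> v \<Longrightarrow> v \<le> 1 \<Longrightarrow> norm (f v - f u) \<le> K * (norm (g v - g u) + norm (h v - h u))"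
  shows "acf f"
  unfolding acf_def
proof (intro allI impI)
  fix \<epsilon> :: real assume \<epsilon>: "0 < \<epsilon>"
  define \<eta> where "\<eta> = \<epsilon> / (2 * (K + 1))"
  have \<eta>: "0 < \<eta>" using K \<epsilon> by (simp add: \<eta>_def)
  obtain d1 where d1: "0 < d1" "\<And>D. dfam 0 1 D \<Longrightarrow> len D < d1 \<Longrightarrow> (\<Sum>I\<in>D. norm (g (snd I) - g (fst I))) < \<eta>"
    using acfD[OF g \<eta>] by metis
  obtain d2 where d2: "0 < d2" "\<And>D. dfam 0 1 D \<Longrightarrow> len D < d2 \<Longrightarrow> (\<Sum>I\<in>D. norm (h (snd I) - h (fst I))) < \<eta>"
    using acfD[OF h \<eta>] by metis
  have "(\<Sum>I\<in>D. norm (f (snd I) - f (fst I))) < \<epsilon>" if D: "dfam 0 1 D" "len D < min d1 d2" for D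
  proof -
    have "(\<Sum>I\<in>D. norm (f (snd I) - f (fst I))) \<le> (\<Sum>I\<in>D. K * (norm (g (snd I) - g (fst I)) + norm (h (snd I) - h (fst I))))"
      using D(1) by (intro sum_mono le) (auto simp: dfam_def less_imp_le)
    also have "\<dots> = K * ((\<Sum>I\<in>D. norm (g (snd I) - g (fst I))) + (\<Sum>I\<in>D. norm (h (snd I) - h (fst I))))"
      by (simp add: sum_distrib_left sum.distrib distrib_left)
    also have "\<dots> \<le> K * (\<eta> + \<eta>)" using d1(2)[OF D(1)] d2(2)[OF D(1)] D(2) K by (intro mult_left_mono add_mono) auto
    also have "\<dots> < (K + 1) * (\<eta> + \<eta>)" using \<eta> by simp
    also have "\<dots> = \<epsilon>" using K by (simp add: \<eta>_def divide_simps)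
    finally show ?thesis .
  qed
  then show "\<exists>\<delta>>0. \<forall>D. dfam 0 1 D \<longrightarrow> len D < \<delta> \<longrightarrow> (\<Sum>I\<in>D. norm (f (snd I) - f (fst I))) < \<epsilon>"
    using d1(1) d2(1) by (intro exI[of _ "min d1 d2"]) auto
qed

lemma acf_cong: "acf g \<Longrightarrow> (\<And>x. x \<in> {0..1} \<Longrightarrow> f x = g x) \<Longrightarrow> acf f"
  by (rule acf_bound[of g g 1]) auto

lemma acf_diff: "acf g \<Longrightarrow> acf h \<Longrightarrow> acf (\<lambda>x. g x - h x :: 'a::real_normed_vector)"
proof (rule acf_bound[of g h 1])
  fix u v
  have "(g v - h v) - (g u - h u) = (g v - g u) - (h v - h u)" by simp
  then show "norm ((g v - h v) - (g u - h u)) \<le> 1 * (norm (g v - g u) + norm (h v - h u))"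
    using norm_triangle_ineq4[of "g v - g u" "h v - h u"] by (simp only: mult_1)
qed auto

lemma acf_Re: "acf g \<Longrightarrow> acf (\<lambda>x. Re (g x))"
proof (rule acf_bound[of g g 1])
  fix u v show "norm (Re (g v) - Re (g u)) \<le> 1 * (norm (g v - g u) + norm (g v - g u))"
    using abs_Re_le_cmod[of "g v - g u"] norm_ge_zero[of "g v - g u"] by simp
qed auto

lemma acf_Im: "acf g \<Longrightarrow> acf (\<lambda>x. Im (g x))"
proof (rule acf_bound[of g g 1])
  fix u v show "norm (Im (g v) - Im (g u)) \<le> 1 * (norm (g v - g u) + norm (g v - g u))"
    using abs_Im_le_cmod[of "g v - g u"] norm_ge_zero[of "g v - g u"] by simp
qed auto

lemma acf_mult:
  fixes g h :: "real \<Rightarrow> complex"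
  assumes g: "acf g" and h: "acf h"
  shows "acf (\<lambda>x. g x * h x)"
proof -
  have "bounded (g ` {0..1})" "bounded (h ` {0..1})"
    using acf_continuous[OF g] acf_continuous[OF h] by (auto intro!: compact_imp_bounded compact_continuous_image)
  then obtain A B where A: "\<And>x. x \<in> {0..1} \<Longrightarrow> norm (g x) \<le> A" and B: "\<And>x. x \<in> {0..1} \<Longrightarrow> norm (h x) \<le> B"
    unfolding bounded_iff by (metis imageI)
  have A0: "0 \<le> A" using order_trans[OF norm_ge_zero A[of 0]] by simp
  have B0: "0 \<le> B" using order_trans[OF norm_ge_zero B[of 0]] by simp
  show ?thesis
  proof (rule acf_bound[OF g h, of "A + B"])
    fix u v :: real assume uv: "0 \<le> u" "u \<le> v" "v \<le> 1"
    have "g v * h v - g u * h u = (g v - g u) * h v + g u * (h v - h u)" by (simp add: algebra_simps)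
    then have "norm (g v * h v - g u * h u) \<le> norm (g v - g u) * norm (h v) + norm (g u) * norm (h v - h u)"
      using norm_triangle_ineq[of "(g v - g u) * h v" "g u * (h v - h u)"] by (simp add: norm_mult)
    also have "\<dots> \<le> norm (g v - g u) * (A + B) + (A + B) * norm (h v - h u)"
      using A[of u] B[of v] uv A0 B0 by (intro add_mono mult_mono) auto
    finally show "norm (g v * h v - g u * h u) \<le> (A + B) * (norm (g v - g u) + norm (h v - h u))"
      by (simp add: algebra_simps)
  qed (use A0 B0 in simp)
qed

lemma acf_integral:
  fixes h :: "real \<Rightarrow> 'a::euclidean_space"
  assumes h: "h absolutely_integrable_on {0..1}"
  shows "acf (\<lambda>x. c + integral {0..x} h)"
  unfolding acf_def
proof (intro allI impI)
  fix \<epsilon> :: real assume "0 < \<epsilon>"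
  then obtain \<delta> where \<delta>: "0 < \<delta>"
    "\<And>T. T \<in> sets lebesgue \<Longrightarrow> T \<subseteq> {0..1} \<Longrightarrow> measure lebesgue T < \<delta> \<Longrightarrow> integral T (\<lambda>x. norm (h x)) < \<epsilon>"
    using absolute_continuity_integral[OF h] by metis
  have nh: "(\<lambda>x. norm (h x)) absolutely_integrable_on {0..1}" using absolutely_integrable_norm[OF h] by (simp add: o_def)
  have hi: "f integrable_on {u..v}" if "f absolutely_integrable_on {0..1}" "0 \<le> u" "v \<le> 1" for u v and f :: "real \<Rightarrow> 'b::euclidean_space"
    using absolutely_integrable_on_subinterval[OF that(1), of u v] that set_lebesgue_integral_eq_integral(1) by auto
  have cmb: "integral {0..v} f - integral {0..u} f = integral {u..v} f" if "f absolutely_integrable_on {0..1}" "0 \<le> u" "u \<le> v" "v \<le> 1" for u v and f :: "real \<Rightarrow> 'b::euclidean_space"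
    using Henstock_Kurzweil_Integration.integral_combine[of 0 u v f] hi[OF that(1), of 0 v] that by (simp add: algebra_simps)
  have "(\<Sum>I\<in>D. norm ((c + integral {0..snd I} h) - (c + integral {0..fst I} h))) < \<epsilon>" if D: "dfam 0 1 D" "len D < \<delta>" for D
  proof -
    have "(\<Sum>I\<in>D. norm ((c + integral {0..snd I} h) - (c + integral {0..fst I} h))) \<le> incr (\<lambda>x. integral {0..x} (\<lambda>x. norm (h x))) D"
      unfolding incr_def
    proof (rule sum_mono)
      fix I assume "I \<in> D"
      then have I: "0 \<le> fst I" "fst I \<le> snd I" "snd I \<le> 1" using D by (auto simp: dfam_def)
      show "norm ((c + integral {0..snd I} h) - (c + integral {0..fst I} h)) \<le>
          integral {0..snd I} (\<lambda>x. norm (h x)) - integral {0..fst I} (\<lambda>x. norm (h x))"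
        using cmb[OF h I] cmb[OF nh I] hi[OF h I(1,3)] hi[OF nh I(1,3)] by (simp add: integral_norm_bound_integral)
    qed
    also have "\<dots> = integral (opn D) (\<lambda>x. norm (h x))" using incr_integral(2)[OF nh D(1)] by simp
    also have "\<dots> < \<epsilon>"
    proof (rule \<delta>(2))
      show "opn D \<in> sets lebesgue" using open_opn by auto
      show "opn D \<subseteq> {0..1}" using D by (force simp: opn_def dfam_def)
      show "measure lebesgue (opn D) < \<delta>" using measure_opn[OF D(1)] D(2) by simp
    qed
    finally show ?thesis .
  qed
  then show "\<exists>\<delta>>0. \<forall>D. dfam 0 1 D \<longrightarrow> len D < \<delta> \<longrightarrow>
      (\<Sum>I\<in>D. norm ((c + integral {0..snd I} h) - (c + integral {0..fst I} h))) < \<epsilon>" using \<delta>(1) by blast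
qed

section \<open>Differentiability of absolutely continuous functions\<close>

text \<open>
  Take intervals of slope below \<open>a\<close> covering the set and, inside them, intervals of
  slope above \<open>b\<close> that still cover most of the set. What remains of the first family
  has small total length, hence small increment; comparing the increments of the two families
  bounds \<open>(b - a)\<close> times the measure.
\<close>

lemma null_steep_steep:
  assumes G: "acf G" and "a < b"
  shows "negligible (steep G b \<inter> steep (\<lambda>x. - G x) (- a))" (is "negligible ?E")
proof -
  have E: "?E \<in> lmeasurable" "?E \<subseteq> {0<..<1}"
    using steep_lmeasurable steep_subset[of G b] by (auto intro: fmeasurable.Int)
  let ?m = "measure lebesgue ?E"
  have main: "(b - a) * ?m \<le> \<eta> * (1 + 3 * \<bar>a\<bar> + 2 * (b - a))" if \<eta>: "0 < \<eta>" for \<eta>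
  proof -
    obtain \<delta> where \<delta>: "0 < \<delta>" "\<And>D. dfam 0 1 D \<Longrightarrow> len D < \<delta> \<Longrightarrow> (\<Sum>I\<in>D. norm (G (snd I) - G (fst I))) < \<eta>"
      using acfD[OF G \<eta>] by metis
    define \<epsilon> where "\<epsilon> = min (\<delta> / 3) \<eta>"
    have \<epsilon>: "0 < \<epsilon>" "\<epsilon> \<le> \<eta>" "3 * \<epsilon> \<le> \<delta>" using \<delta>(1) \<eta> by (auto simp: \<epsilon>_def)
    \<comment> \<open>Steepness of \<open>-G\<close> with slope \<open>-a\<close> means slope below \<open>a\<close> for \<open>G\<close>.\<close>
    have f1: "\<exists>u v. u < x \<and> x < v \<and> v - u < d \<and> G v - G u < a * (v - u)" if x: "x \<in> ?E" and d: "0 < d" for x d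
    proof -
      have "x \<in> steep (\<lambda>x. - G x) (- a)" using x by simp
      then obtain u v where "u < x" "x < v" "v - u < d" "- a * (v - u) < - G v - - G u"
        using d unfolding steep_def by blast
      then show ?thesis by (intro exI[of _ u] exI[of _ v]) auto
    qed
    obtain D1 where D1: "dfam 0 1 D1" "\<And>I. I \<in> D1 \<Longrightarrow> G (snd I) - G (fst I) < a * (snd I - fst I)"
        "measure lebesgue (?E - opn D1) < \<epsilon>" "measure lebesgue (opn D1 - ?E) < \<epsilon>"
      by (rule tight_vitali_family[OF E \<epsilon>(1) f1]) blast+
    have D1m: "opn D1 \<in> lmeasurable" using opn_lmeasurable[OF D1(1)] .
    have D1s: "opn D1 \<subseteq> {0<..<1}" using D1(1) by (force simp: opn_def dfam_def)
    have E1: "?E \<inter> opn D1 \<in> lmeasurable" by (rule fmeasurable.Int[OF E(1) D1m])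
    have f2: "\<exists>u v. u < x \<and> x < v \<and> v - u < d \<and> b * (v - u) < G v - G u" if x: "x \<in> ?E \<inter> opn D1" and d: "0 < d" for x d
    proof -
      have "x \<in> steep G b" using x by simp
      then show ?thesis using d unfolding steep_def by blast
    qed
    obtain D2 where D2: "dfam 0 1 D2" "opn D2 \<subseteq> opn D1" "\<And>I. I \<in> D2 \<Longrightarrow> b * (snd I - fst I) < G (snd I) - G (fst I)"
        "measure lebesgue (?E \<inter> opn D1 - opn D2) < \<epsilon>"
      by (rule vitali_family[OF E1 Int_lower2 open_opn D1s f2 \<epsilon>(1)]) blast+
    have D2m: "opn D2 \<in> lmeasurable" using opn_lmeasurable[OF D2(1)] .
    obtain R where R: "dfam 0 1 R" "incr G D1 = incr G D2 + incr G R" "len D1 = len D2 + len R"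
      using dfam_diff[OF D1(1) D2(1) _ D2(2), where 'a=real] by (metis zero_le_one)
    have l1: "\<bar>?m - len D1\<bar> < \<epsilon>"
      using measure_diff_le[OF E(1) D1m D1(3,4)] measure_opn[OF D1(1)] by simp
    have "measure lebesgue ?E \<le> measure lebesgue ((?E - opn D1) \<union> (?E \<inter> opn D1 - opn D2) \<union> opn D2)"
      using E D1m D2m E1 by (intro measure_mono_fmeasurable) (auto intro!: fmeasurable.Un fmeasurable_Diff)
    also have "\<dots> \<le> measure lebesgue (?E - opn D1) + measure lebesgue (?E \<inter> opn D1 - opn D2) + measure lebesgue (opn D2)"
      using E D1m D2m E1 by (intro order_trans[OF measure_Un_le] add_mono measure_Un_le) auto
    finally have l2: "?m - 2 * \<epsilon> \<le> len D2" using D1(3) D2(4) measure_opn[OF D2(1)] by simp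
    have lR: "len R < 3 * \<epsilon>" "0 \<le> len R" using l1 l2 R(3) len_nonneg[OF R(1)] by auto
    then have "norm (incr G R) < \<eta>" using \<delta>(2)[OF R(1)] \<epsilon>(3) norm_incr_le[of G R] by simp
    then have iR: "- \<eta> < incr G R" by (simp add: abs_less_iff)
    have "b * len D2 \<le> incr G D2" unfolding len_def incr_def sum_distrib_left by (intro sum_mono less_imp_le D2(3))
    moreover have "incr G D1 \<le> a * len D1" unfolding len_def incr_def sum_distrib_left by (intro sum_mono less_imp_le D1(2))
    ultimately have "b * len D2 - \<eta> \<le> a * len D2 + a * len R" using R(2,3) iR by (simp add: algebra_simps)
    moreover have "a * len R \<le> \<bar>a\<bar> * (3 * \<eta>)" using lR \<epsilon>(2) by (intro mult_mono) auto
    ultimately have "(b - a) * len D2 \<le> \<eta> + \<bar>a\<bar> * (3 * \<eta>)" by (simp add: algebra_simps)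
    moreover have "(b - a) * (?m - 2 * \<eta>) \<le> (b - a) * len D2" using l2 \<epsilon>(2) \<open>a < b\<close> by (intro mult_left_mono) auto
    ultimately show ?thesis by (simp add: algebra_simps)
  qed
  have "(b - a) * ?m \<le> 0"
  proof (rule field_le_epsilon)
    fix e :: real assume "0 < e"
    define c where "c = 1 + 3 * \<bar>a\<bar> + 2 * (b - a)"
    have "0 < c" using \<open>a < b\<close> by (simp add: c_def)
    then show "(b - a) * ?m \<le> 0 + e" using main[of "e / c"] \<open>0 < e\<close> unfolding c_def[symmetric] by simp
  qed
  then have "?m \<le> 0" using \<open>a < b\<close> by (simp add: mult_le_0_iff)
  then have "?m = 0" by (simp add: measure_le_0_iff)
  then show ?thesis using E(1) by (simp add: negligible_iff_measure)
qed

text \<open>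
  Locally the total increment is below 1 by absolute continuity, whereas a covering by intervals
  of slope above \<open>k\<close> has increment at least about \<open>k\<close> times the measure.
\<close>

lemma null_steep_infinite:
  assumes G: "acf G"
  shows "negligible (\<Inter>k::nat. steep G (real k))" (is "negligible ?E")
proof -
  have Em: "?E \<in> lmeasurable"
  proof (rule fmeasurableI2[OF steep_lmeasurable[of G "real 0"]])
    show "?E \<subseteq> steep G (real 0)" by blast
    show "?E \<in> sets lebesgue" using steep_lmeasurable[of G] by (auto intro!: sets.countable_INT')
  qed
  obtain \<delta> where \<delta>: "0 < \<delta>" "\<And>D. dfam 0 1 D \<Longrightarrow> len D < \<delta> \<Longrightarrow> (\<Sum>I\<in>D. norm (G (snd I) - G (fst I))) < 1"
    using acfD[OF G zero_less_one] by metis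
  have loc: "negligible (?E \<inter> {c<..<d})" if cd: "0 \<le> c" "c < d" "d \<le> 1" "d - c < \<delta>" for c d
  proof -
    let ?S = "?E \<inter> {c<..<d}"
    have S: "?S \<in> lmeasurable" using Em by (intro fmeasurable.Int) auto
    have "measure lebesgue ?S \<le> 0"
    proof (rule field_le_epsilon)
      fix e :: real assume e: "0 < e"
      obtain k :: nat where k: "2 / e < real k" using reals_Archimedean2 by blast
      have k0: "0 < real k" using k e by (meson divide_pos_pos less_trans zero_less_numeral)
      have f: "\<exists>u v. u < x \<and> x < v \<and> v - u < t \<and> real k * (v - u) < G v - G u" if "x \<in> ?S" "0 < t" for x t
      proof -
        have "x \<in> steep G (real k)" using that by blast
        then show ?thesis using \<open>0 < t\<close> unfolding steep_def by blast
      qed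
      obtain D where D: "dfam c d D" "opn D \<subseteq> {c<..<d}" "\<And>I. I \<in> D \<Longrightarrow> real k * (snd I - fst I) < G (snd I) - G (fst I)"
          "measure lebesgue (?S - opn D) < e / 2"
        by (rule vitali_family[OF S Int_lower2 _ order_refl f, of "e/2"]) (use e in auto)
      have D01: "dfam 0 1 D" using D(1) cd unfolding dfam_def by (meson order_trans)
      have "len D = measure lebesgue (opn D)" using measure_opn[OF D(1)] by simp
      also have "\<dots> \<le> measure lebesgue {c<..<d}" using D(2) open_opn by (intro measure_mono_fmeasurable) auto
      finally have "len D < \<delta>" using cd by simp
      have "real k * len D \<le> incr G D" unfolding len_def incr_def sum_distrib_left by (intro sum_mono less_imp_le D(3))
      also have "\<dots> \<le> norm (incr G D)" by simp
      also have "\<dots> < 1" using \<delta>(2)[OF D01 \<open>len D < \<delta>\<close>] norm_incr_le[of G D] by simp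
      finally have "len D < 1 / real k" using k0 by (simp add: field_simps)
      also have "\<dots> < e / 2" using k k0 e by (simp add: field_simps)
      finally have lD: "len D < e / 2" .
      have "measure lebesgue ?S \<le> measure lebesgue ((?S - opn D) \<union> opn D)"
        using S opn_lmeasurable[OF D(1)] by (intro measure_mono_fmeasurable) (auto intro!: fmeasurable.Un fmeasurable_Diff)
      also have "\<dots> \<le> measure lebesgue (?S - opn D) + measure lebesgue (opn D)"
        using S opn_lmeasurable[OF D(1)] by (intro measure_Un_le) auto
      finally show "measure lebesgue ?S \<le> 0 + e" using D(4) lD measure_opn[OF D(1)] by simp
    qed
    then have "measure lebesgue ?S = 0" by (simp add: measure_le_0_iff)
    then show ?thesis using S by (simp add: negligible_iff_measure)
  qed
  obtain n :: nat where n: "1 / \<delta> < real n" using reals_Archimedean2 by blast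
  have n0: "0 < real n" using n \<delta>(1) by (meson divide_pos_pos less_trans zero_less_one)
  have neg: "negligible ((\<Union>i<n. ?E \<inter> {real i / real n<..<real (Suc i) / real n}) \<union> (\<Union>i\<le>n. {real i / real n}))"
  proof (intro negligible_Un negligible_Union)
    fix T assume "T \<in> (\<lambda>i. ?E \<inter> {real i / real n<..<real (Suc i) / real n}) ` {..<n}"
    then obtain i where i: "i < n" "T = ?E \<inter> {real i / real n<..<real (Suc i) / real n}" by blast
    have "real (Suc i) / real n - real i / real n = 1 / real n" using n0 by (simp add: field_simps)
    also have "\<dots> < \<delta>" using n n0 \<delta>(1) by (simp add: field_simps)
    finally show "negligible T" unfolding i(2) using i(1) n0 by (intro loc) (auto simp: divide_simps)
  qed auto
  show ?thesis
  proof (rule negligible_subset[OF neg], rule subsetI)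
    fix x assume x: "x \<in> ?E"
    then have x01: "0 < x" "x < 1" using steep_subset[of G 0] by (auto dest!: spec[of _ "0::nat"])
    define i where "i = nat \<lfloor>x * real n\<rfloor>"
    have i: "real i \<le> x * real n" "x * real n < real i + 1" using x01 n0 by (auto simp: i_def)
    have "x * real n < real n" using x01 n0 by simp
    then have "i < n" using i by linarith
    show "x \<in> (\<Union>i<n. ?E \<inter> {real i / real n<..<real (Suc i) / real n}) \<union> (\<Union>i\<le>n. {real i / real n})"
    proof (cases "real i = x * real n")
      case True
      then have "x = real i / real n" using n0 by simp
      then show ?thesis using \<open>i < n\<close> by force
    next
      case False
      then have "real i / real n < x" "x < real (Suc i) / real n" using i n0 by (simp_all add: divide_simps)
      then show ?thesis using \<open>i < n\<close> x by (intro UnI1 UN_I[of i]) auto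
    qed
  qed
qed

text \<open>
  Away from the two kinds of null sets the supremum of the slopes that occur on arbitrarily short
  straddling intervals is finite and is the derivative.
\<close>

lemma acf_differentiable_ae_real:
  fixes G :: "real \<Rightarrow> real"
  assumes G: "acf G"
  obtains N where "negligible N" "\<And>x. x \<in> {0..1} - N \<Longrightarrow> x \<in> {0<..<1} \<and> (\<exists>D. (G has_real_derivative D) (at x))"
proof -
  have G': "acf (\<lambda>x. - G x)" by (rule acf_bound[OF G G, of 1]) (auto simp: abs_if)
  define N where "N = {0,1} \<union> (\<Inter>k::nat. steep G (real k)) \<union> (\<Inter>k::nat. steep (\<lambda>x. - G x) (real k)) \<union>
     (\<Union>p\<in>{p \<in> \<rat> \<times> \<rat>. fst p < snd p}. steep G (snd p) \<inter> steep (\<lambda>x. - G x) (- fst p))"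
  have "negligible N" unfolding N_def
    using null_steep_steep[OF G] null_steep_infinite[OF G] null_steep_infinite[OF G']
    by (intro negligible_Un negligible_countable_Union) (auto intro!: countable_image countable_Collect countable_SIGMA countable_rat)
  moreover have "x \<in> {0<..<1} \<and> (\<exists>D. (G has_real_derivative D) (at x))" if x: "x \<in> {0..1} - N" for x
  proof
    show x01: "x \<in> {0<..<1}" using x by (auto simp: N_def less_le)
    let ?B = "{b. x \<notin> steep G b}"
    obtain k where k: "x \<notin> steep G (real k)" using x by (auto simp: N_def)
    obtain l where l: "x \<notin> steep (\<lambda>x. - G x) (real l)" using x by (auto simp: N_def)
    have sep: "x \<notin> steep (\<lambda>x. - G x) (- a)" if xb: "x \<in> steep G b" and ab: "a < b" for a b
    proof -
      obtain p where p: "p \<in> \<rat>" "a < p" "p < b" using Rats_dense_in_real[OF ab] by blast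
      obtain r where r: "r \<in> \<rat>" "p < r" "r < b" using Rats_dense_in_real[OF p(3)] by blast
      have "x \<in> steep G r" using xb steep_antimono[of r b G] r by auto
      then have "x \<notin> steep (\<lambda>x. - G x) (- p)" using x p r unfolding N_def by force
      then show ?thesis using steep_antimono[of "- p" "- a"] p by auto
    qed
    have bdd: "- real l - 1 \<le> b" if "b \<in> ?B" for b
    proof (rule ccontr)
      assume "\<not> - real l - 1 \<le> b"
      then have bl: "b < - real l" by simp
      have cG: "continuous_on {0..1} G" "continuous_on {0..1} (\<lambda>x. - G x)" using acf_continuous G G' by auto
      obtain d1 where d1: "0 < d1" "\<And>u v. 0 < u \<Longrightarrow> u \<le> x \<Longrightarrow> x \<le> v \<Longrightarrow> v < 1 \<Longrightarrow> v - u < d1 \<Longrightarrow> G v - G u \<le> b * (v - u)"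
        using not_steepD[OF cG(1), of x b] \<open>b \<in> ?B\<close> by auto
      obtain d2 where d2: "0 < d2" "\<And>u v. 0 < u \<Longrightarrow> u \<le> x \<Longrightarrow> x \<le> v \<Longrightarrow> v < 1 \<Longrightarrow> v - u < d2 \<Longrightarrow> - G v - - G u \<le> real l * (v - u)"
        using not_steepD[OF cG(2) l] by auto
      define v where "v = x + min (min d1 d2) (1 - x) / 2"
      have v: "x < v" "v < 1" "v - x < d1" "v - x < d2" using d1(1) d2(1) x01 by (auto simp: v_def min_def field_simps)
      have "G v - G x \<le> b * (v - x)" "- G v - - G x \<le> real l * (v - x)" using d1(2)[of x v] d2(2)[of x v] v x01 by auto
      then have "0 \<le> (b + real l) * (v - x)" by (simp add: algebra_simps)
      moreover have "(b + real l) * (v - x) < 0" using bl v by (intro mult_neg_pos) auto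
      ultimately show False by simp
    qed
    define D where "D = Inf ?B"
    have "(G has_real_derivative D) (at x)"
    proof (rule derivative_from_steep[OF acf_continuous[OF G] x01])
      fix b assume "D < b"
      then obtain c where "c \<in> ?B" "c < b" unfolding D_def using k bdd by (subst (asm) cInf_less_iff) (auto intro!: bdd_belowI)
      then show "x \<notin> steep G b" using steep_antimono[of c b G] by auto
    next
      fix a assume a: "a < D"
      then obtain b where b: "a < b" "b < D" using dense by blast
      then have "b \<notin> ?B" unfolding D_def using cInf_lower[of b ?B] bdd by (force intro!: bdd_belowI)
      then show "x \<notin> steep (\<lambda>x. - G x) (- a)" using sep[of b a] b by simp
    qed
    then show "\<exists>D. (G has_real_derivative D) (at x)" by blast
  qed
  ultimately show ?thesis using that by blast
qed

text \<open>
  Intervals with slope at most \<open>e/2\<close> cover almost all of \<open>[0,x]\<close>, and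
  the remaining gaps have small total length, so their increments are small by absolute
  continuity.
\<close>

lemma acf_zero_derivative:
  fixes F :: "real \<Rightarrow> 'a::real_normed_vector"
  assumes F: "acf F" and N: "negligible N"
    and z: "\<And>x. x \<in> {0<..<1} - N \<Longrightarrow> (F has_vector_derivative 0) (at x)"
    and x: "x \<in> {0..1}"
  shows "F x = F 0"
proof (cases "x = 0")
  case False
  then have x0: "0 < x" "x \<le> 1" using x by auto
  have "norm (F x - F 0) \<le> 0"
  proof (rule field_le_epsilon)
    fix e :: real assume e: "0 < e"
    obtain \<delta> where \<delta>: "0 < \<delta>" "\<And>D. dfam 0 1 D \<Longrightarrow> len D < \<delta> \<Longrightarrow> (\<Sum>I\<in>D. norm (F (snd I) - F (fst I))) < e / 2"
      using acfD[OF F, of "e/2"] e by (metis half_gt_zero)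
    let ?S = "{0<..<x} - N"
    have S: "?S \<in> lmeasurable" using N by (intro fmeasurable_Diff) (auto simp: negligible_iff_null_sets)
    have mS: "measure lebesgue ?S = x" using N x0 by (simp add: measure_Diff_null_set negligible_iff_null_sets)
    have f: "\<exists>u v. u < y \<and> y < v \<and> v - u < t \<and> norm (F v - F u) \<le> e / 2 * (v - u)" if y: "y \<in> ?S" and t: "0 < t" for y t
    proof -
      have "(F has_derivative (\<lambda>h. 0)) (at y)" using z[of y] y x0 by (simp add: has_vector_derivative_def)
      then have "\<exists>d>0. \<forall>w. norm (w - y) < d \<longrightarrow> norm (F w - F y - 0) \<le> e / 2 * norm (w - y)"
        unfolding has_derivative_at_alt using e by (meson half_gt_zero)
      then obtain d where d: "0 < d" "\<And>w. norm (w - y) < d \<Longrightarrow> norm (F w - F y) \<le> e / 2 * norm (w - y)" by auto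
      define s where "s = min d t / 3"
      have s: "0 < s" "s < d" "2 * s < t" using d t by (auto simp: s_def)
      have "norm (F (y + s) - F y) \<le> e/2 * s" "norm (F (y - s) - F y) \<le> e/2 * s" using d(2)[of "y + s"] d(2)[of "y - s"] s by auto
      then have "norm (F (y + s) - F (y - s)) \<le> e/2 * s + e/2 * s"
        using norm_triangle_ineq4[of "F (y + s) - F y" "F (y - s) - F y"] by simp
      then show ?thesis using s by (intro exI[of _ "y - s"] exI[of _ "y + s"]) (auto simp: algebra_simps)
    qed
    obtain D where D: "dfam 0 x D" "opn D \<subseteq> {0<..<x}" "\<And>I. I \<in> D \<Longrightarrow> norm (F (snd I) - F (fst I)) \<le> e / 2 * (snd I - fst I)"
        "measure lebesgue (?S - opn D) < \<delta>"
      by (rule vitali_family[OF S Diff_subset _ order_refl f \<delta>(1)]) auto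
    obtain R where R: "dfam 0 x R" "F x - F 0 = incr F D + incr F R" "x - 0 = len D + len R"
      using dfam_complement[OF D(1), where 'a='a] x0 by auto
    have "measure lebesgue ?S \<le> measure lebesgue ((?S - opn D) \<union> opn D)"
      using S opn_lmeasurable[OF D(1)] by (intro measure_mono_fmeasurable) (auto intro!: fmeasurable.Un fmeasurable_Diff)
    also have "\<dots> \<le> measure lebesgue (?S - opn D) + measure lebesgue (opn D)"
      using S opn_lmeasurable[OF D(1)] by (intro measure_Un_le) auto
    finally have "len R < \<delta>" using D(4) mS R(3) measure_opn[OF D(1)] by simp
    moreover have R01: "dfam 0 1 R" using R(1) x0 unfolding dfam_def by (meson order_trans)
    ultimately have "norm (incr F R) < e / 2" using \<delta>(2) norm_incr_le[of F R] by (meson le_less_trans)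
    moreover have "norm (incr F D) \<le> e / 2"
    proof -
      have "norm (incr F D) \<le> (\<Sum>I\<in>D. norm (F (snd I) - F (fst I)))" by (rule norm_incr_le)
      also have "\<dots> \<le> e / 2 * len D" unfolding len_def sum_distrib_left by (intro sum_mono D(3))
      also have "\<dots> \<le> e / 2 * 1" using R(3) x0 len_nonneg[OF R(1)] e by (intro mult_left_mono) auto
      finally show ?thesis by simp
    qed
    ultimately show "norm (F x - F 0) \<le> 0 + e" unfolding R(2) using norm_triangle_ineq[of "incr F D" "incr F R"] by simp
  qed
  then show ?thesis by simp
qed simp

section \<open>Indefinite integrals\<close>

text \<open>
  The integral identity is the working form of \<open>F' = f\<close> almost everywhere with
  \<open>F\<close> absolutely continuous; unlike the latter it is closed under the operations
  below without null sets.
\<close>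

definition prim :: "(real \<Rightarrow> complex) \<Rightarrow> (real \<Rightarrow> complex) \<Rightarrow> bool" where
  "prim F f \<longleftrightarrow> f absolutely_integrable_on {0..1} \<and> (\<forall>x\<in>{0..1}. integral {0..x} f = F x - F 0)"

lemma absint_integrable_on:
  fixes f :: "real \<Rightarrow> 'a::euclidean_space"
  assumes "f absolutely_integrable_on {0..1}" "0 \<le> u" "v \<le> 1"
  shows "f integrable_on {u..v}"
  using absolutely_integrable_on_subinterval[OF assms(1), of u v] set_lebesgue_integral_eq_integral(1) assms by auto

lemma absint_Re: "f absolutely_integrable_on {0..1} \<Longrightarrow> (\<lambda>x. Re (f x)) absolutely_integrable_on {0..1}"
  and absint_Im: "f absolutely_integrable_on {0..1} \<Longrightarrow> (\<lambda>x. Im (f x)) absolutely_integrable_on {0..1}"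
  using absolutely_integrable_linear[OF _ bounded_linear_Re] absolutely_integrable_linear[OF _ bounded_linear_Im]
  by (auto simp: o_def)

lemma absint_mult_continuous:
  fixes f g :: "real \<Rightarrow> complex"
  assumes "f absolutely_integrable_on {0..1}" "continuous_on {0..1} g"
  shows "(\<lambda>x. f x * g x) absolutely_integrable_on {0..1}" "(\<lambda>x. g x * f x) absolutely_integrable_on {0..1}"
proof -
  have "bounded (g ` {0..1})" using assms(2) by (intro compact_imp_bounded compact_continuous_image) auto
  moreover have "g \<in> borel_measurable (lebesgue_on {0..1})"
    using assms(2) by (intro continuous_imp_measurable_on_sets_lebesgue) auto
  ultimately show "(\<lambda>x. g x * f x) absolutely_integrable_on {0..1}"
    using assms(1) by (intro absolutely_integrable_bounded_measurable_product[OF bilinear_times]) auto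
  then show "(\<lambda>x. f x * g x) absolutely_integrable_on {0..1}" by (simp add: mult.commute)
qed

lemma prim_acf: "prim F f \<Longrightarrow> acf F"
  using acf_cong[OF acf_integral[of f "F 0"], of F] by (simp add: prim_def)

lemma prim_continuous: "prim F f \<Longrightarrow> continuous_on {0..1} F"
  using prim_acf acf_continuous by blast

lemma has_vector_derivative_complexI:
  assumes "((\<lambda>x. Re (F x)) has_real_derivative Re D) (at x)" "((\<lambda>x. Im (F x)) has_real_derivative Im D) (at x)"
  shows "(F has_vector_derivative D) (at x)"
  using has_vector_derivative_complex_iff[of F D "at x"] assms by simp

lemma prim_derivative_ae:
  assumes "prim F f"
  obtains N where "negligible N" "\<And>x. x \<in> {0..1} - N \<Longrightarrow> x \<in> {0<..<1} \<and> (F has_vector_derivative f x) (at x)"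
proof -
  have f: "f absolutely_integrable_on {0..1}" and F: "\<And>x. x \<in> {0..1} \<Longrightarrow> F x = F 0 + integral {0..x} f"
    using assms unfolding prim_def by (auto simp: algebra_simps)
  obtain N1 where N1: "negligible N1" "\<And>x. x \<in> {0..1} - N1 \<Longrightarrow> x \<in> {0<..<1} \<and> ((\<lambda>x. integral {0..x} (\<lambda>x. Re (f x))) has_real_derivative Re (f x)) (at x)"
    using lebesgue_differentiation_real[OF absint_Re[OF f]] by blast
  obtain N2 where N2: "negligible N2" "\<And>x. x \<in> {0..1} - N2 \<Longrightarrow> x \<in> {0<..<1} \<and> ((\<lambda>x. integral {0..x} (\<lambda>x. Im (f x))) has_real_derivative Im (f x)) (at x)"
    using lebesgue_differentiation_real[OF absint_Im[OF f]] by blast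
  have "x \<in> {0<..<1} \<and> (F has_vector_derivative f x) (at x)" if x: "x \<in> {0..1} - (N1 \<union> N2)" for x
  proof
    show x01: "x \<in> {0<..<1}" using N1(2) x by blast
    have i: "f integrable_on {0..y}" if "y \<in> {0<..<1}" for y using absint_integrable_on[OF f] that by auto
    have "((\<lambda>x. Re (F x)) has_real_derivative Re (f x)) (at x)"
    proof (rule has_field_derivative_transform_within_open[where S="{0<..<1}"])
      show "((\<lambda>x. Re (F 0) + integral {0..x} (\<lambda>x. Re (f x))) has_real_derivative Re (f x)) (at x)"
        using N1(2) x by (auto intro!: derivative_eq_intros)
      fix y :: real assume "y \<in> {0<..<1}"
      then show "Re (F 0) + integral {0..y} (\<lambda>x. Re (f x)) = Re (F y)"
        using F[of y] integral_linear[OF i bounded_linear_Re] by (simp add: o_def)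
    qed (use x01 in auto)
    moreover have "((\<lambda>x. Im (F x)) has_real_derivative Im (f x)) (at x)"
    proof (rule has_field_derivative_transform_within_open[where S="{0<..<1}"])
      show "((\<lambda>x. Im (F 0) + integral {0..x} (\<lambda>x. Im (f x))) has_real_derivative Im (f x)) (at x)"
        using N2(2) x by (auto intro!: derivative_eq_intros)
      fix y :: real assume "y \<in> {0<..<1}"
      then show "Im (F 0) + integral {0..y} (\<lambda>x. Im (f x)) = Im (F y)"
        using F[of y] integral_linear[OF i bounded_linear_Im] by (simp add: o_def)
    qed (use x01 in auto)
    ultimately show "(F has_vector_derivative f x) (at x)" by (rule has_vector_derivative_complexI)
  qed
  then show ?thesis by (rule that[OF negligible_Un[OF N1(1) N2(1)]])
qed

lemma acf_derivative_ae:
  fixes F :: "real \<Rightarrow> complex"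
  assumes "acf F"
  obtains N where "negligible N" "\<And>x. x \<in> {0..1} - N \<Longrightarrow> x \<in> {0<..<1} \<and> (\<exists>D. (F has_vector_derivative D) (at x))"
proof -
  obtain N1 where N1: "negligible N1" "\<And>x. x \<in> {0..1} - N1 \<Longrightarrow> x \<in> {0<..<1} \<and> (\<exists>D. ((\<lambda>x. Re (F x)) has_real_derivative D) (at x))"
    using acf_differentiable_ae_real[OF acf_Re[OF assms]] by blast
  obtain N2 where N2: "negligible N2" "\<And>x. x \<in> {0..1} - N2 \<Longrightarrow> x \<in> {0<..<1} \<and> (\<exists>D. ((\<lambda>x. Im (F x)) has_real_derivative D) (at x))"
    using acf_differentiable_ae_real[OF acf_Im[OF assms]] by blast
  have "x \<in> {0<..<1} \<and> (\<exists>D. (F has_vector_derivative D) (at x))" if x: "x \<in> {0..1} - (N1 \<union> N2)" for x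
  proof -
    obtain A B where "((\<lambda>x. Re (F x)) has_real_derivative A) (at x)" "((\<lambda>x. Im (F x)) has_real_derivative B) (at x)"
      using N1(2) N2(2) x by blast
    then have "(F has_vector_derivative Complex A B) (at x)" by (intro has_vector_derivative_complexI) auto
    moreover have "x \<in> {0<..<1}" using N1(2) x by blast
    ultimately show ?thesis by (intro conjI exI)
  qed
  then show ?thesis by (rule that[OF negligible_Un[OF N1(1) N2(1)]])
qed

text \<open>
  The difference of \<open>F\<close> and the integral of \<open>f\<close> is absolutely continuous
  with derivative 0 almost everywhere.
\<close>

lemma primI:
  assumes F: "acf F" and N: "negligible N" and f: "f absolutely_integrable_on {0..1}"
    and d: "\<And>x. x \<in> {0<..<1} - N \<Longrightarrow> (F has_vector_derivative f x) (at x)"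
  shows "prim F f"
proof -
  define G where "G = (\<lambda>x. 0 + integral {0..x} f)"
  have G: "prim G f" using f by (simp add: prim_def G_def)
  obtain M where M: "negligible M" "\<And>x. x \<in> {0..1} - M \<Longrightarrow> x \<in> {0<..<1} \<and> (G has_vector_derivative f x) (at x)"
    using prim_derivative_ae[OF G] by blast
  have *: "F x - G x = F 0 - G 0" if "x \<in> {0..1}" for x
  proof (rule acf_zero_derivative[OF acf_diff[OF F prim_acf[OF G]] negligible_Un[OF N M(1)] _ that])
    fix x assume "x \<in> {0<..<1} - (N \<union> M)"
    then show "((\<lambda>x. F x - G x) has_vector_derivative 0) (at x)"
      using has_vector_derivative_diff[of F "f x" "at x" G "f x"] d[of x] M(2)[of x] by auto
  qed
  show ?thesis unfolding prim_def
  proof (intro conjI f ballI)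
    fix x :: real assume "x \<in> {0..1}"
    then show "integral {0..x} f = F x - F 0" using *[of x] by (simp add: G_def algebra_simps)
  qed
qed

lemma prim_spike:
  assumes "prim F f" "negligible N" "\<And>x. x \<in> {0..1} - N \<Longrightarrow> g x = f x"
  shows "prim F g"
  unfolding prim_def
proof (intro conjI ballI)
  show "g absolutely_integrable_on {0..1}"
    by (rule absolutely_integrable_spike[OF _ assms(2,3)]) (use assms(1) in \<open>auto simp: prim_def\<close>)
  fix x :: real assume "x \<in> {0..1}"
  then show "integral {0..x} g = F x - F 0"
    using assms integral_spike[OF assms(2), of "{0..x}" g f] by (auto simp: prim_def)
qed

lemma prim_cong: "prim F f \<Longrightarrow> (\<And>x. x \<in> {0..1} \<Longrightarrow> G x = F x) \<Longrightarrow> (\<And>x. x \<in> {0..1} \<Longrightarrow> g x = f x) \<Longrightarrow> prim G g"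
  using prim_spike[of F f "{}" g] by (simp add: prim_def)

text \<open>
  Almost everywhere both factors are differentiable, so the pointwise product rule and absolute
  continuity of the product suffice.
\<close>

lemma prim_mult:
  assumes F: "prim F f" and G: "prim G g"
  shows "prim (\<lambda>x. F x * G x) (\<lambda>x. f x * G x + F x * g x)"
proof -
  obtain N where N: "negligible N" "\<And>x. x \<in> {0..1} - N \<Longrightarrow> x \<in> {0<..<1} \<and> (F has_vector_derivative f x) (at x)"
    using prim_derivative_ae[OF F] by blast
  obtain M where M: "negligible M" "\<And>x. x \<in> {0..1} - M \<Longrightarrow> x \<in> {0<..<1} \<and> (G has_vector_derivative g x) (at x)"
    using prim_derivative_ae[OF G] by blast
  show ?thesis
  proof (rule primI[OF acf_mult[OF prim_acf[OF F] prim_acf[OF G]] negligible_Un[OF N(1) M(1)]])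
    show "(\<lambda>x. f x * G x + F x * g x) absolutely_integrable_on {0..1}"
      using F G prim_continuous[OF F] prim_continuous[OF G] by (intro set_integral_add(1) absint_mult_continuous) (auto simp: prim_def)
    fix x assume x: "x \<in> {0<..<1} - (N \<union> M)"
    have "(F has_vector_derivative f x) (at x)" "(G has_vector_derivative g x) (at x)" using N(2)[of x] M(2)[of x] x by auto
    from has_vector_derivative_mult[OF this] show "((\<lambda>x. F x * G x) has_vector_derivative f x * G x + F x * g x) (at x)"
      by (simp add: add.commute)
  qed
qed

lemma prim_add: "prim F f \<Longrightarrow> prim G g \<Longrightarrow> prim (\<lambda>x. F x + G x) (\<lambda>x. f x + g x)"
  unfolding prim_def by (auto intro: set_integral_add(1) simp: integral_add absint_integrable_on)

lemma prim_cmult: "prim F f \<Longrightarrow> prim (\<lambda>x. c * F x) (\<lambda>x. c * f x)"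
  unfolding prim_def by (auto intro: absint_mult_continuous simp: right_diff_distrib)

lemma prim_const: "prim (\<lambda>x. c) (\<lambda>x. 0)"
  unfolding prim_def by (auto simp: absolutely_integrable_zero)

lemma prim_C1:
  assumes d: "\<And>x. x \<in> {0..1} \<Longrightarrow> (F has_vector_derivative f x) (at x within {0..1})" and f: "continuous_on {0..1} f"
  shows "prim F f"
  unfolding prim_def
proof (intro conjI ballI)
  show "f absolutely_integrable_on {0..1}" using f by (rule absolutely_integrable_continuous_real)
  fix x :: real assume x: "x \<in> {0..1}"
  have "(f has_integral (F x - F 0)) {0..x}"
  proof (intro fundamental_theorem_of_calculus)
    show "0 \<le> x" using x by simp
    fix y assume "y \<in> {0..x}"
    then have "y \<in> {0..1}" "{0..x} \<subseteq> {0..1}" using x by auto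
    then show "(F has_vector_derivative f y) (at y within {0..x})"
      using has_vector_derivative_within_subset[OF d] by blast
  qed
  then show "integral {0..x} f = F x - F 0" by (rule integral_unique)
qed

lemma prim_has_derivative:
  assumes "prim F f" "continuous_on {0..1} f" "x \<in> {0..1}"
  shows "(F has_vector_derivative f x) (at x within {0..1})"
proof -
  have "((\<lambda>x. F 0 + integral {0..x} f) has_vector_derivative 0 + f x) (at x within {0..1})"
    by (intro has_vector_derivative_add integral_has_vector_derivative assms has_vector_derivative_const)
  then have "((\<lambda>x. F 0 + integral {0..x} f) has_vector_derivative f x) (at x within {0..1})" by simp
  then show ?thesis by (rule has_vector_derivative_transform[OF assms(3), rotated]) (use assms(1) in \<open>auto simp: prim_def\<close>)
qed

lemma D01_eq: "prim F f \<Longrightarrow> continuous_on {0..1} f \<Longrightarrow> x \<in> {0..1} \<Longrightarrow> D01 F x = f x"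
  unfolding D01_def using prim_has_derivative[of F f x]
  by (intro vector_derivative_within_closed_interval) auto

lemma D01_at: "(F has_vector_derivative D) (at x) \<Longrightarrow> x \<in> {0<..<1} \<Longrightarrow> D01 F x = D"
  unfolding D01_def
  by (intro vector_derivative_within_closed_interval) (auto intro: has_vector_derivative_at_within)

lemma absint_iff_integrable: "f absolutely_integrable_on {0..1} \<longleftrightarrow> integrable I01 (f :: real \<Rightarrow> 'a::euclidean_space)"
  by (simp add: integrable_restrict_space set_integrable_def)

lemma AE_I01_iff: "(AE x in I01. P x) \<longleftrightarrow> (\<exists>N. negligible N \<and> (\<forall>x\<in>{0..1}-N. P x))"
proof
  assume "AE x in I01. P x"
  then have "AE x in lebesgue. x \<in> {0..1} \<longrightarrow> P x" by (simp add: AE_restrict_space_iff)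
  then obtain N where "{x. \<not> (x \<in> {0..1} \<longrightarrow> P x)} \<subseteq> N" "N \<in> null_sets lebesgue"
    by (auto simp: eventually_ae_filter)
  then show "\<exists>N. negligible N \<and> (\<forall>x\<in>{0..1}-N. P x)" by (intro exI[of _ N]) (auto simp: negligible_iff_null_sets)
next
  assume "\<exists>N. negligible N \<and> (\<forall>x\<in>{0..1}-N. P x)"
  then obtain N where "N \<in> null_sets lebesgue" "\<forall>x\<in>{0..1}-N. P x" by (auto simp: negligible_iff_null_sets)
  then have "AE x in lebesgue. x \<in> {0..1} \<longrightarrow> P x" by (intro AE_I'[of N]) auto
  then show "AE x in I01. P x" by (simp add: AE_restrict_space_iff)
qed

lemma lebesgue_integral_I01: "f absolutely_integrable_on {0..1} \<Longrightarrow> (LINT x|I01. f x) = integral {0..1} (f :: real \<Rightarrow> 'a::euclidean_space)"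
proof -
  assume f: "f absolutely_integrable_on {0..1}"
  have "(LINT x|I01. f x) = (LINT x:{0..1}|lebesgue. f x)"
    unfolding set_lebesgue_integral_def by (rule integral_restrict_space) auto
  also have "\<dots> = integral {0..1} f" by (rule set_lebesgue_integral_eq_integral(2)[OF f])
  finally show ?thesis .
qed

section \<open>Linear second order systems with integrable coefficients\<close>

text \<open>The twofold integral of \<open>p g\<close>, written as a single integral.\<close>

definition volt :: "(real \<Rightarrow> complex) \<Rightarrow> (real \<Rightarrow> complex) \<Rightarrow> real \<Rightarrow> complex" where
  "volt p g x = integral {0..x} (\<lambda>t. of_real (x - t) * (p t * g t))"

lemma absint_volt:
  fixes p g :: "real \<Rightarrow> complex"
  assumes "p absolutely_integrable_on {0..1}" "continuous_on {0..1} g"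
  shows "(\<lambda>t. of_real (x - t) * (p t * g t)) absolutely_integrable_on {0..1}"
  by (intro absint_mult_continuous assms continuous_intros)

lemma prim_linear: "prim (\<lambda>t. of_real (x - t)) (\<lambda>t. - 1)"
  by (rule prim_C1) (auto intro!: derivative_eq_intros simp: has_vector_derivative_def scaleR_conv_of_real)

lemma prim_integral: "f absolutely_integrable_on {0..1} \<Longrightarrow> prim (\<lambda>x. integral {0..x} f) f"
  by (simp add: prim_def)

text \<open>Integrate by parts the product of \<open>v\<close> with \<open>t \<mapsto> x - t\<close>.\<close>

lemma volt_by_parts:
  assumes y: "prim y v" and v: "prim v f" and x: "x \<in> {0..1}"
  shows "y x = y 0 + of_real x * v 0 + integral {0..x} (\<lambda>t. of_real (x - t) * f t)"
proof -
  have m: "prim (\<lambda>t. of_real (x - t) * v t) (\<lambda>t. - 1 * v t + of_real (x - t) * f t)"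
    by (rule prim_mult[OF prim_linear v])
  have "integral {0..x} (\<lambda>t. - 1 * v t + of_real (x - t) * f t) = - (of_real x * v 0)"
    using m x unfolding prim_def by auto
  moreover have "integral {0..x} (\<lambda>t. - 1 * v t + of_real (x - t) * f t)
      = integral {0..x} (\<lambda>t. - v t) + integral {0..x} (\<lambda>t. of_real (x - t) * f t)"
  proof -
    have "(\<lambda>t. of_real (x - t) * f t) absolutely_integrable_on {0..1}" "v absolutely_integrable_on {0..1}"
      using v y by (auto simp: prim_def intro!: absint_mult_continuous continuous_intros)
    then show ?thesis using x by (simp add: integral_add integral_diff absint_integrable_on)
  qed
  moreover have "integral {0..x} v = y x - y 0" using y x by (simp add: prim_def)
  ultimately show ?thesis by (simp add: algebra_simps)
qed

lemma prim_volt: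
  assumes p: "p absolutely_integrable_on {0..1}" and g: "continuous_on {0..1} g"
  shows "prim (volt p g) (\<lambda>x. integral {0..x} (\<lambda>t. p t * g t))"
proof -
  let ?f = "\<lambda>t. p t * g t"
  have f: "?f absolutely_integrable_on {0..1}" using assms by (intro absint_mult_continuous)
  have W: "prim (\<lambda>x. integral {0..x} ?f) ?f" using f by (rule prim_integral)
  define U where "U = (\<lambda>x. integral {0..x} (\<lambda>s. integral {0..s} ?f))"
  have U: "prim U (\<lambda>x. integral {0..x} ?f)"
    unfolding U_def by (intro prim_integral absolutely_integrable_continuous_real prim_continuous[OF W])
  have "U x = volt p g x" if "x \<in> {0..1}" for x
    using volt_by_parts[OF U W that] by (simp add: volt_def U_def)
  then show ?thesis using prim_cong[OF U] by simp
qed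

text \<open>
  The weight \<open>exp (-K x)\<close> makes the Volterra operator small: \<open>(x - t) exp (-K
  (x - t)) \<le> 1/K\<close>. One fixed \<open>K\<close> works on the whole interval, so no
  iterated kernels are needed.
\<close>

lemma volt_bound:
  assumes p: "p absolutely_integrable_on {0..1}" and g: "continuous_on {0..1} g"
    and K: "0 < K" and M: "0 \<le> M" and le: "\<And>t. t \<in> {0..1} \<Longrightarrow> cmod (g t) \<le> M * exp (K * t)" and x: "x \<in> {0..1}"
  shows "cmod (volt p g x) \<le> integral {0..1} (\<lambda>t. cmod (p t)) / K * M * exp (K * x)"
proof -
  have np: "(\<lambda>t. cmod (p t)) absolutely_integrable_on {0..1}" using absolutely_integrable_norm[OF p] by (simp add: o_def)
  have "cmod (volt p g x) \<le> integral {0..x} (\<lambda>t. cmod (p t) * (M * exp (K * x) / K))"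
    unfolding volt_def
  proof (rule integral_norm_bound_integral)
    show "(\<lambda>t. of_real (x - t) * (p t * g t)) integrable_on {0..x}"
      using absint_volt[OF p g] x by (intro absint_integrable_on) auto
    show "(\<lambda>t. cmod (p t) * (M * exp (K * x) / K)) integrable_on {0..x}"
      using absint_integrable_on[OF np, of 0 x] x by (intro integrable_on_mult_left) auto
    fix t assume t: "t \<in> {0..x}"
    have "K * (x - t) \<le> exp (K * (x - t))" using exp_ge_add_one_self[of "K * (x - t)"] by linarith
    then have e: "(x - t) * exp (K * t) \<le> exp (K * x) / K"
      using K by (simp add: field_simps exp_diff)
    have "cmod (of_real (x - t) * (p t * g t)) = cmod (p t) * ((x - t) * cmod (g t))"
      using t by (simp add: norm_mult del: of_real_diff)
    also have "\<dots> \<le> cmod (p t) * ((x - t) * (M * exp (K * t)))" using t x le[of t] by (intro mult_left_mono) auto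
    also have "\<dots> = cmod (p t) * (M * ((x - t) * exp (K * t)))" by simp
    also have "\<dots> \<le> cmod (p t) * (M * (exp (K * x) / K))" using e M by (intro mult_left_mono) auto
    finally show "cmod (of_real (x - t) * (p t * g t)) \<le> cmod (p t) * (M * exp (K * x) / K)" by simp
  qed
  also have "\<dots> = integral {0..x} (\<lambda>t. cmod (p t)) * (M * exp (K * x) / K)" by (rule integral_mult_left)
  also have "\<dots> \<le> integral {0..1} (\<lambda>t. cmod (p t)) * (M * exp (K * x) / K)"
    using absint_integrable_on[OF np] x M K by (intro mult_right_mono integral_subset_le) auto
  finally show ?thesis by simp
qed

text \<open>
  In the weighted maximum norm the operator has norm at most \<open>1/2\<close>, which can be
  absorbed on the left.
\<close>

lemma volterra_estimate:
  assumes p: "p absolutely_integrable_on {0..1}" and y: "continuous_on {0..1} y"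
    and K: "0 < K" "2 * integral {0..1} (\<lambda>t. cmod (p t)) \<le> K"
    and f: "\<And>t. t \<in> {0..1} \<Longrightarrow> cmod (f t) \<le> M * exp (K * t)"
    and eq: "\<And>t. t \<in> {0..1} \<Longrightarrow> y t = f t + volt p y t" and x: "x \<in> {0..1}"
  shows "cmod (y x) \<le> 2 * M * exp (K * x)"
proof -
  have "continuous_on {0..1} (\<lambda>t. cmod (y t) * exp (- K * t))" using y by (intro continuous_intros)
  then obtain x0 where x0: "x0 \<in> {0..1}" "\<And>t. t \<in> {0..1} \<Longrightarrow> cmod (y t) * exp (- K * t) \<le> cmod (y x0) * exp (- K * x0)"
    using continuous_attains_sup[of "{0..1::real}"] by (metis (no_types, lifting) atLeastatMost_empty_iff2 compact_Icc not_one_le_zero zero_le_one)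
  define m where "m = cmod (y x0) * exp (- K * x0)"
  have m: "0 \<le> m" by (simp add: m_def)
  have le: "cmod (y t) \<le> m * exp (K * t)" if "t \<in> {0..1}" for t
    using x0(2)[OF that] unfolding m_def[symmetric] by (simp add: exp_minus field_simps)
  have "cmod (y x0) \<le> M * exp (K * x0) + integral {0..1} (\<lambda>t. cmod (p t)) / K * m * exp (K * x0)"
    using norm_triangle_ineq[of "f x0" "volt p y x0"] f[OF x0(1)] volt_bound[OF p y K(1) m le x0(1)] eq[OF x0(1)] by simp
  also have "\<dots> \<le> M * exp (K * x0) + 1/2 * m * exp (K * x0)"
    using K m by (intro add_left_mono mult_right_mono) (auto simp: field_simps)
  finally have "m \<le> M + m / 2" unfolding m_def by (simp add: exp_minus field_simps)
  then have "m \<le> 2 * M" by simp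
  then have "m * exp (K * x) \<le> 2 * M * exp (K * x)" by (intro mult_right_mono) auto
  then show ?thesis using le[OF x] by (rule order_trans[rotated])
qed

lemma volt_diff:
  assumes p: "p absolutely_integrable_on {0..1}" and "continuous_on {0..1} g" "continuous_on {0..1} h" "x \<in> {0..1}"
  shows "volt p (\<lambda>t. g t - h t) x = volt p g x - volt p h x"
proof -
  have "(\<lambda>t. of_real (x - t) * (p t * g t)) integrable_on {0..x}" "(\<lambda>t. of_real (x - t) * (p t * h t)) integrable_on {0..x}"
    using absint_volt[OF p] assms by (auto intro!: absint_integrable_on)
  then show ?thesis unfolding volt_def by (simp add: right_diff_distrib integral_diff)
qed

text \<open>Neumann series; the weighted bound makes it converge geometrically, hence uniformly.\<close>

lemma volterra_exists:
  assumes p: "p absolutely_integrable_on {0..1}" and f: "continuous_on {0..1} f"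
  shows "\<exists>y. continuous_on {0..1} y \<and> (\<forall>x\<in>{0..1}. y x = f x + volt p y x)"
proof -
  define P where "P = integral {0..1} (\<lambda>t. cmod (p t))"
  have P: "0 \<le> P" unfolding P_def by (intro integral_nonneg) (use absolutely_integrable_norm[OF p] set_lebesgue_integral_eq_integral(1) in \<open>auto simp: o_def\<close>)
  define K where "K = 2 * P + 1"
  have K: "0 < K" "P / K \<le> 1 / 2" using P by (auto simp: K_def field_simps)
  have "bounded (f ` {0..1})" using f by (intro compact_imp_bounded compact_continuous_image) auto
  then obtain M where M: "0 < M" "\<And>x. x \<in> {0..1} \<Longrightarrow> cmod (f x) \<le> M" unfolding bounded_pos by blast
  define Y where "Y n = (volt p ^^ n) f" for n
  have Yc: "continuous_on {0..1} (Y n)" for n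
    unfolding Y_def by (induction n) (auto intro: f prim_continuous[OF prim_volt[OF p]])
  have Yb: "cmod (Y n x) \<le> (M * (1/2) ^ n) * exp (K * x)" if "x \<in> {0..1}" for n x
    using that
  proof (induction n arbitrary: x)
    case 0
    have "cmod (f x) \<le> M * 1" using M 0 by simp
    also have "\<dots> \<le> M * exp (K * x)" using M K 0 by (intro mult_left_mono) auto
    finally show ?case by (simp add: Y_def)
  next
    case (Suc n)
    have "cmod (volt p (Y n) x) \<le> P / K * (M * (1/2) ^ n) * exp (K * x)"
      unfolding P_def using M by (intro volt_bound[OF p Yc K(1) _ Suc.IH Suc.prems]) auto
    also have "\<dots> \<le> 1 / 2 * (M * (1/2) ^ n) * exp (K * x)" using K M by (intro mult_right_mono) auto
    finally show ?case by (simp add: Y_def)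
  qed
  define y where "y = (\<lambda>x. \<Sum>n. Y n x)"
  define S where "S n x = (\<Sum>i<n. Y i x)" for n x
  have ul: "uniform_limit {0..1} S y sequentially"
    unfolding S_def y_def
  proof (rule Weierstrass_m_test)
    show "cmod (Y n x) \<le> M * exp K * (1/2) ^ n" if x: "x \<in> {0..1}" for n x
    proof -
      have "exp (K * x) \<le> exp K" using x K by simp
      then have "(M * (1/2) ^ n) * exp (K * x) \<le> (M * (1/2) ^ n) * exp K" using M by (intro mult_left_mono) auto
      then show ?thesis using Yb[OF x, of n] by (simp add: mult_ac)
    qed
    show "summable (\<lambda>n. M * exp K * (1/2) ^ n)" by (intro summable_mult summable_geometric) auto
  qed
  have Sc: "continuous_on {0..1} (S n)" for n unfolding S_def by (intro continuous_intros Yc)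
  have yc: "continuous_on {0..1} y"
    by (rule uniform_limit_theorem[OF _ ul]) (auto intro: always_eventually Sc)
  have VS: "volt p (S n) x = S (Suc n) x - f x" if x: "x \<in> {0..1}" for n x
  proof -
    have "volt p (S n) x = (\<Sum>i<n. volt p (Y i) x)"
      unfolding volt_def S_def sum_distrib_left
      using absint_volt[OF p Yc] x by (intro integral_sum) (auto intro!: absint_integrable_on)
    also have "\<dots> = (\<Sum>i<n. Y (Suc i) x)" by (simp add: Y_def)
    also have "\<dots> = S (Suc n) x - f x" unfolding S_def sum.lessThan_Suc_shift by (simp add: Y_def)
    finally show ?thesis .
  qed
  have "y x = f x + volt p y x" if x: "x \<in> {0..1}" for x
  proof -
    have 1: "(\<lambda>n. S n x) \<longlonglongrightarrow> y x" using tendsto_uniform_limitI[OF ul x] .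
    have "(\<lambda>n. volt p (S n) x) \<longlonglongrightarrow> volt p y x"
    proof (rule tendstoI)
      fix e :: real assume e: "0 < e"
      define d where "d = e / exp (K * x)"
      have d: "0 < d" using e by (simp add: d_def)
      from uniform_limitD[OF ul d]
      show "\<forall>\<^sub>F n in sequentially. dist (volt p (S n) x) (volt p y x) < e"
      proof eventually_elim
        case (elim n)
        have "cmod (S n t - y t) \<le> d * exp (K * t)" if t: "t \<in> {0..1}" for t
        proof -
          have "cmod (S n t - y t) \<le> d * 1" using elim t by (auto simp: dist_norm less_imp_le)
          also have "\<dots> \<le> d * exp (K * t)" using d t K by (intro mult_left_mono) auto
          finally show ?thesis .
        qed
        from volt_bound[OF p _ K(1) _ this x]
        have "cmod (volt p (\<lambda>t. S n t - y t) x) \<le> P / K * d * exp (K * x)"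
          using Sc yc d unfolding P_def by (auto intro!: continuous_intros)
        also have "\<dots> \<le> 1 / 2 * d * exp (K * x)" using K d by (intro mult_right_mono) auto
        also have "\<dots> < e" using e by (simp add: d_def)
        finally show ?case using volt_diff[OF p Sc yc x] by (simp add: dist_norm)
      qed
    qed
    then have "(\<lambda>n. S (Suc n) x - f x) \<longlonglongrightarrow> volt p y x" by (simp add: VS[OF x])
    moreover have "(\<lambda>n. S (Suc n) x - f x) \<longlonglongrightarrow> y x - f x"
      by (intro tendsto_intros LIMSEQ_Suc 1)
    ultimately have "volt p y x = y x - f x" by (rule LIMSEQ_unique)
    then show ?thesis by simp
  qed
  then show ?thesis using yc by blast
qed

text \<open>
  The equation \<open>y'' = p y + r\<close> in integrated form, with \<open>v\<close> in the role
  of \<open>y'\<close>.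
\<close>

definition sys :: "(real \<Rightarrow> complex) \<Rightarrow> (real \<Rightarrow> complex) \<Rightarrow> (real \<Rightarrow> complex) \<Rightarrow> (real \<Rightarrow> complex) \<Rightarrow> bool" where
  "sys p r y v \<longleftrightarrow> prim y v \<and> prim v (\<lambda>t. p t * y t + r t)"

lemma sys_continuous: "sys p r y v \<Longrightarrow> continuous_on {0..1} y" "sys p r y v \<Longrightarrow> continuous_on {0..1} v"
  unfolding sys_def using prim_continuous by blast+

lemma sys_add: "sys p r y v \<Longrightarrow> sys p s z w \<Longrightarrow> sys p (\<lambda>t. r t + s t) (\<lambda>t. y t + z t) (\<lambda>t. v t + w t)"
  unfolding sys_def
  using prim_add[of y v z w] prim_cong[OF prim_add[of v "\<lambda>t. p t * y t + r t" w "\<lambda>t. p t * z t + s t"],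
    of "\<lambda>t. v t + w t" "\<lambda>t. p t * (y t + z t) + (r t + s t)"]
  by (auto simp: algebra_simps)

lemma sys_cmult: "sys p r y v \<Longrightarrow> sys p (\<lambda>t. c * r t) (\<lambda>t. c * y t) (\<lambda>t. c * v t)"
  unfolding sys_def using prim_cmult[of y v c] prim_cong[OF prim_cmult[of v "\<lambda>t. p t * y t + r t" c], of "\<lambda>t. c * v t" "\<lambda>t. p t * (c * y t) + c * r t"]
  by (auto simp: algebra_simps)

lemma sys_cong: "sys p r y v \<Longrightarrow> (\<And>t. t \<in> {0..1} \<Longrightarrow> p' t * y' t + r' t = p t * y t + r t) \<Longrightarrow> (\<And>t. t \<in> {0..1} \<Longrightarrow> y' t = y t)
   \<Longrightarrow> (\<And>t. t \<in> {0..1} \<Longrightarrow> v' t = v t) \<Longrightarrow> sys p' r' y' v'"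
  unfolding sys_def by (auto intro: prim_cong)

lemma sys_zero: "sys p (\<lambda>t. 0) (\<lambda>t. 0) (\<lambda>t. 0)"
  unfolding sys_def using prim_const[of 0] by simp

lemma sys_diff:
  assumes "sys p r y v" "sys p s z w"
  shows "sys p (\<lambda>t. r t - s t) (\<lambda>t. y t - z t) (\<lambda>t. v t - w t)"
  using sys_add[OF assms(1) sys_cmult[OF assms(2), of "-1"]] by simp

lemma sys_sum:
  "(\<And>i. i \<in> I \<Longrightarrow> sys p (r i) (y i) (v i)) \<Longrightarrow> sys p (\<lambda>t. \<Sum>i\<in>I. r i t) (\<lambda>t. \<Sum>i\<in>I. y i t) (\<lambda>t. \<Sum>i\<in>I. v i t)"
  by (induction I rule: infinite_finite_induct) (auto simp: sys_zero intro: sys_add)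

lemma sys_exists:
  assumes p: "p absolutely_integrable_on {0..1}" and r: "continuous_on {0..1} r"
  shows "\<exists>y v. sys p r y v \<and> y 0 = a \<and> v 0 = b"
proof -
  define R where "R = volt (\<lambda>_. 1) r"
  have R: "prim R (\<lambda>x. integral {0..x} r)"
    using prim_volt[OF absolutely_integrable_continuous_real r, of "\<lambda>_. 1"] by (simp add: R_def)
  define f where "f = (\<lambda>x. (a + b * of_real x) + R x)"
  have lin: "prim (\<lambda>x. a + b * of_real x) (\<lambda>x. b)"
    by (rule prim_C1) (auto intro!: derivative_eq_intros simp: has_vector_derivative_def scaleR_conv_of_real)
  have fp: "prim f (\<lambda>x. b + integral {0..x} r)" unfolding f_def by (rule prim_add[OF lin R])
  obtain y where y: "continuous_on {0..1} y" "\<And>x. x \<in> {0..1} \<Longrightarrow> y x = f x + volt p y x"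
    using volterra_exists[OF p prim_continuous[OF fp]] by blast
  define v where "v = (\<lambda>x. (b + integral {0..x} r) + integral {0..x} (\<lambda>t. p t * y t))"
  have "prim y v" using prim_cong[OF prim_add[OF fp prim_volt[OF p y(1)]], of y v] y(2) by (simp add: v_def)
  moreover have "prim v (\<lambda>t. (0 + r t) + p t * y t)" unfolding v_def
    by (intro prim_add prim_const prim_integral absint_mult_continuous p y absolutely_integrable_continuous_real r)
  ultimately have "sys p r y v" by (simp add: sys_def add.commute)
  moreover have "y 0 = a" using y(2)[of 0] by (simp add: f_def R_def volt_def)
  moreover have "v 0 = b" by (simp add: v_def)
  ultimately show ?thesis by blast
qed

text \<open>
  Turn the system into a Volterra equation; the term \<open>R/K\<close> shows that solving with a
  given right-hand side gains a factor \<open>1/K\<close>, which drives the convergence of the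
  power series in the spectral parameter.
\<close>

lemma sys_estimate:
  assumes p: "p absolutely_integrable_on {0..1}" and r: "continuous_on {0..1} r" and s: "sys p r y v"
    and K: "1 \<le> K" "2 * integral {0..1} (\<lambda>t. cmod (p t)) \<le> K"
    and R: "0 \<le> R" "\<And>t. t \<in> {0..1} \<Longrightarrow> cmod (r t) \<le> R * exp (K * t)" and x: "x \<in> {0..1}"
  shows "cmod (y x) \<le> 2 * (cmod (y 0) + cmod (v 0) + R / K) * exp (K * x)"
proof (rule volterra_estimate[OF p sys_continuous(1)[OF s] _ K(2) _ _ x])
  have one: "(\<lambda>_. 1 :: complex) absolutely_integrable_on {0..1::real}" by (intro absolutely_integrable_continuous_real continuous_intros)
  show "0 < K" using K by simp
  fix t :: real assume t: "t \<in> {0..1}"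
  have "y t = y 0 + of_real t * v 0 + integral {0..t} (\<lambda>u. of_real (t - u) * (p u * y u + r u))"
    using s unfolding sys_def by (intro volt_by_parts t) auto
  also have "integral {0..t} (\<lambda>u. of_real (t - u) * (p u * y u + r u)) = volt p y t + volt (\<lambda>_. 1) r t"
    unfolding volt_def distrib_left
    using absint_volt[OF p sys_continuous(1)[OF s]] absint_volt[OF one r] t
    by (subst integral_add) (auto intro!: absint_integrable_on simp: distrib_left)
  finally show "y t = (y 0 + of_real t * v 0 + volt (\<lambda>_. 1) r t) + volt p y t" by simp
  have e1: "1 \<le> exp (K * t)" using t K by simp
  have "cmod (y 0 + of_real t * v 0 + volt (\<lambda>_. 1) r t) \<le> cmod (y 0) + cmod (of_real t * v 0) + cmod (volt (\<lambda>_. 1) r t)"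
    by (meson add_right_mono norm_triangle_ineq norm_triangle_le order_trans)
  also have "cmod (of_real t * v 0) \<le> cmod (v 0)" using t by (simp add: norm_mult mult_left_le_one_le)
  also have "cmod (volt (\<lambda>_. 1) r t) \<le> 1 / K * R * exp (K * t)"
    using volt_bound[OF one r _ R t] K by simp
  also have "cmod (y 0) + cmod (v 0) + 1 / K * R * exp (K * t) \<le> (cmod (y 0) + cmod (v 0) + R / K) * exp (K * t)"
    using mult_left_mono[OF e1, of "cmod (y 0) + cmod (v 0)"] by (simp add: algebra_simps)
  finally show "cmod (y 0 + of_real t * v 0 + volt (\<lambda>_. 1) r t) \<le> (cmod (y 0) + cmod (v 0) + R / K) * exp (K * t)" by simp
qed

lemma sys_unique_zero:
  assumes p: "p absolutely_integrable_on {0..1}" and s: "sys p (\<lambda>_. 0) y v" and "y 0 = 0" "v 0 = 0" and x: "x \<in> {0..1}"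
  shows "y x = 0" "v x = 0"
proof -
  define K where "K = max 1 (2 * integral {0..1} (\<lambda>t. cmod (p t)))"
  have y0: "y t = 0" if "t \<in> {0..1}" for t
    using sys_estimate[OF p _ s, of K 0 t] assms that by (auto simp: K_def)
  then show "y x = 0" using x by blast
  have "integral {0..x} (\<lambda>t. p t * y t + 0) = integral {0..x} (\<lambda>t. 0)" using y0 x by (intro integral_cong) auto
  moreover have "integral {0..x} (\<lambda>t. p t * y t + 0) = v x - v 0"
    using s x unfolding sys_def prim_def by blast
  ultimately show "v x = 0" using assms by simp
qed

lemma sys_unique:
  assumes p: "p absolutely_integrable_on {0..1}" and "sys p r y v" "sys p r z w" "y 0 = z 0" "v 0 = w 0" and x: "x \<in> {0..1}"
  shows "y x = z x" "v x = w x"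
  using sys_unique_zero[OF p _ _ _ x, of "\<lambda>t. y t - z t" "\<lambda>t. v t - w t"] sys_diff[OF assms(2,3)] assms by auto

section \<open>Power series in the spectral parameter\<close>

definition ivp :: "(real \<Rightarrow> complex) \<Rightarrow> (real \<Rightarrow> complex) \<Rightarrow> complex \<Rightarrow> complex \<Rightarrow> (real \<Rightarrow> complex) \<times> (real \<Rightarrow> complex)" where
  "ivp p r a b = (SOME yv. sys p r (fst yv) (snd yv) \<and> fst yv 0 = a \<and> snd yv 0 = b)"

lemma ivp:
  assumes "p absolutely_integrable_on {0..1}" "continuous_on {0..1} r"
  shows "sys p r (fst (ivp p r a b)) (snd (ivp p r a b))" "fst (ivp p r a b) 0 = a" "snd (ivp p r a b) 0 = b"
proof -
  have "\<exists>yv. sys p r (fst yv) (snd yv) \<and> fst yv 0 = a \<and> snd yv 0 = b"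
    using sys_exists[OF assms, of a b] by auto
  from someI_ex[OF this] show "sys p r (fst (ivp p r a b)) (snd (ivp p r a b))" "fst (ivp p r a b) 0 = a" "snd (ivp p r a b) 0 = b"
    unfolding ivp_def by blast+
qed

text \<open>Lagrange's identity: the potentials cancel in the derivative of the Wronskian.\<close>

lemma sys_lagrange:
  assumes "sys p r y v" "sys p' r' z w"
  shows "prim (\<lambda>t. y t * w t - v t * z t) (\<lambda>t. (p' t - p t) * (y t * z t) + y t * r' t - r t * z t)"
proof -
  have 1: "prim (\<lambda>t. y t * w t) (\<lambda>t. v t * w t + y t * (p' t * z t + r' t))"
    using assms by (intro prim_mult) (auto simp: sys_def)
  have 2: "prim (\<lambda>t. v t * z t) (\<lambda>t. (p t * y t + r t) * z t + v t * w t)"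
    using assms by (intro prim_mult) (auto simp: sys_def)
  show ?thesis
    by (rule prim_cong[OF prim_add[OF 1 prim_cmult[OF 2, of "-1"]]]) (auto simp: algebra_simps)
qed

lemma sys_v_estimate:
  assumes p: "p absolutely_integrable_on {0..1}" and r: "continuous_on {0..1} r" and s: "sys p r y v"
    and B: "\<And>t. t \<in> {0..1} \<Longrightarrow> cmod (y t) \<le> B" "\<And>t. t \<in> {0..1} \<Longrightarrow> cmod (r t) \<le> B" and x: "x \<in> {0..1}"
  shows "cmod (v x) \<le> cmod (v 0) + (integral {0..1} (\<lambda>t. cmod (p t)) + 1) * B"
proof -
  have B0: "0 \<le> B" using B(1)[of 0] norm_ge_zero[of "y 0"] by (meson atLeastAtMost_iff order_refl order_trans zero_le_one)
  have np: "(\<lambda>t. cmod (p t)) absolutely_integrable_on {0..1}" using absolutely_integrable_norm[OF p] by (simp add: o_def)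
  have i: "(\<lambda>t. (cmod (p t) + 1) * B) integrable_on {0..u}" if "u \<le> 1" for u
    using absint_integrable_on[OF np, of 0 u] that by (intro integrable_on_mult_left integrable_add) auto
  have f: "(\<lambda>t. p t * y t + r t) absolutely_integrable_on {0..1}" and e: "integral {0..x} (\<lambda>t. p t * y t + r t) = v x - v 0"
    using s x by (auto simp: sys_def prim_def)
  have "cmod (v x - v 0) \<le> integral {0..x} (\<lambda>t. (cmod (p t) + 1) * B)"
    unfolding e[symmetric]
  proof (rule integral_norm_bound_integral)
    show "(\<lambda>t. p t * y t + r t) integrable_on {0..x}" using absint_integrable_on[OF f] x by auto
    fix t assume t: "t \<in> {0..x}"
    then have "cmod (p t * y t + r t) \<le> cmod (p t) * cmod (y t) + cmod (r t)"
      by (metis norm_mult norm_triangle_ineq)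
    also have "\<dots> \<le> cmod (p t) * B + B" using B t x by (intro add_mono mult_left_mono) auto
    finally show "cmod (p t * y t + r t) \<le> (cmod (p t) + 1) * B" by (simp add: algebra_simps)
  qed (use i x in auto)
  also have "\<dots> \<le> integral {0..1} (\<lambda>t. (cmod (p t) + 1) * B)"
    using i[of x] i[of 1] x B0 by (intro integral_subset_le) auto
  also have "\<dots> = (integral {0..1} (\<lambda>t. cmod (p t)) + 1) * B"
    using integral_add[OF absint_integrable_on[OF np, of 0 1] integrable_const_ivl[of 1 0 1]] by simp
  finally show ?thesis using norm_triangle_sub[of "v x" "v 0"] by simp
qed

primrec chain :: "(real \<Rightarrow> complex) \<Rightarrow> complex \<Rightarrow> complex \<Rightarrow> complex \<Rightarrow> nat \<Rightarrow> (real \<Rightarrow> complex) \<times> (real \<Rightarrow> complex)" where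
  "chain q \<mu> a b 0 = ivp (\<lambda>t. q t - \<mu>) (\<lambda>_. 0) a b"
| "chain q \<mu> a b (Suc j) = ivp (\<lambda>t. q t - \<mu>) (\<lambda>t. - fst (chain q \<mu> a b j) t) 0 0"

locale potential =
  fixes q :: "real \<Rightarrow> complex"
  assumes q_absint: "q absolutely_integrable_on {0..1}"
begin

text \<open>
  Coefficients of the expansion in the spectral parameter around \<open>\<mu>\<close>:
  differentiating \<open>y'' = (q - \<mu> - z) y\<close> in \<open>z\<close> gives
  \<open>y\<^sub>j\<^sub>+\<^sub>1'' = (q - \<mu>) y\<^sub>j\<^sub>+\<^sub>1 - y\<^sub>j\<close>,
  with zero initial values for \<open>j > 0\<close>.
\<close>

definition ych :: "complex \<Rightarrow> complex \<Rightarrow> complex \<Rightarrow> nat \<Rightarrow> real \<Rightarrow> complex" where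
  "ych \<mu> a b j = fst (chain q \<mu> a b j)"
definition vch :: "complex \<Rightarrow> complex \<Rightarrow> complex \<Rightarrow> nat \<Rightarrow> real \<Rightarrow> complex" where
  "vch \<mu> a b j = snd (chain q \<mu> a b j)"

definition rch :: "complex \<Rightarrow> complex \<Rightarrow> complex \<Rightarrow> nat \<Rightarrow> real \<Rightarrow> complex" where
  "rch \<mu> a b j = (case j of 0 \<Rightarrow> (\<lambda>_. 0) | Suc i \<Rightarrow> (\<lambda>t. - ych \<mu> a b i t))"

lemma shifted_absint: "(\<lambda>t. q t - \<mu>) absolutely_integrable_on {0..1}"
  by (rule set_integral_diff(1)[OF q_absint absolutely_integrable_continuous_real]) (intro continuous_intros)

lemma chain_sys:
  "sys (\<lambda>t. q t - \<mu>) (rch \<mu> a b j) (ych \<mu> a b j) (vch \<mu> a b j)"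
  "ych \<mu> a b j 0 = (if j = 0 then a else 0)" "vch \<mu> a b j 0 = (if j = 0 then b else 0)"
proof -
  have "sys (\<lambda>t. q t - \<mu>) (rch \<mu> a b j) (ych \<mu> a b j) (vch \<mu> a b j) \<and>
    ych \<mu> a b j 0 = (if j = 0 then a else 0) \<and> vch \<mu> a b j 0 = (if j = 0 then b else 0)"
  proof (induction j)
    case 0
    then show ?case using ivp[OF shifted_absint, of "\<lambda>_. 0" \<mu> a b] by (simp add: rch_def ych_def vch_def)
  next
    case (Suc j)
    then have "continuous_on {0..1} (\<lambda>t. - ych \<mu> a b j t)" using sys_continuous(1) by (intro continuous_intros) blast
    from ivp[OF shifted_absint this, of \<mu> 0 0] show ?case by (simp add: rch_def ych_def vch_def)
  qed
  then show "sys (\<lambda>t. q t - \<mu>) (rch \<mu> a b j) (ych \<mu> a b j) (vch \<mu> a b j)"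
    "ych \<mu> a b j 0 = (if j = 0 then a else 0)" "vch \<mu> a b j 0 = (if j = 0 then b else 0)" by blast+
qed

lemmas ych_continuous = sys_continuous(1)[OF chain_sys(1)] and vch_continuous = sys_continuous(2)[OF chain_sys(1)]

lemma rch_0 [simp]: "rch \<mu> a b 0 = (\<lambda>_. 0)" and rch_Suc [simp]: "rch \<mu> a b (Suc j) = (\<lambda>t. - ych \<mu> a b j t)"
  by (simp_all add: rch_def)

lemma sol_sys: "sys (\<lambda>t. q t - \<mu>) (\<lambda>_. 0) (ych \<mu> a b 0) (vch \<mu> a b 0)"
  using chain_sys(1)[of \<mu> a b 0] by simp

text \<open>Both sides solve the same initial value problem.\<close>

lemma sys_sol:
  assumes s: "sys (\<lambda>t. q t - \<mu>) (\<lambda>_. 0) y v" and x: "x \<in> {0..1}"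
  shows "y x = y 0 * ych \<mu> 1 0 0 x + v 0 * ych \<mu> 0 1 0 x" "v x = y 0 * vch \<mu> 1 0 0 x + v 0 * vch \<mu> 0 1 0 x"
proof -
  have t: "sys (\<lambda>t. q t - \<mu>) (\<lambda>_. y 0 * 0 + v 0 * 0) (\<lambda>x. y 0 * ych \<mu> 1 0 0 x + v 0 * ych \<mu> 0 1 0 x) (\<lambda>x. y 0 * vch \<mu> 1 0 0 x + v 0 * vch \<mu> 0 1 0 x)"
    by (intro sys_add sys_cmult sol_sys)
  show "y x = y 0 * ych \<mu> 1 0 0 x + v 0 * ych \<mu> 0 1 0 x" "v x = y 0 * vch \<mu> 1 0 0 x + v 0 * vch \<mu> 0 1 0 x"
    using sys_unique[OF shifted_absint s t[simplified] _ _ x] by (simp_all add: chain_sys)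
qed

text \<open>The Wronskian of two homogeneous solutions is constant, by Lagrange's identity.\<close>

lemma wronskian:
  assumes "x \<in> {0..1}"
  shows "ych \<mu> 1 0 0 x * vch \<mu> 0 1 0 x - vch \<mu> 1 0 0 x * ych \<mu> 0 1 0 x = 1"
proof -
  have "prim (\<lambda>t. ych \<mu> 1 0 0 t * vch \<mu> 0 1 0 t - vch \<mu> 1 0 0 t * ych \<mu> 0 1 0 t) (\<lambda>t. 0)"
    by (rule prim_cong[OF sys_lagrange[OF sol_sys sol_sys]]) auto
  then have "0 = (ych \<mu> 1 0 0 x * vch \<mu> 0 1 0 x - vch \<mu> 1 0 0 x * ych \<mu> 0 1 0 x) - 1"
    using assms unfolding prim_def by (auto simp: chain_sys)
  then show ?thesis by simp
qed

text \<open>Each step of the chain gains a factor \<open>2/K \<le> 1/2\<close> in the weighted norm.\<close>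

lemma chain_bound:
  assumes K: "4 \<le> K" "2 * integral {0..1} (\<lambda>t. cmod (q t - \<mu>)) \<le> K" and x: "x \<in> {0..1}"
  shows "cmod (ych \<mu> a b j x) \<le> 2 * (cmod a + cmod b) * (1/2) ^ j * exp (K * x)"
  using x
proof (induction j arbitrary: x)
  case 0
  then show ?case
    using sys_estimate[OF shifted_absint _ sol_sys[of \<mu> a b], of K 0 x] K by (simp add: chain_sys)
next
  case (Suc j)
  let ?R = "2 * (cmod a + cmod b) * (1/2) ^ j"
  have "cmod (ych \<mu> a b (Suc j) x) \<le> 2 * (cmod (ych \<mu> a b (Suc j) 0) + cmod (vch \<mu> a b (Suc j) 0) + ?R / K) * exp (K * x)"
    using K Suc.prems Suc.IH by (intro sys_estimate[OF shifted_absint _ chain_sys(1)]) (auto intro!: continuous_intros ych_continuous)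
  also have "\<dots> = 2 * (?R / K) * exp (K * x)" by (simp add: chain_sys)
  also have "2 * (?R / K) \<le> ?R / 2"
    using mult_left_mono[of "2 / K" "1 / 2" ?R] K by (simp add: divide_simps)
  then have "2 * (?R / K) * exp (K * x) \<le> ?R / 2 * exp (K * x)" by (intro mult_right_mono) auto
  finally show ?case by simp
qed

text \<open>
  The partial sums solve the equation at \<open>\<mu> + z\<close> up to the right-hand side
  \<open>z\<^sup>n\<^sup>+\<^sup>1 y\<^sub>n\<close>, so the estimate for systems shows that their
  distance to the solution tends to 0.
\<close>

lemma chain_sums:
  assumes z: "cmod z < 1" and x: "x \<in> {0..1}"
  shows "(\<lambda>j. ych \<mu> a b j x * z ^ j) sums ych (\<mu> + z) a b 0 x" "(\<lambda>j. vch \<mu> a b j x * z ^ j) sums vch (\<mu> + z) a b 0 x"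
proof -
  define P where "P = integral {0..1} (\<lambda>t. cmod (q t - \<mu>))"
  define P' where "P' = integral {0..1} (\<lambda>t. cmod (q t - (\<mu> + z)))"
  have n: "(\<lambda>t. cmod (q t - \<nu>)) absolutely_integrable_on {0..1}" for \<nu> using absolutely_integrable_norm[OF shifted_absint] by (simp add: o_def)
  have P0: "0 \<le> P" "0 \<le> P'" unfolding P_def P'_def by (intro integral_nonneg absint_integrable_on n; simp)+
  define K where "K = max 4 (2 * max P P')"
  have K: "4 \<le> K" "2 * P \<le> K" "2 * P' \<le> K" by (auto simp: K_def)
  define A where "A = 2 * (cmod a + cmod b)"
  have A: "0 \<le> A" by (simp add: A_def)
  have yb: "cmod (ych \<mu> a b j t) \<le> A * (1/2) ^ j * exp (K * t)" if "t \<in> {0..1}" for j t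
    using chain_bound[of K \<mu> t a b j] K that by (simp add: A_def P_def)
  define S where "S n t = (\<Sum>j\<le>n. ych \<mu> a b j t * z ^ j)" for n t
  define W where "W n t = (\<Sum>j\<le>n. vch \<mu> a b j t * z ^ j)" for n t
  define E where "E n t = (\<lambda>u. ych (\<mu> + z) a b 0 u - S n u) t" for n t
  define G where "G n t = (\<lambda>u. vch (\<mu> + z) a b 0 u - W n u) t" for n t
  have sS: "sys (\<lambda>t. q t - (\<mu> + z)) (\<lambda>t. z ^ Suc n * ych \<mu> a b n t) (S n) (W n)" for n
  proof -
    have 1: "sys (\<lambda>t. q t - \<mu>) (\<lambda>t. \<Sum>j\<le>n. z ^ j * rch \<mu> a b j t) (\<lambda>t. \<Sum>j\<le>n. z ^ j * ych \<mu> a b j t) (\<lambda>t. \<Sum>j\<le>n. z ^ j * vch \<mu> a b j t)"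
      by (intro sys_sum sys_cmult chain_sys)
    have 2: "(\<Sum>j\<le>n. z ^ j * rch \<mu> a b j t) = - z * S n t + z ^ Suc n * ych \<mu> a b n t" for t
      unfolding S_def by (induction n) (auto simp: algebra_simps)
    show ?thesis
      by (rule sys_cong[OF 1]) (auto simp: 2, auto simp: S_def W_def algebra_simps)
  qed
  have sE: "sys (\<lambda>t. q t - (\<mu> + z)) (\<lambda>t. 0 - z ^ Suc n * ych \<mu> a b n t) (E n) (G n)" for n
    using sys_diff[OF sol_sys sS] by (simp add: E_def[abs_def] G_def[abs_def])
  have E0: "E n 0 = 0" "G n 0 = 0" for n
    unfolding E_def G_def S_def W_def by (simp_all add: chain_sys if_distrib[of "\<lambda>x. x * _"] sum.delta cong: if_cong)
  have rc: "continuous_on {0..1} (\<lambda>t. 0 - z ^ Suc n * ych \<mu> a b n t)" for n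
    by (intro continuous_intros ych_continuous)
  have zn: "cmod (z ^ Suc n) \<le> 1" for n using z by (simp add: norm_power power_le_one del: power_Suc)
  have rb: "cmod (0 - z ^ Suc n * ych \<mu> a b n t) \<le> A * (1/2) ^ n * exp (K * t)" if "t \<in> {0..1}" for n t
  proof -
    have "cmod (0 - z ^ Suc n * ych \<mu> a b n t) = cmod (z ^ Suc n) * cmod (ych \<mu> a b n t)" by (simp add: norm_mult)
    also have "\<dots> \<le> 1 * (A * (1/2) ^ n * exp (K * t))" using zn yb[OF that] by (intro mult_mono) auto
    finally show ?thesis by simp
  qed
  have Eb: "cmod (E n t) \<le> A * (1/2) ^ n * exp K" if t: "t \<in> {0..1}" for n t
  proof -
    have "cmod (E n t) \<le> 2 * (cmod (E n 0) + cmod (G n 0) + (A * (1/2) ^ n) / K) * exp (K * t)"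
      using K A rb t by (intro sys_estimate[OF shifted_absint rc sE]) (auto simp: P'_def)
    also have "\<dots> = 2 * (A * (1/2) ^ n) / K * exp (K * t)" by (simp add: E0)
    also have "2 * (A * (1/2) ^ n) / K * exp (K * t) \<le> (A * (1/2) ^ n) * exp K"
    proof (rule mult_mono)
      show "2 * (A * (1/2) ^ n) / K \<le> A * (1/2) ^ n"
        using mult_left_mono[of "2 / K" 1 "A * (1/2) ^ n"] K A by (simp add: mult_ac)
    qed (use K A t in auto)
    finally show ?thesis by simp
  qed
  have Gb: "cmod (G n x) \<le> (P' + 1) * (A * (1/2) ^ n * exp K)" for n
  proof -
    have "cmod (G n x) \<le> cmod (G n 0) + (P' + 1) * (A * (1/2) ^ n * exp K)"
      unfolding P'_def
    proof (rule sys_v_estimate[OF shifted_absint rc sE Eb _ x])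
      fix t :: real assume t: "t \<in> {0..1}"
      have "A * (1/2) ^ n * exp (K * t) \<le> A * (1/2) ^ n * exp K" using A K t by (intro mult_left_mono) auto
      then show "cmod (0 - z ^ Suc n * ych \<mu> a b n t) \<le> A * (1/2) ^ n * exp K" using rb[OF t, of n] by linarith
    qed
    then show ?thesis by (simp add: E0)
  qed
  have lim: "(\<lambda>n. A * (1/2) ^ n * exp K) \<longlonglongrightarrow> 0" "(\<lambda>n. (P' + 1) * (A * (1/2) ^ n * exp K)) \<longlonglongrightarrow> 0"
    by (auto intro!: tendsto_eq_intros LIMSEQ_realpow_zero)
  have "(\<lambda>n. E n x) \<longlonglongrightarrow> 0" by (rule Lim_null_comparison[OF _ lim(1)]) (use Eb x in auto)
  then have "(\<lambda>n. ych (\<mu> + z) a b 0 x - E n x) \<longlonglongrightarrow> ych (\<mu> + z) a b 0 x - 0" by (intro tendsto_intros)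
  then show "(\<lambda>j. ych \<mu> a b j x * z ^ j) sums ych (\<mu> + z) a b 0 x" by (simp add: sums_def_le E_def S_def)
  have "(\<lambda>n. G n x) \<longlonglongrightarrow> 0" by (rule Lim_null_comparison[OF _ lim(2)]) (use Gb in auto)
  then have "(\<lambda>n. vch (\<mu> + z) a b 0 x - G n x) \<longlonglongrightarrow> vch (\<mu> + z) a b 0 x - 0" by (intro tendsto_intros)
  then show "(\<lambda>j. vch \<mu> a b j x * z ^ j) sums vch (\<mu> + z) a b 0 x" by (simp add: sums_def_le G_def W_def)
qed

lemma has_fps_expansion_sumsI:
  fixes f :: "complex \<Rightarrow> complex"
  assumes "\<And>z. cmod z < 1 \<Longrightarrow> (\<lambda>j. c j * z ^ j) sums f z"
  shows "f has_fps_expansion Abs_fps c"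
  unfolding has_fps_expansion_def
proof
  have "summable (\<lambda>j. c j * (1/2) ^ j)" using assms[of "1/2"] by (auto intro: sums_summable)
  then have "norm (1/2 :: complex) \<le> fps_conv_radius (Abs_fps c)"
    unfolding fps_conv_radius_def by (intro conv_radius_geI) auto
  then show "0 < fps_conv_radius (Abs_fps c)" by (rule less_le_trans[rotated]) auto
  have "\<forall>\<^sub>F z in nhds 0. z \<in> ball 0 1" by (intro eventually_nhds_in_open) auto
  then show "\<forall>\<^sub>F z in nhds 0. eval_fps (Abs_fps c) z = f z"
    by eventually_elim (auto simp: eval_fps_def intro!: sums_unique[symmetric] assms)
qed

lemma sol_fps_expansion:
  assumes "x \<in> {0..1}"
  shows "(\<lambda>z. ych (\<mu> + z) a b 0 x) has_fps_expansion Abs_fps (\<lambda>j. ych \<mu> a b j x)"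
    "(\<lambda>z. vch (\<mu> + z) a b 0 x) has_fps_expansion Abs_fps (\<lambda>j. vch \<mu> a b j x)"
  using chain_sums[OF _ assms] by (auto intro!: has_fps_expansion_sumsI)

end

section \<open>Root spaces and Jordan chains\<close>

text \<open>The representative prescribed by the operator domain.\<close>

definition ext01 :: "(real \<Rightarrow> complex) \<Rightarrow> real \<Rightarrow> complex" where
  "ext01 f x = (if x \<in> {0..1} then f x else 0)"

lemma ext01_in [simp]: "x \<in> {0..1} \<Longrightarrow> ext01 f x = f x" and ext01_out: "x \<notin> {0..1} \<Longrightarrow> ext01 f x = 0"
  by (auto simp: ext01_def)

lemma sum_functions_apply: "(\<Sum>i\<in>I. f i) x = (\<Sum>i\<in>I. f i x :: complex)"
  by (induction I rule: infinite_finite_induct) auto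

lemma ext01_ext01 [simp]: "ext01 (ext01 f) = ext01 f" by (auto simp: ext01_def)

lemma L2_01_AE_continuous:
  assumes N: "negligible N" and eq: "\<And>x. x \<in> {0..1} - N \<Longrightarrow> f x = g x" and g: "continuous_on {0..1} g"
  shows "f \<in> L2_01"
  unfolding L2_01_def
proof (intro CollectI conjI)
  have "g \<in> borel_measurable I01" using g by (intro continuous_imp_measurable_on_sets_lebesgue) auto
  then have "g measurable_on {0..1}" by (simp add: measurable_on_iff_borel_measurable)
  then have "f measurable_on {0..1}"
    by (rule measurable_on_spike[OF _ N]) (use eq in auto)
  then show "f \<in> borel_measurable I01" by (simp add: measurable_on_iff_borel_measurable)
  have "(\<lambda>x. (cmod (g x))\<^sup>2) absolutely_integrable_on {0..1}"
    using g by (intro absolutely_integrable_continuous_real continuous_intros)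
  then have "(\<lambda>x. (cmod (f x))\<^sup>2) absolutely_integrable_on {0..1}"
    by (rule absolutely_integrable_spike[OF _ N]) (use eq in auto)
  then show "integrable I01 (\<lambda>x. (cmod (f x))\<^sup>2)" by (simp add: absint_iff_integrable)
qed

context potential begin

text \<open>
  Absolute continuity of \<open>y'\<close> turns the almost everywhere equation into an integral
  identity.
\<close>

lemma dom_imp_sys:
  assumes y: "y \<in> T4_dom q \<alpha>" and e: "L2_eq (\<lambda>x. sl_expr q y x - \<mu> * y x) z" and z: "continuous_on {0..1} z"
  shows "sys (\<lambda>t. q t - \<mu>) (\<lambda>t. - z t) y (D01 y)"
proof -
  have y': "\<And>x. x \<in> {0..1} \<Longrightarrow> y differentiable (at x within {0..1})" "absolutely_continuous_on 0 1 (D01 y)"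
    using y by (auto simp: T4_dom_def)
  have a: "acf (D01 y)" using y'(2) by (simp add: absolutely_continuous_on_iff_acf)
  have d: "(y has_vector_derivative D01 y x) (at x within {0..1})" if "x \<in> {0..1}" for x
    unfolding D01_def using y'(1)[OF that] by (simp add: vector_derivative_works[symmetric])
  have p: "prim y (D01 y)" using d acf_continuous[OF a] by (intro prim_C1) auto
  obtain N where N: "negligible N" "\<And>x. x \<in> {0..1} - N \<Longrightarrow> x \<in> {0<..<1} \<and> (\<exists>D. (D01 y has_vector_derivative D) (at x))"
    using acf_derivative_ae[OF a] by blast
  obtain M where M: "negligible M" "\<And>x. x \<in> {0..1} - M \<Longrightarrow> sl_expr q y x - \<mu> * y x = z x"
    using e unfolding L2_eq_def AE_I01_iff by blast
  have "prim (D01 y) (\<lambda>t. (q t - \<mu>) * y t + - z t)"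
  proof (rule primI[OF a negligible_Un[OF N(1) M(1)]])
    show "(\<lambda>t. (q t - \<mu>) * y t + - z t) absolutely_integrable_on {0..1}"
      by (intro set_integral_add(1) absint_mult_continuous shifted_absint prim_continuous[OF p] absolutely_integrable_continuous_real continuous_intros z)
    fix x assume x: "x \<in> {0<..<1} - (N \<union> M)"
    then obtain D where D: "(D01 y has_vector_derivative D) (at x)" using N(2)[of x] by auto
    then have "D01 (D01 y) x = D" using x by (intro D01_at) auto
    moreover have "sl_expr q y x - \<mu> * y x = z x" using M(2)[of x] x by auto
    ultimately have "D = (q x - \<mu>) * y x + - z x" by (simp add: sl_expr_def algebra_simps)
    then show "(D01 y has_vector_derivative (q x - \<mu>) * y x + - z x) (at x)" using D by simp
  qed
  then show ?thesis using p by (simp add: sys_def)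
qed

text \<open>
  A continuous right-hand side \<open>z\<close> makes \<open>-y'' + q y = z + \<mu> y\<close>
  continuous up to a null set, which is all that membership in the domain requires beyond the
  boundary conditions.
\<close>

lemma sys_imp_dom:
  assumes s: "sys (\<lambda>t. q t - \<mu>) (\<lambda>t. - z t) y v" and z: "continuous_on {0..1} z" and bc: "v 0 + v 1 = 0" "y 0 + \<alpha> * y 1 = 0"
  shows "ext01 y \<in> T4_dom q \<alpha>" "L2_eq (\<lambda>x. sl_expr q (ext01 y) x - \<mu> * ext01 y x) z"
proof -
  let ?y = "ext01 y"
  have p: "prim ?y v" using s by (auto simp: sys_def intro: prim_cong)
  have vc: "continuous_on {0..1} v" by (rule sys_continuous[OF s])
  have D: "D01 ?y x = v x" if "x \<in> {0..1}" for x using D01_eq[OF p vc that] .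
  have pv: "prim (D01 ?y) (\<lambda>t. (q t - \<mu>) * y t - z t)" using s D by (auto simp: sys_def intro: prim_cong)
  obtain N where N: "negligible N" "\<And>x. x \<in> {0..1} - N \<Longrightarrow> x \<in> {0<..<1} \<and> (D01 ?y has_vector_derivative (q x - \<mu>) * y x - z x) (at x)"
    using prim_derivative_ae[OF pv] by blast
  have DD: "D01 (D01 ?y) x = (q x - \<mu>) * y x - z x" if "x \<in> {0..1} - N" for x using N(2)[OF that] D01_at by blast
  have eq: "sl_expr q ?y x = \<mu> * ?y x + z x" if "x \<in> {0..1} - N" for x
    using DD[OF that] that by (simp add: sl_expr_def algebra_simps)
  show "L2_eq (\<lambda>x. sl_expr q ?y x - \<mu> * ?y x) z"
    unfolding L2_eq_def AE_I01_iff using N(1) eq by (intro exI[of _ N]) auto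
  show "?y \<in> T4_dom q \<alpha>" unfolding T4_dom_def
  proof (intro CollectI conjI ballI allI impI)
    show "?y differentiable (at x within {0..1})" if "x \<in> {0..1}" for x
      using prim_has_derivative[OF p vc that] by (auto simp: has_vector_derivative_def differentiable_def)
    show "absolutely_continuous_on 0 1 (D01 ?y)" using prim_acf[OF pv] by (simp add: absolutely_continuous_on_iff_acf)
    show "sl_expr q ?y \<in> L2_01"
      by (rule L2_01_AE_continuous[OF N(1) eq]) (auto intro!: continuous_intros z prim_continuous[OF p])
    show "D01 ?y 0 + D01 ?y 1 = 0" using bc D by simp
    show "?y 0 + \<alpha> * ?y 1 = 0" using bc by simp
  qed (auto simp: ext01_def)
qed

lemma T4_dom_ext: "y \<in> T4_dom q \<alpha> \<Longrightarrow> ext01 y = y"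
  by (auto simp: T4_dom_def ext01_def)

lemma T4_dom_continuous: "y \<in> T4_dom q \<alpha> \<Longrightarrow> continuous_on {0..1} y"
  by (auto simp: T4_dom_def intro!: differentiable_imp_continuous_on simp: differentiable_on_def)

text \<open>
  From here on the operator is replaced by the integrated system together with the two boundary
  conditions.
\<close>

lemma eigenfunction_iff:
  "T4_eigenfunction q \<alpha> \<mu> y \<longleftrightarrow> ext01 y = y \<and> y \<noteq> 0 \<and>
     (\<exists>v. sys (\<lambda>t. q t - \<mu>) (\<lambda>t. 0) y v \<and> v 0 + v 1 = 0 \<and> y 0 + \<alpha> * y 1 = 0)" (is "?L \<longleftrightarrow> ?R")
proof -
  have *: "L2_eq (sl_expr q y) (\<lambda>x. \<mu> * y x) \<longleftrightarrow> L2_eq (\<lambda>x. sl_expr q y x - \<mu> * y x) (\<lambda>x. 0)" for y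
    by (simp add: L2_eq_def)
  have c0: "continuous_on {0..1::real} (\<lambda>x. 0 :: complex)" by simp
  show ?thesis
  proof
    assume L: ?L
    then have "y \<in> T4_dom q \<alpha>" "L2_eq (\<lambda>x. sl_expr q y x - \<mu> * y x) (\<lambda>x. 0)" unfolding T4_eigenfunction_def * by auto
    from dom_imp_sys[OF this c0] L show ?R by (auto simp: T4_eigenfunction_def T4_dom_ext T4_dom_def)
  next
    assume R: ?R
    then obtain v where v: "sys (\<lambda>t. q t - \<mu>) (\<lambda>t. 0) y v" "v 0 + v 1 = 0" "y 0 + \<alpha> * y 1 = 0" by blast
    from sys_imp_dom[of \<mu> "\<lambda>_. 0" y v \<alpha>, OF _ c0 v(2,3)] v(1) R show ?L unfolding T4_eigenfunction_def * by auto
  qed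
qed

lemma kernel_power_ext: "y \<in> T4_kernel_power q \<alpha> \<mu> k \<Longrightarrow> ext01 y = y"
  by (cases k) (auto simp: T4_dom_ext, auto simp: ext01_def fun_eq_iff)

lemma kernel_power_continuous: "y \<in> T4_kernel_power q \<alpha> \<mu> k \<Longrightarrow> continuous_on {0..1} y"
  by (cases k) (auto simp: T4_dom_continuous zero_fun_def)

lemma kernel_power_SucD:
  assumes "y \<in> T4_kernel_power q \<alpha> \<mu> (Suc k)"
  obtains z v where "z \<in> T4_kernel_power q \<alpha> \<mu> k" "sys (\<lambda>t. q t - \<mu>) (\<lambda>t. - z t) y v" "v 0 + v 1 = 0" "y 0 + \<alpha> * y 1 = 0"
proof -
  obtain z where y: "y \<in> T4_dom q \<alpha>" and z: "z \<in> T4_kernel_power q \<alpha> \<mu> k" "L2_eq (\<lambda>x. sl_expr q y x - \<mu> * y x) z"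
    using assms by auto
  show ?thesis
    using that[OF z(1) dom_imp_sys[OF y z(2) kernel_power_continuous[OF z(1)]]] y by (auto simp: T4_dom_def)
qed

lemma kernel_power_SucI:
  assumes z: "z \<in> T4_kernel_power q \<alpha> \<mu> k" and s: "sys (\<lambda>t. q t - \<mu>) (\<lambda>t. - z t) y v" "v 0 + v 1 = 0" "y 0 + \<alpha> * y 1 = 0"
  shows "ext01 y \<in> T4_kernel_power q \<alpha> \<mu> (Suc k)"
  using sys_imp_dom[OF s(1) kernel_power_continuous[OF z] s(2,3)] z by auto

text \<open>
  If \<open>y = 0\<close>, then its derivative \<open>v\<close> vanishes, so the indefinite
  integral of the continuous function \<open>r\<close> vanishes and so does \<open>r\<close>.
\<close>

lemma sys_rhs_zero:
  assumes s: "sys p r y v" and r: "continuous_on {0..1} r" and y: "\<And>x. x \<in> {0..1} \<Longrightarrow> y x = 0" and x: "x \<in> {0..1}"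
  shows "v x = 0" "r x = 0"
proof -
  have uniq: "d = 0" if "(f has_vector_derivative d) (at t within {0..1})" "\<And>x. x \<in> {0..1} \<Longrightarrow> f x = 0" "t \<in> {0..1}" for f :: "real \<Rightarrow> complex" and d t
  proof -
    have "((\<lambda>x. 0) has_vector_derivative d) (at t within {0..1})"
      using that by (intro has_vector_derivative_transform[OF that(3) _ that(1)]) auto
    moreover have "((\<lambda>x::real. 0::complex) has_vector_derivative 0) (at t within {0..1})" by simp
    ultimately show ?thesis using that(3) vector_derivative_within_closed_interval[of 0 1 t] by (metis zero_less_one)
  qed
  have v0: "v t = 0" if "t \<in> {0..1}" for t
    using uniq[OF prim_has_derivative[of y v t] y that] s that sys_continuous(2)[OF s] by (simp add: sys_def)
  then show "v x = 0" using x by simp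
  have "prim v r" using s y unfolding sys_def by (auto intro: prim_cong)
  then show "r x = 0" using uniq[OF prim_has_derivative[of v r x] v0 x] r x by simp
qed

end

text \<open>
  The two boundary forms are \<open>v(0) + v(1)\<close> and \<open>y(0) + \<alpha> y(1)\<close>,
  in one order or the other. All chain elements satisfy the first form \<open>lA\<close>, whose
  homogeneous solutions are the multiples of \<open>Y 0\<close>; the second form \<open>lB\<close>
  vanishes precisely on the first \<open>m\<close> elements and fails at index \<open>m\<close>,
  which is where the chain ends.
\<close>

locale jordan_chain = potential +
  fixes \<alpha> \<mu> :: complex and Y V :: "nat \<Rightarrow> real \<Rightarrow> complex" and m :: nat and lA lB :: "complex \<Rightarrow> complex \<Rightarrow> complex \<Rightarrow> complex \<Rightarrow> complex"
  assumes l: "(lA = (\<lambda>a b c d. b + d) \<and> lB = (\<lambda>a b c d. a + \<alpha> * c)) \<or> (lB = (\<lambda>a b c d. b + d) \<and> lA = (\<lambda>a b c d. a + \<alpha> * c))"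
    and Y0: "sys (\<lambda>t. q t - \<mu>) (\<lambda>t. 0) (Y 0) (V 0)"
    and YSuc: "\<And>j. sys (\<lambda>t. q t - \<mu>) (\<lambda>t. - Y j t) (Y (Suc j)) (V (Suc j))"
    and lAY: "\<And>j. lA (Y j 0) (V j 0) (Y j 1) (V j 1) = 0"
    and lBY: "\<And>j. j < m \<Longrightarrow> lB (Y j 0) (V j 0) (Y j 1) (V j 1) = 0" "lB (Y m 0) (V m 0) (Y m 1) (V m 1) \<noteq> 0"
    and hom: "\<And>w u. sys (\<lambda>t. q t - \<mu>) (\<lambda>t. 0) w u \<Longrightarrow> lA (w 0) (u 0) (w 1) (u 1) = 0 \<Longrightarrow> \<exists>b. \<forall>x\<in>{0..1}. w x = b * Y 0 x \<and> u x = b * V 0 x"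
    and nz: "\<exists>x\<in>{0..1}. Y 0 x \<noteq> 0"
begin

definition comb :: "nat \<Rightarrow> (nat \<Rightarrow> complex) \<Rightarrow> real \<Rightarrow> complex" where
  "comb n a x = (\<Sum>j<n. a j * Y j x)"

lemma Y_continuous: "continuous_on {0..1} (Y j)"
  using sys_continuous(1)[OF Y0] sys_continuous(1)[OF YSuc] by (cases j) auto

lemma comb_continuous: "continuous_on {0..1} (comb n a)"
  unfolding comb_def by (intro continuous_intros Y_continuous)

lemma comb_sys_Suc:
  "sys (\<lambda>t. q t - \<mu>) (\<lambda>t. - comb n (\<lambda>j. a (Suc j)) t) (comb (Suc n) a) (\<lambda>t. \<Sum>j<Suc n. a j * V j t)"
proof -
  have "sys (\<lambda>t. q t - \<mu>) (\<lambda>t. a 0 * 0 + (\<Sum>j<n. a (Suc j) * (- Y j t))) (\<lambda>t. a 0 * Y 0 t + (\<Sum>j<n. a (Suc j) * Y (Suc j) t)) (\<lambda>t. a 0 * V 0 t + (\<Sum>j<n. a (Suc j) * V (Suc j) t))"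
    by (intro sys_add sys_sum sys_cmult Y0 YSuc)
  then show ?thesis
    by (rule sys_cong) (simp_all add: comb_def sum.lessThan_Suc_shift sum_negf del: sum.lessThan_Suc)
qed

lemma lB_sum: "lB (\<Sum>j<n. a j * Y j 0) (\<Sum>j<n. a j * V j 0) (\<Sum>j<n. a j * Y j 1) (\<Sum>j<n. a j * V j 1) = (\<Sum>j<n. a j * lB (Y j 0) (V j 0) (Y j 1) (V j 1))"
  and lA_sum: "lA (\<Sum>j<n. a j * Y j 0) (\<Sum>j<n. a j * V j 0) (\<Sum>j<n. a j * Y j 1) (\<Sum>j<n. a j * V j 1) = (\<Sum>j<n. a j * lA (Y j 0) (V j 0) (Y j 1) (V j 1))"
  using l by (auto simp: sum.distrib sum_distrib_left algebra_simps)

lemma comb_in_kernel: "n \<le> m \<Longrightarrow> ext01 (comb n a) \<in> T4_kernel_power q \<alpha> \<mu> n"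
proof (induction n arbitrary: a)
  case 0
  then show ?case by (auto simp: comb_def ext01_def zero_fun_def)
next
  case (Suc n)
  have IH: "ext01 (comb n (\<lambda>j. a (Suc j))) \<in> T4_kernel_power q \<alpha> \<mu> n" using Suc by simp
  have s: "sys (\<lambda>t. q t - \<mu>) (\<lambda>t. - ext01 (comb n (\<lambda>j. a (Suc j))) t) (comb (Suc n) a) (\<lambda>t. \<Sum>j<Suc n. a j * V j t)"
    by (rule sys_cong[OF comb_sys_Suc[of n a]]) simp_all
  have "lA (comb (Suc n) a 0) (\<Sum>j<Suc n. a j * V j 0) (comb (Suc n) a 1) (\<Sum>j<Suc n. a j * V j 1) = 0"
    unfolding comb_def lA_sum using lAY by simp
  moreover have "lB (comb (Suc n) a 0) (\<Sum>j<Suc n. a j * V j 0) (comb (Suc n) a 1) (\<Sum>j<Suc n. a j * V j 1) = 0"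
    unfolding comb_def lB_sum using lBY Suc.prems by (intro sum.neutral) auto
  ultimately have "(\<Sum>j<Suc n. a j * V j 0) + (\<Sum>j<Suc n. a j * V j 1) = 0" "comb (Suc n) a 0 + \<alpha> * comb (Suc n) a 1 = 0"
    using l by auto
  from kernel_power_SucI[OF IH s this] show ?case .
qed

text \<open>
  Induction on the power. If \<open>(T - \<mu>) y\<close> is the combination with coefficients
  \<open>a\<close>, then the shifted combination solves the same inhomogeneous equation, so it
  differs from \<open>y\<close> by a multiple \<open>b\<close> of \<open>Y 0\<close>; the form
  \<open>lB\<close> forces the coefficient of \<open>Y m\<close> to vanish.
\<close>

lemma kernel_in_comb: "y \<in> T4_kernel_power q \<alpha> \<mu> k \<Longrightarrow> \<exists>a. \<forall>x\<in>{0..1}. y x = comb m a x"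
proof (induction k arbitrary: y)
  case 0
  then show ?case by (intro exI[of _ "\<lambda>_. 0"]) (auto simp: comb_def)
next
  case (Suc k)
  obtain z v where z: "z \<in> T4_kernel_power q \<alpha> \<mu> k" and s: "sys (\<lambda>t. q t - \<mu>) (\<lambda>t. - z t) y v" "v 0 + v 1 = 0" "y 0 + \<alpha> * y 1 = 0"
    using kernel_power_SucD[OF Suc.prems] by blast
  obtain a where a: "\<And>x. x \<in> {0..1} \<Longrightarrow> z x = comb m a x" using Suc.IH[OF z] by blast
  \<comment> \<open>The shift lifts \<open>z = (T - \<mu>) y\<close> back by one level of the chain.\<close>
  define a' where "a' j = (case j of 0 \<Rightarrow> 0 | Suc i \<Rightarrow> a i)" for j
  have a'[simp]: "a' 0 = 0" "\<And>j. a' (Suc j) = a j" by (simp_all add: a'_def)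
  define w where "w t = y t - comb (Suc m) a' t" for t
  define u where "u t = v t - (\<Sum>j<Suc m. a' j * V j t)" for t
  have "sys (\<lambda>t. q t - \<mu>) (\<lambda>t. - z t - - comb m a t) w u"
    using sys_diff[OF s(1) comb_sys_Suc[of m a']] by (simp add: w_def[abs_def] u_def[abs_def])
  then have ws: "sys (\<lambda>t. q t - \<mu>) (\<lambda>t. 0) w u" by (rule sys_cong) (simp_all add: a)
  have y0: "lA (y 0) (v 0) (y 1) (v 1) = 0" "lB (y 0) (v 0) (y 1) (v 1) = 0" using s l by auto
  have lw: "lA (w 0) (u 0) (w 1) (u 1) = lA (y 0) (v 0) (y 1) (v 1) - lA (comb (Suc m) a' 0) (\<Sum>j<Suc m. a' j * V j 0) (comb (Suc m) a' 1) (\<Sum>j<Suc m. a' j * V j 1)"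
    "lB (w 0) (u 0) (w 1) (u 1) = lB (y 0) (v 0) (y 1) (v 1) - lB (comb (Suc m) a' 0) (\<Sum>j<Suc m. a' j * V j 0) (comb (Suc m) a' 1) (\<Sum>j<Suc m. a' j * V j 1)"
    unfolding w_def u_def using l by (auto simp: algebra_simps)
  have "lA (w 0) (u 0) (w 1) (u 1) = 0" unfolding lw comb_def lA_sum using lAY y0 by simp
  from hom[OF ws this] obtain b where b: "\<And>x. x \<in> {0..1} \<Longrightarrow> w x = b * Y 0 x \<and> u x = b * V 0 x" by blast
  have "lB (w 0) (u 0) (w 1) (u 1) = - (a' m * lB (Y m 0) (V m 0) (Y m 1) (V m 1))"
    unfolding lw comb_def lB_sum using lBY(1) y0 by simp
  moreover have "lB (w 0) (u 0) (w 1) (u 1) = b * lB (Y 0 0) (V 0 0) (Y 0 1) (V 0 1)"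
    using b[of 0] b[of 1] l by (auto simp: algebra_simps)
  ultimately have e: "b * lB (Y 0 0) (V 0 0) (Y 0 1) (V 0 1) = - (a' m * lB (Y m 0) (V m 0) (Y m 1) (V m 1))" by simp
  show ?case
  proof (cases m)
    case 0
    then have "b = 0" using e lBY(2) by simp
    then have "y x = comb m a x" if "x \<in> {0..1}" for x using b[OF that] 0 by (simp add: w_def comb_def)
    then show ?thesis by blast
  next
    case (Suc n)
    then have am: "a' m = 0" using e lBY by simp
    have "y x = comb m (a'(0 := b)) x" if "x \<in> {0..1}" for x
    proof -
      have "y x = b * Y 0 x + comb (Suc m) a' x" using b[OF that] by (simp add: w_def algebra_simps)
      also have "comb (Suc m) a' x = comb m a' x" by (simp add: comb_def am)
      also have "b * Y 0 x + comb m a' x = comb m (a'(0 := b)) x"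
        unfolding comb_def Suc sum.lessThan_Suc_shift by simp
      finally show ?thesis .
    qed
    then show ?thesis by blast
  qed
qed

text \<open>
  Applying the equation to a vanishing combination gives a vanishing combination with one term
  less, whose coefficients are 0 by induction; what remains is a multiple of \<open>Y 0\<close>.
\<close>

lemma comb_independent: "(\<And>x. x \<in> {0..1} \<Longrightarrow> comb n a x = 0) \<Longrightarrow> j < n \<Longrightarrow> a j = 0"
proof (induction n arbitrary: a j)
  case (Suc n)
  have c: "continuous_on {0..1} (\<lambda>t. - comb n (\<lambda>j. a (Suc j)) t)" by (intro continuous_intros comb_continuous)
  have "comb n (\<lambda>j. a (Suc j)) x = 0" if "x \<in> {0..1}" for x
    using sys_rhs_zero(2)[OF comb_sys_Suc c Suc.prems(1) that] by simp
  then have s: "a (Suc i) = 0" if "i < n" for i using Suc.IH[of "\<lambda>j. a (Suc j)" i] that by blast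
  obtain x where x: "x \<in> {0..1}" "Y 0 x \<noteq> 0" using nz by blast
  have "a 0 * Y 0 x = 0"
    using Suc.prems(1)[OF x(1)] s unfolding comb_def sum.lessThan_Suc_shift by simp
  then have "a 0 = 0" using x by simp
  then show ?case using s Suc.prems(2) by (cases j) auto
qed simp

lemma root_space_eq: "T4_root_space q \<alpha> \<mu> = {ext01 (comb m a) | a. True}"
proof (intro equalityI subsetI)
  fix y assume "y \<in> T4_root_space q \<alpha> \<mu>"
  then obtain k where k: "y \<in> T4_kernel_power q \<alpha> \<mu> k" by (auto simp: T4_root_space_def)
  then obtain a where a: "\<And>x. x \<in> {0..1} \<Longrightarrow> y x = comb m a x" using kernel_in_comb by blast
  have "ext01 y = ext01 (comb m a)" using a by (auto simp: ext01_def)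
  then show "y \<in> {ext01 (comb m a) | a. True}" using kernel_power_ext[OF k] by auto
next
  fix y assume "y \<in> {ext01 (comb m a) | a. True}"
  then show "y \<in> T4_root_space q \<alpha> \<mu>" using comb_in_kernel[of m] by (auto simp: T4_root_space_def)
qed

text \<open>The \<open>m\<close> chain elements are independent and span the root space.\<close>

lemma alg_mult_eq: "T4_alg_mult q \<alpha> \<mu> = m"
proof -
  define E where "E j = ext01 (Y j)" for j
  have sumE: "(\<Sum>j<m. (\<lambda>x. a j * E j x)) = ext01 (comb m a)" for a
    by (rule ext) (auto simp: sum_functions_apply E_def ext01_def comb_def intro!: sum.neutral)
  have indep: "a j = 0" if "(\<Sum>j<m. (\<lambda>x. a j * E j x)) = 0" "j < m" for a j
  proof (rule comb_independent[OF _ that(2)])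
    fix x :: real assume "x \<in> {0..1}"
    then show "comb m a x = 0" using fun_cong[OF that(1)[unfolded sumE], of x] by simp
  qed
  have inj: "inj_on E {..<m}"
  proof (rule inj_onI, rule ccontr)
    fix i j assume ij: "i \<in> {..<m}" "j \<in> {..<m}" "E i = E j" "i \<noteq> j"
    define a where "a k = (if k = i then 1 else if k = j then -1 else 0 :: complex)" for k
    have "(\<Sum>k<m. (\<lambda>x. a k * E k x)) = (\<Sum>k\<in>{i,j}. (\<lambda>x. a k * E k x))"
      using ij by (intro sum.mono_neutral_right) (auto simp: a_def zero_fun_def)
    also have "\<dots> = 0" using ij by (auto simp: a_def fun_eq_iff)
    finally have "a i = 0" using indep[of a i] ij by simp
    then show False by (simp add: a_def)
  qed
  have re: "(\<Sum>v\<in>E ` {..<m}. (\<lambda>x. u v * v x)) = (\<Sum>j<m. (\<lambda>x. u (E j) * E j x))" for u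
    by (subst sum.reindex[OF inj]) simp
  have "cfun.independent (E ` {..<m})"
  proof (rule cfun.independent_if_scalars_zero)
    fix f e assume "(\<Sum>v\<in>E ` {..<m}. (\<lambda>x. f v * v x)) = 0" "e \<in> E ` {..<m}"
    then show "f e = 0" using indep[of "\<lambda>j. f (E j)"] unfolding re by auto
  qed simp
  moreover have "cfun.span (E ` {..<m}) = T4_root_space q \<alpha> \<mu>"
  proof -
    have "cfun.span (E ` {..<m}) = range (\<lambda>u. \<Sum>v\<in>E ` {..<m}. (\<lambda>x. u v * v x))"
      by (rule cfun.span_finite) simp
    also have "\<dots> = {ext01 (comb m a) | a. True}"
    proof (intro equalityI subsetI)
      fix f assume "f \<in> range (\<lambda>u. \<Sum>v\<in>E ` {..<m}. (\<lambda>x. u v * v x))"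
      then show "f \<in> {ext01 (comb m a) | a. True}" unfolding re sumE[of "\<lambda>j. u (E j)" for u] by auto
    next
      fix f assume "f \<in> {ext01 (comb m a) | a. True}"
      then obtain a where a: "f = ext01 (comb m a)" by auto
      define u where "u v = a (inv_into {..<m} E v)" for v
      have "(\<Sum>v\<in>E ` {..<m}. (\<lambda>x. u v * v x)) = (\<Sum>j<m. (\<lambda>x. a j * E j x))"
        unfolding re u_def using inv_into_f_f[OF inj] by (intro sum.cong) auto
      then show "f \<in> range (\<lambda>u. \<Sum>v\<in>E ` {..<m}. (\<lambda>x. u v * v x))" using a sumE by (intro range_eqI[of _ _ u]) simp
    qed
    finally show ?thesis using root_space_eq by simp
  qed
  ultimately have "cfun.dim (T4_root_space q \<alpha> \<mu>) = card (E ` {..<m})"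
    using cfun.dim_span_eq_card_independent by metis
  then show ?thesis using card_image[OF inj] by (simp add: T4_alg_mult_def)
qed

end

section \<open>The characteristic function and the adjoint problem\<close>

lemma singular_system:
  fixes a b c d :: complex
  assumes "a * d - b * c = 0"
  shows "\<exists>x y. (x, y) \<noteq> (0, 0) \<and> a * x + b * y = 0 \<and> c * x + d * y = 0"
proof (cases "a = 0 \<and> b = 0")
  case True
  then show ?thesis
  proof (cases "c = 0 \<and> d = 0")
    case False
    then show ?thesis using True by (intro exI[of _ d] exI[of _ "-c"]) auto
  qed (intro exI[of _ 1] exI[of _ 1], auto)
next
  case False
  then show ?thesis using assms by (intro exI[of _ b] exI[of _ "-a"]) (auto simp: algebra_simps)
qed

lemma orthogonal_pair:
  fixes p q x y :: complex
  assumes "p * x + q * y = 0" "x \<noteq> 0 \<or> y \<noteq> 0"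
  shows "\<exists>b. p = b * y \<and> q = b * (- x)"
proof (cases "y = 0")
  case True
  then show ?thesis using assms by (intro exI[of _ "- q / x"]) auto
next
  case False
  have "q * y = - (p * x)" using assms(1) by (simp add: add_eq_0_iff)
  then show ?thesis using False by (intro exI[of _ "p / y"]) (simp add: field_simps)
qed

locale bvp = potential +
  fixes \<alpha> :: complex
  assumes alpha: "\<alpha> \<noteq> 1" "\<alpha> \<noteq> -1"
begin

text \<open>
  The determinant of the two boundary conditions on the span of the fundamental system, simplified
  by the Wronskian identity.
\<close>

definition \<Delta> :: "complex \<Rightarrow> complex" where
  "\<Delta> \<mu> = 1 + \<alpha> + vch \<mu> 0 1 0 1 + \<alpha> * ych \<mu> 1 0 0 1"

definition Fc :: "complex \<Rightarrow> real \<Rightarrow> complex fps" where "Fc \<mu> x = Abs_fps (\<lambda>j. ych \<mu> 1 0 j x)"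
definition Fs :: "complex \<Rightarrow> real \<Rightarrow> complex fps" where "Fs \<mu> x = Abs_fps (\<lambda>j. ych \<mu> 0 1 j x)"
definition Gc :: "complex \<Rightarrow> real \<Rightarrow> complex fps" where "Gc \<mu> x = Abs_fps (\<lambda>j. vch \<mu> 1 0 j x)"
definition Gs :: "complex \<Rightarrow> real \<Rightarrow> complex fps" where "Gs \<mu> x = Abs_fps (\<lambda>j. vch \<mu> 0 1 j x)"

text \<open>
  The Taylor expansion of \<open>\<Delta>\<close> at \<open>\<mu>\<close>, kept in determinant
  form: the boundary values of the chains below are read off from the rows of this determinant.
\<close>

definition F\<Delta> :: "complex \<Rightarrow> complex fps" where
  "F\<Delta> \<mu> = (1 + Gs \<mu> 1) * (1 + fps_const \<alpha> * Fc \<mu> 1) - (fps_const \<alpha> * Fs \<mu> 1) * Gc \<mu> 1"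

lemma \<Delta>_det: "\<Delta> \<mu> = (1 + vch \<mu> 0 1 0 1) * (1 + \<alpha> * ych \<mu> 1 0 0 1) - (\<alpha> * ych \<mu> 0 1 0 1) * vch \<mu> 1 0 0 1"
proof -
  have "ych \<mu> 1 0 0 1 * vch \<mu> 0 1 0 1 = 1 + vch \<mu> 1 0 0 1 * ych \<mu> 0 1 0 1"
    using wronskian[of 1 \<mu>] by (simp add: algebra_simps)
  then have "\<alpha> * (ych \<mu> 1 0 0 1 * vch \<mu> 0 1 0 1) = \<alpha> + \<alpha> * (vch \<mu> 1 0 0 1 * ych \<mu> 0 1 0 1)" by (simp add: algebra_simps)
  then show ?thesis unfolding \<Delta>_def by (simp add: algebra_simps)
qed

lemma \<Delta>_adjoint_det: "\<Delta> \<mu> = (1 + ych \<mu> 1 0 0 1) * (vch \<mu> 0 1 0 1 + \<alpha>) - ych \<mu> 0 1 0 1 * vch \<mu> 1 0 0 1"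
  using wronskian[of 1 \<mu>] unfolding \<Delta>_def by (simp add: algebra_simps)

lemma \<Delta>_fps: "(\<lambda>z. \<Delta> (\<mu> + z)) has_fps_expansion F\<Delta> \<mu>"
  unfolding \<Delta>_det F\<Delta>_def Fc_def Fs_def Gc_def Gs_def
  by (intro has_fps_expansion_diff has_fps_expansion_add has_fps_expansion_mult has_fps_expansion_const has_fps_expansion_1 sol_fps_expansion) auto

lemma \<Delta>_holomorphic: "\<Delta> holomorphic_on A"
proof -
  have "\<Delta> analytic_on {\<mu>}" for \<mu>
  proof -
    have "(\<lambda>z. \<Delta> (\<mu> + z)) analytic_on {0}" using \<Delta>_fps has_fps_expansion_imp_analytic_0 by blast
    then have "(\<lambda>z. \<Delta> (\<mu> + z)) \<circ> (\<lambda>z. z - \<mu>) analytic_on {\<mu>}"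
      by (intro analytic_on_compose_gen[of _ _ _ "{0}"] analytic_intros) auto
    then show ?thesis by (simp add: o_def)
  qed
  then have "\<Delta> analytic_on UNIV" using analytic_on_analytic_at by blast
  then show ?thesis using analytic_imp_holomorphic holomorphic_on_subset by blast
qed

lemma F\<Delta>_nonzero_zorder: "F\<Delta> \<mu> \<noteq> 0 \<Longrightarrow> zorder \<Delta> \<mu> = int (subdegree (F\<Delta> \<mu>))"
  using has_fps_expansion_zorder[OF \<Delta>_fps] .

lemma F\<Delta>_0: "fps_nth (F\<Delta> \<mu>) 0 = \<Delta> \<mu>"
  by (simp add: F\<Delta>_def \<Delta>_det Fc_def Fs_def Gc_def Gs_def)

text \<open>
  A solution whose initial values \<open>U1\<close>, \<open>U2\<close> are themselves power series
  in the spectral parameter; its coefficients satisfy the same chain relation.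
\<close>

definition YU :: "complex \<Rightarrow> complex fps \<Rightarrow> complex fps \<Rightarrow> nat \<Rightarrow> real \<Rightarrow> complex" where
  "YU \<mu> U1 U2 j x = fps_nth (U1 * Fc \<mu> x + U2 * Fs \<mu> x) j"
definition VU :: "complex \<Rightarrow> complex fps \<Rightarrow> complex fps \<Rightarrow> nat \<Rightarrow> real \<Rightarrow> complex" where
  "VU \<mu> U1 U2 j x = fps_nth (U1 * Gc \<mu> x + U2 * Gs \<mu> x) j"

lemma at_0: "Fc \<mu> 0 = 1" "Fs \<mu> 0 = 0" "Gc \<mu> 0 = 0" "Gs \<mu> 0 = 1"
  by (auto simp: fps_eq_iff Fc_def Fs_def Gc_def Gs_def chain_sys)

lemma YU_sys:
  "sys (\<lambda>t. q t - \<mu>) (\<lambda>t. case j of 0 \<Rightarrow> 0 | Suc i \<Rightarrow> - YU \<mu> A B i t) (YU \<mu> A B j) (VU \<mu> A B j)"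
proof -
  have "sys (\<lambda>t. q t - \<mu>)
      (\<lambda>t. (\<Sum>i=0..j. fps_nth A i * rch \<mu> 1 0 (j - i) t) + (\<Sum>i=0..j. fps_nth B i * rch \<mu> 0 1 (j - i) t))
      (\<lambda>t. (\<Sum>i=0..j. fps_nth A i * ych \<mu> 1 0 (j - i) t) + (\<Sum>i=0..j. fps_nth B i * ych \<mu> 0 1 (j - i) t))
      (\<lambda>t. (\<Sum>i=0..j. fps_nth A i * vch \<mu> 1 0 (j - i) t) + (\<Sum>i=0..j. fps_nth B i * vch \<mu> 0 1 (j - i) t))"
    by (intro sys_add sys_sum sys_cmult chain_sys)
  moreover have "(\<Sum>i=0..j. fps_nth U i * rch \<mu> a b (j - i) t) = (case j of 0 \<Rightarrow> 0 | Suc k \<Rightarrow> - (\<Sum>i=0..k. fps_nth U i * ych \<mu> a b (k - i) t))" for U a b t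
  proof (cases j)
    case (Suc k)
    have "(\<Sum>i=0..k. fps_nth U i * rch \<mu> a b (Suc k - i) t) = - (\<Sum>i=0..k. fps_nth U i * ych \<mu> a b (k - i) t)"
      unfolding sum_negf[symmetric] by (intro sum.cong) (auto simp: Suc_diff_le)
    then show ?thesis using Suc by simp
  qed simp
  ultimately show ?thesis
    by (elim sys_cong) (auto simp: YU_def VU_def Fc_def Fs_def Gc_def Gs_def fps_mult_nth split: nat.splits)
qed

lemma YU_sys_0: "sys (\<lambda>t. q t - \<mu>) (\<lambda>t. 0) (YU \<mu> A B 0) (VU \<mu> A B 0)"
  using YU_sys[where j="0::nat"] unfolding nat.case .

lemma YU_sys_Suc: "sys (\<lambda>t. q t - \<mu>) (\<lambda>t. - YU \<mu> A B j t) (YU \<mu> A B (Suc j)) (VU \<mu> A B (Suc j))"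
  using YU_sys[where j="Suc j"] unfolding nat.case .

text \<open>
  Choose the initial values as the series orthogonal to one row \<open>RA\<close> of the boundary
  matrix. Then one boundary form vanishes identically in the spectral parameter, and the other is
  the determinant up to sign; so its Taylor coefficients vanish exactly below the order of the
  zero, and the chain has that length.
\<close>

lemma alg_mult_aux:
  assumes rows: "(lA = (\<lambda>a b c d. b + d) \<and> lB = (\<lambda>a b c d. a + \<alpha> * c) \<and> RA1 = Gc \<mu> 1 \<and> RA2 = 1 + Gs \<mu> 1 \<and> RB1 = 1 + fps_const \<alpha> * Fc \<mu> 1 \<and> RB2 = fps_const \<alpha> * Fs \<mu> 1) \<or>
      (lB = (\<lambda>a b c d. b + d) \<and> lA = (\<lambda>a b c d. a + \<alpha> * c) \<and> RB1 = Gc \<mu> 1 \<and> RB2 = 1 + Gs \<mu> 1 \<and> RA1 = 1 + fps_const \<alpha> * Fc \<mu> 1 \<and> RA2 = fps_const \<alpha> * Fs \<mu> 1)"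
    and nzA: "fps_nth RA1 0 \<noteq> 0 \<or> fps_nth RA2 0 \<noteq> 0" and nz\<Delta>: "F\<Delta> \<mu> \<noteq> 0"
  shows "T4_alg_mult q \<alpha> \<mu> = subdegree (F\<Delta> \<mu>)"
proof -
  \<comment> \<open>\<open>(RA2, -RA1)\<close> annihilates the row \<open>(RA1, RA2)\<close>.\<close>
  define U1 where "U1 = RA2"
  define U2 where "U2 = - RA1"
  let ?Y = "YU \<mu> U1 U2" and ?V = "VU \<mu> U1 U2"
  have det: "RA2 * RB1 - RA1 * RB2 = F\<Delta> \<mu> \<or> RA2 * RB1 - RA1 * RB2 = - F\<Delta> \<mu>"
    using rows by (auto simp: F\<Delta>_def algebra_simps)
  have lc: "U * (fps_const \<alpha> * F) = fps_const \<alpha> * (U * F)" for U F by (rule mult.left_commute)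
  have UB: "fps_nth (U1 * RB1 + U2 * RB2) j = fps_nth (F\<Delta> \<mu>) j \<or> fps_nth (U1 * RB1 + U2 * RB2) j = - fps_nth (F\<Delta> \<mu>) j" for j
  proof -
    have "U1 * RB1 + U2 * RB2 = RA2 * RB1 - RA1 * RB2" by (simp add: U1_def U2_def)
    then have "U1 * RB1 + U2 * RB2 = F\<Delta> \<mu> \<or> U1 * RB1 + U2 * RB2 = - F\<Delta> \<mu>" using det by simp
    then show ?thesis by (elim disjE) (simp_all only: fps_neg_nth simp_thms)
  qed
  have bA: "lA (?Y j 0) (?V j 0) (?Y j 1) (?V j 1) = fps_nth (U1 * RA1 + U2 * RA2) j"
    and bB: "lB (?Y j 0) (?V j 0) (?Y j 1) (?V j 1) = fps_nth (U1 * RB1 + U2 * RB2) j" for j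
    using rows by (auto simp: YU_def VU_def at_0 lc distrib_left fps_mult_left_const_nth)
  have Y0: "sys (\<lambda>t. q t - \<mu>) (\<lambda>t. 0) (?Y 0) (?V 0)" by (rule YU_sys_0)
  have s0: "?Y 0 x = fps_nth U1 0 * ych \<mu> 1 0 0 x + fps_nth U2 0 * ych \<mu> 0 1 0 x"
    "?V 0 x = fps_nth U1 0 * vch \<mu> 1 0 0 x + fps_nth U2 0 * vch \<mu> 0 1 0 x" for x
    by (simp_all add: YU_def VU_def Fc_def Fs_def Gc_def Gs_def)
  interpret jordan_chain q \<alpha> \<mu> ?Y ?V "subdegree (F\<Delta> \<mu>)" lA lB
  proof
    show "(lA = (\<lambda>a b c d. b + d) \<and> lB = (\<lambda>a b c d. a + \<alpha> * c)) \<or> (lB = (\<lambda>a b c d. b + d) \<and> lA = (\<lambda>a b c d. a + \<alpha> * c))"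
      using rows by blast
    show "sys (\<lambda>t. q t - \<mu>) (\<lambda>t. 0) (?Y 0) (?V 0)" by (rule Y0)
    show "sys (\<lambda>t. q t - \<mu>) (\<lambda>t. - ?Y j t) (?Y (Suc j)) (?V (Suc j))" for j by (rule YU_sys_Suc)
    show "lA (?Y j 0) (?V j 0) (?Y j 1) (?V j 1) = 0" for j unfolding bA by (simp add: U1_def U2_def)
    show "lB (?Y j 0) (?V j 0) (?Y j 1) (?V j 1) = 0" if "j < subdegree (F\<Delta> \<mu>)" for j
      using UB[of j] nth_less_subdegree_zero[OF that] unfolding bB by auto
    show "lB (?Y (subdegree (F\<Delta> \<mu>)) 0) (?V (subdegree (F\<Delta> \<mu>)) 0) (?Y (subdegree (F\<Delta> \<mu>)) 1) (?V (subdegree (F\<Delta> \<mu>)) 1) \<noteq> 0"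
      using UB[of "subdegree (F\<Delta> \<mu>)"] nth_subdegree_nonzero[OF nz\<Delta>] unfolding bB by auto
    show "\<exists>b. \<forall>x\<in>{0..1}. w x = b * ?Y 0 x \<and> u x = b * ?V 0 x"
      if w: "sys (\<lambda>t. q t - \<mu>) (\<lambda>t. 0) w u" and lw: "lA (w 0) (u 0) (w 1) (u 1) = 0" for w u
    proof -
      have "w 0 * fps_nth RA1 0 + u 0 * fps_nth RA2 0 = 0"
        using lw rows sys_sol[OF w, of 1] by (auto simp: Fc_def Fs_def Gc_def Gs_def algebra_simps)
      from orthogonal_pair[OF this nzA] obtain b where b: "w 0 = b * fps_nth U1 0" "u 0 = b * fps_nth U2 0"
        by (auto simp: U1_def U2_def)
      show ?thesis
      proof (intro exI[of _ b] ballI conjI)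
        fix x :: real assume x: "x \<in> {0..1}"
        show "w x = b * ?Y 0 x" unfolding sys_sol(1)[OF w x] s0 b by (simp only: distrib_left mult.assoc)
        show "u x = b * ?V 0 x" unfolding sys_sol(2)[OF w x] s0 b by (simp only: distrib_left mult.assoc)
      qed
    qed
    show "\<exists>x\<in>{0..1}. ?Y 0 x \<noteq> 0"
    proof (rule ccontr)
      assume "\<not> (\<exists>x\<in>{0..1}. ?Y 0 x \<noteq> 0)"
      then have z: "?Y 0 x = 0" if "x \<in> {0..1}" for x using that by blast
      have "?V 0 0 = 0" "?Y 0 0 = 0" using sys_rhs_zero(1)[OF Y0 _ z, of 0] z[of 0] by auto
      then have "fps_nth U1 0 = 0" "fps_nth U2 0 = 0" unfolding s0 by (simp_all add: chain_sys)
      then show False using nzA by (simp add: U1_def U2_def)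
    qed
  qed
  show ?thesis by (rule alg_mult_eq)
qed

text \<open>
  If three entries of the boundary matrix vanished, the Wronskian identity would give \<open>c(1)
  = -1\<close> and then \<open>\<alpha> = 1\<close>.
\<close>

lemma rows_nonzero: "vch \<mu> 1 0 0 1 \<noteq> 0 \<or> 1 + vch \<mu> 0 1 0 1 \<noteq> 0 \<or> 1 + \<alpha> * ych \<mu> 1 0 0 1 \<noteq> 0"
proof (rule ccontr)
  assume "\<not> ?thesis"
  then have h: "vch \<mu> 1 0 0 1 = 0" "1 + vch \<mu> 0 1 0 1 = 0" "1 + \<alpha> * ych \<mu> 1 0 0 1 = 0" by auto
  then have "vch \<mu> 0 1 0 1 = -1" by (simp add: add_eq_0_iff)
  then have "ych \<mu> 1 0 0 1 = -1" using wronskian[of 1 \<mu>] h(1) by simp (metis minus_minus)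
  then have "\<alpha> = 1" using h(3) by simp
  then show False using alpha by simp
qed

text \<open>
  At least one row of the boundary matrix does not vanish at \<open>\<mu>\<close>, and that row
  can serve as \<open>RA\<close>.
\<close>

lemma alg_mult_subdegree:
  assumes "F\<Delta> \<mu> \<noteq> 0" shows "T4_alg_mult q \<alpha> \<mu> = subdegree (F\<Delta> \<mu>)"
proof (cases "vch \<mu> 1 0 0 1 \<noteq> 0 \<or> 1 + vch \<mu> 0 1 0 1 \<noteq> 0")
  case True
  show ?thesis
    by (rule alg_mult_aux[OF disjI1 _ assms, of "\<lambda>a b c d. b + d" "\<lambda>a b c d. a + \<alpha> * c"])
       (use True in \<open>auto simp: Gc_def Gs_def\<close>)
next
  case False
  then have "1 + \<alpha> * ych \<mu> 1 0 0 1 \<noteq> 0" using rows_nonzero by blast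
  then show ?thesis
    by (intro alg_mult_aux[OF disjI2 _ assms, of "\<lambda>a b c d. b + d" "\<lambda>a b c d. a + \<alpha> * c"])
       (auto simp: Fc_def Fs_def)
qed

text \<open>
  A nontrivial combination of the fundamental system meets both boundary conditions iff their
  determinant vanishes.
\<close>

lemma eigenvalue_iff: "\<mu> \<in> T4_eigenvalues q \<alpha> \<longleftrightarrow> \<Delta> \<mu> = 0"
proof
  assume "\<mu> \<in> T4_eigenvalues q \<alpha>"
  then obtain y where "T4_eigenfunction q \<alpha> \<mu> y" by (auto simp: T4_eigenvalues_def)
  then obtain v where y: "ext01 y = y" "y \<noteq> 0" and v: "sys (\<lambda>t. q t - \<mu>) (\<lambda>t. 0) y v" "v 0 + v 1 = 0" "y 0 + \<alpha> * y 1 = 0"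
    unfolding eigenfunction_iff by blast
  have ne: "(y 0, v 0) \<noteq> (0, 0)"
  proof
    assume "(y 0, v 0) = (0, 0)"
    then have "y x = 0" if "x \<in> {0..1}" for x using sys_sol(1)[OF v(1) that] by simp
    then have "y = 0" using y(1) by (metis ext01_def ext zero_fun_def zero_fun_apply)
    then show False using y by simp
  qed
  have e: "v 0 * (1 + vch \<mu> 0 1 0 1) = - (y 0 * vch \<mu> 1 0 0 1)" "y 0 * (1 + \<alpha> * ych \<mu> 1 0 0 1) = - (v 0 * (\<alpha> * ych \<mu> 0 1 0 1))"
  proof -
    have "v 0 + v 1 = v 0 * (1 + vch \<mu> 0 1 0 1) + y 0 * vch \<mu> 1 0 0 1"
      using sys_sol(2)[OF v(1), of 1] by (simp add: algebra_simps)
    then show "v 0 * (1 + vch \<mu> 0 1 0 1) = - (y 0 * vch \<mu> 1 0 0 1)" using v(2) by (simp add: eq_neg_iff_add_eq_0)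
    have "y 0 + \<alpha> * y 1 = y 0 * (1 + \<alpha> * ych \<mu> 1 0 0 1) + v 0 * (\<alpha> * ych \<mu> 0 1 0 1)"
      using sys_sol(1)[OF v(1), of 1] by (simp add: algebra_simps)
    then show "y 0 * (1 + \<alpha> * ych \<mu> 1 0 0 1) = - (v 0 * (\<alpha> * ych \<mu> 0 1 0 1))" using v(3) by (simp add: eq_neg_iff_add_eq_0)
  qed
  have "y 0 * \<Delta> \<mu> = 0"
  proof -
    have "y 0 * \<Delta> \<mu> = (1 + vch \<mu> 0 1 0 1) * (y 0 * (1 + \<alpha> * ych \<mu> 1 0 0 1)) - (\<alpha> * ych \<mu> 0 1 0 1) * (y 0 * vch \<mu> 1 0 0 1)"
      unfolding \<Delta>_det by (simp add: algebra_simps)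
    also have "\<dots> = - (\<alpha> * ych \<mu> 0 1 0 1) * (v 0 * (1 + vch \<mu> 0 1 0 1) + y 0 * vch \<mu> 1 0 0 1)"
      unfolding e(2) by (simp add: algebra_simps)
    finally show ?thesis using e(1) by simp
  qed
  moreover have "v 0 * \<Delta> \<mu> = 0"
  proof -
    have "v 0 * \<Delta> \<mu> = (v 0 * (1 + vch \<mu> 0 1 0 1)) * (1 + \<alpha> * ych \<mu> 1 0 0 1) - (v 0 * (\<alpha> * ych \<mu> 0 1 0 1)) * vch \<mu> 1 0 0 1"
      unfolding \<Delta>_det by (simp add: algebra_simps)
    also have "\<dots> = - vch \<mu> 1 0 0 1 * (y 0 * (1 + \<alpha> * ych \<mu> 1 0 0 1) + v 0 * (\<alpha> * ych \<mu> 0 1 0 1))"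
      unfolding e(1) by (simp add: algebra_simps)
    finally show ?thesis using e(2) by simp
  qed
  ultimately show "\<Delta> \<mu> = 0" using ne by auto
next
  assume "\<Delta> \<mu> = 0"
  then have "vch \<mu> 1 0 0 1 * (\<alpha> * ych \<mu> 0 1 0 1) - (1 + vch \<mu> 0 1 0 1) * (1 + \<alpha> * ych \<mu> 1 0 0 1) = 0"
    unfolding \<Delta>_det by (simp add: algebra_simps)
  from singular_system[OF this] obtain a b where ab: "(a, b) \<noteq> (0, 0)"
    "vch \<mu> 1 0 0 1 * a + (1 + vch \<mu> 0 1 0 1) * b = 0" "(1 + \<alpha> * ych \<mu> 1 0 0 1) * a + (\<alpha> * ych \<mu> 0 1 0 1) * b = 0" by blast
  define y where "y = ych \<mu> a b 0"
  define v where "v = vch \<mu> a b 0"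
  have s: "sys (\<lambda>t. q t - \<mu>) (\<lambda>t. 0) y v" unfolding y_def v_def by (rule sol_sys)
  have i: "y 0 = a" "v 0 = b" unfolding y_def v_def by (simp_all add: chain_sys)
  have bc: "v 0 + v 1 = 0" "y 0 + \<alpha> * y 1 = 0" using ab sys_sol[OF s, of 1] i by (auto simp: algebra_simps)
  have "sys (\<lambda>t. q t - \<mu>) (\<lambda>t. 0) (ext01 y) v" by (rule sys_cong[OF s]) auto
  moreover have "ext01 y \<noteq> 0"
  proof
    assume "ext01 y = 0"
    then have "y x = 0" if "x \<in> {0..1}" for x using that by (metis ext01_in zero_fun_apply)
    then have "y 0 = 0" "v 0 = 0" using sys_rhs_zero(1)[OF s, of 0] by auto
    then show False using ab i by simp
  qed
  ultimately have "T4_eigenfunction q \<alpha> \<mu> (ext01 y)" unfolding eigenfunction_iff using bc by auto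
  then show "\<mu> \<in> T4_eigenvalues q \<alpha>" by (auto simp: T4_eigenvalues_def)
qed

text \<open>
  The boundary conditions \<open>z(0) + z(1) = 0\<close> and \<open>z'(1) + \<alpha> z'(0) =
  0\<close> are those of the transposed operator; their determinant is again
  \<open>\<Delta>\<close>, so it has the same zeros.
\<close>

lemma adjoint_solution:
  assumes "\<Delta> \<nu> = 0"
  obtains z w where "sys (\<lambda>t. q t - \<nu>) (\<lambda>t. 0) z w" "z 0 + z 1 = 0" "w 1 + \<alpha> * w 0 = 0" "\<exists>x\<in>{0..1}. z x \<noteq> 0"
proof -
  have "(1 + ych \<nu> 1 0 0 1) * (vch \<nu> 0 1 0 1 + \<alpha>) - ych \<nu> 0 1 0 1 * vch \<nu> 1 0 0 1 = 0"
    using assms unfolding \<Delta>_adjoint_det .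
  from singular_system[OF this] obtain a b where ab: "(a, b) \<noteq> (0, 0)"
    "(1 + ych \<nu> 1 0 0 1) * a + ych \<nu> 0 1 0 1 * b = 0" "vch \<nu> 1 0 0 1 * a + (vch \<nu> 0 1 0 1 + \<alpha>) * b = 0" by blast
  define z where "z = ych \<nu> a b 0"
  define w where "w = vch \<nu> a b 0"
  have s: "sys (\<lambda>t. q t - \<nu>) (\<lambda>t. 0) z w" unfolding z_def w_def by (rule sol_sys)
  have i: "z 0 = a" "w 0 = b" unfolding z_def w_def by (simp_all add: chain_sys)
  have bc: "z 0 + z 1 = 0" "w 1 + \<alpha> * w 0 = 0" using ab sys_sol[OF s, of 1] i by (auto simp: algebra_simps)
  have "\<exists>x\<in>{0..1}. z x \<noteq> 0"
  proof (rule ccontr)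
    assume "\<not> ?thesis"
    then have "z 0 = 0" "w 0 = 0" using sys_rhs_zero(1)[OF s, of 0] by auto
    then show False using ab i by simp
  qed
  then show ?thesis using that s bc by blast
qed

text \<open>
  Lagrange's identity has vanishing boundary terms, so \<open>(\<mu> - \<nu>) \<integral> y z = -
  \<integral> \<zeta> z\<close>, where \<open>\<zeta> = (T - \<mu>) y\<close> is in the preceding
  kernel and the right-hand side is 0 by induction.
\<close>

lemma adjoint_orthogonal:
  assumes z: "sys (\<lambda>t. q t - \<nu>) (\<lambda>t. 0) z w" "z 0 + z 1 = 0" "w 1 + \<alpha> * w 0 = 0" and "\<mu> \<noteq> \<nu>"
    and y: "y \<in> T4_kernel_power q \<alpha> \<mu> k"
  shows "integral {0..1} (\<lambda>x. y x * z x) = 0"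
  using y
proof (induction k arbitrary: y)
  case 0
  then show ?case by simp
next
  case (Suc k)
  obtain \<zeta> v where \<zeta>: "\<zeta> \<in> T4_kernel_power q \<alpha> \<mu> k" and s: "sys (\<lambda>t. q t - \<mu>) (\<lambda>t. - \<zeta> t) y v" "v 0 + v 1 = 0" "y 0 + \<alpha> * y 1 = 0"
    using kernel_power_SucD[OF Suc.prems] by blast
  have c: "continuous_on {0..1} y" "continuous_on {0..1} z" "continuous_on {0..1} \<zeta>"
    using sys_continuous s z kernel_power_continuous[OF \<zeta>] by blast+
  have "prim (\<lambda>t. y t * w t - v t * z t) (\<lambda>t. (\<mu> - \<nu>) * (y t * z t) + \<zeta> t * z t)"
    by (rule prim_cong[OF sys_lagrange[OF s(1) z(1)]]) auto
  then have "integral {0..1} (\<lambda>t. (\<mu> - \<nu>) * (y t * z t) + \<zeta> t * z t) = (y 1 * w 1 - v 1 * z 1) - (y 0 * w 0 - v 0 * z 0)"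
    unfolding prim_def by auto
  also have "\<dots> = 0"
  proof -
    have "v 1 = - v 0" "y 0 = - \<alpha> * y 1" "z 1 = - z 0" "w 1 = - \<alpha> * w 0"
      using s(2,3) z(2,3) by (simp_all add: add_eq_0_iff add.commute)
    then show ?thesis by (simp add: algebra_simps)
  qed
  also have "integral {0..1} (\<lambda>t. (\<mu> - \<nu>) * (y t * z t) + \<zeta> t * z t) = (\<mu> - \<nu>) * integral {0..1} (\<lambda>t. y t * z t) + integral {0..1} (\<lambda>t. \<zeta> t * z t)"
    using c by (subst integral_add) (auto intro!: integrable_continuous_real continuous_intros)
  finally show ?case using Suc.IH[OF \<zeta>] \<open>\<mu> \<noteq> \<nu>\<close> by simp
qed

end

section \<open>Asymptotics of the characteristic function\<close>

lemma cmod_sin_le: "cmod (sin z) \<le> exp \<bar>Im z\<bar>" and cmod_cos_le: "cmod (cos z) \<le> exp \<bar>Im z\<bar>"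
  using cmod_sin_le_exp[of 1 z] cmod_cos_le_exp[of 1 z] by auto

lemma prim_sin: "prim (\<lambda>t. sin (\<rho> * of_real (x - t))) (\<lambda>t. - \<rho> * cos (\<rho> * of_real (x - t)))"
  and prim_cos: "prim (\<lambda>t. cos (\<rho> * of_real (x - t))) (\<lambda>t. \<rho> * sin (\<rho> * of_real (x - t)))"
proof -
  have d: "((\<lambda>t. \<rho> * of_real (x - t)) has_vector_derivative - \<rho>) (at t within S)" for t S
    by (auto intro!: derivative_eq_intros simp: has_vector_derivative_def scaleR_conv_of_real algebra_simps)
  show "prim (\<lambda>t. sin (\<rho> * of_real (x - t))) (\<lambda>t. - \<rho> * cos (\<rho> * of_real (x - t)))"
    using field_vector_diff_chain_within[OF d, of sin "cos (\<rho> * of_real (x - t))" t "{0..1}" for t]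
    by (intro prim_C1) (auto intro!: continuous_intros DERIV_sin[THEN has_field_derivative_at_within] simp: o_def mult.commute)
  show "prim (\<lambda>t. cos (\<rho> * of_real (x - t))) (\<lambda>t. \<rho> * sin (\<rho> * of_real (x - t)))"
    using field_vector_diff_chain_within[OF d, of cos "- sin (\<rho> * of_real (x - t))" t "{0..1}" for t]
    by (intro prim_C1) (auto intro!: continuous_intros DERIV_cos[THEN has_field_derivative_at_within] simp: o_def mult.commute)
qed

context potential begin

definition Q :: real where "Q = integral {0..1} (\<lambda>t. cmod (q t))"

lemma norm_q_absint: "(\<lambda>t. cmod (q t)) absolutely_integrable_on {0..1}"
  using absolutely_integrable_norm[OF q_absint] by (simp add: o_def)

lemma Q_nonneg: "0 \<le> Q"
  unfolding Q_def by (intro integral_nonneg absint_integrable_on[OF norm_q_absint]) auto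

lemma q_integral_bound:
  assumes g: "continuous_on {0..1} g" and B: "\<And>t. 0 \<le> t \<Longrightarrow> t \<le> x \<Longrightarrow> cmod (g t) \<le> B" and x: "x \<in> {0..1}"
  shows "cmod (integral {0..x} (\<lambda>t. q t * g t)) \<le> Q * B"
proof -
  have B0: "0 \<le> B" using B[of 0] x norm_ge_zero[of "g 0"] by (meson atLeastAtMost_iff order_refl order_trans)
  have "cmod (integral {0..x} (\<lambda>t. q t * g t)) \<le> integral {0..x} (\<lambda>t. cmod (q t) * B)"
    using x B absint_integrable_on[OF norm_q_absint, of 0 x] absint_integrable_on[OF absint_mult_continuous(1)[OF q_absint g], of 0 x]
    by (intro integral_norm_bound_integral integrable_on_mult_left) (auto simp: norm_mult intro!: mult_left_mono)
  also have "\<dots> = integral {0..x} (\<lambda>t. cmod (q t)) * B" by simp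
  also have "\<dots> \<le> Q * B" unfolding Q_def
    using absint_integrable_on[OF norm_q_absint] x B0 by (intro mult_right_mono integral_subset_le) auto
  finally show ?thesis .
qed

text \<open>
  Lagrange's identity with the trigonometric solution \<open>sin (\<rho>(x - t))\<close> or
  \<open>cos (\<rho>(x - t))\<close> of the free equation. The first identity is multiplied by
  \<open>\<rho>\<close>, which avoids a case distinction at \<open>\<rho> = 0\<close>.
\<close>

lemma variation_of_constants:
  assumes s: "sys (\<lambda>t. q t - \<rho>\<^sup>2) (\<lambda>_. 0) y v" and x: "x \<in> {0..1}"
  shows "\<rho> * y x = \<rho> * (y 0 * cos (\<rho> * of_real x)) + v 0 * sin (\<rho> * of_real x) + integral {0..x} (\<lambda>t. q t * (sin (\<rho> * of_real (x - t)) * y t))"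
    "v x = - \<rho> * y 0 * sin (\<rho> * of_real x) + v 0 * cos (\<rho> * of_real x) + integral {0..x} (\<lambda>t. q t * (cos (\<rho> * of_real (x - t)) * y t))"
proof -
  have 1: "sys (\<lambda>t. - \<rho>\<^sup>2) (\<lambda>_. 0) (\<lambda>t. sin (\<rho> * of_real (x - t))) (\<lambda>t. - \<rho> * cos (\<rho> * of_real (x - t)))"
    unfolding sys_def by (intro conjI prim_sin prim_cong[OF prim_cmult[OF prim_cos[of \<rho> x], of "- \<rho>"]]) (auto simp: power2_eq_square)
  have 2: "sys (\<lambda>t. - \<rho>\<^sup>2) (\<lambda>_. 0) (\<lambda>t. cos (\<rho> * of_real (x - t))) (\<lambda>t. \<rho> * sin (\<rho> * of_real (x - t)))"
    unfolding sys_def by (intro conjI prim_cos prim_cong[OF prim_cmult[OF prim_sin[of \<rho> x], of \<rho>]]) (auto simp: power2_eq_square)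
  have "integral {0..x} (\<lambda>t. (- \<rho>\<^sup>2 - (q t - \<rho>\<^sup>2)) * (y t * sin (\<rho> * of_real (x - t))) + y t * 0 - 0 * sin (\<rho> * of_real (x - t)))
      = - integral {0..x} (\<lambda>t. q t * (sin (\<rho> * of_real (x - t)) * y t))"
    unfolding integral_neg[symmetric] by (intro integral_cong) (auto simp: algebra_simps)
  moreover have "integral {0..x} (\<lambda>t. (- \<rho>\<^sup>2 - (q t - \<rho>\<^sup>2)) * (y t * sin (\<rho> * of_real (x - t))) + y t * 0 - 0 * sin (\<rho> * of_real (x - t)))
      = (y x * (- \<rho> * cos (\<rho> * of_real (x - x))) - v x * sin (\<rho> * of_real (x - x))) - (y 0 * (- \<rho> * cos (\<rho> * of_real (x - 0))) - v 0 * sin (\<rho> * of_real (x - 0)))"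
    using sys_lagrange[OF s 1] x unfolding prim_def by blast
  ultimately
  show "\<rho> * y x = \<rho> * (y 0 * cos (\<rho> * of_real x)) + v 0 * sin (\<rho> * of_real x) + integral {0..x} (\<lambda>t. q t * (sin (\<rho> * of_real (x - t)) * y t))"
    by (simp add: algebra_simps)
  have "integral {0..x} (\<lambda>t. (- \<rho>\<^sup>2 - (q t - \<rho>\<^sup>2)) * (y t * cos (\<rho> * of_real (x - t))) + y t * 0 - 0 * cos (\<rho> * of_real (x - t)))
      = - integral {0..x} (\<lambda>t. q t * (cos (\<rho> * of_real (x - t)) * y t))"
    unfolding integral_neg[symmetric] by (intro integral_cong) (auto simp: algebra_simps)
  moreover have "integral {0..x} (\<lambda>t. (- \<rho>\<^sup>2 - (q t - \<rho>\<^sup>2)) * (y t * cos (\<rho> * of_real (x - t))) + y t * 0 - 0 * cos (\<rho> * of_real (x - t)))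
      = (y x * (\<rho> * sin (\<rho> * of_real (x - x))) - v x * cos (\<rho> * of_real (x - x))) - (y 0 * (\<rho> * sin (\<rho> * of_real (x - 0))) - v 0 * cos (\<rho> * of_real (x - 0)))"
    using sys_lagrange[OF s 2] x unfolding prim_def by blast
  ultimately
  show "v x = - \<rho> * y 0 * sin (\<rho> * of_real x) + v 0 * cos (\<rho> * of_real x) + integral {0..x} (\<lambda>t. q t * (cos (\<rho> * of_real (x - t)) * y t))"
    by (simp add: algebra_simps)
qed

text \<open>
  The solution for the zero potential and \<open>\<mu> = \<rho>\<^sup>2\<close> with initial
  values \<open>a\<close>, \<open>b\<close>.
\<close>

definition free :: "complex \<Rightarrow> complex \<Rightarrow> complex \<Rightarrow> real \<Rightarrow> complex" where
  "free \<rho> a b x = a * cos (\<rho> * of_real x) + b * sin (\<rho> * of_real x) / \<rho>"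

lemma trig_growth:
  assumes "0 \<le> x" shows "cmod (sin (\<rho> * of_real x)) \<le> exp (\<bar>Im \<rho>\<bar> * x)" "cmod (cos (\<rho> * of_real x)) \<le> exp (\<bar>Im \<rho>\<bar> * x)"
  using cmod_sin_le[of "\<rho> * of_real x"] cmod_cos_le[of "\<rho> * of_real x"] assms by (simp_all add: abs_mult)

lemma free_bound:
  assumes "0 \<le> x" shows "cmod (free \<rho> a b x) \<le> (cmod a + cmod b / cmod \<rho>) * exp (\<bar>Im \<rho>\<bar> * x)"
proof -
  have "cmod (free \<rho> a b x) \<le> cmod a * cmod (cos (\<rho> * of_real x)) + cmod b / cmod \<rho> * cmod (sin (\<rho> * of_real x))"
    unfolding free_def by (rule norm_triangle_le) (simp add: norm_mult norm_divide)
  also have "\<dots> \<le> cmod a * exp (\<bar>Im \<rho>\<bar> * x) + cmod b / cmod \<rho> * exp (\<bar>Im \<rho>\<bar> * x)"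
    using trig_growth[OF assms, of \<rho>] by (intro add_mono mult_left_mono) auto
  finally show ?thesis by (simp add: algebra_simps)
qed

lemma free_continuous: "continuous_on A (free \<rho> a b)"
  unfolding free_def by (cases "\<rho> = 0") (auto intro!: continuous_intros)

lemma perturbation_terms:
  assumes g: "continuous_on {0..1} g" and M: "\<And>t. t \<in> {0..1} \<Longrightarrow> cmod (g t) \<le> M * exp (\<bar>Im \<rho>\<bar> * t)" and M0: "0 \<le> M" and x: "x \<in> {0..1}"
  shows "cmod (integral {0..x} (\<lambda>t. q t * (sin (\<rho> * of_real (x - t)) * g t))) \<le> Q * (M * exp (\<bar>Im \<rho>\<bar> * x))"
    "cmod (integral {0..x} (\<lambda>t. q t * (cos (\<rho> * of_real (x - t)) * g t))) \<le> Q * (M * exp (\<bar>Im \<rho>\<bar> * x))"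
proof -
  have e: "exp (\<bar>Im \<rho>\<bar> * (x - t)) * (M * exp (\<bar>Im \<rho>\<bar> * t)) = M * exp (\<bar>Im \<rho>\<bar> * x)" for t
    by (simp add: exp_add[symmetric] algebra_simps)
  show "cmod (integral {0..x} (\<lambda>t. q t * (sin (\<rho> * of_real (x - t)) * g t))) \<le> Q * (M * exp (\<bar>Im \<rho>\<bar> * x))"
  proof (rule q_integral_bound[OF _ _ x])
    show "continuous_on {0..1} (\<lambda>t. sin (\<rho> * of_real (x - t)) * g t)" by (intro continuous_intros g)
    fix t assume t: "0 \<le> t" "t \<le> x"
    have "cmod (sin (\<rho> * of_real (x - t)) * g t) \<le> exp (\<bar>Im \<rho>\<bar> * (x - t)) * (M * exp (\<bar>Im \<rho>\<bar> * t))"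
      unfolding norm_mult using t x trig_growth(1)[of "x - t" \<rho>] M[of t] by (intro mult_mono) auto
    then show "cmod (sin (\<rho> * of_real (x - t)) * g t) \<le> M * exp (\<bar>Im \<rho>\<bar> * x)" unfolding e .
  qed
  show "cmod (integral {0..x} (\<lambda>t. q t * (cos (\<rho> * of_real (x - t)) * g t))) \<le> Q * (M * exp (\<bar>Im \<rho>\<bar> * x))"
  proof (rule q_integral_bound[OF _ _ x])
    show "continuous_on {0..1} (\<lambda>t. cos (\<rho> * of_real (x - t)) * g t)" by (intro continuous_intros g)
    fix t assume t: "0 \<le> t" "t \<le> x"
    have "cmod (cos (\<rho> * of_real (x - t)) * g t) \<le> exp (\<bar>Im \<rho>\<bar> * (x - t)) * (M * exp (\<bar>Im \<rho>\<bar> * t))"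
      unfolding norm_mult using t x trig_growth(2)[of "x - t" \<rho>] M[of t] by (intro mult_mono) auto
    then show "cmod (cos (\<rho> * of_real (x - t)) * g t) \<le> M * exp (\<bar>Im \<rho>\<bar> * x)" unfolding e .
  qed
qed

text \<open>
  In the maximum norm weighted by \<open>exp (-\<bar>Im \<rho>\<bar> x)\<close> the perturbation
  has norm at most \<open>Q/\<bar>\<rho>\<bar> \<le> 1/2\<close>.
\<close>

lemma solution_growth:
  assumes s: "sys (\<lambda>t. q t - \<rho>\<^sup>2) (\<lambda>_. 0) y v" and \<rho>: "2 * Q + 1 \<le> cmod \<rho>" and x: "x \<in> {0..1}"
  shows "cmod (y x) \<le> 2 * (cmod (y 0) + cmod (v 0) / cmod \<rho>) * exp (\<bar>Im \<rho>\<bar> * x)" (is "_ \<le> 2 * ?N * _")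
proof -
  let ?s = "\<bar>Im \<rho>\<bar>"
  have \<rho>0: "0 < cmod \<rho>" using \<rho> Q_nonneg by linarith
  have y: "continuous_on {0..1} y" by (rule sys_continuous[OF s])
  have "continuous_on {0..1} (\<lambda>t. cmod (y t) * exp (- ?s * t))" using y by (intro continuous_intros)
  then obtain x0 where x0: "x0 \<in> {0..1}" "\<And>t. t \<in> {0..1} \<Longrightarrow> cmod (y t) * exp (- ?s * t) \<le> cmod (y x0) * exp (- ?s * x0)"
    using continuous_attains_sup[of "{0..1::real}"] by (metis (no_types, lifting) atLeastatMost_empty_iff2 compact_Icc not_one_le_zero zero_le_one)
  define m where "m = cmod (y x0) * exp (- ?s * x0)"
  have m: "0 \<le> m" by (simp add: m_def)
  have le: "cmod (y t) \<le> m * exp (?s * t)" if "t \<in> {0..1}" for t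
    using x0(2)[OF that] unfolding m_def[symmetric] by (simp add: exp_minus field_simps)
  have "\<rho> * y x0 = \<rho> * free \<rho> (y 0) (v 0) x0 + integral {0..x0} (\<lambda>t. q t * (sin (\<rho> * of_real (x0 - t)) * y t))"
    using variation_of_constants(1)[OF s x0(1)] \<rho>0 by (simp add: free_def algebra_simps)
  then have "cmod \<rho> * cmod (y x0) \<le> cmod \<rho> * cmod (free \<rho> (y 0) (v 0) x0) + Q * (m * exp (?s * x0))"
    using norm_triangle_mono[OF order_refl perturbation_terms(1)[OF y le m x0(1)]] by (metis norm_mult)
  also have "\<dots> \<le> cmod \<rho> * (?N * exp (?s * x0)) + (cmod \<rho> / 2) * (m * exp (?s * x0))"
    using free_bound[of x0 \<rho> "y 0" "v 0"] x0(1) \<rho> m by (intro add_mono mult_left_mono mult_right_mono) auto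
  also have "\<dots> = cmod \<rho> * ((?N + m / 2) * exp (?s * x0))" by (simp add: algebra_simps)
  finally have "cmod (y x0) \<le> (?N + m / 2) * exp (?s * x0)" using \<rho>0 by simp
  then have "cmod (y x0) * exp (- ?s * x0) \<le> (?N + m / 2) * exp (?s * x0) * exp (- ?s * x0)" by (intro mult_right_mono) auto
  also have "\<dots> = ?N + m / 2" using exp_minus_inverse[of "?s * x0"] by (simp add: mult.assoc)
  finally have "m \<le> ?N + m / 2" by (simp add: m_def)
  then have "m \<le> 2 * ?N" by simp
  then have "m * exp (?s * x) \<le> 2 * ?N * exp (?s * x)" by (intro mult_right_mono) auto
  then show ?thesis using le[OF x] by (rule order_trans[rotated])
qed

lemma first_order:
  assumes s: "sys (\<lambda>t. q t - \<rho>\<^sup>2) (\<lambda>_. 0) y v" and \<rho>: "2 * Q + 1 \<le> cmod \<rho>" and x: "x \<in> {0..1}"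
  shows "cmod (y x - free \<rho> (y 0) (v 0) x) \<le> 2 * Q * (cmod (y 0) + cmod (v 0) / cmod \<rho>) / cmod \<rho> * exp (\<bar>Im \<rho>\<bar> * x)" (is "_ \<le> 2 * Q * ?N / _ * _")
proof -
  have \<rho>0: "0 < cmod \<rho>" using \<rho> Q_nonneg by linarith
  have y: "continuous_on {0..1} y" by (rule sys_continuous[OF s])
  have "\<rho> * (y x - free \<rho> (y 0) (v 0) x) = integral {0..x} (\<lambda>t. q t * (sin (\<rho> * of_real (x - t)) * y t))"
    using variation_of_constants(1)[OF s x] \<rho>0 by (simp add: free_def algebra_simps)
  then have "cmod \<rho> * cmod (y x - free \<rho> (y 0) (v 0) x) \<le> Q * (2 * ?N * exp (\<bar>Im \<rho>\<bar> * x))"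
    using perturbation_terms(1)[OF y solution_growth[OF s \<rho>] _ x] unfolding norm_mult[symmetric] by simp
  then have "cmod (y x - free \<rho> (y 0) (v 0) x) \<le> Q * (2 * ?N * exp (\<bar>Im \<rho>\<bar> * x)) / cmod \<rho>"
    using \<rho>0 by (simp add: pos_le_divide_eq mult.commute)
  then show ?thesis by (simp add: mult_ac)
qed

text \<open>Insert the first order approximation into the integral of the variation of constants formula.\<close>

lemma second_order:
  assumes s: "sys (\<lambda>t. q t - \<rho>\<^sup>2) (\<lambda>_. 0) y v" and \<rho>: "2 * Q + 1 \<le> cmod \<rho>" and N: "cmod (y 0) + cmod (v 0) / cmod \<rho> \<le> N"
  shows "cmod (\<rho> * y 1 - \<rho> * (y 0 * cos \<rho>) - v 0 * sin \<rho> - integral {0..1} (\<lambda>t. q t * (sin (\<rho> * of_real (1 - t)) * free \<rho> (y 0) (v 0) t))) \<le> 2 * Q\<^sup>2 * N / cmod \<rho> * exp \<bar>Im \<rho>\<bar>"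
    "cmod (v 1 + \<rho> * y 0 * sin \<rho> - v 0 * cos \<rho> - integral {0..1} (\<lambda>t. q t * (cos (\<rho> * of_real (1 - t)) * free \<rho> (y 0) (v 0) t))) \<le> 2 * Q\<^sup>2 * N / cmod \<rho> * exp \<bar>Im \<rho>\<bar>"
proof -
  let ?f = "free \<rho> (y 0) (v 0)"
  have \<rho>0: "0 < cmod \<rho>" using \<rho> Q_nonneg by linarith
  have y: "continuous_on {0..1} y" by (rule sys_continuous[OF s])
  have c: "continuous_on {0..1} (\<lambda>t. y t - ?f t)" by (intro continuous_intros y free_continuous)
  have N0: "0 \<le> N" using N by (meson add_nonneg_nonneg divide_nonneg_nonneg norm_ge_zero order_trans)
  define M where "M = 2 * Q * N / cmod \<rho>"
  have M0: "0 \<le> M" using N0 Q_nonneg by (simp add: M_def)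
  have M: "cmod (y t - ?f t) \<le> M * exp (\<bar>Im \<rho>\<bar> * t)" if "t \<in> {0..1}" for t
  proof -
    have "2 * Q * (cmod (y 0) + cmod (v 0) / cmod \<rho>) / cmod \<rho> * exp (\<bar>Im \<rho>\<bar> * t) \<le> M * exp (\<bar>Im \<rho>\<bar> * t)"
      unfolding M_def using N Q_nonneg by (intro mult_right_mono divide_right_mono mult_left_mono) auto
    then show ?thesis using first_order[OF s \<rho> that] by linarith
  qed
  have i: "(\<lambda>t. q t * (h t * g t)) integrable_on {0..1}" if "continuous_on {0..1} g" "continuous_on {0..1} h" for g h
    using absint_integrable_on[OF absint_mult_continuous(1)[OF q_absint continuous_on_mult[OF that(2,1)]], of 0 1] by simp
  have cs: "continuous_on {0..1} (\<lambda>t. sin (\<rho> * of_real (1 - t)))" "continuous_on {0..1} (\<lambda>t. cos (\<rho> * of_real (1 - t)))" by (intro continuous_intros)+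
  have "integral {0..1} (\<lambda>t. q t * (h t * y t)) - integral {0..1} (\<lambda>t. q t * (h t * ?f t)) = integral {0..1} (\<lambda>t. q t * (h t * (y t - ?f t)))"
    if "continuous_on {0..1} h" for h
    using i[OF y that] i[OF free_continuous that] by (simp add: integral_diff[symmetric] algebra_simps)
  note d = this[OF cs(1)] this[OF cs(2)]
  have e: "Q * (M * exp (\<bar>Im \<rho>\<bar> * 1)) = 2 * Q\<^sup>2 * N / cmod \<rho> * exp \<bar>Im \<rho>\<bar>" by (simp add: M_def power2_eq_square)
  note pt = perturbation_terms[OF c M M0, of 1, unfolded e]
  show "cmod (\<rho> * y 1 - \<rho> * (y 0 * cos \<rho>) - v 0 * sin \<rho> - integral {0..1} (\<lambda>t. q t * (sin (\<rho> * of_real (1 - t)) * ?f t))) \<le> 2 * Q\<^sup>2 * N / cmod \<rho> * exp \<bar>Im \<rho>\<bar>"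
    using pt(1) d(1) variation_of_constants(1)[OF s, of 1] by simp
  show "cmod (v 1 + \<rho> * y 0 * sin \<rho> - v 0 * cos \<rho> - integral {0..1} (\<lambda>t. q t * (cos (\<rho> * of_real (1 - t)) * ?f t))) \<le> 2 * Q\<^sup>2 * N / cmod \<rho> * exp \<bar>Im \<rho>\<bar>"
    using pt(2) d(2) variation_of_constants(2)[OF s, of 1] by simp
qed

end

locale bvp0 = bvp +
  assumes mean: "integral {0..1} q = 0"
begin

definition sinI :: "complex \<Rightarrow> complex" where
  "sinI \<rho> = integral {0..1} (\<lambda>t. q t * sin (\<rho> * of_real (2 * t - 1)))"

text \<open>
  Product formulas split the first order terms of \<open>s'(1)\<close> and \<open>c(1)\<close>
  into \<open>sin \<rho> \<integral> q = 0\<close> and integrals of \<open>q\<close> against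
  \<open>sin (\<rho>(2t - 1))\<close>, which enter with the factors \<open>1\<close> and
  \<open>-1\<close>; hence the weight \<open>1 - \<alpha>\<close>.
\<close>

lemma \<Delta>_asymptotics:
  assumes \<rho>: "2 * Q + 1 \<le> cmod \<rho>"
  shows "cmod (\<Delta> (\<rho>\<^sup>2) - (1 + \<alpha>) * (1 + cos \<rho>) - (1 - \<alpha>) / (2 * \<rho>) * sinI \<rho>) \<le> 2 * Q\<^sup>2 * (1 + cmod \<alpha>) * exp \<bar>Im \<rho>\<bar> / (cmod \<rho>)\<^sup>2"
proof -
  have \<rho>0: "0 < cmod \<rho>" "\<rho> \<noteq> 0" using \<rho> Q_nonneg by auto
  let ?e = "2 * Q\<^sup>2 / cmod \<rho> * exp \<bar>Im \<rho>\<bar>"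
  let ?S = "\<lambda>t. sin (\<rho> * of_real (1 - t)) * cos (\<rho> * of_real t)"
  let ?C = "\<lambda>t. cos (\<rho> * of_real (1 - t)) * sin (\<rho> * of_real t)"
  have 1: "cmod (\<rho> * ych (\<rho>\<^sup>2) 1 0 0 1 - \<rho> * cos \<rho> - integral {0..1} (\<lambda>t. q t * ?S t)) \<le> ?e"
    using second_order(1)[OF sol_sys[of "\<rho>\<^sup>2" 1 0] \<rho>, of 1] by (simp add: chain_sys free_def)
  have 2: "cmod (\<rho> * vch (\<rho>\<^sup>2) 0 1 0 1 - \<rho> * cos \<rho> - integral {0..1} (\<lambda>t. q t * ?C t)) \<le> ?e"
  proof -
    have "cmod (vch (\<rho>\<^sup>2) 0 1 0 1 - cos \<rho> - integral {0..1} (\<lambda>t. q t * (cos (\<rho> * of_real (1 - t)) * free \<rho> 0 1 t))) \<le> 2 * Q\<^sup>2 * (1 / cmod \<rho>) / cmod \<rho> * exp \<bar>Im \<rho>\<bar>"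
      using second_order(2)[OF sol_sys[of "\<rho>\<^sup>2" 0 1] \<rho>, of "1 / cmod \<rho>"] by (simp add: chain_sys)
    moreover have "integral {0..1} (\<lambda>t. q t * (cos (\<rho> * of_real (1 - t)) * free \<rho> 0 1 t)) = integral {0..1} (\<lambda>t. q t * ?C t) / \<rho>"
      unfolding integral_divide[symmetric] by (intro integral_cong) (simp add: free_def)
    ultimately have "cmod \<rho> * cmod (vch (\<rho>\<^sup>2) 0 1 0 1 - cos \<rho> - integral {0..1} (\<lambda>t. q t * ?C t) / \<rho>) \<le> cmod \<rho> * (2 * Q\<^sup>2 * (1 / cmod \<rho>) / cmod \<rho> * exp \<bar>Im \<rho>\<bar>)"
      by (intro mult_left_mono) auto
    also have "cmod \<rho> * (2 * Q\<^sup>2 * (1 / cmod \<rho>) / cmod \<rho> * exp \<bar>Im \<rho>\<bar>) = ?e" using \<rho>0 by simp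
    also have "cmod \<rho> * cmod (vch (\<rho>\<^sup>2) 0 1 0 1 - cos \<rho> - integral {0..1} (\<lambda>t. q t * ?C t) / \<rho>) = cmod (\<rho> * vch (\<rho>\<^sup>2) 0 1 0 1 - \<rho> * cos \<rho> - integral {0..1} (\<lambda>t. q t * ?C t))"
      unfolding norm_mult[symmetric] using \<rho>0 by (simp add: algebra_simps)
    finally show ?thesis .
  qed
  have qi: "(\<lambda>t. q t * g t) integrable_on {0..1}" if "continuous_on {0..1} g" for g
    using absint_integrable_on[OF absint_mult_continuous(1)[OF q_absint that], of 0 1] by simp
  have SC: "\<alpha> * integral {0..1} (\<lambda>t. q t * ?S t) + integral {0..1} (\<lambda>t. q t * ?C t) = (1 - \<alpha>) / 2 * sinI \<rho>"
  proof -
    have sum: "?S t + ?C t = sin \<rho>" and dif: "?C t - ?S t = sin (\<rho> * of_real (2 * t - 1))" for t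
    proof -
      have "\<rho> * of_real (1 - t) + \<rho> * of_real t = \<rho>" by (simp add: algebra_simps)
      then show "?S t + ?C t = sin \<rho>" using sin_add[of "\<rho> * of_real (1 - t)" "\<rho> * of_real t"] by simp
      have "\<rho> * of_real t - \<rho> * of_real (1 - t) = \<rho> * of_real (2 * t - 1)" by (simp add: algebra_simps)
      then show "?C t - ?S t = sin (\<rho> * of_real (2 * t - 1))"
        using sin_diff[of "\<rho> * of_real t" "\<rho> * of_real (1 - t)"] by (simp add: mult.commute)
    qed
    have e: "\<alpha> * (q t * ?S t) + q t * ?C t = (1 + \<alpha>) / 2 * sin \<rho> * q t + (1 - \<alpha>) / 2 * (q t * sin (\<rho> * of_real (2 * t - 1)))" for t
      unfolding sum[of t, symmetric] dif[of t, symmetric] by (simp add: field_simps)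
    have "\<alpha> * integral {0..1} (\<lambda>t. q t * ?S t) + integral {0..1} (\<lambda>t. q t * ?C t) = integral {0..1} (\<lambda>t. \<alpha> * (q t * ?S t) + q t * ?C t)"
      by (subst integral_add) (auto intro!: integrable_on_mult_right qi continuous_intros)
    also have "\<dots> = integral {0..1} (\<lambda>t. (1 + \<alpha>) / 2 * sin \<rho> * q t + (1 - \<alpha>) / 2 * (q t * sin (\<rho> * of_real (2 * t - 1))))" unfolding e ..
    also have "\<dots> = (1 + \<alpha>) / 2 * sin \<rho> * integral {0..1} q + (1 - \<alpha>) / 2 * sinI \<rho>"
      unfolding sinI_def using absint_integrable_on[OF q_absint, of 0 1]
      by (subst integral_add) (auto intro!: integrable_on_mult_right qi continuous_intros)
    finally show ?thesis by (simp add: mean)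
  qed
  have "\<rho> * (\<Delta> (\<rho>\<^sup>2) - (1 + \<alpha>) * (1 + cos \<rho>) - (1 - \<alpha>) / (2 * \<rho>) * sinI \<rho>)
     = \<alpha> * (\<rho> * ych (\<rho>\<^sup>2) 1 0 0 1 - \<rho> * cos \<rho> - integral {0..1} (\<lambda>t. q t * ?S t))
       + (\<rho> * vch (\<rho>\<^sup>2) 0 1 0 1 - \<rho> * cos \<rho> - integral {0..1} (\<lambda>t. q t * ?C t))"
  proof -
    have "\<rho> * ((1 - \<alpha>) / (2 * \<rho>) * sinI \<rho>) = \<alpha> * integral {0..1} (\<lambda>t. q t * ?S t) + integral {0..1} (\<lambda>t. q t * ?C t)"
      unfolding SC using \<rho>0 by simp
    then show ?thesis unfolding \<Delta>_def by (simp add: algebra_simps)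
  qed
  then have "cmod \<rho> * cmod (\<Delta> (\<rho>\<^sup>2) - (1 + \<alpha>) * (1 + cos \<rho>) - (1 - \<alpha>) / (2 * \<rho>) * sinI \<rho>)
    = cmod (\<alpha> * (\<rho> * ych (\<rho>\<^sup>2) 1 0 0 1 - \<rho> * cos \<rho> - integral {0..1} (\<lambda>t. q t * ?S t))
       + (\<rho> * vch (\<rho>\<^sup>2) 0 1 0 1 - \<rho> * cos \<rho> - integral {0..1} (\<lambda>t. q t * ?C t)))"
    unfolding norm_mult[symmetric] by (rule arg_cong)
  also have "\<dots> \<le> cmod \<alpha> * ?e + ?e"
    using mult_left_mono[OF 1, of "cmod \<alpha>"] 2 by (intro norm_triangle_mono) (simp_all add: norm_mult)
  also have "\<dots> = cmod \<rho> * (2 * Q\<^sup>2 * (1 + cmod \<alpha>) * exp \<bar>Im \<rho>\<bar> / (cmod \<rho>)\<^sup>2)"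
    using \<rho>0 by (simp add: field_simps power2_eq_square)
  finally show ?thesis by (rule mult_left_le_imp_le) (rule \<rho>0(1))
qed

lemma sinI_bound: "cmod (sinI \<rho>) \<le> Q * exp \<bar>Im \<rho>\<bar>"
  unfolding sinI_def
proof (rule q_integral_bound)
  fix t :: real assume t: "0 \<le> t" "t \<le> 1"
  have "\<bar>Im \<rho> * (2 * t - 1)\<bar> \<le> \<bar>Im \<rho>\<bar> * 1" unfolding abs_mult using t by (intro mult_left_mono) auto
  then have "exp \<bar>Im (\<rho> * of_real (2 * t - 1))\<bar> \<le> exp \<bar>Im \<rho>\<bar>" by simp
  then show "cmod (sin (\<rho> * of_real (2 * t - 1))) \<le> exp \<bar>Im \<rho>\<bar>" using cmod_sin_le order_trans by blast
qed (auto intro!: continuous_intros)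

lemma sin_lipschitz:
  assumes "\<bar>Im z\<bar> \<le> 1" "\<bar>Im w\<bar> \<le> 1" shows "cmod (sin z - sin w) \<le> exp 1 * cmod (z - w)"
proof (rule field_differentiable_bound[of "{z. Im z \<le> 1} \<inter> {z. Im z \<ge> -1}" sin cos])
  show "convex ({z. Im z \<le> 1} \<inter> {z. Im z \<ge> -1})" by (intro convex_Int convex_halfspace_Im_le convex_halfspace_Im_ge)
  show "(sin has_field_derivative cos t) (at t within {z. Im z \<le> 1} \<inter> {z. Im z \<ge> -1})" for t :: complex
    by (rule has_field_derivative_at_within[OF DERIV_sin])
  fix t assume "t \<in> {z. Im z \<le> 1} \<inter> {z. Im z \<ge> -1}"
  then have "exp \<bar>Im t\<bar> \<le> exp 1" by auto
  then show "cmod (cos t) \<le> exp 1" using cmod_cos_le order_trans by blast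
qed (use assms in auto)

lemma sinI_lipschitz:
  assumes "\<bar>Im z\<bar> \<le> 1" "\<bar>Im w\<bar> \<le> 1" shows "cmod (sinI z - sinI w) \<le> Q * (exp 1 * cmod (z - w))"
proof -
  have qi: "(\<lambda>t. q t * sin (\<rho> * of_real (2 * t - 1))) integrable_on {0..1}" for \<rho>
    using absint_integrable_on[OF absint_mult_continuous(1)[OF q_absint, of "\<lambda>t. sin (\<rho> * of_real (2 * t - 1))"], of 0 1]
    by (simp add: continuous_intros)
  have "sinI z - sinI w = integral {0..1} (\<lambda>t. q t * (sin (z * of_real (2 * t - 1)) - sin (w * of_real (2 * t - 1))))"
    unfolding sinI_def using qi by (simp add: integral_diff[symmetric] right_diff_distrib)
  also have "cmod \<dots> \<le> Q * (exp 1 * cmod (z - w))"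
  proof (rule q_integral_bound)
    fix t :: real assume t: "0 \<le> t" "t \<le> 1"
    then have a: "\<bar>2 * t - 1\<bar> \<le> 1" by auto
    have "\<bar>Im z * (2 * t - 1)\<bar> \<le> 1" "\<bar>Im w * (2 * t - 1)\<bar> \<le> 1" using assms a by (simp_all add: abs_mult mult_le_one)
    then have "cmod (sin (z * of_real (2 * t - 1)) - sin (w * of_real (2 * t - 1))) \<le> exp 1 * cmod (z * of_real (2 * t - 1) - w * of_real (2 * t - 1))"
      by (intro sin_lipschitz) auto
    also have "cmod (z * of_real (2 * t - 1) - w * of_real (2 * t - 1)) = cmod (z - w) * \<bar>2 * t - 1\<bar>"
      unfolding left_diff_distrib[symmetric] norm_mult norm_of_real ..
    also have "\<dots> \<le> cmod (z - w) * 1" using a by (intro mult_left_mono) auto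
    finally show "cmod (sin (z * of_real (2 * t - 1)) - sin (w * of_real (2 * t - 1))) \<le> exp 1 * cmod (z - w)" by simp
  qed (auto intro!: continuous_intros)
  finally show ?thesis .
qed

lemma \<Delta>_leading:
  obtains C where "0 < C" "\<And>\<rho>. 2 * Q + 1 \<le> cmod \<rho> \<Longrightarrow> cmod (\<Delta> (\<rho>\<^sup>2) - (1 + \<alpha>) * (1 + cos \<rho>)) \<le> C * exp \<bar>Im \<rho>\<bar> / cmod \<rho>"
proof -
  define C where "C = (1 + cmod \<alpha>) * (Q + 2 * Q\<^sup>2) + 1"
  show ?thesis
  proof (rule that[of C])
    show "0 < C" using Q_nonneg by (simp add: C_def add_nonneg_pos)
    fix \<rho> assume \<rho>: "2 * Q + 1 \<le> cmod \<rho>"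
    then have \<rho>1: "1 \<le> cmod \<rho>" using Q_nonneg by simp
    let ?E = "exp \<bar>Im \<rho>\<bar>"
    have "cmod ((1 - \<alpha>) / (2 * \<rho>) * sinI \<rho>) \<le> (1 + cmod \<alpha>) / cmod \<rho> * (Q * ?E)"
    proof -
      have "cmod (1 - \<alpha>) \<le> 1 + cmod \<alpha>" by (metis norm_one norm_triangle_ineq4)
      then have "cmod ((1 - \<alpha>) / (2 * \<rho>)) \<le> (1 + cmod \<alpha>) / cmod \<rho>" unfolding norm_divide norm_mult using \<rho>1
        by (intro frac_le) auto
      then show ?thesis unfolding norm_mult[of _ "sinI \<rho>"] using sinI_bound Q_nonneg by (intro mult_mono) auto
    qed
    moreover have "2 * Q\<^sup>2 * (1 + cmod \<alpha>) * ?E / (cmod \<rho>)\<^sup>2 \<le> 2 * Q\<^sup>2 * (1 + cmod \<alpha>) * ?E / cmod \<rho>"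
    proof (rule divide_left_mono)
      show "cmod \<rho> \<le> (cmod \<rho>)\<^sup>2" using self_le_power[OF \<rho>1, of 2] by simp
      show "0 < (cmod \<rho>)\<^sup>2 * cmod \<rho>" using \<rho>1 by (intro mult_pos_pos zero_less_power) auto
    qed auto
    ultimately have "cmod (\<Delta> (\<rho>\<^sup>2) - (1 + \<alpha>) * (1 + cos \<rho>)) \<le> (1 + cmod \<alpha>) / cmod \<rho> * (Q * ?E) + 2 * Q\<^sup>2 * (1 + cmod \<alpha>) * ?E / cmod \<rho>"
      using \<Delta>_asymptotics[OF \<rho>] norm_triangle_sub[of "\<Delta> (\<rho>\<^sup>2) - (1 + \<alpha>) * (1 + cos \<rho>)" "(1 - \<alpha>) / (2 * \<rho>) * sinI \<rho>"] by linarith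
    also have "\<dots> = (C - 1) * ?E / cmod \<rho>" by (simp add: C_def algebra_simps add_divide_distrib)
    also have "\<dots> \<le> C * ?E / cmod \<rho>" by (intro divide_right_mono mult_right_mono) auto
    finally show "cmod (\<Delta> (\<rho>\<^sup>2) - (1 + \<alpha>) * (1 + cos \<rho>)) \<le> C * ?E / cmod \<rho>" .
  qed
qed

end

section \<open>Counting zeros by Rouche's theorem\<close>

lemma entire_finite_zeros:
  fixes f :: "complex \<Rightarrow> complex"
  assumes "f holomorphic_on UNIV" "f z0 \<noteq> 0"
  shows "finite {z \<in> cball 0 R. f z = 0}"
proof (cases "\<exists>z. f z = 0")
  case True
  then have "\<not> f constant_on UNIV" using assms(2) unfolding constant_on_def by (metis UNIV_I)
  then show ?thesis using assms(1) by (intro holomorphic_compact_finite_zeros[of f UNIV]) auto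
qed simp

text \<open>Rouche's theorem counts with winding numbers; on a circle these are 1 for the enclosed zeros.\<close>

lemma rouche_disc:
  fixes f g :: "complex \<Rightarrow> complex"
  assumes f: "f holomorphic_on UNIV" and g: "g holomorphic_on UNIV" and R: "0 < R"
    and less: "\<And>z. cmod z = R \<Longrightarrow> cmod (g z - f z) < cmod (f z)"
  shows "(\<Sum>p\<in>{p\<in>ball 0 R. g p = 0}. zorder g p) = (\<Sum>p\<in>{p\<in>ball 0 R. f p = 0}. zorder f p)"
proof -
  let ?s = "ball 0 (R + 1) :: complex set"
  have nz: "f (of_real R) \<noteq> 0" "g (of_real R) \<noteq> 0" using less[of "of_real R"] R by auto
  have fin: "finite {p \<in> ?s. h p = 0}" if "h holomorphic_on UNIV" "h (of_real R) \<noteq> 0" for h :: "complex \<Rightarrow> complex"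
    by (rule finite_subset[OF _ entire_finite_zeros[OF that, of "R + 1"]]) auto
  have eq: "(\<lambda>p. f p + (g p - f p)) = g" by auto
  have "(\<Sum>p\<in>{p\<in>?s. f p + (g p - f p) = 0}. winding_number (circlepath 0 R) p * zorder (\<lambda>p. f p + (g p - f p)) p)
      = (\<Sum>p\<in>{p\<in>?s. f p = 0}. winding_number (circlepath 0 R) p * zorder f p)"
  proof (rule Rouche_theorem)
    show "finite {p \<in> ?s. f p + (g p - f p) = 0}" using fin[OF g nz(2)] by simp
    show "finite {p \<in> ?s. f p = 0}" by (rule fin[OF f nz(1)])
    show "f holomorphic_on ?s" "(\<lambda>p. g p - f p) holomorphic_on ?s"
      using holomorphic_on_subset[OF f] holomorphic_on_subset[OF g] by (auto intro: holomorphic_on_diff)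
    show "path_image (circlepath 0 R) \<subseteq> ?s" using R by auto
    show "\<forall>z\<in>path_image (circlepath 0 R). cmod (g z - f z) < cmod (f z)" using R less by auto
    show "\<forall>z. z \<notin> ?s \<longrightarrow> winding_number (circlepath 0 R) z = 0"
      using R by (auto intro!: winding_number_zero_outside[of _ "cball 0 R"])
  qed auto
  then have main: "(\<Sum>p\<in>{p\<in>?s. g p = 0}. winding_number (circlepath 0 R) p * zorder g p)
      = (\<Sum>p\<in>{p\<in>?s. f p = 0}. winding_number (circlepath 0 R) p * zorder f p)" unfolding eq by simp
  have red: "(\<Sum>p\<in>{p\<in>?s. h p = 0}. winding_number (circlepath 0 R) p * zorder h p) = of_int (\<Sum>p\<in>{p\<in>ball 0 R. h p = 0}. zorder h p)"
    if h: "h holomorphic_on UNIV" "h (of_real R) \<noteq> 0" and nzs: "\<And>z. cmod z = R \<Longrightarrow> h z \<noteq> 0" for h :: "complex \<Rightarrow> complex"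
  proof -
    have "(\<Sum>p\<in>{p\<in>?s. h p = 0}. winding_number (circlepath 0 R) p * zorder h p) = (\<Sum>p\<in>{p\<in>ball 0 R. h p = 0}. winding_number (circlepath 0 R) p * zorder h p)"
    proof (rule sum.mono_neutral_right[OF fin[OF h]])
      show "{p \<in> ball 0 R. h p = 0} \<subseteq> {p \<in> ?s. h p = 0}" by auto
      show "\<forall>i\<in>{p \<in> ?s. h p = 0} - {p \<in> ball 0 R. h p = 0}. winding_number (circlepath 0 R) i * zorder h i = 0"
      proof
        fix p assume p: "p \<in> {p \<in> ?s. h p = 0} - {p \<in> ball 0 R. h p = 0}"
        then have "p \<notin> cball 0 R" using nzs[of p] by auto
        then have "winding_number (circlepath 0 R) p = 0"
          using R by (intro winding_number_zero_outside[of _ "cball 0 R"]) auto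
        then show "winding_number (circlepath 0 R) p * zorder h p = 0" by simp
      qed
    qed
    also have "\<dots> = (\<Sum>p\<in>{p\<in>ball 0 R. h p = 0}. of_int (zorder h p))"
      by (intro sum.cong refl) (auto simp: winding_number_circlepath)
    finally show ?thesis by simp
  qed
  have "of_int (\<Sum>p\<in>{p\<in>ball 0 R. g p = 0}. zorder g p) = (of_int (\<Sum>p\<in>{p\<in>ball 0 R. f p = 0}. zorder f p) :: complex)"
    using main red[OF f nz(1)] red[OF g nz(2)] less by fastforce
  then show ?thesis by (simp only: of_int_eq_iff)
qed

text \<open>\<open>2 (1 + cos \<rho>) = exp (-i\<rho>) (1 + exp (i\<rho>))\<^sup>2\<close>.\<close>

lemma cos_plus_one_factor:
  assumes "0 \<le> Im \<rho>"
  shows "cmod (1 + cos \<rho>) = exp \<bar>Im \<rho>\<bar> * (cmod (1 + exp (\<i> * \<rho>)))\<^sup>2 / 2"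
proof -
  have "1 + cos \<rho> = (1 + exp (\<i> * \<rho>))\<^sup>2 * exp (- (\<i> * \<rho>)) / 2"
    unfolding cos_exp_eq by (simp add: power2_eq_square algebra_simps exp_minus field_simps flip: exp_add)
  then have "cmod (1 + cos \<rho>) = cmod ((1 + exp (\<i> * \<rho>))\<^sup>2 * exp (- (\<i> * \<rho>)) / 2)" by (rule arg_cong)
  also have "\<dots> = exp \<bar>Im \<rho>\<bar> * (cmod (1 + exp (\<i> * \<rho>)))\<^sup>2 / 2" using assms by (simp add: norm_mult norm_divide norm_power)
  finally show ?thesis .
qed

lemma upper_representative: "\<exists>\<rho>'. (\<rho>' = \<rho> \<or> \<rho>' = - \<rho>) \<and> 0 \<le> Im \<rho>'"
  by (cases "0 \<le> Im \<rho>") (auto intro: exI[of _ "- \<rho>"])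

text \<open>
  On these circles either the imaginary part is at least 1 and \<open>exp (i\<rho>)\<close> is
  small, or \<open>\<rho>\<close> lies within distance 1 of a multiple of \<open>2\<pi>\<close> in
  real part and \<open>exp (i\<rho>)\<close> has nonnegative real part.
\<close>

lemma cos_plus_one_lower:
  assumes N: "1 \<le> N" and \<rho>: "cmod \<rho> = 2 * pi * real N"
  shows "exp \<bar>Im \<rho>\<bar> / 8 \<le> cmod (1 + cos \<rho>)"
proof -
  obtain \<rho>' where r: "\<rho>' = \<rho> \<or> \<rho>' = - \<rho>" "0 \<le> Im \<rho>'" using upper_representative by blast
  have same: "cos \<rho>' = cos \<rho>" "\<bar>Im \<rho>'\<bar> = \<bar>Im \<rho>\<bar>" "cmod \<rho>' = 2 * pi * real N" using r \<rho> by auto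
  define \<xi> \<tau> where "\<xi> = Re \<rho>'" and "\<tau> = Im \<rho>'"
  have \<tau>0: "0 \<le> \<tau>" using r by (simp add: \<tau>_def)
  let ?w = "exp (\<i> * \<rho>')"
  have nw: "cmod ?w = exp (- \<tau>)" by (simp add: \<tau>_def)
  have "1 / 2 \<le> cmod (1 + ?w)"
  proof (cases "1 \<le> \<tau>")
    case True
    have "exp (- \<tau>) \<le> exp (- 1)" using True by simp
    also have "exp (- 1 :: real) \<le> 1 / 2" using exp_ge_add_one_self[of 1] by (simp add: exp_minus field_simps)
    finally have "cmod ?w \<le> 1 / 2" using nw by simp
    then show ?thesis using norm_triangle_ineq2[of 1 "- ?w"] by simp
  next
    case False
    define X where "X = 2 * pi * real N"
    have X: "6 \<le> X" using N pi_gt3 mult_mono[of 3 pi 1 "real N"] by (simp add: X_def)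
    have "\<xi>\<^sup>2 + \<tau>\<^sup>2 = X\<^sup>2" using same(3) cmod_power2[of \<rho>'] by (simp add: X_def \<xi>_def \<tau>_def)
    then have prod: "(X - \<bar>\<xi>\<bar>) * (X + \<bar>\<xi>\<bar>) = \<tau>\<^sup>2" by (simp add: algebra_simps power2_eq_square)
    have "\<tau>\<^sup>2 \<le> 1" using False \<tau>0 by (simp add: power_le_one)
    have d0: "0 \<le> X - \<bar>\<xi>\<bar>" using abs_Re_le_cmod[of \<rho>'] same(3) by (simp add: X_def \<xi>_def)
    then have "(X - \<bar>\<xi>\<bar>) * 6 \<le> (X - \<bar>\<xi>\<bar>) * (X + \<bar>\<xi>\<bar>)" using X by (intro mult_left_mono) auto
    then have "(X - \<bar>\<xi>\<bar>) * 6 \<le> 1" unfolding prod using \<open>\<tau>\<^sup>2 \<le> 1\<close> by linarith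
    moreover have "u \<le> 1" if "u * 6 \<le> 1" for u :: real using that by linarith
    ultimately have d1: "X - \<bar>\<xi>\<bar> \<le> 1" by blast
    have "cos \<xi> = cos \<bar>\<xi>\<bar>" by (simp add: abs_if)
    also have "\<dots> = cos (X - (X - \<bar>\<xi>\<bar>))" by simp
    also have "\<dots> = cos (X - \<bar>\<xi>\<bar>)"
      unfolding cos_diff X_def using cos_int_times_real[of "int N" "2 * pi"] cos_2npi[of N] sin_2npi[of N] by (simp add: mult_ac)
    also have "\<dots> \<ge> 0" using d0 d1 pi_gt3 by (intro cos_ge_zero) auto
    finally have c: "0 \<le> cos \<xi>" .
    have "Re (1 + ?w) = 1 + exp (- \<tau>) * cos \<xi>" by (simp add: Re_exp \<xi>_def \<tau>_def)
    then have "1 \<le> Re (1 + ?w)" using c by simp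
    then show ?thesis using complex_Re_le_cmod[of "1 + ?w"] by linarith
  qed
  then have "(1 / 2)\<^sup>2 \<le> (cmod (1 + ?w))\<^sup>2" by (intro power_mono) auto
  then have "exp \<bar>Im \<rho>'\<bar> * (1 / 4) \<le> exp \<bar>Im \<rho>'\<bar> * (cmod (1 + ?w))\<^sup>2" by (intro mult_left_mono) (auto simp: power2_eq_square)
  then show ?thesis using cos_plus_one_factor[OF r(2)] unfolding same(1,2) by linarith
qed

text \<open>
  A small \<open>1 + exp (i\<rho>)\<close> puts \<open>i\<rho>\<close> near a logarithm of
  \<open>-1\<close>.
\<close>

lemma cos_plus_one_small:
  assumes s: "cmod (1 + cos \<rho>) \<le> exp \<bar>Im \<rho>\<bar> * \<epsilon>\<^sup>2 / 2" and \<epsilon>: "0 \<le> \<epsilon>" "\<epsilon> < 1 / 2"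
  obtains m :: int where "cmod (\<rho> - of_real ((2 * of_int m + 1) * pi)) \<le> 2 * \<epsilon>"
proof -
  obtain \<rho>' where r: "\<rho>' = \<rho> \<or> \<rho>' = - \<rho>" "0 \<le> Im \<rho>'" using upper_representative by blast
  have same: "cos \<rho>' = cos \<rho>" "\<bar>Im \<rho>'\<bar> = \<bar>Im \<rho>\<bar>" using r by auto
  let ?w = "exp (\<i> * \<rho>')"
  have "exp \<bar>Im \<rho>\<bar> * (cmod (1 + ?w))\<^sup>2 \<le> exp \<bar>Im \<rho>\<bar> * \<epsilon>\<^sup>2"
    using s cos_plus_one_factor[OF r(2)] same by simp
  then have "(cmod (1 + ?w))\<^sup>2 \<le> \<epsilon>\<^sup>2" by simp
  then have w: "cmod (1 + ?w) \<le> \<epsilon>" using \<epsilon> power2_le_imp_le by blast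
  define z where "z = - (1 + ?w)"
  have z: "cmod z \<le> \<epsilon>" unfolding z_def norm_minus_cancel by (rule w)
  have z1: "1 + z = - ?w" by (simp add: z_def)
  \<comment> \<open>\<open>1 + z = -exp (i\<rho>')\<close> is close to 1, so its principal logarithm is small.\<close>
  define L where "L = Ln (1 + z)"
  have L: "cmod L \<le> 2 * \<epsilon>" using norm_Ln_le[of z] z \<epsilon> by (simp add: L_def)
  have "1 + z \<noteq> 0" unfolding z1 by simp
  then have "exp L = - ?w" using exp_Ln[of "1 + z"] z1 by (simp add: L_def)
  also have "- ?w = exp (\<i> * \<rho>' + of_real pi * \<i>)" by (simp add: exp_add)
  finally obtain k :: int where k: "L = \<i> * \<rho>' + of_real pi * \<i> + of_real (of_int (2 * k) * pi) * \<i>"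
    unfolding exp_eq by blast
  have "- \<i> * L = \<rho>' + of_real ((2 * of_int k + 1) * pi)" unfolding k by (simp add: algebra_simps)
  moreover have "cmod (- \<i> * L) = cmod L" by (simp add: norm_mult)
  ultimately have d: "cmod (\<rho>' + of_real ((2 * of_int k + 1) * pi)) \<le> 2 * \<epsilon>" using L by simp
  show ?thesis
  proof (cases "\<rho>' = \<rho>")
    case True
    have "- of_real ((2 * of_int k + 1) * pi) = (of_real ((2 * of_int (- k - 1) + 1) * pi) :: complex)" by (simp add: algebra_simps)
    then show ?thesis using d True that[of "- k - 1"] by (metis diff_minus_eq_add minus_minus)
  next
    case False
    then have "\<rho>' = - \<rho>" using r by blast
    then have "\<rho>' + of_real ((2 * of_int k + 1) * pi) = - (\<rho> - of_real ((2 * of_int k + 1) * pi))" by simp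
    then show ?thesis using d that[of k] by (metis norm_minus_cancel)
  qed
qed

text \<open>The modulus determines \<open>m\<close> up to sign, and the real part fixes the sign.\<close>

lemma odd_pi_unique:
  assumes \<rho>: "2 * pi * real n < cmod \<rho>" "cmod \<rho> < 2 * pi * real (n + 1)" "0 \<le> Re \<rho>"
    and m: "cmod (\<rho> - of_real ((2 * of_int m + 1) * pi)) \<le> 1"
  shows "m = int n"
proof -
  have "Re \<rho> - (2 * of_int m + 1) * pi \<le> 1" "- 1 \<le> Re \<rho> - (2 * of_int m + 1) * pi"
    using abs_Re_le_cmod[of "\<rho> - of_real ((2 * of_int m + 1) * pi)"] m by auto
  then have "-1 \<le> (2 * of_int m + 1) * pi" using \<rho>(3) by linarith
  then have "(- 1) * pi < (2 * of_int m + 1) * pi" using pi_gt3 by linarith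
  then have "(- 1 :: real) < 2 * of_int m + 1" by (subst (asm) mult_less_cancel_right_pos) auto
  then have m0: "0 \<le> m" by linarith
  have "\<bar>cmod \<rho> - cmod (of_real ((2 * of_int m + 1) * pi) :: complex)\<bar> \<le> 1"
    using m norm_triangle_ineq3[of \<rho> "of_real ((2 * of_int m + 1) * pi)"] by linarith
  moreover have "cmod (of_real ((2 * of_int m + 1) * pi) :: complex) = (2 * of_int m + 1) * pi"
    unfolding norm_of_real using m0 by simp
  ultimately have "\<bar>cmod \<rho> - (2 * of_int m + 1) * pi\<bar> \<le> 1" by simp
  then have a: "(2 * of_int m + 1) * pi < 2 * pi * real (n + 1) + pi" "2 * pi * real n - pi < (2 * of_int m + 1) * pi"
    using \<rho>(1,2) pi_gt3 by linarith+
  have "(2 * of_int m + 1) * pi < (2 * real n + 3) * pi" using a(1) by (simp add: algebra_simps)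
  then have 1: "2 * of_int m + 1 < 2 * real n + 3" by (subst (asm) mult_less_cancel_right_pos) auto
  have "(2 * real n - 1) * pi < (2 * of_int m + 1) * pi" using a(2) by (simp add: algebra_simps)
  then have 2: "2 * real n - 1 < 2 * of_int m + 1" by (subst (asm) mult_less_cancel_right_pos) auto
  show ?thesis using 1 2 by linarith
qed

context bvp0 begin

text \<open>
  Radii of circles on which \<open>1 + cos \<surd>\<mu>\<close> is bounded below by a multiple of
  its natural size.
\<close>

definition rad :: "nat \<Rightarrow> real" where "rad N = (2 * pi * real N)\<^sup>2"

lemma unperturbed_zero: "bvp0 (\<lambda>_. 0) \<alpha>"
  by unfold_locales (use alpha in auto)

text \<open>The characteristic function of the zero potential.\<close>

definition \<Delta>0 :: "complex \<Rightarrow> complex" where "\<Delta>0 = bvp.\<Delta> (\<lambda>_. 0) \<alpha>"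

lemma \<Delta>0_holomorphic: "\<Delta>0 holomorphic_on A"
proof -
  interpret Z: bvp0 "\<lambda>_. 0" \<alpha> by (rule unperturbed_zero)
  show ?thesis unfolding \<Delta>0_def by (rule Z.\<Delta>_holomorphic)
qed

lemma \<Delta>0_square: "\<Delta>0 (\<rho>\<^sup>2) = (1 + \<alpha>) * (1 + cos \<rho>)"
proof -
  interpret Z: bvp0 "\<lambda>_. 0" \<alpha> by (rule unperturbed_zero)
  have Q0: "Z.Q = 0" by (simp add: Z.Q_def)
  have s0: "Z.sinI \<rho> = 0" for \<rho> by (simp add: Z.sinI_def)
  have big: "\<Delta>0 (\<rho>\<^sup>2) - (1 + \<alpha>) * (1 + cos \<rho>) = 0" if "1 \<le> cmod \<rho>" for \<rho>
    using Z.\<Delta>_asymptotics[of \<rho>] that by (simp add: Q0 s0 \<Delta>0_def)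
  have hol: "(\<lambda>\<rho>. \<Delta>0 (\<rho>\<^sup>2) - (1 + \<alpha>) * (1 + cos \<rho>)) holomorphic_on UNIV"
    by (intro holomorphic_intros holomorphic_on_compose_gen[OF _ \<Delta>0_holomorphic[of UNIV], unfolded o_def]) auto
  have "\<Delta>0 (\<rho>\<^sup>2) - (1 + \<alpha>) * (1 + cos \<rho>) = 0"
  proof (rule analytic_continuation[OF hol, of "{z. 1 \<le> cmod z}" 2])
    show "(2::complex) islimpt {z. 1 \<le> cmod z}"
    proof (rule islimpt_subset[OF interior_limit_point[of 2 "{z. 1 \<le> cmod z}"]])
      have "ball 2 1 \<subseteq> {z::complex. 1 \<le> cmod z}"
      proof
        fix z :: complex assume "z \<in> ball 2 1"
        then show "z \<in> {z. 1 \<le> cmod z}" using norm_triangle_ineq2[of 2 "2 - z"] by (simp add: dist_norm)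
      qed
      then show "(2::complex) \<in> interior {z. 1 \<le> cmod z}" unfolding mem_interior by (intro exI[of _ 1]) simp
    qed simp
  qed (use big in auto)
  then show ?thesis by simp
qed

text \<open>
  Differentiate \<open>\<Delta>0 (\<rho>\<^sup>2) = (1 + \<alpha>) (1 + cos \<rho>)\<close> twice
  at a zero \<open>\<rho> \<noteq> 0\<close> of the right-hand side.
\<close>

lemma \<Delta>0_zorder: "zorder \<Delta>0 (of_real (((2 * real n + 1) * pi)\<^sup>2)) = 2"
proof (rule zorder_zero_eqI[OF \<Delta>0_holomorphic open_UNIV UNIV_I])
  define \<rho>0 :: complex where "\<rho>0 = of_real ((2 * real n + 1) * pi)"
  have e: "of_real (((2 * real n + 1) * pi)\<^sup>2) = \<rho>0\<^sup>2" by (simp add: \<rho>0_def)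
  have "0 < (2 * real n + 1) * pi" by simp
  then have \<rho>0: "\<rho>0 \<noteq> 0" unfolding \<rho>0_def of_real_eq_0_iff by linarith
  have sc: "sin \<rho>0 = 0" "cos \<rho>0 = -1"
  proof -
    have "sin ((2 * real n + 1) * pi) = 0" using sin_npi[of "2 * n + 1"] by (simp add: mult.commute add.commute)
    then show "sin \<rho>0 = 0" unfolding \<rho>0_def sin_of_real by simp
    have "cos ((2 * real n + 1) * pi) = -1" using cos_npi[of "2 * n + 1"] by (simp add: mult.commute add.commute)
    then show "cos \<rho>0 = -1" unfolding \<rho>0_def cos_of_real by simp
  qed
  have D: "(\<Delta>0 has_field_derivative deriv \<Delta>0 z) (at z)" for z
    using holomorphic_derivI[OF \<Delta>0_holomorphic open_UNIV UNIV_I] .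
  have DD: "(deriv \<Delta>0 has_field_derivative deriv (deriv \<Delta>0) z) (at z)" for z
    using holomorphic_derivI[OF holomorphic_deriv[OF \<Delta>0_holomorphic open_UNIV] open_UNIV UNIV_I] .
  have 1: "2 * \<rho> * deriv \<Delta>0 (\<rho>\<^sup>2) = - (1 + \<alpha>) * sin \<rho>" for \<rho>
  proof (rule DERIV_unique)
    show "((\<lambda>\<rho>. \<Delta>0 (\<rho>\<^sup>2)) has_field_derivative 2 * \<rho> * deriv \<Delta>0 (\<rho>\<^sup>2)) (at \<rho>)"
      by (rule DERIV_cong[OF DERIV_chain2[OF D]]) (auto intro!: derivative_eq_intros)
    show "((\<lambda>\<rho>. \<Delta>0 (\<rho>\<^sup>2)) has_field_derivative - (1 + \<alpha>) * sin \<rho>) (at \<rho>)"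
      unfolding \<Delta>0_square by (auto intro!: derivative_eq_intros simp: algebra_simps)
  qed
  have 2: "2 * deriv \<Delta>0 (\<rho>\<^sup>2) + 2 * \<rho> * (2 * \<rho> * deriv (deriv \<Delta>0) (\<rho>\<^sup>2)) = - (1 + \<alpha>) * cos \<rho>" for \<rho>
  proof (rule DERIV_unique)
    have "((\<lambda>\<rho>. deriv \<Delta>0 (\<rho>\<^sup>2)) has_field_derivative 2 * \<rho> * deriv (deriv \<Delta>0) (\<rho>\<^sup>2)) (at \<rho>)"
      by (rule DERIV_cong[OF DERIV_chain2[OF DD]]) (auto intro!: derivative_eq_intros)
    from DERIV_mult[OF DERIV_cmult[OF DERIV_ident, of 2] this]
    show "((\<lambda>\<rho>. 2 * \<rho> * deriv \<Delta>0 (\<rho>\<^sup>2)) has_field_derivative 2 * deriv \<Delta>0 (\<rho>\<^sup>2) + 2 * \<rho> * (2 * \<rho> * deriv (deriv \<Delta>0) (\<rho>\<^sup>2))) (at \<rho>)"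
      by (simp add: algebra_simps)
    show "((\<lambda>\<rho>. 2 * \<rho> * deriv \<Delta>0 (\<rho>\<^sup>2)) has_field_derivative - (1 + \<alpha>) * cos \<rho>) (at \<rho>)"
      unfolding 1 by (auto intro!: derivative_eq_intros)
  qed
  have d0: "\<Delta>0 (\<rho>0\<^sup>2) = 0" "deriv \<Delta>0 (\<rho>0\<^sup>2) = 0" using \<Delta>0_square[of \<rho>0] 1[of \<rho>0] sc \<rho>0 by auto
  have a1: "1 + \<alpha> \<noteq> 0" using alpha by (metis add.commute add_eq_0_iff)
  have d2: "deriv (deriv \<Delta>0) (\<rho>0\<^sup>2) \<noteq> 0" using 2[of \<rho>0] d0 sc a1 by (auto simp: add.commute[of \<alpha> 1])
  show "(deriv ^^ i) \<Delta>0 (of_real (((2 * real n + 1) * pi)\<^sup>2)) = 0" if "i < nat 2" for i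
  proof -
    have "i = 0 \<or> i = 1" using that by auto
    then show ?thesis unfolding e using d0 by auto
  qed
  show "(deriv ^^ nat 2) \<Delta>0 (of_real (((2 * real n + 1) * pi)\<^sup>2)) \<noteq> 0"
    unfolding e using d2 by (simp add: numeral_2_eq_2)
qed simp

lemma \<Delta>0_zeros: "{p \<in> ball 0 (rad N). \<Delta>0 p = 0} = (\<lambda>n. of_real (((2 * real n + 1) * pi)\<^sup>2)) ` {..<N}"
proof (intro equalityI subsetI)
  fix p assume p: "p \<in> {p \<in> ball 0 (rad N). \<Delta>0 p = 0}"
  define \<rho> where "\<rho> = csqrt p"
  have \<rho>: "\<rho>\<^sup>2 = p" by (simp add: \<rho>_def)
  have a1: "1 + \<alpha> \<noteq> 0" using alpha by (metis add.commute add_eq_0_iff)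
  have "cos \<rho> = -1" using p \<Delta>0_square[of \<rho>] a1 by (simp add: \<rho> add_eq_0_iff)
  then have "\<rho> \<in> {z. cos z = -1}" by simp
  then obtain n :: int where n: "\<rho> = of_real (2 * of_int n * pi) + of_real pi"
    unfolding mem_Collect_eq ccos_eq_minus1 by auto
  then have n': "\<rho> = of_real ((2 * of_int n + 1) * pi)" by (simp add: algebra_simps)
  have "0 \<le> Re \<rho>" using csqrt_principal[of p] by (auto simp: \<rho>_def)
  then have "0 \<le> (2 * real_of_int n + 1) * pi" unfolding n' by simp
  then have "0 \<le> 2 * real_of_int n + 1" using zero_le_mult_iff[of "2 * real_of_int n + 1" pi] pi_gt3 by auto
  then have n0: "0 \<le> n" by linarith
  then have pn: "p = of_real (((2 * real (nat n) + 1) * pi)\<^sup>2)" using n' \<rho> by simp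
  have "cmod p = ((2 * real (nat n) + 1) * pi)\<^sup>2" unfolding pn norm_of_real by simp
  then have "((2 * real (nat n) + 1) * pi)\<^sup>2 < (2 * pi * real N)\<^sup>2" using p by (simp add: rad_def)
  then have "(2 * real (nat n) + 1) * pi < (2 * real N) * pi" using power_less_imp_less_base[of _ 2 "2 * pi * real N"] by (simp add: mult_ac)
  then have "2 * real (nat n) + 1 < 2 * real N" by (subst (asm) mult_less_cancel_right_pos) auto
  then show "p \<in> (\<lambda>n. of_real (((2 * real n + 1) * pi)\<^sup>2)) ` {..<N}" using pn by (intro image_eqI[of _ _ "nat n"]) auto
next
  fix p :: complex assume "p \<in> (\<lambda>n. of_real (((2 * real n + 1) * pi)\<^sup>2)) ` {..<N}"
  then obtain n where n: "n < N" "p = of_real (((2 * real n + 1) * pi)\<^sup>2)" by auto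
  have "cos ((2 * real n + 1) * pi) = -1" using cos_npi[of "2 * n + 1"] by (simp add: mult.commute add.commute)
  then have "cos (complex_of_real ((2 * real n + 1) * pi)) = -1" unfolding cos_of_real by simp
  then have "\<Delta>0 p = 0" unfolding n(2) of_real_power \<Delta>0_square by simp
  moreover have "((2 * real n + 1) * pi)\<^sup>2 < (2 * pi * real N)\<^sup>2"
  proof (rule power_strict_mono)
    have "(2 * real n + 1) * pi < (2 * real N) * pi" using n(1) by (intro mult_strict_right_mono) auto
    then show "(2 * real n + 1) * pi < 2 * pi * real N" by (simp add: mult_ac)
  qed auto
  then have "cmod p < rad N" unfolding n(2) norm_of_real rad_def by simp
  ultimately show "p \<in> {p \<in> ball 0 (rad N). \<Delta>0 p = 0}" by simp
qed

lemma \<Delta>0_count: "(\<Sum>p\<in>{p \<in> ball 0 (rad N). \<Delta>0 p = 0}. zorder \<Delta>0 p) = 2 * int N"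
proof -
  have "inj_on (\<lambda>n. of_real (((2 * real n + 1) * pi)\<^sup>2) :: complex) {..<N}"
  proof (rule inj_onI)
    fix m n assume "(of_real (((2 * real m + 1) * pi)\<^sup>2) :: complex) = of_real (((2 * real n + 1) * pi)\<^sup>2)"
    then have "((2 * real m + 1) * pi)\<^sup>2 = ((2 * real n + 1) * pi)\<^sup>2" by (simp only: of_real_eq_iff)
    then have "(2 * real m + 1) * pi = (2 * real n + 1) * pi" by (subst (asm) power2_eq_iff_nonneg) auto
    then show "m = n" by simp
  qed
  then show ?thesis unfolding \<Delta>0_zeros by (simp only: sum.reindex o_def \<Delta>0_zorder) simp
qed

text \<open>
  Rouche's theorem compares \<open>\<Delta>\<close> with the characteristic function of the zero
  potential, the lower bound for \<open>1 + cos\<close> dominating the perturbation on large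
  circles.
\<close>

lemma zero_count:
  obtains N0 where "1 \<le> N0" "\<And>N. N0 \<le> N \<Longrightarrow> (\<Sum>p\<in>{p \<in> ball 0 (rad N). \<Delta> p = 0}. zorder \<Delta> p) = 2 * int N"
    "\<And>N p. N0 \<le> N \<Longrightarrow> cmod p = rad N \<Longrightarrow> \<Delta> p \<noteq> 0"
proof -
  obtain C where C: "0 < C" "\<And>\<rho>. 2 * Q + 1 \<le> cmod \<rho> \<Longrightarrow> cmod (\<Delta> (\<rho>\<^sup>2) - (1 + \<alpha>) * (1 + cos \<rho>)) \<le> C * exp \<bar>Im \<rho>\<bar> / cmod \<rho>"
    using \<Delta>_leading by metis
  have a1: "1 + \<alpha> \<noteq> 0" using alpha by (metis add.commute add_eq_0_iff)
  define T where "T = max (2 * Q + 1) (8 * C / cmod (1 + \<alpha>) + 1)"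
  obtain N1 :: nat where N1: "T < real N1" using reals_Archimedean2 by blast
  define N0 where "N0 = max 1 N1"
  have less: "cmod (\<Delta> z - \<Delta>0 z) < cmod (\<Delta>0 z)" if N: "N0 \<le> N" and z: "cmod z = rad N" for N z
  proof -
    define \<rho> where "\<rho> = csqrt z"
    have \<rho>: "\<rho>\<^sup>2 = z" by (simp add: \<rho>_def)
    have "(cmod \<rho>)\<^sup>2 = (2 * pi * real N)\<^sup>2" using z \<rho> by (simp add: rad_def flip: norm_power)
    then have c: "cmod \<rho> = 2 * pi * real N" by (subst (asm) power2_eq_iff_nonneg) auto
    have "1 * real N \<le> (2 * pi) * real N" using pi_gt3 by (intro mult_right_mono) auto
    moreover have "real N1 \<le> real N" using N by (simp add: N0_def)
    ultimately have cT: "T < cmod \<rho>" using N1 unfolding c by linarith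
    moreover have "2 * Q + 1 \<le> T" by (simp add: T_def)
    ultimately have c0: "0 < cmod \<rho>" using Q_nonneg by linarith
    have "cmod (\<Delta> z - \<Delta>0 z) \<le> C * exp \<bar>Im \<rho>\<bar> / cmod \<rho>"
      using C(2)[of \<rho>] cT \<Delta>0_square[of \<rho>] by (simp add: \<rho> T_def)
    also have "\<dots> < cmod (1 + \<alpha>) * (exp \<bar>Im \<rho>\<bar> / 8)"
    proof -
      have "8 * C / cmod (1 + \<alpha>) < cmod \<rho>" using cT by (simp add: T_def)
      then have "8 * C < cmod (1 + \<alpha>) * cmod \<rho>" using a1 by (simp add: pos_divide_less_eq mult.commute)
      then have "C / cmod \<rho> < cmod (1 + \<alpha>) / 8" using c0 by (simp add: pos_divide_less_eq)
      then have "C / cmod \<rho> * exp \<bar>Im \<rho>\<bar> < cmod (1 + \<alpha>) / 8 * exp \<bar>Im \<rho>\<bar>" by (intro mult_strict_right_mono) auto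
      then show ?thesis by simp
    qed
    also have "\<dots> \<le> cmod (1 + \<alpha>) * cmod (1 + cos \<rho>)"
      using cos_plus_one_lower[of N \<rho>] c N by (intro mult_left_mono) (auto simp: N0_def)
    also have "\<dots> = cmod (\<Delta>0 z)" using \<Delta>0_square[of \<rho>] by (simp add: \<rho> norm_mult)
    finally show ?thesis .
  qed
  show ?thesis
  proof (rule that[of N0])
    show "1 \<le> N0" by (simp add: N0_def)
    fix N assume N: "N0 \<le> N"
    have "0 < rad N" using N by (simp add: rad_def N0_def)
    from rouche_disc[OF \<Delta>0_holomorphic \<Delta>_holomorphic this less[OF N]] \<Delta>0_count
    show "(\<Sum>p\<in>{p \<in> ball 0 (rad N). \<Delta> p = 0}. zorder \<Delta> p) = 2 * int N" by simp
  next
    fix N and p :: complex assume "N0 \<le> N" "cmod p = rad N"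
    from less[OF this] show "\<Delta> p \<noteq> 0" by auto
  qed
qed

text \<open>
  Otherwise \<open>\<Delta>\<close> would vanish identically, but it has no zeros on large
  circles.
\<close>

lemma F\<Delta>_nonzero: "F\<Delta> \<mu> \<noteq> 0"
proof
  assume z: "F\<Delta> \<mu> = 0"
  obtain N0 where N0: "\<And>N p. N0 \<le> N \<Longrightarrow> cmod p = rad N \<Longrightarrow> \<Delta> p \<noteq> 0" using zero_count by metis
  have "\<forall>\<^sub>F h in nhds 0. \<Delta> (\<mu> + h) = 0" using \<Delta>_fps[of \<mu>] unfolding z has_fps_expansion_def by (auto elim: eventually_mono)
  then obtain S where S: "open S" "0 \<in> S" "\<And>h. h \<in> S \<Longrightarrow> \<Delta> (\<mu> + h) = 0" unfolding eventually_nhds by blast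
  have "open ((\<lambda>h. \<mu> + h) ` S)" using S(1) by (rule open_translation)
  then have "\<Delta> p = 0" for p
    using S by (intro analytic_continuation_open[of "(\<lambda>h. \<mu> + h) ` S" UNIV \<Delta> "\<lambda>_. 0" p] \<Delta>_holomorphic) auto
  moreover have "cmod (of_real (rad N0)) = rad N0" unfolding norm_of_real by (simp add: rad_def)
  ultimately show False using N0[OF order_refl] by blast
qed

lemma alg_mult_zorder: "int (T4_alg_mult q \<alpha> \<mu>) = zorder \<Delta> \<mu>"
  using alg_mult_subdegree[OF F\<Delta>_nonzero] F\<Delta>_nonzero_zorder[OF F\<Delta>_nonzero] by simp

lemma alg_mult_pos: "\<Delta> \<mu> = 0 \<Longrightarrow> 1 \<le> T4_alg_mult q \<alpha> \<mu>"
  using alg_mult_subdegree[OF F\<Delta>_nonzero] F\<Delta>_0[of \<mu>] F\<Delta>_nonzero[of \<mu>] subdegree_eq_0_iff[of "F\<Delta> \<mu>"] by (metis One_nat_def Suc_leI gr0I)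

end

section \<open>Pairs of zeros near the unperturbed eigenvalues\<close>

text \<open>The square roots of the double eigenvalues belonging to the zero potential.\<close>

definition rn :: "nat \<Rightarrow> real" where "rn n = (2 * real n + 1) * pi"

lemma rn_pos: "0 < rn n" and rn_ge: "real n \<le> rn n"
proof -
  show "0 < rn n" by (simp add: rn_def)
  have "real n * 1 \<le> (2 * real n + 1) * pi" using pi_gt3 by (intro mult_mono) auto
  then show "real n \<le> rn n" by (simp add: rn_def)
qed

lemma sin_rn: "sin (rn n) = 0" and cos_rn: "cos (rn n) = -1"
  using sin_npi[of "2 * n + 1"] cos_npi[of "2 * n + 1"] by (simp_all add: rn_def mult.commute add.commute)

text \<open>The cubic term of the cosine series is absent, which is why the error is of order four.\<close>

lemma cos_cubic: 
  assumes "cmod z \<le> 1" shows "cmod (1 - cos z - z\<^sup>2 / 2) \<le> exp 1 * (cmod z)^4"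
proof -
  have S: "(\<Sum>k\<le>3. complex_of_real (cos_coeff k) * z ^ k) = 1 - z\<^sup>2 / 2"
  proof -
    have "cos_coeff 0 = 1" "cos_coeff 1 = 0" "cos_coeff 2 = - 1 / 2" "cos_coeff 3 = 0" by (simp_all add: cos_coeff_def)
    moreover have "{..3::nat} = {0, 1, 2, 3}" by auto
    ultimately show ?thesis by simp
  qed
  then have "cmod (cos z - (1 - z\<^sup>2 / 2)) \<le> exp \<bar>Im z\<bar> * (cmod z) ^ 4 / 6"
  proof -
    have "(fact 3 :: real) = 6" "Suc 3 = 4" by (simp_all add: fact_numeral)
    then show ?thesis using Taylor_cos[of z 3] unfolding S by simp
  qed
  also have "\<dots> \<le> exp 1 * (cmod z) ^ 4 / 1"
  proof -
    have "\<bar>Im z\<bar> \<le> 1" using abs_Im_le_cmod[of z] assms by linarith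
    then show ?thesis by (intro frac_le mult_right_mono) auto
  qed
  finally have "cmod (cos z - (1 - z\<^sup>2 / 2)) \<le> exp 1 * (cmod z) ^ 4" by simp
  moreover have "1 - cos z - z\<^sup>2 / 2 = - (cos z - (1 - z\<^sup>2 / 2))" by simp
  ultimately show ?thesis by (metis norm_minus_cancel)
qed

context bvp0 begin

abbreviation s :: "nat \<Rightarrow> complex" where "s n \<equiv> sin_coeff01 q (2 * n + 1)"

text \<open>
  \<open>sin (r\<^sub>n(2t - 1)) = sin (2 r\<^sub>n t) cos r\<^sub>n - cos (2 r\<^sub>n t) sin
  r\<^sub>n\<close>, with \<open>cos r\<^sub>n = -1\<close> and \<open>sin r\<^sub>n = 0\<close>.
\<close>

lemma sinI_rn: "sinI (of_real (rn n)) = - s n"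
proof -
  have t: "sin (complex_of_real (rn n) * of_real (2 * t - 1)) = - of_real (sin (2 * pi * real (2 * n + 1) * t))" for t
  proof -
    have e: "rn n * (2 * t - 1) = 2 * pi * real (2 * n + 1) * t - rn n" by (simp add: rn_def algebra_simps)
    have "sin (rn n * (2 * t - 1)) = - sin (2 * pi * real (2 * n + 1) * t)"
      unfolding e sin_diff cos_rn sin_rn by simp
    then show ?thesis unfolding of_real_mult[symmetric] sin_of_real by simp
  qed
  have "continuous_on {0..1} (\<lambda>x. complex_of_real (sin (2 * pi * real (2 * n + 1) * x)))" by (intro continuous_intros)
  from absint_mult_continuous(1)[OF q_absint this]
  have "s n = integral {0..1} (\<lambda>x. q x * of_real (sin (2 * pi * real (2 * n + 1) * x)))"
    unfolding sin_coeff01_def by (rule lebesgue_integral_I01)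
  then show ?thesis unfolding sinI_def t by simp
qed

lemma s_bound: "cmod (s n) \<le> Q"
  using sinI_bound[of "of_real (rn n)"] unfolding sinI_rn by simp

text \<open>
  At a zero, \<open>1 + cos \<rho>\<close> is of relative size
  \<open>O(1/\<bar>\<rho>\<bar>)\<close>; being quadratic near its zeros it localizes
  \<open>\<rho>\<close> within \<open>O(n\<^sup>-\<^sup>1\<^sup>/\<^sup>2)\<close>.
\<close>

lemma zero_localization:
  obtains K N1 where "0 < K" "\<And>n. N1 \<le> n \<Longrightarrow> K / sqrt (real n) \<le> 1" "1 \<le> N1"
    "\<And>n \<nu>. N1 \<le> n \<Longrightarrow> \<Delta> \<nu> = 0 \<Longrightarrow> rad n < cmod \<nu> \<Longrightarrow> cmod \<nu> < rad (n + 1) \<Longrightarrow>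
       \<exists>\<rho>. \<nu> = \<rho>\<^sup>2 \<and> cmod (\<rho> - of_real (rn n)) \<le> K / sqrt (real n)"
proof -
  obtain C where C: "0 < C" "\<And>\<rho>. 2 * Q + 1 \<le> cmod \<rho> \<Longrightarrow> cmod (\<Delta> (\<rho>\<^sup>2) - (1 + \<alpha>) * (1 + cos \<rho>)) \<le> C * exp \<bar>Im \<rho>\<bar> / cmod \<rho>"
    using \<Delta>_leading by metis
  have "1 + \<alpha> \<noteq> 0" using alpha by (metis add.commute add_eq_0_iff)
  then have a1: "0 < cmod (1 + \<alpha>)" by simp
  define K0 where "K0 = sqrt (2 * C / cmod (1 + \<alpha>))"
  have K0: "0 < K0" using C a1 by (simp add: K0_def)
  define N1 where "N1 = nat \<lceil>max (2 * Q + 1) (16 * K0\<^sup>2 + 1)\<rceil>"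
  have N1: "2 * Q + 1 \<le> real n" "16 * K0\<^sup>2 < real n" if "N1 \<le> n" for n using that unfolding N1_def by linarith+
  have n0: "0 < real n" if "N1 \<le> n" for n using N1(1)[OF that] Q_nonneg by linarith
  have small: "K0 / sqrt (real n) < 1 / 4" if "N1 \<le> n" for n
  proof -
    have "4 * K0 < sqrt (real n)" using N1(2)[OF that] by (intro real_less_rsqrt) (simp add: power_mult_distrib)
    then show ?thesis using n0[OF that] by (simp add: divide_simps)
  qed
  show ?thesis
  proof (rule that[of "2 * K0" N1])
    show "0 < 2 * K0" using K0 by simp
    show "2 * K0 / sqrt (real n) \<le> 1" if "N1 \<le> n" for n
    proof -
      have "2 * K0 / sqrt (real n) = 2 * (K0 / sqrt (real n))" by simp
      then show ?thesis using small[OF that] by linarith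
    qed
    show "1 \<le> N1" using n0[of N1] by simp
    fix n \<nu> assume n: "N1 \<le> n" and z: "\<Delta> \<nu> = 0" and an: "rad n < cmod \<nu>" "cmod \<nu> < rad (n + 1)"
    define \<rho> where "\<rho> = csqrt \<nu>"
    have \<rho>: "\<rho>\<^sup>2 = \<nu>" by (simp add: \<rho>_def)
    have "(2 * pi * real n)\<^sup>2 < (cmod \<rho>)\<^sup>2" "(cmod \<rho>)\<^sup>2 < (2 * pi * real (n + 1))\<^sup>2"
      using an unfolding rad_def \<rho>[symmetric] norm_power by auto
    then have c: "2 * pi * real n < cmod \<rho>" "cmod \<rho> < 2 * pi * real (n + 1)"
      using power_less_imp_less_base[of "2 * pi * real n" 2] power_less_imp_less_base[of "cmod \<rho>" 2 "2 * pi * real (n + 1)"] by auto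
    have "1 * real n \<le> (2 * pi) * real n" using pi_gt3 by (intro mult_right_mono) auto
    then have cn: "real n < cmod \<rho>" using c by linarith
    define \<epsilon> where "\<epsilon> = K0 / sqrt (real n)"
    have "cmod (1 + \<alpha>) * cmod (1 + cos \<rho>) \<le> C * exp \<bar>Im \<rho>\<bar> / cmod \<rho>"
      using C(2)[of \<rho>] cn N1(1)[OF n] by (simp add: \<rho> z norm_mult)
    also have "\<dots> \<le> C * exp \<bar>Im \<rho>\<bar> / real n" using cn C(1) n0[OF n] by (intro divide_left_mono mult_pos_pos) auto
    also have "\<dots> = cmod (1 + \<alpha>) * (exp \<bar>Im \<rho>\<bar> * \<epsilon>\<^sup>2 / 2)"
      using C a1 n0[OF n] by (simp add: \<epsilon>_def K0_def power_divide)
    finally have "cmod (1 + cos \<rho>) \<le> exp \<bar>Im \<rho>\<bar> * \<epsilon>\<^sup>2 / 2" using a1 by (simp only: mult_le_cancel_left_pos)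
    moreover have "0 \<le> \<epsilon>" using K0 by (simp add: \<epsilon>_def)
    moreover have "\<epsilon> < 1 / 2" using small[OF n] unfolding \<epsilon>_def by linarith
    ultimately obtain m :: int where m: "cmod (\<rho> - of_real ((2 * of_int m + 1) * pi)) \<le> 2 * \<epsilon>"
      using cos_plus_one_small by blast
    \<comment> \<open>The principal root excludes the zeros near \<open>-r\<^sub>n\<close>.\<close>
    have "0 \<le> Re \<rho>" using csqrt_principal[of \<nu>] by (auto simp: \<rho>_def)
    then have "m = int n" using odd_pi_unique[OF c _ order_trans[OF m]] small[OF n] by (simp add: \<epsilon>_def)
    then have "cmod (\<rho> - of_real (rn n)) \<le> 2 * K0 / sqrt (real n)" using m by (simp add: rn_def \<epsilon>_def)
    then show "\<exists>\<rho>. \<nu> = \<rho>\<^sup>2 \<and> cmod (\<rho> - of_real (rn n)) \<le> 2 * K0 / sqrt (real n)" using \<rho> by blast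
  qed
qed

definition B :: real where "B = cmod ((1 - \<alpha>) / (1 + \<alpha>))"

lemma alpha_plus: "1 + \<alpha> \<noteq> 0" and alpha_minus: "1 - \<alpha> \<noteq> 0"
  using alpha by (metis add.commute add_eq_0_iff, simp)

lemma B_pos: "0 < B" using alpha_plus alpha_minus by (simp add: B_def)

definition D :: real where "D = 16 * exp 1 * Q\<^sup>2 * (1 + cmod \<alpha>) / (cmod (1 + \<alpha>) * B)"

lemma D_nonneg: "0 \<le> D" using B_pos by (simp add: D_def)

text \<open>
  With \<open>\<rho> = r\<^sub>n + \<kappa> w\<close> the main term contributes
  \<open>(1+\<alpha>) \<kappa>\<^sup>2 w\<^sup>2/2\<close> and the integral \<open>-(1-\<alpha>)
  s\<^sub>2\<^sub>n\<^sub>+\<^sub>1/(2 r\<^sub>n) = -(1+\<alpha>) \<kappa>\<^sup>2/2\<close>. The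
  error terms are the quartic remainder of the cosine, the variation of the integral and of
  \<open>1/\<rho>\<close> over a distance of order \<open>\<bar>\<kappa>\<bar>\<close>, and the
  second order remainder \<open>O(1/r\<^sub>n\<^sup>2)\<close>; divided by
  \<open>\<kappa>\<^sup>2\<close> the last one is of order \<open>1/(r\<^sub>n
  \<bar>s\<^sub>2\<^sub>n\<^sub>+\<^sub>1\<bar>)\<close>.
\<close>

lemma scaled_estimate:
  assumes \<kappa>: "\<kappa>\<^sup>2 = (1 - \<alpha>) / (1 + \<alpha>) * s n / of_real (rn n)" and s0: "s n \<noteq> 0" and w: "cmod w \<le> 2"
    and \<kappa>s: "cmod \<kappa> \<le> 1 / 4" and r: "2 * Q + 2 \<le> rn n"
  shows "cmod (\<Delta> ((of_real (rn n) + \<kappa> * w)\<^sup>2) * (2 / ((1 + \<alpha>) * \<kappa>\<^sup>2)) - (w\<^sup>2 - 1))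
     \<le> 32 * exp 1 * (cmod \<kappa>)\<^sup>2 + 4 * cmod \<kappa> / rn n + 4 * exp 1 * Q * (cmod \<kappa> / cmod (s n)) + D / (rn n * cmod (s n))"
proof -
  let ?r = "of_real (rn n) :: complex"
  define \<rho> where "\<rho> = ?r + \<kappa> * w"
  have r0: "?r \<noteq> 0" "0 < rn n" using rn_pos[of n] by auto
  have \<kappa>0: "\<kappa> \<noteq> 0"
  proof
    assume "\<kappa> = 0"
    then have "(1 - \<alpha>) / (1 + \<alpha>) * s n / ?r = 0" using \<kappa> by simp
    then show False using s0 r0 alpha_plus alpha_minus by simp
  qed
  have kw: "cmod (\<kappa> * w) \<le> 2 * cmod \<kappa>" unfolding norm_mult using w mult_left_mono[of "cmod w" 2 "cmod \<kappa>"] by simp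
  have nk: "(cmod \<kappa>)\<^sup>2 = B * cmod (s n) / rn n"
    using arg_cong[OF \<kappa>, of cmod] r0 by (simp add: norm_power norm_mult norm_divide B_def)
  have \<rho>r: "rn n / 2 \<le> cmod \<rho>" "2 * Q + 1 \<le> cmod \<rho>"
  proof -
    have "cmod ?r - cmod (\<kappa> * w) \<le> cmod \<rho>" unfolding \<rho>_def using norm_triangle_ineq4[of "?r + \<kappa> * w" "\<kappa> * w"] by simp
    then have "rn n - 1 / 2 \<le> cmod \<rho>" using kw \<kappa>s r0 by simp
    then show "rn n / 2 \<le> cmod \<rho>" "2 * Q + 1 \<le> cmod \<rho>" using r Q_nonneg by linarith+
  qed
  have \<rho>0: "\<rho> \<noteq> 0" "0 < cmod \<rho>" using \<rho>r r0 by auto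
  have Im: "\<bar>Im \<rho>\<bar> \<le> 1" using abs_Im_le_cmod[of "\<kappa> * w"] kw \<kappa>s by (simp add: \<rho>_def)
  define E where "E = \<Delta> (\<rho>\<^sup>2) - (1 + \<alpha>) * (1 + cos \<rho>) - (1 - \<alpha>) / (2 * \<rho>) * sinI \<rho>"
  have E: "cmod E \<le> 8 * exp 1 * Q\<^sup>2 * (1 + cmod \<alpha>) / (rn n)\<^sup>2"
  proof -
    have "cmod E \<le> 2 * Q\<^sup>2 * (1 + cmod \<alpha>) * exp \<bar>Im \<rho>\<bar> / (cmod \<rho>)\<^sup>2" unfolding E_def by (rule \<Delta>_asymptotics[OF \<rho>r(2)])
    also have "\<dots> \<le> 2 * Q\<^sup>2 * (1 + cmod \<alpha>) * exp 1 / (rn n / 2)\<^sup>2"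
      using \<rho>r(1) r0 Im by (intro frac_le mult_left_mono power_mono) auto
    finally show ?thesis by (simp add: power_divide mult_ac)
  qed
  have c: "(1 - \<alpha>) / ((1 + \<alpha>) * \<kappa>\<^sup>2) = ?r / s n" 
  proof -
    define A where "A = (1 - \<alpha>) / (1 + \<alpha>)"
    have "A \<noteq> 0" using alpha_plus alpha_minus by (simp add: A_def)
    then have "A / (A * s n / ?r) = ?r / s n" using r0 by simp
    moreover have "(1 - \<alpha>) / ((1 + \<alpha>) * \<kappa>\<^sup>2) = A / \<kappa>\<^sup>2" by (simp add: A_def)
    ultimately show ?thesis unfolding \<kappa> A_def by simp
  qed
  have "cos \<rho> = cos ?r * cos (\<kappa> * w) - sin ?r * sin (\<kappa> * w)" unfolding \<rho>_def by (rule cos_add)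
  moreover have "cos ?r = -1" "sin ?r = 0" using sin_rn[of n] cos_rn[of n] by (simp_all add: cos_of_real sin_of_real)
  ultimately have cosr: "cos \<rho> = - cos (\<kappa> * w)" by simp
  define e1 where "e1 = sinI \<rho> + s n"
  have e1: "cmod e1 \<le> Q * (exp 1 * (2 * cmod \<kappa>))"
  proof -
    have "cmod (sinI \<rho> - sinI ?r) \<le> Q * (exp 1 * cmod (\<rho> - ?r))" using Im by (intro sinI_lipschitz) auto
    also have "\<dots> \<le> Q * (exp 1 * (2 * cmod \<kappa>))" using kw Q_nonneg by (intro mult_left_mono) (auto simp: \<rho>_def)
    finally show ?thesis by (simp add: sinI_rn e1_def)
  qed
  have dec: "\<Delta> (\<rho>\<^sup>2) * (2 / ((1 + \<alpha>) * \<kappa>\<^sup>2)) - (w\<^sup>2 - 1)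
     = E * (2 / ((1 + \<alpha>) * \<kappa>\<^sup>2)) + (1 - cos (\<kappa> * w) - (\<kappa> * w)\<^sup>2 / 2) * (2 / \<kappa>\<^sup>2) + (\<kappa> * w / \<rho> + (?r / s n) / \<rho> * e1)"
  proof -
    have 1: "\<Delta> (\<rho>\<^sup>2) = E + (1 + \<alpha>) * (1 - cos (\<kappa> * w)) + (1 - \<alpha>) / (2 * \<rho>) * sinI \<rho>" by (simp add: E_def cosr)
    have 2: "(1 + \<alpha>) * (1 - cos (\<kappa> * w)) * (2 / ((1 + \<alpha>) * \<kappa>\<^sup>2)) = (1 - cos (\<kappa> * w)) * (2 / \<kappa>\<^sup>2)" using alpha_plus by simp
    have 3: "(1 - \<alpha>) / (2 * \<rho>) * sinI \<rho> * (2 / ((1 + \<alpha>) * \<kappa>\<^sup>2)) = ((1 - \<alpha>) / ((1 + \<alpha>) * \<kappa>\<^sup>2)) / \<rho> * sinI \<rho>" using \<rho>0 by simp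
    have 4: "(?r / s n) / \<rho> * sinI \<rho> = (?r / s n) / \<rho> * e1 - ?r / \<rho>" 
    proof -
      have "sinI \<rho> = e1 - s n" by (simp add: e1_def)
      then show ?thesis using s0 by (simp add: right_diff_distrib)
    qed
    have 5: "1 - ?r / \<rho> = \<kappa> * w / \<rho>" using \<rho>0 by (simp add: field_simps) (simp add: \<rho>_def)
    have 6: "(\<kappa> * w)\<^sup>2 / 2 * (2 / \<kappa>\<^sup>2) = w\<^sup>2" using \<kappa>0 by (simp add: power_mult_distrib)
    have "\<Delta> (\<rho>\<^sup>2) * (2 / ((1 + \<alpha>) * \<kappa>\<^sup>2)) = E * (2 / ((1 + \<alpha>) * \<kappa>\<^sup>2)) + (1 - cos (\<kappa> * w)) * (2 / \<kappa>\<^sup>2) + ((?r / s n) / \<rho> * e1 - ?r / \<rho>)"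
    proof -
      have dist: "(E + X + Y) * b = E * b + X * b + Y * b" for X Y b by (simp add: distrib_right)
      show ?thesis unfolding 1 dist 2 3 c 4 ..
    qed
    moreover have "(1 - cos (\<kappa> * w) - (\<kappa> * w)\<^sup>2 / 2) * (2 / \<kappa>\<^sup>2) = (1 - cos (\<kappa> * w)) * (2 / \<kappa>\<^sup>2) - w\<^sup>2"
      unfolding left_diff_distrib 6 ..
    moreover have "A - (W - 1) = P + Z + (K + V)" if "A = P + Y + (V - R)" "Z = Y - W" "1 - R = K" for A W P Z K V Y R :: complex
      unfolding that(1,2) that(3)[symmetric] by simp
    ultimately show ?thesis using 5 by blast
  qed
  have t1: "cmod (E * (2 / ((1 + \<alpha>) * \<kappa>\<^sup>2))) \<le> D / (rn n * cmod (s n))"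
  proof -
    have "cmod (E * (2 / ((1 + \<alpha>) * \<kappa>\<^sup>2))) = cmod E * (2 / (cmod (1 + \<alpha>) * (B * cmod (s n) / rn n)))"
      by (simp add: norm_mult norm_divide norm_power nk)
    also have "\<dots> \<le> 8 * exp 1 * Q\<^sup>2 * (1 + cmod \<alpha>) / (rn n)\<^sup>2 * (2 / (cmod (1 + \<alpha>) * (B * cmod (s n) / rn n)))"
      using E B_pos r0 by (intro mult_right_mono) auto
    also have "\<dots> = D / (rn n * cmod (s n))" using r0 by (simp add: D_def power2_eq_square mult_ac)
    finally show ?thesis .
  qed
  have t2: "cmod ((1 - cos (\<kappa> * w) - (\<kappa> * w)\<^sup>2 / 2) * (2 / \<kappa>\<^sup>2)) \<le> 32 * exp 1 * (cmod \<kappa>)\<^sup>2"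
  proof -
    have "cmod (1 - cos (\<kappa> * w) - (\<kappa> * w)\<^sup>2 / 2) \<le> exp 1 * cmod (\<kappa> * w) ^ 4" using kw \<kappa>s by (intro cos_cubic) auto
    also have "\<dots> \<le> exp 1 * (2 * cmod \<kappa>) ^ 4" using kw by (intro mult_left_mono power_mono) auto
    finally have "cmod (1 - cos (\<kappa> * w) - (\<kappa> * w)\<^sup>2 / 2) * (2 / (cmod \<kappa>)\<^sup>2) \<le> exp 1 * (2 * cmod \<kappa>) ^ 4 * (2 / (cmod \<kappa>)\<^sup>2)" by (intro mult_right_mono) auto
    also have "\<dots> = 32 * exp 1 * (cmod \<kappa>)\<^sup>2" using \<kappa>0 by (simp add: eval_nat_numeral field_simps)
    finally have "cmod (1 - cos (\<kappa> * w) - (\<kappa> * w)\<^sup>2 / 2) * (2 / (cmod \<kappa>)\<^sup>2) \<le> 32 * exp 1 * (cmod \<kappa>)\<^sup>2" .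
    moreover have "cmod (2 / \<kappa>\<^sup>2) = 2 / (cmod \<kappa>)\<^sup>2" by (simp add: norm_divide norm_power)
    ultimately show ?thesis unfolding norm_mult[of _ "2 / \<kappa>\<^sup>2"] by simp
  qed
  have t3: "cmod (\<kappa> * w / \<rho>) \<le> 4 * cmod \<kappa> / rn n"
  proof -
    have "cmod (\<kappa> * w / \<rho>) \<le> 2 * cmod \<kappa> / (rn n / 2)" unfolding norm_divide using kw \<rho>r r0 by (intro frac_le) auto
    then show ?thesis by simp
  qed
  have t4: "cmod ((?r / s n) / \<rho> * e1) \<le> 4 * exp 1 * Q * (cmod \<kappa> / cmod (s n))"
  proof -
    have "cmod ((?r / s n) / \<rho> * e1) = (rn n / cmod \<rho>) * (cmod e1 / cmod (s n))" using r0 by (simp add: norm_mult norm_divide)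
    also have "\<dots> \<le> 2 * (Q * (exp 1 * (2 * cmod \<kappa>)) / cmod (s n))"
      using \<rho>r r0 \<rho>0 e1 by (intro mult_mono divide_right_mono) (auto simp: divide_simps)
    finally show ?thesis by (simp add: mult_ac)
  qed
  show ?thesis unfolding \<rho>_def[symmetric] dec
  proof -
    have tri: "cmod (a + b + (c + d)) \<le> A2 + B2 + C2 + D2"
      if "cmod a \<le> D2" "cmod b \<le> A2" "cmod c \<le> B2" "cmod d \<le> C2" for a b c d :: complex and A2 B2 C2 D2
      using norm_triangle_ineq[of "a + b" "c + d"] norm_triangle_ineq[of a b] norm_triangle_ineq[of c d] that by linarith
    show "cmod (E * (2 / ((1 + \<alpha>) * \<kappa>\<^sup>2)) + (1 - cos (\<kappa> * w) - (\<kappa> * w)\<^sup>2 / 2) * (2 / \<kappa>\<^sup>2) + (\<kappa> * w / \<rho> + (?r / s n) / \<rho> * e1))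
      \<le> 32 * exp 1 * (cmod \<kappa>)\<^sup>2 + 4 * cmod \<kappa> / rn n + 4 * exp 1 * Q * (cmod \<kappa> / cmod (s n)) + D / (rn n * cmod (s n))"
      by (rule tri[OF t1 t2 t3 t4])
  qed
qed

text \<open>
  All estimates below hold for the indices that are admissible for a large enough threshold.
  Stating them for single indices instead of limits lets the same lemmas serve for the full
  sequence and for a subsequence.
\<close>

definition admissible :: "real \<Rightarrow> nat \<Rightarrow> bool" where
  "admissible T n \<longleftrightarrow> s n \<noteq> 0 \<and> T \<le> rn n \<and> T \<le> rn n * cmod (s n)"

lemma scaled_small:
  assumes \<eta>: "0 < \<eta>"
  obtains T where "0 < T" "\<And>n \<kappa> w. admissible T n \<Longrightarrow> \<kappa>\<^sup>2 = (1 - \<alpha>) / (1 + \<alpha>) * s n / of_real (rn n) \<Longrightarrow> cmod w \<le> 2 \<Longrightarrow>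
     cmod (\<Delta> ((of_real (rn n) + \<kappa> * w)\<^sup>2) * (2 / ((1 + \<alpha>) * \<kappa>\<^sup>2)) - (w\<^sup>2 - 1)) < \<eta> \<and> cmod \<kappa> < \<eta>"
proof -
  define k where "k T = sqrt (B * Q / T)" for T
  define h where "h T = 32 * exp 1 * (k T)\<^sup>2 + 4 * k T / T + 4 * exp 1 * Q * sqrt (B / T) + D / T" for T
  have k: "(k \<longlongrightarrow> 0) at_top" unfolding k_def
    by (rule tendsto_eq_intros tendsto_divide_0[OF tendsto_const] filterlim_at_top_imp_at_infinity filterlim_ident | simp)+
  have h: "(h \<longlongrightarrow> 0) at_top" unfolding h_def
    by (rule tendsto_eq_intros k tendsto_divide_0[OF tendsto_const] tendsto_divide_0[OF tendsto_mult[OF tendsto_const k]] filterlim_at_top_imp_at_infinity filterlim_ident | simp)+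
  have k4: "\<forall>\<^sub>F T in at_top. k T < 1 / 4" by (rule order_tendstoD(2)[OF k]) simp
  have "\<forall>\<^sub>F T in at_top. h T < \<eta> \<and> k T < \<eta> \<and> k T < 1 / 4 \<and> 2 * Q + 2 \<le> T"
    using order_tendstoD(2)[OF h \<eta>] order_tendstoD(2)[OF k \<eta>] k4 eventually_ge_at_top[of "2 * Q + 2"]
    by eventually_elim simp
  then obtain T where T: "h T < \<eta>" "k T < \<eta>" "k T < 1 / 4" "2 * Q + 2 \<le> T" unfolding eventually_at_top_linorder by blast
  have T0: "0 < T" using T(4) Q_nonneg by linarith
  have "cmod (\<Delta> ((of_real (rn n) + \<kappa> * w)\<^sup>2) * (2 / ((1 + \<alpha>) * \<kappa>\<^sup>2)) - (w\<^sup>2 - 1)) < \<eta> \<and> cmod \<kappa> < \<eta>"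
    if n: "admissible T n" and \<kappa>: "\<kappa>\<^sup>2 = (1 - \<alpha>) / (1 + \<alpha>) * s n / of_real (rn n)" and w: "cmod w \<le> 2" for n \<kappa> w
  proof -
    have s0: "s n \<noteq> 0" and Tr: "T \<le> rn n" "T \<le> rn n * cmod (s n)" using n by (auto simp: admissible_def)
    have nk: "(cmod \<kappa>)\<^sup>2 = B * cmod (s n) / rn n"
      using arg_cong[OF \<kappa>, of cmod] rn_pos[of n] by (simp add: norm_power norm_mult norm_divide B_def)
    also have "\<dots> \<le> B * Q / T" using B_pos s_bound[of n] Tr T0 Q_nonneg by (intro frac_le mult_left_mono) auto
    finally have "(cmod \<kappa>)\<^sup>2 \<le> B * Q / T" .
    then have kk: "cmod \<kappa> \<le> k T" unfolding k_def by (rule real_le_rsqrt)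
    have "(cmod \<kappa> / cmod (s n))\<^sup>2 = B / (rn n * cmod (s n))" using s0 by (simp add: power_divide nk) (simp add: power2_eq_square)
    also have "\<dots> \<le> B / T" using B_pos Tr T0 by (intro frac_le) auto
    finally have ks: "cmod \<kappa> / cmod (s n) \<le> sqrt (B / T)" by (rule real_le_rsqrt)
    have "cmod (\<Delta> ((of_real (rn n) + \<kappa> * w)\<^sup>2) * (2 / ((1 + \<alpha>) * \<kappa>\<^sup>2)) - (w\<^sup>2 - 1))
      \<le> 32 * exp 1 * (cmod \<kappa>)\<^sup>2 + 4 * cmod \<kappa> / rn n + 4 * exp 1 * Q * (cmod \<kappa> / cmod (s n)) + D / (rn n * cmod (s n))"
      using kk T Tr by (intro scaled_estimate[OF \<kappa> s0 w]) auto
    also have "\<dots> \<le> h T" unfolding h_def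
      using kk ks Tr T0 Q_nonneg D_nonneg order_trans[OF norm_ge_zero kk] by (intro add_mono mult_left_mono frac_le power_mono) auto
    finally show ?thesis using T kk by linarith
  qed
  then show ?thesis using that T0 by blast
qed

text \<open>
  On the circle of radius \<open>\<epsilon>\<close> around \<open>\<sigma>\<close> the limit
  \<open>w\<^sup>2 - 1\<close> has modulus at least \<open>\<epsilon>\<close>, at the centre it
  vanishes; so the rescaled function has a zero inside by the minimum principle.
\<close>

lemma scaled_zero:
  assumes \<epsilon>: "0 < \<epsilon>" "\<epsilon> \<le> 1 / 2"
  obtains T where "0 < T" "\<And>n \<kappa> \<sigma>. admissible T n \<Longrightarrow> \<kappa>\<^sup>2 = (1 - \<alpha>) / (1 + \<alpha>) * s n / of_real (rn n) \<Longrightarrow> \<sigma> = 1 \<or> \<sigma> = -1 \<Longrightarrow>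
     (\<exists>w. cmod (w - \<sigma>) < \<epsilon> \<and> \<Delta> ((of_real (rn n) + \<kappa> * w)\<^sup>2) = 0) \<and> cmod \<kappa> < \<epsilon>"
proof -
  obtain T where T: "0 < T" "\<And>n \<kappa> w. admissible T n \<Longrightarrow> \<kappa>\<^sup>2 = (1 - \<alpha>) / (1 + \<alpha>) * s n / of_real (rn n) \<Longrightarrow> cmod w \<le> 2 \<Longrightarrow>
     cmod (\<Delta> ((of_real (rn n) + \<kappa> * w)\<^sup>2) * (2 / ((1 + \<alpha>) * \<kappa>\<^sup>2)) - (w\<^sup>2 - 1)) < \<epsilon> / 2 \<and> cmod \<kappa> < \<epsilon> / 2"
    using scaled_small[of "\<epsilon> / 2"] \<epsilon> by (metis half_gt_zero)
  have "(\<exists>w. cmod (w - \<sigma>) < \<epsilon> \<and> \<Delta> ((of_real (rn n) + \<kappa> * w)\<^sup>2) = 0) \<and> cmod \<kappa> < \<epsilon>"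
    if n: "admissible T n" and \<kappa>: "\<kappa>\<^sup>2 = (1 - \<alpha>) / (1 + \<alpha>) * s n / of_real (rn n)" and \<sigma>: "\<sigma> = 1 \<or> \<sigma> = -1" for n \<kappa> \<sigma>
  proof
    have \<sigma>1: "cmod \<sigma> = 1" "\<sigma>\<^sup>2 = 1" using \<sigma> by auto
    show "cmod \<kappa> < \<epsilon>" using T(2)[OF n \<kappa>, of 0] \<epsilon> by simp
    have r0: "(of_real (rn n) :: complex) \<noteq> 0" using rn_pos[of n] by simp
    have \<kappa>0: "\<kappa> \<noteq> 0"
    proof
      assume "\<kappa> = 0"
      then have "(1 - \<alpha>) / (1 + \<alpha>) * s n / of_real (rn n) = 0" using \<kappa> by simp
      then show False using n r0 alpha_plus alpha_minus by (simp add: admissible_def)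
    qed
    define F where "F w = \<Delta> ((of_real (rn n) + \<kappa> * w)\<^sup>2) * (2 / ((1 + \<alpha>) * \<kappa>\<^sup>2))" for w
    have est: "cmod (F w - (w\<^sup>2 - 1)) < \<epsilon> / 2" if "cmod w \<le> 2" for w using T(2)[OF n \<kappa> that] by (simp add: F_def)
    have hol: "F holomorphic_on A" for A unfolding F_def
      by (intro holomorphic_intros holomorphic_on_compose_gen[OF _ \<Delta>_holomorphic[of UNIV], unfolded o_def]) auto
    obtain w where w: "w \<in> ball \<sigma> \<epsilon>" "F w = 0"
    proof (rule holomorphic_contract_to_zero[of \<sigma> \<epsilon> F])
      show "continuous_on (cball \<sigma> \<epsilon>) F" using hol holomorphic_on_imp_continuous_on by blast
      fix z assume z: "cmod (\<sigma> - z) = \<epsilon>"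
      have z2: "cmod z \<le> 2" using norm_triangle_ineq4[of \<sigma> "\<sigma> - z"] z \<sigma>1 \<epsilon> by simp
      have "cmod (z + \<sigma>) \<ge> 1" using norm_triangle_ineq2[of "2 * \<sigma>" "\<sigma> - z"] z \<sigma>1 \<epsilon> by (simp add: norm_mult algebra_simps)
      then have "\<epsilon> * 1 \<le> cmod (\<sigma> - z) * cmod (z + \<sigma>)" unfolding z using \<epsilon> by (intro mult_left_mono) auto
      also have "\<dots> = cmod (z\<^sup>2 - 1)" unfolding norm_mult[symmetric] using \<sigma>1
        by (metis (no_types, lifting) add.commute mult.commute norm_minus_commute power2_eq_square square_diff_square_factored)
      finally have "\<epsilon> \<le> cmod (z\<^sup>2 - 1)" by simp
      moreover have "cmod (z\<^sup>2 - 1) - cmod (F z - (z\<^sup>2 - 1)) \<le> cmod (F z)" using norm_triangle_ineq4[of "F z" "F z - (z\<^sup>2 - 1)"] by simp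
      moreover have "cmod (F \<sigma>) < \<epsilon> / 2" using est[of \<sigma>] \<sigma>1 by simp
      ultimately show "cmod (F \<sigma>) < cmod (F z)" using est[OF z2] by linarith
    qed (use \<epsilon> hol in auto)
    have "\<Delta> ((of_real (rn n) + \<kappa> * w)\<^sup>2) = 0" using w(2) \<kappa>0 alpha_plus by (simp add: F_def)
    then show "\<exists>w. cmod (w - \<sigma>) < \<epsilon> \<and> \<Delta> ((of_real (rn n) + \<kappa> * w)\<^sup>2) = 0" using w(1) by (auto simp: dist_norm norm_minus_commute)
  qed
  then show ?thesis using that T(1) by blast
qed

end

section \<open>Simplicity and labelling of the zeros\<close>

text \<open>Used to list finitely many eigenvalues with their multiplicities along a given index set.\<close>

lemma fibres_of_prescribed_size:
  fixes m :: "'b \<Rightarrow> nat"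
  assumes "finite I" "finite Z" "(\<Sum>p\<in>Z. m p) = card I"
  obtains f :: "'a \<Rightarrow> 'b" where "\<And>i. i \<in> I \<Longrightarrow> f i \<in> Z" "\<And>p. p \<in> Z \<Longrightarrow> card {i \<in> I. f i = p} = m p"
proof -
  have "card (SIGMA p:Z. {..<m p}) = card I" using assms by (simp add: card_SigmaI)
  then obtain g where g: "bij_betw g I (SIGMA p:Z. {..<m p})"
    using finite_same_card_bij[OF assms(1)] assms(2) by (metis finite_SigmaI finite_lessThan)
  show ?thesis
  proof (rule that[of "fst \<circ> g"])
    show "(fst \<circ> g) i \<in> Z" if "i \<in> I" for i using bij_betwE[OF g] that by auto
    fix p assume p: "p \<in> Z"
    have "g ` {i \<in> I. (fst \<circ> g) i = p} = {p} \<times> {..<m p}"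
    proof (intro equalityI subsetI)
      fix x assume "x \<in> g ` {i \<in> I. (fst \<circ> g) i = p}"
      then show "x \<in> {p} \<times> {..<m p}" using bij_betwE[OF g] by force
    next
      fix x assume x: "x \<in> {p} \<times> {..<m p}"
      then have "x \<in> g ` I" using bij_betw_imp_surj_on[OF g] p by auto
      then obtain i where "i \<in> I" "x = g i" by blast
      moreover have "fst x = p" using x by auto
      ultimately show "x \<in> g ` {i \<in> I. (fst \<circ> g) i = p}" by auto
    qed
    moreover have "inj_on g {i \<in> I. (fst \<circ> g) i = p}" using bij_betw_imp_inj_on[OF g] by (rule inj_on_subset) auto
    ultimately show "card {i \<in> I. (fst \<circ> g) i = p} = m p" using card_image by fastforce
  qed
qed

context bvp0 begin

definition annulus :: "nat \<Rightarrow> complex set" where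
  "annulus n = {p. \<Delta> p = 0 \<and> rad n < cmod p \<and> cmod p < rad (n + 1)}"

lemma rad_mono: "m \<le> n \<Longrightarrow> rad m \<le> rad n"
  unfolding rad_def by (intro power_mono) auto

text \<open>
  The square roots are taken separately as in the asymptotic formula, so that the sign of
  \<open>\<kappa>\<close> matches the labels.
\<close>

definition \<kappa> :: "nat \<Rightarrow> complex" where
  "\<kappa> n = csqrt (2 * gamma4 \<alpha>) / 2 * csqrt (of_nat (2 * n + 1) * s n) / (2 * of_real (rn n))"

lemma \<kappa>_square: "(\<kappa> n)\<^sup>2 = (1 - \<alpha>) / (1 + \<alpha>) * s n / of_real (rn n)"
proof -
  have r: "complex_of_real (rn n) = of_nat (2 * n + 1) * of_real pi" by (simp add: rn_def)
  have nz: "of_nat (2 * n + 1) \<noteq> (0::complex)" "complex_of_real pi \<noteq> 0" by (simp_all del: of_nat_Suc of_nat_add)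
  have "(\<kappa> n)\<^sup>2 = (2 * gamma4 \<alpha>) / 4 * (of_nat (2 * n + 1) * s n) / (4 * (of_real (rn n))\<^sup>2)"
    unfolding \<kappa>_def by (simp add: power_divide power_mult_distrib)
  also have "\<dots> = (1 - \<alpha>) / (1 + \<alpha>) * s n / of_real (rn n)"
  proof -
    have alg: "(2 * (8 * P * A)) / 4 * (N * S) / (4 * (N * P)\<^sup>2) = A * S / (N * P)" if "N \<noteq> 0" "P \<noteq> 0" for N P S A :: complex
      using that by (simp add: field_simps power2_eq_square)
    have g: "8 * of_real pi * (1 - \<alpha>) / (1 + \<alpha>) = 8 * of_real pi * ((1 - \<alpha>) / (1 + \<alpha>))" by simp
    show ?thesis unfolding r gamma4_def g by (rule alg[OF nz])
  qed
  finally show ?thesis .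
qed

lemma \<kappa>_nonzero: "s n \<noteq> 0 \<Longrightarrow> \<kappa> n \<noteq> 0"
  using \<kappa>_square[of n] rn_pos[of n] alpha_plus alpha_minus by (metis divide_eq_0_iff mult_eq_0_iff of_real_eq_0_iff less_irrefl zero_power2)

definition branch :: "nat \<Rightarrow> complex \<Rightarrow> complex" where
  "branch n w = (of_real (rn n) + \<kappa> n * w)\<^sup>2"

lemma near_rn_annulus:
  assumes "cmod (\<rho> - of_real (rn n)) \<le> 1" shows "rad n < cmod (\<rho>\<^sup>2)" "cmod (\<rho>\<^sup>2) < rad (n + 1)"
proof -
  have n: "rn n - 1 \<le> cmod \<rho>" "cmod \<rho> \<le> rn n + 1"
    using norm_triangle_ineq3[of \<rho> "of_real (rn n)"] assms rn_pos[of n] by auto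
  have e: "2 * pi * real n = rn n - pi" "2 * pi * real (n + 1) = rn n + pi" by (simp_all add: rn_def algebra_simps)
  have c: "2 * pi * real n < cmod \<rho>" "cmod \<rho> < 2 * pi * real (n + 1)" unfolding e using n pi_gt3 by linarith+
  show "rad n < cmod (\<rho>\<^sup>2)" unfolding rad_def norm_power by (rule power_strict_mono[OF c(1)]) auto
  show "cmod (\<rho>\<^sup>2) < rad (n + 1)" unfolding rad_def norm_power by (rule power_strict_mono[OF c(2)]) auto
qed

text \<open>
  The alternative \<open>\<rho>' = -\<rho>\<close> is excluded because both numbers lie near
  \<open>r\<^sub>n\<close>.
\<close>

lemma near_rn_inj:
  assumes "cmod (\<rho> - of_real (rn n)) \<le> 1" "cmod (\<rho>' - of_real (rn n)) \<le> 1" "\<rho>\<^sup>2 = \<rho>'\<^sup>2" shows "\<rho> = \<rho>'"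
proof (rule ccontr)
  assume "\<rho> \<noteq> \<rho>'"
  then have "\<rho> = - \<rho>'" using assms(3) power2_eq_iff by blast
  then have "(\<rho> - of_real (rn n)) + (\<rho>' - of_real (rn n)) = - of_real (2 * rn n)" by simp
  then have "2 * rn n \<le> cmod (\<rho> - of_real (rn n)) + cmod (\<rho>' - of_real (rn n))"
    using norm_triangle_ineq[of "\<rho> - of_real (rn n)" "\<rho>' - of_real (rn n)"] rn_pos[of n] by simp
  moreover have "1 < rn n" using pi_gt3 mult_mono[of 1 "2 * real n + 1" 3 pi] by (simp add: rn_def)
  ultimately show False using assms(1,2) by linarith
qed

text \<open>The difference of two consecutive counts in discs.\<close>

lemma annulus_count:
  obtains N0 where "1 \<le> N0" "\<And>n. N0 \<le> n \<Longrightarrow> (\<Sum>p\<in>annulus n. zorder \<Delta> p) = 2" "\<And>n p. N0 \<le> n \<Longrightarrow> cmod p = rad n \<Longrightarrow> \<Delta> p \<noteq> 0"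
    "\<And>N. N0 \<le> N \<Longrightarrow> (\<Sum>p\<in>{p \<in> ball 0 (rad N). \<Delta> p = 0}. zorder \<Delta> p) = 2 * int N" "\<And>R. finite {p \<in> ball 0 R. \<Delta> p = 0}"
proof -
  obtain N0 where N0: "1 \<le> N0" "\<And>N. N0 \<le> N \<Longrightarrow> (\<Sum>p\<in>{p \<in> ball 0 (rad N). \<Delta> p = 0}. zorder \<Delta> p) = 2 * int N"
    "\<And>N p. N0 \<le> N \<Longrightarrow> cmod p = rad N \<Longrightarrow> \<Delta> p \<noteq> 0" using zero_count by metis
  have "cmod (of_real (rad N0)) = rad N0" unfolding norm_of_real by (simp add: rad_def)
  then have "\<Delta> (of_real (rad N0)) \<noteq> 0" using N0(3) by blast
  then have fin: "finite {p \<in> ball 0 R. \<Delta> p = 0}" for R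
    by (rule finite_subset[rotated, OF entire_finite_zeros[OF \<Delta>_holomorphic, of _ R]]) auto
  have "(\<Sum>p\<in>annulus n. zorder \<Delta> p) = 2" if n: "N0 \<le> n" for n
  proof -
    have eq: "{p \<in> ball 0 (rad (n + 1)). \<Delta> p = 0} = {p \<in> ball 0 (rad n). \<Delta> p = 0} \<union> annulus n"
      using N0(3)[OF n] rad_mono[of n "n + 1"] by (auto simp: annulus_def) (meson linorder_neqE_linordered_idom)
    have "finite (annulus n)" using fin[of "rad (n + 1)"] unfolding eq by simp
    then have "(\<Sum>p\<in>{p \<in> ball 0 (rad (n + 1)). \<Delta> p = 0}. zorder \<Delta> p) = (\<Sum>p\<in>{p \<in> ball 0 (rad n). \<Delta> p = 0}. zorder \<Delta> p) + (\<Sum>p\<in>annulus n. zorder \<Delta> p)"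
      unfolding eq by (intro sum.union_disjoint fin) (auto simp: annulus_def)
    then show ?thesis using N0(2)[of n] N0(2)[of "n + 1"] n by simp
  qed
  then show ?thesis using that N0 fin by blast
qed

text \<open>
  The rescaled equation has a zero near \<open>-1\<close> and one near \<open>1\<close>. As
  multiplicities in the annulus add up to 2, these are all its zeros and both are simple.
\<close>

lemma zero_pair:
  assumes \<epsilon>: "0 < \<epsilon>" "\<epsilon> \<le> 1 / 2"
  obtains T where "0 < T" "\<And>n. admissible T n \<Longrightarrow> \<exists>w1 w2. cmod (w1 + 1) < \<epsilon> \<and> cmod (w2 - 1) < \<epsilon> \<and> cmod (\<kappa> n) < \<epsilon> \<and>
     annulus n = {branch n w1, branch n w2} \<and> branch n w1 \<noteq> branch n w2 \<and> (\<forall>p\<in>annulus n. T4_alg_mult q \<alpha> p = 1)"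
proof -
  obtain T where T: "0 < T" "\<And>n \<kappa> \<sigma>. admissible T n \<Longrightarrow> \<kappa>\<^sup>2 = (1 - \<alpha>) / (1 + \<alpha>) * s n / of_real (rn n) \<Longrightarrow> \<sigma> = 1 \<or> \<sigma> = -1 \<Longrightarrow>
     (\<exists>w. cmod (w - \<sigma>) < \<epsilon> \<and> \<Delta> ((of_real (rn n) + \<kappa> * w)\<^sup>2) = 0) \<and> cmod \<kappa> < \<epsilon>"
    by (rule scaled_zero[OF \<epsilon>]) blast
  obtain N0 where N0: "\<And>n. N0 \<le> n \<Longrightarrow> (\<Sum>p\<in>annulus n. zorder \<Delta> p) = 2" "\<And>R. finite {p \<in> ball 0 R. \<Delta> p = 0}"
    by (rule annulus_count) blast
  define T' where "T' = max T (rn N0)"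
  have "\<exists>w1 w2. cmod (w1 + 1) < \<epsilon> \<and> cmod (w2 - 1) < \<epsilon> \<and> cmod (\<kappa> n) < \<epsilon> \<and>
     annulus n = {branch n w1, branch n w2} \<and> branch n w1 \<noteq> branch n w2 \<and> (\<forall>p\<in>annulus n. T4_alg_mult q \<alpha> p = 1)"
    if n: "admissible T' n" for n
  proof -
    have a: "admissible T n" "s n \<noteq> 0" "rn N0 \<le> rn n" using n by (auto simp: admissible_def T'_def)
    have "2 * real N0 + 1 \<le> 2 * real n + 1" using a(3) unfolding rn_def by (subst (asm) mult_le_cancel_right_pos) auto
    then have nN: "N0 \<le> n" by simp
    obtain w1 where w1: "cmod (w1 + 1) < \<epsilon>" "\<Delta> (branch n w1) = 0" and k: "cmod (\<kappa> n) < \<epsilon>"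
      using T(2)[OF a(1) \<kappa>_square, of "-1"] by (auto simp: branch_def)
    obtain w2 where w2: "cmod (w2 - 1) < \<epsilon>" "\<Delta> (branch n w2) = 0"
      using T(2)[OF a(1) \<kappa>_square, of 1] by (auto simp: branch_def)
    have b: "cmod w1 \<le> 2" "cmod w2 \<le> 2"
      using norm_triangle_ineq4[of "w1 + 1" 1] norm_triangle_ineq[of "w2 - 1" 1] w1(1) w2(1) \<epsilon> by auto
    have kb: "cmod (\<kappa> n * w) \<le> 1" if "cmod w \<le> 2" for w
    proof -
      have "cmod (\<kappa> n) * cmod w \<le> 1/2 * 2" by (rule mult_mono) (use k that \<epsilon> in auto)
      then show ?thesis by (simp add: norm_mult)
    qed
    have nk: "cmod (of_real (rn n) + \<kappa> n * w - of_real (rn n)) \<le> 1" if "cmod w \<le> 2" for w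
      unfolding add_diff_cancel_left' by (rule kb[OF that])
    have "branch n w1 \<noteq> branch n w2"
    proof
      assume "branch n w1 = branch n w2"
      then have "of_real (rn n) + \<kappa> n * w1 = of_real (rn n) + \<kappa> n * w2"
        unfolding branch_def by (rule near_rn_inj[OF nk[OF b(1)] nk[OF b(2)]])
      then have "w1 = w2" using \<kappa>_nonzero[OF a(2)] by simp
      then have "(w1 + 1) - (w2 - 1) = 2" by simp
      then have "2 \<le> cmod (w1 + 1) + cmod (w2 - 1)" using norm_triangle_ineq4[of "w1 + 1" "w2 - 1"] by simp
      then show False using w1(1) w2(1) \<epsilon> by linarith
    qed
    have in_a: "branch n w1 \<in> annulus n" "branch n w2 \<in> annulus n"
      using near_rn_annulus[OF nk[OF b(1)]] near_rn_annulus[OF nk[OF b(2)]] w1(2) w2(2)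
      unfolding annulus_def branch_def mem_Collect_eq by blast+
    have fin: "finite (annulus n)" by (rule finite_subset[OF _ N0(2)[of "rad (n + 1)"]]) (auto simp: annulus_def)
    have ge: "1 \<le> zorder \<Delta> p" if "p \<in> annulus n" for p using alg_mult_pos[of p] alg_mult_zorder[of p] that by (simp add: annulus_def)
    define A where "A = annulus n - {branch n w1, branch n w2}"
    have "(\<Sum>p\<in>annulus n. zorder \<Delta> p) = (\<Sum>p\<in>{branch n w1, branch n w2}. zorder \<Delta> p) + (\<Sum>p\<in>A. zorder \<Delta> p)"
      unfolding A_def using in_a fin by (subst sum.subset_diff[of "{branch n w1, branch n w2}"]) auto
    then have two: "2 = zorder \<Delta> (branch n w1) + zorder \<Delta> (branch n w2) + (\<Sum>p\<in>A. zorder \<Delta> p)"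
      using N0(1)[OF nN] \<open>branch n w1 \<noteq> branch n w2\<close> by simp
    have "int (card A) \<le> (\<Sum>p\<in>A. zorder \<Delta> p)" using sum_mono[of A "\<lambda>_. 1" "zorder \<Delta>"] ge by (auto simp: A_def)
    then have "card A = 0" "zorder \<Delta> (branch n w1) = 1" "zorder \<Delta> (branch n w2) = 1" using two ge[OF in_a(1)] ge[OF in_a(2)] by linarith+
    moreover have "finite A" using fin by (simp add: A_def)
    ultimately have an: "annulus n = {branch n w1, branch n w2}" using in_a by (auto simp: A_def)
    moreover have "\<forall>p\<in>annulus n. T4_alg_mult q \<alpha> p = 1"
      unfolding an using alg_mult_zorder[of "branch n w1"] alg_mult_zorder[of "branch n w2"] \<open>zorder \<Delta> (branch n w1) = 1\<close> \<open>zorder \<Delta> (branch n w2) = 1\<close> by auto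
    ultimately show ?thesis using w1 w2 k \<open>branch n w1 \<noteq> branch n w2\<close> by blast
  qed
  then show ?thesis using that[of T'] T(1) by (auto simp: T'_def)
qed

text \<open>
  The root near \<open>w = (-1)\<^sup>j\<close>; it is unique for admissible indices, and the
  threshold \<open>1/2\<close> keeps the label independent of the precision asked for later.
\<close>

definition lab :: "nat \<Rightarrow> nat \<Rightarrow> complex" where
  "lab n j = (SOME p. \<Delta> p = 0 \<and> (\<exists>w. p = branch n w \<and> cmod (w - (-1) ^ j) < 1 / 2))"

text \<open>
  For admissible indices the root selected by \<open>lab\<close> exists and is unique; by
  uniqueness it also satisfies every sharper localization, for indices admissible with a larger
  threshold.
\<close>

lemma labelled_zeros:
  obtains T1 where "0 < T1"
    "\<And>n. admissible T1 n \<Longrightarrow> annulus n = {lab n 1, lab n 2} \<and> lab n 1 \<noteq> lab n 2 \<and> (\<forall>p\<in>annulus n. T4_alg_mult q \<alpha> p = 1)"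
    "\<And>\<epsilon>. 0 < \<epsilon> \<Longrightarrow> \<epsilon> \<le> 1 / 2 \<Longrightarrow> \<exists>T. \<forall>n. admissible T n \<longrightarrow> (\<forall>j\<in>{1,2}. \<exists>w. lab n j = branch n w \<and> cmod (w - (-1) ^ j) < \<epsilon> \<and> cmod (\<kappa> n) < \<epsilon>)"
proof -
  obtain T1 where T1: "0 < T1" "\<And>n. admissible T1 n \<Longrightarrow> \<exists>w1 w2. cmod (w1 + 1) < 1/2 \<and> cmod (w2 - 1) < 1/2 \<and> cmod (\<kappa> n) < 1/2 \<and>
     annulus n = {branch n w1, branch n w2} \<and> branch n w1 \<noteq> branch n w2 \<and> (\<forall>p\<in>annulus n. T4_alg_mult q \<alpha> p = 1)"
    by (rule zero_pair[of "1/2"]) (simp, simp, blast)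
  have uniq: "p = branch n w" if n: "admissible T1 n" and j: "j = 1 \<or> j = (2::nat)" and p: "\<Delta> p = 0" "p = branch n w'" "cmod (w' - (-1) ^ j) < 1 / 2"
      and w: "\<Delta> (branch n w) = 0" "cmod (w - (-1) ^ j) < 1 / 2" for n j p w w'
  proof -
    have sn: "s n \<noteq> 0" using n by (simp add: admissible_def)
    obtain w1 w2 where w12: "cmod (w1 + 1) < 1/2" "cmod (w2 - 1) < 1/2" "cmod (\<kappa> n) < 1/2" "annulus n = {branch n w1, branch n w2}"
      using T1(2)[OF n] by blast
    have b: "cmod v \<le> 2" if "cmod (v - (-1) ^ i) < 1 / 2" for v and i :: nat
      using norm_triangle_ineq[of "v - (-1) ^ i" "(-1) ^ i"] that by (simp add: norm_power)
    have b': "cmod w1 \<le> 2" "cmod w2 \<le> 2" using b[of w1 1] b[of w2 2] w12 by auto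
    have kb: "cmod (\<kappa> n * v) \<le> 1" if "cmod v \<le> 2" for v
    proof -
      have "cmod (\<kappa> n) * cmod v \<le> 1/2 * 2" by (rule mult_mono) (use w12(3) that in auto)
      then show ?thesis by (simp add: norm_mult)
    qed
    have nk: "cmod (of_real (rn n) + \<kappa> n * v - of_real (rn n)) \<le> 1" if "cmod v \<le> 2" for v
      unfolding add_diff_cancel_left' by (rule kb[OF that])
    have inj: "v = v'" if "branch n v = branch n v'" "cmod v \<le> 2" "cmod v' \<le> 2" for v v'
    proof -
      have "of_real (rn n) + \<kappa> n * v = of_real (rn n) + \<kappa> n * v'"
        using that(1) unfolding branch_def by (rule near_rn_inj[OF nk[OF that(2)] nk[OF that(3)]])
      then show ?thesis using \<kappa>_nonzero[OF sn] by simp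
    qed
    have key: "v = (if j = 1 then w1 else w2)" if "\<Delta> (branch n v) = 0" "cmod (v - (-1) ^ j) < 1 / 2" for v
    proof -
      have "branch n v \<in> annulus n"
        using near_rn_annulus[OF nk[OF b[OF that(2)]]] that(1) unfolding annulus_def branch_def mem_Collect_eq by blast
      then have vv: "v = w1 \<or> v = w2" using w12(4) inj b[OF that(2)] b' by auto
      have "\<not> (cmod (v + 1) < 1/2 \<and> cmod (v - 1) < 1/2)"
      proof
        assume "cmod (v + 1) < 1/2 \<and> cmod (v - 1) < 1/2"
        moreover have "cmod ((v + 1) - (v - 1)) \<le> cmod (v + 1) + cmod (v - 1)" by (rule norm_triangle_ineq4)
        moreover have "cmod ((v + 1) - (v - 1)) = 2" by simp
        ultimately show False by linarith
      qed
      then show ?thesis using vv j that(2) w12(1,2) by auto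
    qed
    show ?thesis using key[of w'] key[of w] p w by simp
  qed
  have lab: "lab n j = branch n w" if n: "admissible T1 n" and j: "j = 1 \<or> j = (2::nat)" and w: "\<Delta> (branch n w) = 0" "cmod (w - (-1) ^ j) < 1 / 2" for n j w
  proof -
    have ex: "\<exists>p. \<Delta> p = 0 \<and> (\<exists>w. p = branch n w \<and> cmod (w - (-1) ^ j) < 1 / 2)" using w by blast
    from someI_ex[OF ex] show ?thesis unfolding lab_def[symmetric] using uniq[OF n j _ _ _ w] by blast
  qed
  show ?thesis
  proof (rule that[OF T1(1)])
    fix n assume n: "admissible T1 n"
    then obtain w1 w2 where w12: "cmod (w1 + 1) < 1/2" "cmod (w2 - 1) < 1/2" "annulus n = {branch n w1, branch n w2}"
       "branch n w1 \<noteq> branch n w2" "\<forall>p\<in>annulus n. T4_alg_mult q \<alpha> p = 1" using T1(2) by blast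
    then have z: "\<Delta> (branch n w1) = 0" "\<Delta> (branch n w2) = 0" by (auto simp: annulus_def)
    show "annulus n = {lab n 1, lab n 2} \<and> lab n 1 \<noteq> lab n 2 \<and> (\<forall>p\<in>annulus n. T4_alg_mult q \<alpha> p = 1)"
      using lab[OF n, of 1 w1] lab[OF n, of 2 w2] w12 z by simp
  next
    fix \<epsilon> :: real assume \<epsilon>: "0 < \<epsilon>" "\<epsilon> \<le> 1 / 2"
    obtain T where T: "0 < T" "\<And>n. admissible T n \<Longrightarrow> \<exists>w1 w2. cmod (w1 + 1) < \<epsilon> \<and> cmod (w2 - 1) < \<epsilon> \<and> cmod (\<kappa> n) < \<epsilon> \<and>
       annulus n = {branch n w1, branch n w2} \<and> branch n w1 \<noteq> branch n w2 \<and> (\<forall>p\<in>annulus n. T4_alg_mult q \<alpha> p = 1)"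
      by (rule zero_pair[OF \<epsilon>]) blast
    have "\<forall>j\<in>{1,2}. \<exists>w. lab n j = branch n w \<and> cmod (w - (-1) ^ j) < \<epsilon> \<and> cmod (\<kappa> n) < \<epsilon>" if n: "admissible (max T T1) n" for n
    proof -
      have a: "admissible T n" "admissible T1 n" using n by (auto simp: admissible_def)
      obtain w1 w2 where w12: "cmod (w1 + 1) < \<epsilon>" "cmod (w2 - 1) < \<epsilon>" "cmod (\<kappa> n) < \<epsilon>" "annulus n = {branch n w1, branch n w2}"
        using T(2)[OF a(1)] by blast
      then have z: "\<Delta> (branch n w1) = 0" "\<Delta> (branch n w2) = 0" by (auto simp: annulus_def)
      have "lab n 1 = branch n w1" "lab n 2 = branch n w2" using lab[OF a(2), of 1 w1] lab[OF a(2), of 2 w2] w12 z \<epsilon> by auto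
      then show ?thesis using w12 by auto
    qed
    then show "\<exists>T. \<forall>n. admissible T n \<longrightarrow> (\<forall>j\<in>{1,2}. \<exists>w. lab n j = branch n w \<and> cmod (w - (-1) ^ j) < \<epsilon> \<and> cmod (\<kappa> n) < \<epsilon>)" by blast
  qed
qed

end

section \<open>Shape of the eigenfunctions\<close>

lemma over_sqrt_small:
  assumes "0 < m" obtains N where "1 \<le> N" "\<And>n. N \<le> n \<Longrightarrow> M / sqrt (real n) \<le> m"
proof (rule that[of "nat \<lceil>(M / m)\<^sup>2\<rceil> + 1"])
  fix n assume n: "nat \<lceil>(M / m)\<^sup>2\<rceil> + 1 \<le> n"
  then have "(M / m)\<^sup>2 \<le> real n" by linarith
  then have "\<bar>M / m\<bar> \<le> sqrt (real n)" by (metis real_sqrt_abs real_sqrt_le_mono)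
  then have "M / m \<le> sqrt (real n)" by linarith
  moreover have "0 < sqrt (real n)" using n by simp
  ultimately show "M / sqrt (real n) \<le> m" using assms by (simp add: pos_divide_le_eq mult.commute)
qed simp

lemma integral_sin_squared: "integral {0..1} (\<lambda>x. (sin (rn n * x))\<^sup>2) = 1 / 2"
proof -
  let ?F = "\<lambda>x. x / 2 - sin (2 * rn n * x) / (4 * rn n)"
  have "((\<lambda>x. (sin (rn n * x))\<^sup>2) has_integral (?F 1 - ?F 0)) {0..1}"
  proof (rule fundamental_theorem_of_calculus)
    fix x :: real
    have "((\<lambda>x. ?F x) has_real_derivative (1 / 2 - cos (2 * rn n * x) * (2 * rn n) / (4 * rn n))) (at x)"
      using rn_pos[of n] by (auto intro!: derivative_eq_intros)
    moreover have "1 / 2 - cos (2 * rn n * x) * (2 * rn n) / (4 * rn n) = (sin (rn n * x))\<^sup>2"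
    proof -
      have "cos (2 * rn n * x) * (2 * rn n) / (4 * rn n) = cos (2 * (rn n * x)) / 2" using rn_pos[of n] by (simp add: mult.assoc)
      then show ?thesis unfolding cos_double_sin by simp
    qed
    ultimately show "(?F has_vector_derivative (sin (rn n * x))\<^sup>2) (at x within {0..1})"
      unfolding has_real_derivative_iff_has_vector_derivative[symmetric] by (simp add: has_field_derivative_at_within)
  qed simp
  moreover have "sin (2 * rn n * 1) = 0" using sin_double[of "rn n"] sin_rn[of n] by simp
  ultimately show ?thesis by (simp add: integral_unique)
qed

lemma L2_norm_continuous:
  assumes "continuous_on {0..1} f" shows "(L2_norm f)\<^sup>2 = integral {0..1} (\<lambda>x. (cmod (f x))\<^sup>2)"
proof -
  have "(\<lambda>x. (cmod (f x))\<^sup>2) absolutely_integrable_on {0..1}" using assms by (intro absolutely_integrable_continuous_real continuous_intros)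
  from lebesgue_integral_I01[OF this] have e: "(LINT x|I01. (cmod (f x))\<^sup>2) = integral {0..1} (\<lambda>x. (cmod (f x))\<^sup>2)" .
  show ?thesis unfolding L2_norm_def e
    using assms by (intro real_sqrt_pow2 integral_nonneg integrable_continuous_real continuous_intros) auto
qed

text \<open>
  Pointwise the squares differ by at most \<open>3 \<eta> \<bar>\<beta>\<bar>\<^sup>2\<close>, and
  \<open>sin\<^sup>2\<close> has mean \<open>1/2\<close>.
\<close>

lemma near_sine_norm:
  assumes f: "continuous_on {0..1} f" and \<beta>: "\<And>x. x \<in> {0..1} \<Longrightarrow> cmod (f x - \<beta> * of_real (sin (rn n * x))) \<le> cmod \<beta> * \<eta>"
    and \<eta>: "0 \<le> \<eta>" "\<eta> \<le> 1"
  shows "\<bar>(L2_norm f)\<^sup>2 - (cmod \<beta>)\<^sup>2 / 2\<bar> \<le> 3 * \<eta> * (cmod \<beta>)\<^sup>2"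
proof -
  let ?b = "cmod \<beta>"
  have pw: "\<bar>(cmod (f x))\<^sup>2 - ?b\<^sup>2 * (sin (rn n * x))\<^sup>2\<bar> \<le> 3 * \<eta> * ?b\<^sup>2" if x: "x \<in> {0..1}" for x
  proof -
    let ?s = "cmod (\<beta> * of_real (sin (rn n * x)))"
    have s: "?s\<^sup>2 = ?b\<^sup>2 * (sin (rn n * x))\<^sup>2" by (simp add: norm_mult power_mult_distrib)
    have s1: "?s \<le> ?b" using mult_left_mono[OF abs_sin_le_one[of "rn n * x"], of ?b] by (simp add: norm_mult)
    have d: "\<bar>cmod (f x) - ?s\<bar> \<le> ?b * \<eta>" using norm_triangle_ineq3[of "f x" "\<beta> * of_real (sin (rn n * x))"] \<beta>[OF x] by linarith
    have "?b * \<eta> \<le> ?b * 1" using \<eta> by (intro mult_left_mono) auto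
    then have "cmod (f x) + ?s \<le> 3 * ?b" using d s1 by linarith
    then have "\<bar>cmod (f x) - ?s\<bar> * (cmod (f x) + ?s) \<le> (?b * \<eta>) * (3 * ?b)" using d \<eta> by (intro mult_mono) auto
    moreover have "(cmod (f x))\<^sup>2 - ?s\<^sup>2 = (cmod (f x) - ?s) * (cmod (f x) + ?s)" by (simp add: power2_eq_square algebra_simps)
    ultimately show ?thesis unfolding s[symmetric] by (simp add: abs_mult power2_eq_square mult_ac)
  qed
  have i1: "(\<lambda>x. (cmod (f x))\<^sup>2) integrable_on {0..1}" using f by (intro integrable_continuous_real continuous_intros)
  have i2: "(\<lambda>x. ?b\<^sup>2 * (sin (rn n * x))\<^sup>2) integrable_on {0..1}" by (intro integrable_continuous_real continuous_intros)
  have "norm (integral {0..1} (\<lambda>x. (cmod (f x))\<^sup>2 - ?b\<^sup>2 * (sin (rn n * x))\<^sup>2)) \<le> integral {0..1::real} (\<lambda>x. 3 * \<eta> * ?b\<^sup>2)"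
    by (rule Henstock_Kurzweil_Integration.integral_norm_bound_integral[OF integrable_diff[OF i1 i2] integrable_const_ivl]) (use pw in auto)
  then show ?thesis using L2_norm_continuous[OF f] integral_diff[OF i1 i2] by (simp add: integral_sin_squared)
qed

text \<open>
  The norm fixes \<open>\<bar>\<beta>\<bar> = \<surd>2 + O(\<eta>)\<close>; multiplication by
  \<open>cnj \<beta> / \<bar>\<beta>\<bar>\<close> removes the phase.
\<close>

lemma normalized_near_sine:
  assumes f: "continuous_on {0..1} f" and \<beta>: "\<And>x. x \<in> {0..1} \<Longrightarrow> cmod (f x - \<beta> * of_real (sin (rn n * x))) \<le> cmod \<beta> * \<eta>"
    and \<eta>: "0 \<le> \<eta>" "\<eta> \<le> 1 / 12" and b0: "\<beta> \<noteq> 0" and one: "L2_norm f = 1"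
  shows "\<exists>c. cmod c = 1 \<and> (\<forall>x\<in>{0..1}. cmod (c * f x - of_real (sqrt 2 * sin (rn n * x))) \<le> 26 * \<eta>)"
proof (intro exI conjI ballI)
  define b where "b = cmod \<beta>"
  have b: "0 < b" using b0 by (simp add: b_def)
  have B: "\<bar>1 - b\<^sup>2 / 2\<bar> \<le> 3 * \<eta> * b\<^sup>2" using near_sine_norm[OF f \<beta>] \<eta> one by (simp add: b_def)
  have "3 * \<eta> * b\<^sup>2 \<le> 1 / 4 * b\<^sup>2" using \<eta> by (intro mult_right_mono) auto
  then have b4: "b\<^sup>2 \<le> 4" using B by linarith
  then have b2: "b \<le> 2" using power2_le_imp_le[of b 2] by simp
  have "3 * \<eta> * b\<^sup>2 \<le> 3 * \<eta> * 4" using \<eta> b4 by (intro mult_left_mono) auto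
  then have "\<bar>b\<^sup>2 - 2\<bar> \<le> 24 * \<eta>" using B by linarith
  moreover have "b\<^sup>2 - 2 = (b - sqrt 2) * (b + sqrt 2)" by (simp add: algebra_simps power2_eq_square)
  moreover have "\<bar>b - sqrt 2\<bar> * 1 \<le> \<bar>b - sqrt 2\<bar> * (b + sqrt 2)" using b real_sqrt_ge_one[of 2] by (intro mult_left_mono) linarith+
  ultimately have bs: "\<bar>b - sqrt 2\<bar> \<le> 24 * \<eta>" using b by (simp add: abs_mult)
  show "cmod (cnj \<beta> / of_real b) = 1" using b by (simp add: norm_divide b_def)
  fix x :: real assume x: "x \<in> {0..1}"
  let ?S = "of_real (sin (rn n * x)) :: complex"
  \<comment> \<open>The phase factor turns the coefficient \<open>\<beta>\<close> into its modulus.\<close>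
  have cb: "cnj \<beta> / of_real b * \<beta> = of_real b"
    using complex_norm_square[of \<beta>] b by (simp add: b_def field_simps power2_eq_square)
  have "cnj \<beta> / of_real b * f x - of_real (sqrt 2 * sin (rn n * x))
      = cnj \<beta> / of_real b * (f x - \<beta> * ?S) + of_real ((b - sqrt 2) * sin (rn n * x))"
    unfolding right_diff_distrib mult.assoc[symmetric] cb by (simp add: algebra_simps)
  also have "cmod \<dots> \<le> cmod (cnj \<beta> / of_real b) * cmod (f x - \<beta> * ?S) + \<bar>b - sqrt 2\<bar> * \<bar>sin (rn n * x)\<bar>"
    by (rule norm_triangle_le) (simp add: norm_mult norm_divide abs_mult[symmetric] del: of_real_mult of_real_diff)
  also have "\<dots> \<le> 1 * (b * \<eta>) + 24 * \<eta> * 1"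
    using \<beta>[OF x] bs \<open>cmod (cnj \<beta> / of_real b) = 1\<close> by (intro add_mono mult_mono) (auto simp: b_def)
  also have "\<dots> \<le> 26 * \<eta>" using mult_right_mono[OF b2 \<eta>(1)] by simp
  finally show "cmod (cnj \<beta> / of_real b * f x - of_real (sqrt 2 * sin (rn n * x))) \<le> 26 * \<eta>" .
qed

context bvp0 begin

text \<open>
  Write the eigenfunction as \<open>a cos \<rho>x + \<beta> sin \<rho>x\<close> up to first order.
  The condition \<open>y(0) + \<alpha> y(1) = 0\<close> reads \<open>a (1 + \<alpha> c(1)) =
  -\<alpha> \<beta> \<rho> s(1)\<close>, where \<open>c(1) \<rightarrow> -1\<close> and
  \<open>\<rho> s(1) = O(n\<^sup>-\<^sup>1\<^sup>/\<^sup>2)\<close>; hence \<open>a\<close> is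
  small compared to \<open>\<beta>\<close>, and replacing \<open>\<rho>\<close> by
  \<open>r\<^sub>n\<close> costs another \<open>O(n\<^sup>-\<^sup>1\<^sup>/\<^sup>2)\<close>.
\<close>

lemma eigenfunction_shape:
  obtains C N where "0 < C" "1 \<le> N"
    "\<And>n \<nu> \<Psi>. N \<le> n \<Longrightarrow> \<nu> \<in> annulus n \<Longrightarrow> T4_eigenfunction q \<alpha> \<nu> \<Psi> \<Longrightarrow>
       \<exists>\<beta>. \<beta> \<noteq> 0 \<and> (\<forall>x\<in>{0..1}. cmod (\<Psi> x - \<beta> * of_real (sin (rn n * x))) \<le> cmod \<beta> * (C / sqrt (real n)))"
proof -
  obtain K N1 where K: "0 < K" "\<And>n. N1 \<le> n \<Longrightarrow> K / sqrt (real n) \<le> 1" "1 \<le> N1"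
    "\<And>n \<nu>. N1 \<le> n \<Longrightarrow> \<Delta> \<nu> = 0 \<Longrightarrow> rad n < cmod \<nu> \<Longrightarrow> cmod \<nu> < rad (n + 1) \<Longrightarrow>
       \<exists>\<rho>. \<nu> = \<rho>\<^sup>2 \<and> cmod (\<rho> - of_real (rn n)) \<le> K / sqrt (real n)" by (rule zero_localization) blast
  let ?e = "exp 1 :: real"
  define M where "M = cmod \<alpha> * (4 * K + 2 * Q * ?e)"
  have a1: "0 < cmod (1 - \<alpha>)" using alpha_minus by simp
  obtain N2 where N2: "1 \<le> N2" "\<And>n. N2 \<le> n \<Longrightarrow> M / sqrt (real n) \<le> cmod (1 - \<alpha>) / 2"
    using over_sqrt_small[of "cmod (1 - \<alpha>) / 2" M] a1 by auto
  define K4 where "K4 = 2 * cmod \<alpha> * (?e * K + 2 * Q * ?e) / cmod (1 - \<alpha>)"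
  have K4: "0 \<le> K4" using K Q_nonneg a1 by (simp add: K4_def)
  define C where "C = 2 * Q * ?e * (K4 + 1) + ?e * K4 + ?e * K + 1"
  define N where "N = max (max N1 N2) (nat \<lceil>2 * Q + 1\<rceil>)"
  show ?thesis
  proof (rule that[of C N])
    show "0 < C" unfolding C_def using K4 K Q_nonneg by (intro add_nonneg_pos add_nonneg_nonneg mult_nonneg_nonneg) auto
    show "1 \<le> N" using K(3) by (simp add: N_def)
    fix n \<nu> \<Psi> assume n: "N \<le> n" and \<nu>: "\<nu> \<in> annulus n" and eig: "T4_eigenfunction q \<alpha> \<nu> \<Psi>"
    have n': "N1 \<le> n" "N2 \<le> n" "2 * Q + 1 \<le> real n" "1 \<le> n" using n K(3) unfolding N_def by linarith+
    define h where "h = 1 / sqrt (real n)"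
    have "1 \<le> sqrt (real n)" using n'(4) by simp
    moreover then have "sqrt (real n) * 1 \<le> sqrt (real n) * sqrt (real n)" by (intro mult_left_mono) auto
    ultimately have h: "0 < h" "h \<le> 1" "1 / real n \<le> h" unfolding h_def using n'(4) by (auto simp: frac_le)
    obtain \<rho> where \<rho>: "\<nu> = \<rho>\<^sup>2" "cmod (\<rho> - of_real (rn n)) \<le> K * h"
      using K(4)[OF n'(1)] \<nu> by (auto simp: annulus_def h_def)
    define \<delta> where "\<delta> = \<rho> - of_real (rn n)"
    have \<delta>: "cmod \<delta> \<le> K * h" "cmod \<delta> \<le> 1" using \<rho>(2) K(2)[OF n'(1)] by (auto simp: \<delta>_def h_def)
    have \<rho>\<delta>: "\<rho> = of_real (rn n) + \<delta>" by (simp add: \<delta>_def)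
    have rb: "real n \<le> cmod \<rho>"
    proof -
      have "rn n - 1 \<le> cmod \<rho>" using norm_triangle_ineq3[of \<rho> "of_real (rn n)"] \<delta>(2) rn_pos[of n] by (simp add: \<delta>_def)
      moreover have "(real n + 1) * 1 \<le> rn n" unfolding rn_def using pi_gt3 n'(4) by (intro mult_mono) auto
      ultimately show ?thesis by simp
    qed
    have rQ: "2 * Q + 1 \<le> cmod \<rho>" using rb n' by linarith
    have r0: "0 < cmod \<rho>" "\<rho> \<noteq> 0" using rb n'(4) by auto
    have rh: "1 / cmod \<rho> \<le> h" using rb n'(4) h(3) by (intro order_trans[OF _ h(3)] frac_le) auto
    have Im: "\<bar>Im \<rho>\<bar> \<le> 1" using abs_Im_le_cmod[of \<delta>] \<delta>(2) by (simp add: \<rho>\<delta>)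
    have eI: "exp (\<bar>Im \<rho>\<bar> * x) \<le> ?e" if "x \<in> {0..1}" for x
      using mult_mono[OF Im, of x 1] that by simp
    obtain v where v: "sys (\<lambda>t. q t - \<rho>\<^sup>2) (\<lambda>t. 0) \<Psi> v" and bc: "v 0 + v 1 = 0" "\<Psi> 0 + \<alpha> * \<Psi> 1 = 0"
      and e0: "ext01 \<Psi> = \<Psi>" "\<Psi> \<noteq> 0" using eig unfolding eigenfunction_iff \<rho>(1) by blast
    define a b \<beta> where "a = \<Psi> 0" and "b = v 0" and "\<beta> = v 0 / \<rho>"
    have nb: "cmod b / cmod \<rho> = cmod \<beta>" "b = \<beta> * \<rho>" using r0 by (simp_all add: \<beta>_def b_def norm_divide)
    define c s1 where "c = ych (\<rho>\<^sup>2) 1 0 0 1" and "s1 = ych (\<rho>\<^sup>2) 0 1 0 1"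
    have c1: "cmod (c - cos \<rho>) \<le> 2 * Q * ?e * h"
    proof -
      have "cmod (c - cos \<rho>) \<le> 2 * Q / cmod \<rho> * exp (\<bar>Im \<rho>\<bar> * 1)"
        using first_order[OF sol_sys[of "\<rho>\<^sup>2" 1 0] rQ, of 1] by (simp add: chain_sys free_def c_def)
      also have "\<dots> = 2 * Q * exp (\<bar>Im \<rho>\<bar> * 1) * (1 / cmod \<rho>)" by simp
      also have "\<dots> \<le> 2 * Q * ?e * h" using eI[of 1] rh Q_nonneg by (intro mult_mono) auto
      finally show ?thesis .
    qed
    have s1b: "cmod (\<rho> * s1) \<le> (?e * K + 2 * Q * ?e) * h"
    proof -
      have "cmod (s1 - sin \<rho> / \<rho>) \<le> 2 * Q * (1 / cmod \<rho>) / cmod \<rho> * exp (\<bar>Im \<rho>\<bar> * 1)"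
        using first_order[OF sol_sys[of "\<rho>\<^sup>2" 0 1] rQ, of 1] by (simp add: chain_sys free_def s1_def)
      then have "cmod \<rho> * cmod (s1 - sin \<rho> / \<rho>) \<le> cmod \<rho> * (2 * Q * (1 / cmod \<rho>) / cmod \<rho> * exp (\<bar>Im \<rho>\<bar> * 1))" by (intro mult_left_mono) auto
      also have "\<dots> = 2 * Q * exp (\<bar>Im \<rho>\<bar> * 1) * (1 / cmod \<rho>)" using r0 by simp
      also have "\<dots> \<le> 2 * Q * ?e * h" using eI[of 1] rh Q_nonneg by (intro mult_mono) auto
      also have "cmod \<rho> * cmod (s1 - sin \<rho> / \<rho>) = cmod (\<rho> * s1 - sin \<rho>)"
        unfolding norm_mult[symmetric] right_diff_distrib using r0 by simp
      finally have 1: "cmod (\<rho> * s1 - sin \<rho>) \<le> 2 * Q * ?e * h" .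
      have "sin \<rho> = - sin \<delta>" unfolding \<rho>\<delta> sin_add sin_of_real cos_of_real sin_rn cos_rn by simp
      moreover have "cmod (sin \<delta> - sin 0) \<le> ?e * cmod (\<delta> - 0)" using abs_Im_le_cmod[of \<delta>] \<delta>(2) by (intro sin_lipschitz) auto
      ultimately have "cmod (sin \<rho>) \<le> ?e * cmod \<delta>" by simp
      also have "\<dots> \<le> ?e * (K * h)" using \<delta>(1) by (intro mult_left_mono) auto
      finally show ?thesis using 1 norm_triangle_sub[of "\<rho> * s1" "sin \<rho>"] by (simp add: algebra_simps)
    qed
    have den: "cmod (1 - \<alpha>) / 2 \<le> cmod (1 + \<alpha> * c)"
    proof -
      have "cos \<rho> = - cos \<delta>" unfolding \<rho>\<delta> cos_add sin_of_real cos_of_real sin_rn cos_rn by simp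
      moreover have "cmod (1 - cos \<delta>) \<le> 4 * cmod \<delta>"
      proof -
        have "cmod (1 - cos \<delta>) \<le> cmod (1 - cos \<delta> - \<delta>\<^sup>2 / 2) + cmod (\<delta>\<^sup>2 / 2)" using norm_triangle_ineq[of "1 - cos \<delta> - \<delta>\<^sup>2 / 2" "\<delta>\<^sup>2 / 2"] by simp
        also have "\<dots> \<le> ?e * cmod \<delta> ^ 4 + cmod \<delta> ^ 2 / 2" using cos_cubic[OF \<delta>(2)] by (simp add: norm_divide norm_power)
        also have "\<dots> \<le> ?e * cmod \<delta> ^ 1 + cmod \<delta> ^ 1 / 2" using \<delta>(2) by (intro add_mono mult_left_mono divide_right_mono power_decreasing) auto
        also have "\<dots> \<le> 4 * cmod \<delta>" using mult_right_mono[OF exp_le, of "cmod \<delta>"] norm_ge_zero[of \<delta>] by (simp, linarith)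
        finally show ?thesis .
      qed
      ultimately have "cmod (1 + cos \<rho>) \<le> 4 * (K * h)" using \<delta>(1) by simp
      then have "cmod (1 + c) \<le> 4 * (K * h) + 2 * Q * ?e * h" using c1 norm_triangle_ineq[of "1 + cos \<rho>" "c - cos \<rho>"] by simp
      then have "cmod \<alpha> * cmod (1 + c) \<le> cmod \<alpha> * (4 * (K * h) + 2 * Q * ?e * h)" by (intro mult_left_mono) auto
      also have "\<dots> = M * h" by (simp add: M_def algebra_simps)
      also have "\<dots> \<le> cmod (1 - \<alpha>) / 2" using N2(2)[OF n'(2)] by (simp add: h_def)
      finally have "cmod (\<alpha> * (1 + c)) \<le> cmod (1 - \<alpha>) / 2" by (simp add: norm_mult)
      moreover have "1 - \<alpha> = (1 + \<alpha> * c) - \<alpha> * (1 + c)" by (simp add: algebra_simps)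
      then have "cmod (1 - \<alpha>) \<le> cmod (1 + \<alpha> * c) + cmod (\<alpha> * (1 + c))" by (metis norm_triangle_ineq4)
      ultimately show ?thesis by linarith
    qed
    have ab: "cmod a \<le> K4 * h * cmod \<beta>"
    proof -
      have "a * (1 + \<alpha> * c) = - (\<alpha> * (\<beta> * (\<rho> * s1)))"
      proof -
        have "\<Psi> 1 = a * c + \<beta> * (\<rho> * s1)" using sys_sol(1)[OF v, of 1] r0 by (simp add: a_def c_def s1_def \<beta>_def mult_ac)
        then have "a + \<alpha> * (a * c + \<beta> * (\<rho> * s1)) = 0" using bc(2) by (simp add: a_def)
        then show ?thesis by (simp add: algebra_simps eq_neg_iff_add_eq_0)
      qed
      then have "cmod a * cmod (1 + \<alpha> * c) = cmod \<alpha> * (cmod \<beta> * cmod (\<rho> * s1))" by (metis norm_minus_cancel norm_mult)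
      moreover have "cmod a * (cmod (1 - \<alpha>) / 2) \<le> cmod a * cmod (1 + \<alpha> * c)" using den by (intro mult_left_mono) auto
      moreover have "cmod \<alpha> * (cmod \<beta> * cmod (\<rho> * s1)) \<le> cmod \<alpha> * (cmod \<beta> * ((?e * K + 2 * Q * ?e) * h))" using s1b by (intro mult_left_mono) auto
      ultimately have "cmod a * (cmod (1 - \<alpha>) / 2) \<le> cmod \<alpha> * (cmod \<beta> * ((?e * K + 2 * Q * ?e) * h))" by linarith
      then have "cmod a \<le> cmod \<alpha> * (cmod \<beta> * ((?e * K + 2 * Q * ?e) * h)) / (cmod (1 - \<alpha>) / 2)" using a1 by (simp add: pos_le_divide_eq)
      also have "\<dots> = K4 * h * cmod \<beta>" using a1 by (simp add: K4_def field_simps)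
      finally show ?thesis .
    qed
    have "\<beta> \<noteq> 0"
    proof
      assume "\<beta> = 0"
      then have "\<Psi> 0 = 0" "v 0 = 0" using ab r0 by (auto simp: a_def \<beta>_def)
      then have "\<Psi> x = 0" if "x \<in> {0..1}" for x using sys_unique_zero(1)[OF shifted_absint v _ _ that] by simp
      then have "\<Psi> = 0" using e0(1) by (metis ext01_def ext zero_fun_apply)
      then show False using e0 by simp
    qed
    moreover have "cmod (\<Psi> x - \<beta> * of_real (sin (rn n * x))) \<le> cmod \<beta> * (C / sqrt (real n))" if x: "x \<in> {0..1}" for x
    proof -
      have "cmod (\<Psi> x - free \<rho> a b x) \<le> 2 * Q * (cmod a + cmod \<beta>) / cmod \<rho> * exp (\<bar>Im \<rho>\<bar> * x)"
        using first_order[OF v rQ x] nb by (simp add: a_def b_def)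
      also have "\<dots> = 2 * Q * (cmod a + cmod \<beta>) * exp (\<bar>Im \<rho>\<bar> * x) * (1 / cmod \<rho>)" by simp
      also have "\<dots> \<le> 2 * Q * ((K4 + 1) * cmod \<beta>) * ?e * h"
      proof -
        have "K4 * h * cmod \<beta> \<le> K4 * 1 * cmod \<beta>" using K4 h by (intro mult_right_mono mult_left_mono) auto
        then have "cmod a + cmod \<beta> \<le> (K4 + 1) * cmod \<beta>" using ab by (simp add: algebra_simps)
        then show ?thesis using eI[OF x] rh Q_nonneg K4 by (intro mult_mono mult_nonneg_nonneg) auto
      qed
      finally have 1: "cmod (\<Psi> x - free \<rho> a b x) \<le> 2 * Q * ((K4 + 1) * cmod \<beta>) * ?e * h" .
      have fr: "free \<rho> a b x - \<beta> * of_real (sin (rn n * x)) = a * cos (\<rho> * of_real x) + \<beta> * (sin (\<rho> * of_real x) - sin (of_real (rn n * x)))"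
        using r0 by (simp add: free_def nb(2) sin_of_real[symmetric] algebra_simps)
      have 2: "cmod (a * cos (\<rho> * of_real x)) \<le> (K4 * h * cmod \<beta>) * ?e"
      proof -
        have "0 \<le> x" using x by simp
        then have "cmod (cos (\<rho> * of_real x)) \<le> ?e" using trig_growth(2)[of x \<rho>] order_trans[OF _ eI[OF x]] by blast
        then show ?thesis unfolding norm_mult using ab K4 h by (intro mult_mono) auto
      qed
      have "cmod (sin (\<rho> * of_real x) - sin (of_real (rn n * x))) \<le> ?e * cmod (\<rho> * of_real x - of_real (rn n * x))"
        using mult_mono[OF Im, of x 1] x by (intro sin_lipschitz) (auto simp: abs_mult)
      also have "\<rho> * of_real x - of_real (rn n * x) = \<delta> * of_real x" by (simp add: \<delta>_def algebra_simps)
      also have "?e * cmod (\<delta> * of_real x) \<le> ?e * (K * h * 1)" unfolding norm_mult using \<delta>(1) x K h by (intro mult_left_mono mult_mono) auto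
      finally have "cmod (sin (\<rho> * of_real x) - sin (of_real (rn n * x))) \<le> ?e * (K * h)" by simp
      then have 3: "cmod (\<beta> * (sin (\<rho> * of_real x) - sin (of_real (rn n * x)))) \<le> cmod \<beta> * (?e * (K * h))"
        unfolding norm_mult by (intro mult_left_mono) auto
      have "cmod (\<Psi> x - \<beta> * of_real (sin (rn n * x))) \<le> cmod (\<Psi> x - free \<rho> a b x) + cmod (free \<rho> a b x - \<beta> * of_real (sin (rn n * x)))"
        using norm_triangle_ineq[of "\<Psi> x - free \<rho> a b x" "free \<rho> a b x - \<beta> * of_real (sin (rn n * x))"] by simp
      also have "\<dots> \<le> 2 * Q * ((K4 + 1) * cmod \<beta>) * ?e * h + ((K4 * h * cmod \<beta>) * ?e + cmod \<beta> * (?e * (K * h)))"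
        unfolding fr using 1 2 3 norm_triangle_ineq[of "a * cos (\<rho> * of_real x)" "\<beta> * (sin (\<rho> * of_real x) - sin (of_real (rn n * x)))"] by linarith
      also have "\<dots> = cmod \<beta> * ((C - 1) * h)" by (simp add: C_def algebra_simps)
      also have "\<dots> \<le> cmod \<beta> * (C * h)" using h by (intro mult_left_mono mult_right_mono) auto
      finally show ?thesis by (simp add: h_def)
    qed
    ultimately show "\<exists>\<beta>. \<beta> \<noteq> 0 \<and> (\<forall>x\<in>{0..1}. cmod (\<Psi> x - \<beta> * of_real (sin (rn n * x))) \<le> cmod \<beta> * (C / sqrt (real n)))" by blast
  qed
qed

end

section \<open>Estimates for Riesz bases\<close>

lemma L2_product: "f \<in> L2_01 \<Longrightarrow> g \<in> L2_01 \<Longrightarrow> integrable I01 (\<lambda>x. f x * cnj (g x))"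
proof -
  assume f: "f \<in> L2_01" and g: "g \<in> L2_01"
  have le: "cmod (a * cnj b) \<le> (cmod a)\<^sup>2 + (cmod b)\<^sup>2" for a b
  proof -
    have "0 \<le> cmod a * cmod b" by simp
    then show ?thesis using sum_squares_bound[of "cmod a" "cmod b"] unfolding norm_mult complex_mod_cnj by linarith
  qed
  have "(\<lambda>x. cnj (g x)) \<in> borel_measurable I01"
    by (rule measurable_compose[OF _ borel_measurable_continuous_onI]) (use g in \<open>auto simp: L2_01_def intro!: continuous_intros\<close>)
  then have m: "(\<lambda>x. f x * cnj (g x)) \<in> borel_measurable I01" using f by (auto simp: L2_01_def)
  show ?thesis
    by (rule Bochner_Integration.integrable_bound[OF Bochner_Integration.integrable_add[of I01 "\<lambda>x. (cmod (f x))\<^sup>2" "\<lambda>x. (cmod (g x))\<^sup>2"]])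
      (use f g le m in \<open>auto simp: L2_01_def\<close>)
qed

lemma L2_add: "f \<in> L2_01 \<Longrightarrow> g \<in> L2_01 \<Longrightarrow> (\<lambda>x. f x + g x) \<in> L2_01"
proof -
  assume f: "f \<in> L2_01" and g: "g \<in> L2_01"
  have le: "(cmod (a + b))\<^sup>2 \<le> 2 * (cmod a)\<^sup>2 + 2 * (cmod b)\<^sup>2" for a b
    using power_mono[OF norm_triangle_ineq[of a b], of 2] sum_squares_bound[of "cmod a" "cmod b"] by (simp add: power2_sum)
  have "integrable I01 (\<lambda>x. (cmod (f x + g x))\<^sup>2)"
    by (rule Bochner_Integration.integrable_bound[OF Bochner_Integration.integrable_add[of I01 "\<lambda>x. 2 * (cmod (f x))\<^sup>2" "\<lambda>x. 2 * (cmod (g x))\<^sup>2"]])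
      (use f g le in \<open>auto simp: L2_01_def\<close>)
  then show ?thesis using f g by (auto simp: L2_01_def)
qed

lemma L2_cmult: "f \<in> L2_01 \<Longrightarrow> (\<lambda>x. c * f x) \<in> L2_01"
  by (auto simp: L2_01_def norm_mult power_mult_distrib)

lemma L2_zero: "(\<lambda>x. 0) \<in> L2_01" by (simp add: L2_01_def)

lemma L2_sum: "(\<And>i. i < N \<Longrightarrow> f i \<in> L2_01) \<Longrightarrow> (\<lambda>x. \<Sum>i<(N::nat). c i * f i x) \<in> L2_01"
  by (induction N) (auto intro!: L2_zero L2_add L2_cmult)

lemma L2_norm_square: "(L2_norm f)\<^sup>2 = (LINT x|I01. (cmod (f x))\<^sup>2)"
  unfolding L2_norm_def by (intro real_sqrt_pow2 integral_nonneg_AE) auto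

lemma L2_norm_nonneg: "0 \<le> L2_norm f"
  unfolding L2_norm_def by (intro real_sqrt_ge_zero integral_nonneg_AE) auto

lemma L2_norm_cmult: "L2_norm (\<lambda>x. c * f x) = cmod c * L2_norm f"
  by (simp add: L2_norm_def norm_mult power_mult_distrib real_sqrt_mult)

lemma L2_norm_cong: "f \<in> L2_01 \<Longrightarrow> g \<in> L2_01 \<Longrightarrow> L2_eq f g \<Longrightarrow> L2_norm f = L2_norm g"
  unfolding L2_norm_def L2_eq_def
  by (intro arg_cong[of _ _ sqrt] integral_cong_AE) (auto simp: L2_01_def)

lemma L2_norm_add:
  assumes f: "f \<in> L2_01" and g: "g \<in> L2_01"
  shows "(L2_norm (\<lambda>x. f x + g x))\<^sup>2 = (L2_norm f)\<^sup>2 + (L2_norm g)\<^sup>2 + 2 * Re (L2_inner f g)"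
proof -
  have "(cmod (a + b))\<^sup>2 = ((cmod a)\<^sup>2 + (cmod b)\<^sup>2) + 2 * Re (a * cnj b)" for a b
    unfolding cmod_power2 by (simp add: power2_eq_square algebra_simps)
  then have "(L2_norm (\<lambda>x. f x + g x))\<^sup>2 = (LINT x|I01. ((cmod (f x))\<^sup>2 + (cmod (g x))\<^sup>2) + 2 * Re (f x * cnj (g x)))"
    unfolding L2_norm_square by (simp only:)
  also have "\<dots> = (LINT x|I01. (cmod (f x))\<^sup>2 + (cmod (g x))\<^sup>2) + (LINT x|I01. 2 * Re (f x * cnj (g x)))"
    using f g L2_product[OF f g] by (intro Bochner_Integration.integral_add Bochner_Integration.integrable_add integrable_mult_right integrable_Re) (auto simp: L2_01_def)
  also have "(LINT x|I01. (cmod (f x))\<^sup>2 + (cmod (g x))\<^sup>2) = (L2_norm f)\<^sup>2 + (L2_norm g)\<^sup>2"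
    unfolding L2_norm_square using f g by (intro Bochner_Integration.integral_add) (auto simp: L2_01_def)
  also have "(LINT x|I01. 2 * Re (f x * cnj (g x))) = 2 * Re (L2_inner f g)"
    unfolding L2_inner_def unfolding integral_Re[OF L2_product[OF f g], symmetric] by (rule integral_mult_right_zero)
  finally show ?thesis .
qed

lemma L2_inner_self: "L2_inner f f = of_real ((L2_norm f)\<^sup>2)"
  unfolding L2_inner_def L2_norm_square complex_norm_square[symmetric] by (rule integral_complex_of_real)

lemma L2_inner_sum:
  fixes N :: nat
  assumes "\<And>i. i < N \<Longrightarrow> f i \<in> L2_01" "g \<in> L2_01"
  shows "L2_inner (\<lambda>x. \<Sum>i<N. c i * f i x) g = (\<Sum>i<N. c i * L2_inner (f i) g)"
proof -
  have "L2_inner (\<lambda>x. \<Sum>i<N. c i * f i x) g = (LINT x|I01. (\<Sum>i<N. c i * (f i x * cnj (g x))))"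
    unfolding L2_inner_def by (simp add: sum_distrib_right mult.assoc)
  also have "\<dots> = (\<Sum>i<N. (LINT x|I01. c i * (f i x * cnj (g x))))"
    using assms L2_product by (intro Bochner_Integration.integral_sum integrable_mult_right) auto
  finally show ?thesis by (simp add: L2_inner_def)
qed

text \<open>
  Three consequences of the bounded invertible map \<open>A\<close> onto the basis: boundedness, a
  lower bound for combinations of two elements by applying the inverse, and completeness. For the
  last one, an element \<open>f\<close> orthogonal to the basis is at least as far from any finite
  combination as its own norm, by Pythagoras; but finite combinations come arbitrarily close.
\<close>

lemma riesz_basis_estimates:
  assumes riesz: "L2_riesz_basis \<phi>" and \<phi>: "\<And>i. \<phi> i \<in> L2_01"
  obtains K where "0 < K" "\<And>i. L2_norm (\<phi> i) \<le> K"
    "\<And>i j a b. i \<noteq> j \<Longrightarrow> (cmod a)\<^sup>2 + (cmod b)\<^sup>2 \<le> (K * L2_norm (\<lambda>x. a * \<phi> i x + b * \<phi> j x))\<^sup>2"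
    "\<And>f. f \<in> L2_01 \<Longrightarrow> (\<And>i. L2_inner (\<phi> i) f = 0) \<Longrightarrow> L2_norm f = 0"
proof -
  obtain e A B where e: "L2_orthonormal_basis e" and A: "L2_bounded_linear A" and B: "L2_bounded_linear B"
    and inv: "\<And>f. f \<in> L2_01 \<Longrightarrow> L2_eq (A (B f)) f" "\<And>f. f \<in> L2_01 \<Longrightarrow> L2_eq (B (A f)) f"
    and \<phi>A: "\<And>i. L2_eq (\<phi> i) (A (e i))" using riesz unfolding L2_riesz_basis_def by blast
  note e' = e[unfolded L2_orthonormal_basis_def]
  have e2: "\<And>i. e i \<in> L2_01" by (rule e'[THEN conjunct1, rule_format])
  have ip: "\<And>i j. L2_inner (e i) (e j) = (if i = j then 1 else 0)" by (rule e'[THEN conjunct2, THEN conjunct1, rule_format])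
  note dense = e'[THEN conjunct2, THEN conjunct2, rule_format]
  note A' = A[unfolded L2_bounded_linear_def] and B' = B[unfolded L2_bounded_linear_def]
  have A2: "\<And>f. f \<in> L2_01 \<Longrightarrow> A f \<in> L2_01" by (rule A'[THEN conjunct1, rule_format])
  have B2: "\<And>f. f \<in> L2_01 \<Longrightarrow> B f \<in> L2_01" by (rule B'[THEN conjunct1, rule_format])
  note Aadd = A'[THEN conjunct2, THEN conjunct1, rule_format, unfolded L2_eq_def]
  note Amul = A'[THEN conjunct2, THEN conjunct2, THEN conjunct1, rule_format, unfolded L2_eq_def]
  obtain KA where KA: "\<And>f. f \<in> L2_01 \<Longrightarrow> L2_norm (A f) \<le> KA * L2_norm f" using A'[THEN conjunct2, THEN conjunct2, THEN conjunct2] by blast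
  obtain KB where KB: "\<And>f. f \<in> L2_01 \<Longrightarrow> L2_norm (B f) \<le> KB * L2_norm f" using B'[THEN conjunct2, THEN conjunct2, THEN conjunct2] by blast
  define K where "K = max 1 (max KA KB)"
  have K: "0 < K" by (simp add: K_def)
  have KA': "L2_norm (A f) \<le> K * L2_norm f" if "f \<in> L2_01" for f
    using KA[OF that] L2_norm_nonneg[of f] by (intro order_trans[OF KA[OF that]] mult_right_mono) (auto simp: K_def)
  have KB': "L2_norm (B f) \<le> K * L2_norm f" if "f \<in> L2_01" for f
    using KB[OF that] L2_norm_nonneg[of f] by (intro order_trans[OF KB[OF that]] mult_right_mono) (auto simp: K_def)
  have e1: "(L2_norm (e i))\<^sup>2 = 1" for i
  proof -
    have "complex_of_real ((L2_norm (e i))\<^sup>2) = 1" using ip[of i i] unfolding L2_inner_self by simp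
    then show ?thesis unfolding of_real_eq_1_iff .
  qed
  then have e1': "L2_norm (e i) = 1" for i using L2_norm_nonneg[of "e i"] e1[of i] unfolding power2_eq_1_iff by linarith
  show ?thesis
  proof (rule that[OF K])
    show "L2_norm (\<phi> i) \<le> K" for i
      using KA'[OF e2[of i]] L2_norm_cong[OF \<phi> A2[OF e2] \<phi>A] by (simp add: e1')
  next
    fix i j :: nat and a b assume ij: "i \<noteq> j"
    let ?g = "\<lambda>x. a * e i x + b * e j x"
    have g: "?g \<in> L2_01" by (intro L2_add L2_cmult e2)
    have "(L2_norm ?g)\<^sup>2 = (cmod a)\<^sup>2 + (cmod b)\<^sup>2 + 2 * Re (L2_inner (\<lambda>x. a * e i x) (\<lambda>x. b * e j x))"
      unfolding L2_norm_add[OF L2_cmult[OF e2] L2_cmult[OF e2]] by (simp add: L2_norm_cmult e1')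
    also have "L2_inner (\<lambda>x. a * e i x) (\<lambda>x. b * e j x) = a * cnj b * L2_inner (e i) (e j)"
    proof -
      have "(LINT x|I01. a * e i x * cnj (b * e j x)) = (LINT x|I01. (a * cnj b) * (e i x * cnj (e j x)))"
        by (rule Bochner_Integration.integral_cong) (auto simp: algebra_simps)
      also have "\<dots> = (a * cnj b) * (LINT x|I01. e i x * cnj (e j x))" by (rule integral_mult_right_zero)
      finally show ?thesis unfolding L2_inner_def .
    qed
    finally have n: "(L2_norm ?g)\<^sup>2 = (cmod a)\<^sup>2 + (cmod b)\<^sup>2" using ij by (simp add: ip)
    have "AE x in I01. A ?g x = a * \<phi> i x + b * \<phi> j x"
      using Aadd[OF L2_cmult[OF e2, of a i] L2_cmult[OF e2, of b j]] Amul[OF e2, of a i] Amul[OF e2, of b j] \<phi>A[of i] \<phi>A[of j]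
      unfolding L2_eq_def by eventually_elim simp
    then have eq: "L2_norm (A ?g) = L2_norm (\<lambda>x. a * \<phi> i x + b * \<phi> j x)"
      by (intro L2_norm_cong A2[OF g] L2_add L2_cmult \<phi>) (simp add: L2_eq_def)
    have "L2_norm ?g = L2_norm (B (A ?g))" using L2_norm_cong[OF B2[OF A2[OF g]] g inv(2)[OF g]] by simp
    also have "\<dots> \<le> K * L2_norm (\<lambda>x. a * \<phi> i x + b * \<phi> j x)" using KB'[OF A2[OF g]] eq by simp
    finally show "(cmod a)\<^sup>2 + (cmod b)\<^sup>2 \<le> (K * L2_norm (\<lambda>x. a * \<phi> i x + b * \<phi> j x))\<^sup>2"
      unfolding n[symmetric] using L2_norm_nonneg by (rule power_mono)
  next
    fix f assume f: "f \<in> L2_01" and orth: "\<And>i. L2_inner (\<phi> i) f = 0"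
    have small: "L2_norm f \<le> K * \<epsilon>" if \<epsilon>: "0 < \<epsilon>" for \<epsilon>
    proof -
      obtain N :: nat and c where Nc: "L2_norm (\<lambda>x. B f x - (\<Sum>i<N. c i * e i x)) < \<epsilon>" using dense[OF B2[OF f] \<epsilon>] by blast
      \<comment> \<open>\<open>A\<close> maps the remainder of the expansion of \<open>B f\<close> to the remainder of the expansion of \<open>f\<close>.\<close>
      let ?r = "\<lambda>M x. B f x + (\<Sum>i<M. (- c i) * e i x)"
      have r: "?r M \<in> L2_01" for M by (intro L2_add B2[OF f] L2_sum e2)
      have "AE x in I01. A (?r M) x = A (B f) x + (\<Sum>i<M. (- c i) * \<phi> i x)" for M
      proof (induction M)
        case (Suc M)
        have "?r (Suc M) = (\<lambda>x. ?r M x + (- c M) * e M x)" by (auto simp: fun_eq_iff)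
        then have "AE x in I01. A (?r (Suc M)) x = A (?r M) x + A (\<lambda>x. (- c M) * e M x) x"
          using Aadd[OF r[of M] L2_cmult[OF e2, of "- c M" M]] by (simp only:)
        then show ?case using Suc Amul[OF e2, of "- c M" M] \<phi>A[of M] unfolding L2_eq_def by eventually_elim simp
      qed simp
      from this[of N] have "AE x in I01. A (?r N) x = f x + (\<Sum>i<N. (- c i) * \<phi> i x)"
        using inv(1)[OF f] unfolding L2_eq_def by eventually_elim simp
      then have "L2_norm (A (?r N)) = L2_norm (\<lambda>x. f x + (\<Sum>i<N. (- c i) * \<phi> i x))"
        by (intro L2_norm_cong A2[OF r] L2_add f L2_sum \<phi>) (simp add: L2_eq_def)
      then have "L2_norm (\<lambda>x. (\<Sum>i<N. (- c i) * \<phi> i x) + f x) \<le> K * L2_norm (?r N)" using KA'[OF r[of N]] by (simp add: add.commute)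
      also have "\<dots> \<le> K * \<epsilon>" using Nc K by (intro mult_left_mono) (auto simp: sum_negf)
      finally have b: "L2_norm (\<lambda>x. (\<Sum>i<N. (- c i) * \<phi> i x) + f x) \<le> K * \<epsilon>" .
      have "(L2_norm f)\<^sup>2 \<le> (L2_norm (\<lambda>x. (\<Sum>i<N. (- c i) * \<phi> i x) + f x))\<^sup>2"
        unfolding L2_norm_add[OF L2_sum[OF \<phi>] f] L2_inner_sum[OF \<phi> f] by (simp add: orth)
      then show ?thesis using order_trans[OF power2_le_imp_le[OF _ L2_norm_nonneg] b] by blast
    qed
    have "L2_norm f \<le> 0"
    proof (rule field_le_epsilon)
      fix d :: real assume "0 < d"
      then show "L2_norm f \<le> 0 + d" using small[of "d / K"] K by simp
    qed
    then show "L2_norm f = 0" using L2_norm_nonneg[of f] by simp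
  qed
qed

section \<open>Root functions that form no Riesz basis\<close>

lemma continuous_in_L2: "continuous_on {0..1} f \<Longrightarrow> f \<in> L2_01"
  by (rule L2_01_AE_continuous[of "{}"]) auto

lemma L2_norm_zero_continuous:
  assumes f: "continuous_on {0..1} f" and z: "L2_norm f = 0" and x: "x \<in> {0..1}" shows "f x = 0"
proof -
  have "integral {0..1} (\<lambda>x. (cmod (f x))\<^sup>2) = 0" using L2_norm_continuous[OF f] z by simp
  moreover have "continuous_on {0..1} (\<lambda>x. (cmod (f x))\<^sup>2)" using f by (intro continuous_intros)
  ultimately have "\<forall>x\<in>{0..1}. (cmod (f x))\<^sup>2 = 0" using integral_eq_0_iff[of 0 1 "\<lambda>x. (cmod (f x))\<^sup>2"] by simp
  then show ?thesis using x by simp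
qed

context bvp0 begin

lemma eigenfunction_unique_eigenvalue:
  assumes "T4_eigenfunction q \<alpha> \<nu> y" "T4_eigenfunction q \<alpha> \<mu> y" shows "\<nu> = \<mu>"
proof (rule ccontr)
  assume ne: "\<nu> \<noteq> \<mu>"
  obtain v where v: "sys (\<lambda>t. q t - \<nu>) (\<lambda>t. 0) y v" and y: "ext01 y = y" "y \<noteq> 0" using assms(1) unfolding eigenfunction_iff by blast
  obtain w where w: "sys (\<lambda>t. q t - \<mu>) (\<lambda>t. 0) y w" using assms(2) unfolding eigenfunction_iff by blast
  have w': "sys (\<lambda>t. q t - \<nu>) (\<lambda>t. (\<nu> - \<mu>) * y t) y w" by (rule sys_cong[OF w]) (auto simp: algebra_simps)
  have c: "continuous_on {0..1} (\<lambda>t. (\<nu> - \<mu>) * y t - 0)" using sys_continuous(1)[OF v] by (intro continuous_intros)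
  have "(\<nu> - \<mu>) * y x - 0 = 0" if "x \<in> {0..1}" for x
    by (rule sys_rhs_zero(2)[OF sys_diff[OF w' v] c _ that]) simp
  then have "ext01 y x = 0" for x using ne by (auto simp: ext01_def)
  then show False using y by (metis ext zero_fun_apply)
qed

lemma eigenfunction_in_root_space: "T4_eigenfunction q \<alpha> \<nu> y \<Longrightarrow> y \<in> T4_root_space q \<alpha> \<nu>"
proof -
  assume y: "T4_eigenfunction q \<alpha> \<nu> y"
  then have "L2_eq (\<lambda>x. sl_expr q y x - \<nu> * y x) 0"
    unfolding T4_eigenfunction_def L2_eq_def by (auto elim: eventually_mono)
  then have "y \<in> T4_kernel_power q \<alpha> \<nu> (Suc 0)" using y by (auto simp: T4_eigenfunction_def)
  then show ?thesis unfolding T4_root_space_def by blast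
qed

text \<open>A one-dimensional root space is spanned by any eigenfunction.\<close>

lemma simple_root_function:
  assumes m: "T4_alg_mult q \<alpha> \<nu> = 1" and \<Delta>: "\<Delta> \<nu> = 0" and y: "y \<in> T4_root_space q \<alpha> \<nu>" "y \<noteq> 0"
  shows "T4_eigenfunction q \<alpha> \<nu> y"
proof -
  obtain \<psi> where \<psi>: "T4_eigenfunction q \<alpha> \<nu> \<psi>" using \<Delta> eigenvalue_iff[of \<nu>] by (auto simp: T4_eigenvalues_def)
  obtain b where b: "T4_root_space q \<alpha> \<nu> \<subseteq> cfun.span b" "card b = cfun.dim (T4_root_space q \<alpha> \<nu>)"
    by (rule cfun.basis_exists[of "T4_root_space q \<alpha> \<nu>"])
  obtain u where "b = {u}" using b(2) m unfolding T4_alg_mult_def by (auto simp: card_1_singleton_iff)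
  then have u: "\<exists>c. f = (\<lambda>x. c * u x)" if "f \<in> T4_root_space q \<alpha> \<nu>" for f
    using b(1) that by (auto simp: cfun.span_singleton)
  obtain c1 where c1: "y = (\<lambda>x. c1 * u x)" using u[OF y(1)] by blast
  obtain c2 where c2: "\<psi> = (\<lambda>x. c2 * u x)" using u[OF eigenfunction_in_root_space[OF \<psi>]] by blast
  have "\<psi> \<noteq> 0" using \<psi> unfolding T4_eigenfunction_def by blast
  then have "c2 \<noteq> 0" using c2 by (auto simp: fun_eq_iff)
  define k where "k = c1 / c2"
  have yk: "y = (\<lambda>x. k * \<psi> x)" using c1 c2 \<open>c2 \<noteq> 0\<close> by (simp add: k_def)
  obtain v where v: "sys (\<lambda>t. q t - \<nu>) (\<lambda>t. 0) \<psi> v" "v 0 + v 1 = 0" "\<psi> 0 + \<alpha> * \<psi> 1 = 0" and e: "ext01 \<psi> = \<psi>"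
    using \<psi> unfolding eigenfunction_iff by blast
  have s: "sys (\<lambda>t. q t - \<nu>) (\<lambda>t. 0) y (\<lambda>t. k * v t)" using sys_cmult[OF v(1), of k] unfolding yk by simp
  have "k * v 0 + k * v 1 = 0" using v(2) by (metis distrib_left mult_zero_right)
  moreover have "y 0 + \<alpha> * y 1 = k * (\<psi> 0 + \<alpha> * \<psi> 1)" unfolding yk by (simp add: algebra_simps)
  moreover have "ext01 y = y"
  proof
    fix x show "ext01 y x = y x" using fun_cong[OF e, of x] unfolding yk ext01_def by (auto split: if_splits)
  qed
  ultimately show ?thesis unfolding eigenfunction_iff using y(2) s v(3) by (intro conjI exI[of _ "\<lambda>t. k * v t"]) auto
qed

text \<open>Otherwise the conjugate of the adjoint solution would be orthogonal to the whole family.\<close>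

lemma complete_family_meets_root_space:
  assumes \<Delta>: "\<Delta> \<nu> = 0" and \<phi>: "\<And>i. \<phi> i \<in> T4_root_functions q \<alpha>"
    and complete: "\<And>f. f \<in> L2_01 \<Longrightarrow> (\<And>i. L2_inner (\<phi> i) f = 0) \<Longrightarrow> L2_norm f = 0"
  shows "\<exists>i. \<phi> i \<in> T4_root_space q \<alpha> \<nu>"
proof (rule ccontr)
  assume none: "\<not> ?thesis"
  obtain z w where z: "sys (\<lambda>t. q t - \<nu>) (\<lambda>t. 0) z w" "z 0 + z 1 = 0" "w 1 + \<alpha> * w 0 = 0" and nz: "\<exists>x\<in>{0..1}. z x \<noteq> 0"
    by (rule adjoint_solution[OF \<Delta>])
  have zc: "continuous_on {0..1} z" by (rule sys_continuous(1)[OF z(1)])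
  then have cc: "continuous_on {0..1} (\<lambda>x. cnj (z x))" by (intro continuous_intros)
  have "L2_inner (\<phi> i) (\<lambda>x. cnj (z x)) = 0" for i
  proof -
    obtain \<mu> where \<mu>: "\<phi> i \<in> T4_root_space q \<alpha> \<mu>" using \<phi>[of i] by (auto simp: T4_root_functions_def)
    then obtain k where k: "\<phi> i \<in> T4_kernel_power q \<alpha> \<mu> k" by (auto simp: T4_root_space_def)
    have "\<mu> \<noteq> \<nu>" using none \<mu> by blast
    from adjoint_orthogonal[OF z this k] have 0: "integral {0..1} (\<lambda>x. \<phi> i x * z x) = 0" .
    have "(\<lambda>x. \<phi> i x * z x) absolutely_integrable_on {0..1}"
      by (rule absolutely_integrable_continuous_real) (intro continuous_intros kernel_power_continuous[OF k] zc)
    from lebesgue_integral_I01[OF this] 0 show ?thesis by (simp add: L2_inner_def)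
  qed
  then have "L2_norm (\<lambda>x. cnj (z x)) = 0" by (rule complete[OF continuous_in_L2[OF cc]])
  then have "z x = 0" if "x \<in> {0..1}" for x using L2_norm_zero_continuous[OF cc _ that] by simp
  then show False using nz by blast
qed

text \<open>
  For each admissible index the basis contains eigenfunctions \<open>\<phi>\<^sub>1\<close>,
  \<open>\<phi>\<^sub>2\<close> of both eigenvalues, close to \<open>\<beta>\<^sub>1 sin r\<^sub>n
  x\<close> and \<open>\<beta>\<^sub>2 sin r\<^sub>n x\<close>. The combination
  \<open>\<beta>\<^sub>2 \<phi>\<^sub>1 - \<beta>\<^sub>1 \<phi>\<^sub>2\<close> is then too small
  for the lower Riesz bound.
\<close>

lemma no_riesz_basis:
  assumes often: "\<And>T M. \<exists>n\<ge>M. admissible T n" and \<phi>: "\<And>i. \<phi> i \<in> T4_root_functions q \<alpha>"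
  shows "\<not> L2_riesz_basis \<phi>"
proof
  assume R: "L2_riesz_basis \<phi>"
  have cont: "continuous_on {0..1} (\<phi> i)" for i
    using \<phi>[of i] kernel_power_continuous by (auto simp: T4_root_functions_def T4_root_space_def)
  obtain K where K: "0 < K" "\<And>i. L2_norm (\<phi> i) \<le> K"
    "\<And>i j a b. i \<noteq> j \<Longrightarrow> (cmod a)\<^sup>2 + (cmod b)\<^sup>2 \<le> (K * L2_norm (\<lambda>x. a * \<phi> i x + b * \<phi> j x))\<^sup>2"
    "\<And>f. f \<in> L2_01 \<Longrightarrow> (\<And>i. L2_inner (\<phi> i) f = 0) \<Longrightarrow> L2_norm f = 0"
    by (rule riesz_basis_estimates[OF R continuous_in_L2[OF cont]]) blast
  obtain C N1 where C: "0 < C" "1 \<le> N1" and shape: "\<And>n \<nu> \<Psi>. N1 \<le> n \<Longrightarrow> \<nu> \<in> annulus n \<Longrightarrow> T4_eigenfunction q \<alpha> \<nu> \<Psi> \<Longrightarrow>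
       \<exists>\<beta>. \<beta> \<noteq> 0 \<and> (\<forall>x\<in>{0..1}. cmod (\<Psi> x - \<beta> * of_real (sin (rn n * x))) \<le> cmod \<beta> * (C / sqrt (real n)))"
    by (rule eigenfunction_shape) blast
  obtain T1 where T1: "\<And>n. admissible T1 n \<Longrightarrow> annulus n = {lab n 1, lab n 2} \<and> lab n 1 \<noteq> lab n 2 \<and> (\<forall>p\<in>annulus n. T4_alg_mult q \<alpha> p = 1)"
    by (rule labelled_zeros) blast
  \<comment> \<open>The bound \<open>1/12\<close> gives \<open>\<bar>\<beta>\<bar>\<^sup>2 \<le> 4 K\<^sup>2\<close>, and \<open>1/(4K\<^sup>2)\<close> contradicts the lower Riesz bound.\<close>
  have mpos: "0 < min (1 / 12) (1 / (4 * K\<^sup>2))" using K(1) by simp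
  obtain N2 where N2: "\<And>n. N2 \<le> n \<Longrightarrow> C / sqrt (real n) \<le> min (1 / 12) (1 / (4 * K\<^sup>2))" by (rule over_sqrt_small[OF mpos]) blast
  obtain n where n: "max N1 N2 \<le> n" "admissible T1 n" using often by blast
  define \<eta> where "\<eta> = C / sqrt (real n)"
  have \<eta>: "0 \<le> \<eta>" "\<eta> \<le> 1 / 12" "\<eta> \<le> 1 / (4 * K\<^sup>2)" using N2[of n] n(1) C(1) by (auto simp: \<eta>_def)
  note lab = T1[OF n(2)]
  have element: "\<exists>i \<beta>. T4_eigenfunction q \<alpha> \<nu> (\<phi> i) \<and> \<beta> \<noteq> 0 \<and> (cmod \<beta>)\<^sup>2 \<le> 4 * K\<^sup>2 \<and>
      (\<forall>x\<in>{0..1}. cmod (\<phi> i x - \<beta> * of_real (sin (rn n * x))) \<le> cmod \<beta> * \<eta>)" if \<nu>: "\<nu> \<in> annulus n" for \<nu>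
  proof -
    have \<Delta>: "\<Delta> \<nu> = 0" using \<nu> by (simp add: annulus_def)
    have "\<exists>i. \<phi> i \<in> T4_root_space q \<alpha> \<nu>" by (rule complete_family_meets_root_space[OF \<Delta> \<phi>]) (rule K(4), assumption)
    then obtain i where i: "\<phi> i \<in> T4_root_space q \<alpha> \<nu>" by blast
    have nz: "\<phi> i \<noteq> 0" using \<phi>[of i] by (simp add: T4_root_functions_def)
    have m: "T4_alg_mult q \<alpha> \<nu> = 1" using lab \<nu> by blast
    have eig: "T4_eigenfunction q \<alpha> \<nu> (\<phi> i)" by (rule simple_root_function[OF m \<Delta> i nz])
    obtain \<beta> where \<beta>: "\<beta> \<noteq> 0" "\<forall>x\<in>{0..1}. cmod (\<phi> i x - \<beta> * of_real (sin (rn n * x))) \<le> cmod \<beta> * \<eta>"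
      using shape[OF _ \<nu> eig] n(1) unfolding \<eta>_def by auto
    have "\<bar>(L2_norm (\<phi> i))\<^sup>2 - (cmod \<beta>)\<^sup>2 / 2\<bar> \<le> 3 * \<eta> * (cmod \<beta>)\<^sup>2"
      using \<beta>(2) \<eta> by (intro near_sine_norm[OF cont]) auto
    moreover have "3 * \<eta> * (cmod \<beta>)\<^sup>2 \<le> 1 / 4 * (cmod \<beta>)\<^sup>2" using \<eta>(2) by (intro mult_right_mono) auto
    moreover have "(L2_norm (\<phi> i))\<^sup>2 \<le> K\<^sup>2" by (rule power_mono[OF K(2) L2_norm_nonneg])
    ultimately have "(cmod \<beta>)\<^sup>2 \<le> 4 * K\<^sup>2" by linarith
    then show ?thesis using eig \<beta> by blast
  qed
  obtain i1 \<beta>1 where 1: "T4_eigenfunction q \<alpha> (lab n 1) (\<phi> i1)" "\<beta>1 \<noteq> 0" "(cmod \<beta>1)\<^sup>2 \<le> 4 * K\<^sup>2"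
    "\<forall>x\<in>{0..1}. cmod (\<phi> i1 x - \<beta>1 * of_real (sin (rn n * x))) \<le> cmod \<beta>1 * \<eta>" using element[of "lab n 1"] lab by blast
  obtain i2 \<beta>2 where 2: "T4_eigenfunction q \<alpha> (lab n 2) (\<phi> i2)" "\<beta>2 \<noteq> 0" "(cmod \<beta>2)\<^sup>2 \<le> 4 * K\<^sup>2"
    "\<forall>x\<in>{0..1}. cmod (\<phi> i2 x - \<beta>2 * of_real (sin (rn n * x))) \<le> cmod \<beta>2 * \<eta>" using element[of "lab n 2"] lab by blast
  have ne: "i1 \<noteq> i2" using eigenfunction_unique_eigenvalue 1(1) 2(1) lab by blast
  let ?g = "\<lambda>x. \<beta>2 * \<phi> i1 x + (- \<beta>1) * \<phi> i2 x"
  have gc: "continuous_on {0..1} ?g" by (intro continuous_intros cont)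
  have gb: "cmod (?g x) \<le> 2 * cmod \<beta>1 * cmod \<beta>2 * \<eta>" if x: "x \<in> {0..1}" for x
  proof -
    let ?S = "of_real (sin (rn n * x)) :: complex"
    have "?g x = \<beta>2 * (\<phi> i1 x - \<beta>1 * ?S) - \<beta>1 * (\<phi> i2 x - \<beta>2 * ?S)" by (simp add: algebra_simps)
    then have "cmod (?g x) \<le> cmod \<beta>2 * cmod (\<phi> i1 x - \<beta>1 * ?S) + cmod \<beta>1 * cmod (\<phi> i2 x - \<beta>2 * ?S)"
      by (metis norm_mult norm_triangle_ineq4)
    also have "\<dots> \<le> cmod \<beta>2 * (cmod \<beta>1 * \<eta>) + cmod \<beta>1 * (cmod \<beta>2 * \<eta>)" using 1(4) 2(4) x by (intro add_mono mult_left_mono) auto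
    finally show ?thesis by (simp add: algebra_simps)
  qed
  have "(L2_norm ?g)\<^sup>2 \<le> integral {0..1::real} (\<lambda>x. (2 * cmod \<beta>1 * cmod \<beta>2 * \<eta>)\<^sup>2)"
    unfolding L2_norm_continuous[OF gc] using gb
    by (intro integral_le integrable_continuous_real continuous_intros cont power_mono) auto
  then have gn: "(L2_norm ?g)\<^sup>2 \<le> (2 * cmod \<beta>1 * cmod \<beta>2 * \<eta>)\<^sup>2" by simp
  have "(cmod \<beta>2)\<^sup>2 + (cmod (- \<beta>1))\<^sup>2 \<le> K\<^sup>2 * (L2_norm ?g)\<^sup>2" using K(3)[OF ne, of \<beta>2 "- \<beta>1"] unfolding power_mult_distrib .
  also have "\<dots> \<le> K\<^sup>2 * (2 * cmod \<beta>1 * cmod \<beta>2 * \<eta>)\<^sup>2" by (rule mult_left_mono[OF gn]) simp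
  also have "\<dots> = (4 * K\<^sup>2 * \<eta>\<^sup>2 * (cmod \<beta>2)\<^sup>2) * (cmod \<beta>1)\<^sup>2" by (simp add: power_mult_distrib mult_ac)
  also have "\<dots> \<le> (4 * K\<^sup>2 * \<eta>\<^sup>2 * (cmod \<beta>2)\<^sup>2) * (4 * K\<^sup>2)" by (rule mult_left_mono[OF 1(3)]) simp
  also have "\<dots> = (4 * K\<^sup>2 * \<eta>)\<^sup>2 * (cmod \<beta>2)\<^sup>2" by (simp add: power_mult_distrib power2_eq_square mult_ac)
  also have "\<dots> \<le> 1\<^sup>2 * (cmod \<beta>2)\<^sup>2"
    using \<eta>(1,3) K(1) by (intro mult_right_mono power_mono) (auto simp: pos_le_divide_eq mult_ac)
  finally have "(cmod (- \<beta>1))\<^sup>2 \<le> 0" by simp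
  then show False using 1(2) by simp
qed

end

section \<open>Enumeration and asymptotics of the spectrum\<close>

context bvp0 begin

text \<open>
  Since \<open>ln n \<ge> 1\<close> for \<open>n \<ge> 3\<close>, the hypothesis makes \<open>1/(n
  \<bar>s\<^sub>2\<^sub>n\<^sub>+\<^sub>1\<bar>)\<close> small.
\<close>

lemma eventually_admissible:
  assumes nk: "filterlim nk at_top F" and ne: "\<forall>\<^sub>F k in F. s (nk k) \<noteq> 0"
    and lim: "((\<lambda>k. of_real (ln (real (nk k))) / (of_nat (nk k) * s (nk k))) \<longlongrightarrow> 0) F"
  shows "\<forall>\<^sub>F k in F. admissible T (nk k)"
proof -
  have e: "0 < 1 / (\<bar>T\<bar> + 1)" by simp
  have big: "\<forall>\<^sub>F k in F. nk k \<ge> max 3 (nat \<lceil>T\<rceil>)" using nk unfolding filterlim_at_top by blast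
  show ?thesis using ne tendstoD[OF lim e] big
  proof eventually_elim
    case (elim k)
    define n where "n = nk k"
    have n: "3 \<le> n" "T \<le> real n" "s n \<noteq> 0" using elim(1,3) by (auto simp: n_def)
    define p where "p = real n * cmod (s n)"
    have p: "0 < p" using n by (simp add: p_def)
    have "exp 1 \<le> real n" using exp_le n(1) by linarith
    then have l: "1 \<le> ln (real n)" using n(1) by (subst ln_ge_iff) auto
    have "cmod (of_real (ln (real n)) / (of_nat n * s n)) < 1 / (\<bar>T\<bar> + 1)" using elim(2) by (simp add: n_def)
    then have "ln (real n) / p < 1 / (\<bar>T\<bar> + 1)" using l by (simp add: norm_divide norm_mult p_def)
    moreover have "1 / p \<le> ln (real n) / p" using l p by (intro divide_right_mono) auto
    ultimately have "1 / p < 1 / (\<bar>T\<bar> + 1)" by linarith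
    then have "\<bar>T\<bar> + 1 < p" using p by (simp add: divide_less_cancel frac_less2 field_simps)
    moreover have "p \<le> rn n * cmod (s n)" unfolding p_def using rn_ge[of n] by (rule mult_right_mono) simp
    moreover have "T \<le> rn n" using n(2) rn_ge[of n] by linarith
    ultimately show ?case using n(3) unfolding admissible_def n_def by linarith
  qed
qed

lemma annuli_cover:
  assumes "rad M \<le> cmod \<mu>" obtains n where "M \<le> n" "rad n \<le> cmod \<mu>" "cmod \<mu> < rad (n + 1)"
proof -
  have ex: "\<exists>N. cmod \<mu> < rad N"
  proof -
    obtain N :: nat where N: "max 1 (cmod \<mu>) < real N" using reals_Archimedean2 by blast
    have "1 * real N \<le> (2 * pi) * real N" using pi_gt3 by (intro mult_right_mono) auto
    then have x: "real N \<le> 2 * pi * real N" by simp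
    then have "(2 * pi * real N) * 1 \<le> (2 * pi * real N) * (2 * pi * real N)" using N by (intro mult_left_mono) linarith+
    then show ?thesis using N x unfolding rad_def power2_eq_square by (intro exI[of _ N]) linarith
  qed
  define N where "N = (LEAST N. cmod \<mu> < rad N)"
  have N: "cmod \<mu> < rad N" unfolding N_def using ex by (rule LeastI_ex)
  have MN: "M < N"
  proof (rule ccontr)
    assume "\<not> M < N"
    then have "rad N \<le> rad M" by (intro rad_mono) simp
    then show False using N assms by linarith
  qed
  have "\<not> cmod \<mu> < rad (N - 1)" using MN not_less_Least[of "N - 1" "\<lambda>N. cmod \<mu> < rad N"] by (simp add: N_def)
  then show ?thesis using that[of "N - 1"] MN N by simp
qed

lemma annuli_disjoint: "\<mu> \<in> annulus n \<Longrightarrow> \<mu> \<in> annulus m \<Longrightarrow> n = m"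
proof (rule ccontr)
  assume \<mu>: "\<mu> \<in> annulus n" "\<mu> \<in> annulus m" and "n \<noteq> m"
  then have "n + 1 \<le> m \<or> m + 1 \<le> n" by linarith
  then show False using \<mu> rad_mono[of "n + 1" m] rad_mono[of "m + 1" n] by (auto simp: annulus_def)
qed

text \<open>
  Inside a large disc with \<open>2M\<close> zeros, counted with multiplicity, the values are
  distributed over the \<open>2M\<close> pairs \<open>(n,j)\<close> with \<open>n < M\<close> in
  any way that respects multiplicities; outside, each annulus contains the two labelled simple
  zeros.
\<close>

lemma enumeration:
  assumes adm: "\<And>T. \<forall>\<^sub>F n in sequentially. admissible T n"
  obtains ev M where "{ev n j | n j. j \<in> {1,2}} = T4_eigenvalues q \<alpha>"
    "\<And>\<mu>. \<mu> \<in> T4_eigenvalues q \<alpha> \<Longrightarrow> finite {(n, j). j \<in> {1,2} \<and> ev n j = \<mu>} \<and>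
        card {(n, j). j \<in> {1,2} \<and> ev n j = \<mu>} = T4_alg_mult q \<alpha> \<mu>"
    "\<And>n j. M \<le> n \<Longrightarrow> j \<in> {1, 2::nat} \<Longrightarrow> ev n j = lab n j \<and> lab n j \<in> annulus n \<and> T4_alg_mult q \<alpha> (lab n j) = 1"
proof -
  obtain T1 where T1: "\<And>n. admissible T1 n \<Longrightarrow> annulus n = {lab n 1, lab n 2} \<and> lab n 1 \<noteq> lab n 2 \<and> (\<forall>p\<in>annulus n. T4_alg_mult q \<alpha> p = 1)"
    by (rule labelled_zeros) blast
  obtain N0 where N0: "1 \<le> N0" "\<And>n p. N0 \<le> n \<Longrightarrow> cmod p = rad n \<Longrightarrow> \<Delta> p \<noteq> 0"
    "\<And>N. N0 \<le> N \<Longrightarrow> (\<Sum>p\<in>{p \<in> ball 0 (rad N). \<Delta> p = 0}. zorder \<Delta> p) = 2 * int N" "\<And>R. finite {p \<in> ball 0 R. \<Delta> p = 0}"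
    by (rule annulus_count) blast
  obtain M1 where M1: "\<And>n. M1 \<le> n \<Longrightarrow> admissible T1 n" using adm[of T1] unfolding eventually_sequentially by blast
  \<comment> \<open>From \<open>M\<close> on the annuli hold exactly the labelled pairs, and the circle \<open>\<bar>\<mu>\<bar> = rad M\<close> separates them from the \<open>2M\<close> inner zeros.\<close>
  define M where "M = max N0 M1"
  have M: "N0 \<le> M" "\<And>n. M \<le> n \<Longrightarrow> annulus n = {lab n 1, lab n 2} \<and> lab n 1 \<noteq> lab n 2 \<and> (\<forall>p\<in>annulus n. T4_alg_mult q \<alpha> p = 1)"
    using T1 M1 by (auto simp: M_def)
  define Z where "Z = {p \<in> ball 0 (rad M). \<Delta> p = 0}"
  define I where "I = {..<M} \<times> {1, 2::nat}"
  have fI: "finite I" and cI: "card I = 2 * M" by (simp_all add: I_def card_cartesian_product)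
  have fZ: "finite Z" unfolding Z_def by (rule N0(4))
  have "int (\<Sum>p\<in>Z. T4_alg_mult q \<alpha> p) = (\<Sum>p\<in>Z. zorder \<Delta> p)" unfolding of_nat_sum alg_mult_zorder ..
  also have "\<dots> = int (card I)" using N0(3)[OF M(1)] by (simp add: Z_def cI)
  finally have sumZ: "(\<Sum>p\<in>Z. T4_alg_mult q \<alpha> p) = card I" by (simp only: of_nat_eq_iff)
  obtain f where f: "\<And>i. i \<in> I \<Longrightarrow> f i \<in> Z" "\<And>p. p \<in> Z \<Longrightarrow> card {i \<in> I. f i = p} = T4_alg_mult q \<alpha> p"
    by (rule fibres_of_prescribed_size[OF fI fZ sumZ]) blast
  define ev where "ev n j = (if n < M then f (n, j) else lab n j)" for n j
  have outer: "ev n j = lab n j" "lab n j \<in> annulus n" "T4_alg_mult q \<alpha> (lab n j) = 1" if "M \<le> n" "j \<in> {1, 2}" for n j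
  proof -
    show "lab n j \<in> annulus n" using M(2)[OF that(1)] that(2) by auto
    then show "T4_alg_mult q \<alpha> (lab n j) = 1" using M(2)[OF that(1)] by blast
    show "ev n j = lab n j" using that by (simp add: ev_def)
  qed
  have outer_far: "rad M < cmod (lab n j)" if "M \<le> n" "j \<in> {1, 2}" for n j
    using outer(2)[OF that] rad_mono[OF that(1)] by (simp add: annulus_def)
  have inner: "ev n j \<in> Z" if "n < M" "j \<in> {1, 2}" for n j using f(1)[of "(n, j)"] that by (auto simp: ev_def I_def)
  have ZI: "{(n, j). j \<in> {1,2} \<and> ev n j = \<mu>} = {i \<in> I. f i = \<mu>}" if \<mu>: "\<mu> \<in> Z" for \<mu>
  proof -
    have lt: "n < M" if "j \<in> {1, 2}" "ev n j = \<mu>" for n j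
    proof (rule ccontr)
      assume "\<not> n < M"
      then have "M \<le> n" by simp
      then have "rad M < cmod \<mu>" using outer(1)[of n j] outer_far[of n j] that by simp
      then show False using \<mu> by (simp add: Z_def)
    qed
    show ?thesis
    proof (intro set_eqI iffI)
      fix p assume "p \<in> {(n, j). j \<in> {1,2} \<and> ev n j = \<mu>}"
      then obtain n j where p: "p = (n, j)" "j \<in> {1, 2}" "ev n j = \<mu>" by blast
      then show "p \<in> {i \<in> I. f i = \<mu>}" using lt[OF p(2,3)] by (simp add: I_def ev_def)
    qed (auto simp: I_def ev_def)
  qed
  have far: "\<exists>n j. M \<le> n \<and> j \<in> {1, 2} \<and> \<mu> = lab n j \<and> \<mu> \<in> annulus n" if \<mu>: "\<Delta> \<mu> = 0" "\<mu> \<notin> Z" for \<mu>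
  proof -
    have "rad M \<le> cmod \<mu>" using \<mu> by (simp add: Z_def)
    then obtain n where n: "M \<le> n" "rad n \<le> cmod \<mu>" "cmod \<mu> < rad (n + 1)" by (rule annuli_cover)
    have "cmod \<mu> \<noteq> rad n" using N0(2)[of n \<mu>] \<mu>(1) n(1) M(1) by auto
    then have "\<mu> \<in> annulus n" using \<mu>(1) n by (simp add: annulus_def)
    then show ?thesis using M(2)[OF n(1)] n(1) by blast
  qed
  show ?thesis
  proof (rule that[of ev M])
    show "{ev n j | n j. j \<in> {1,2}} = T4_eigenvalues q \<alpha>"
    proof (intro set_eqI iffI)
      fix \<mu> assume "\<mu> \<in> {ev n j | n j. j \<in> {1,2}}"
      then obtain n j where nj: "\<mu> = ev n j" "j \<in> {1, 2}" by blast
      then have "\<Delta> \<mu> = 0" using inner[of n j] outer(1,2)[of n j] by (cases "n < M") (auto simp: Z_def annulus_def)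
      then show "\<mu> \<in> T4_eigenvalues q \<alpha>" using eigenvalue_iff by blast
    next
      fix \<mu> assume "\<mu> \<in> T4_eigenvalues q \<alpha>"
      then have \<Delta>: "\<Delta> \<mu> = 0" using eigenvalue_iff by blast
      show "\<mu> \<in> {ev n j | n j. j \<in> {1,2}}"
      proof (cases "\<mu> \<in> Z")
        case True
        have "{(n, j). j \<in> {1,2} \<and> ev n j = \<mu>} \<noteq> {}" unfolding ZI[OF True]
        proof
          assume e: "{i \<in> I. f i = \<mu>} = {}"
          show False using f(2)[OF True] alg_mult_pos[OF \<Delta>] unfolding e by simp
        qed
        then show ?thesis by blast
      next
        case False
        then obtain n j where nj: "M \<le> n" "j \<in> {1, 2}" "\<mu> = lab n j" using far[OF \<Delta>] by blast
        then have "\<mu> = ev n j" using outer(1)[OF nj(1,2)] by simp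
        then show ?thesis using nj(2) by blast
      qed
    qed
  next
    fix \<mu> assume "\<mu> \<in> T4_eigenvalues q \<alpha>"
    then have \<Delta>: "\<Delta> \<mu> = 0" using eigenvalue_iff by blast
    show "finite {(n, j). j \<in> {1,2} \<and> ev n j = \<mu>} \<and> card {(n, j). j \<in> {1,2} \<and> ev n j = \<mu>} = T4_alg_mult q \<alpha> \<mu>"
    proof (cases "\<mu> \<in> Z")
      case True
      show ?thesis unfolding ZI[OF True] using f(2)[OF True] fI by auto
    next
      case False
      then obtain n j where nj: "M \<le> n" "j \<in> {1, 2}" "\<mu> = lab n j" "\<mu> \<in> annulus n" using far[OF \<Delta>] by blast
      have "n' = n \<and> j' = j" if j': "j' \<in> {1, 2}" "ev n' j' = \<mu>" for n' j'
      proof -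
        have "\<not> n' < M" using inner[of n' j'] j' False by blast
        then have n': "M \<le> n'" by simp
        then have "\<mu> = lab n' j'" "\<mu> \<in> annulus n'" using outer(1,2)[OF n' j'(1)] j'(2) by auto
        then have "n' = n" using annuli_disjoint[OF _ nj(4)] by blast
        then show ?thesis using M(2)[OF nj(1)] \<open>\<mu> = lab n' j'\<close> nj(2,3) j'(1) by auto
      qed
      then have "{(n, j). j \<in> {1,2} \<and> ev n j = \<mu>} = {(n, j)}" using nj outer(1)[OF nj(1,2)] by auto
      then show ?thesis using outer(3)[OF nj(1,2)] nj(3) by simp
    qed
  next
    show "ev n j = lab n j \<and> lab n j \<in> annulus n \<and> T4_alg_mult q \<alpha> (lab n j) = 1" if "M \<le> n" "j \<in> {1, 2}" for n j
      using outer[OF that] by blast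
  qed
qed

text \<open>
  \<open>\<rho>\<^sup>2 - r\<^sub>n\<^sup>2 = (\<rho> - r\<^sub>n)(\<rho> + r\<^sub>n)\<close>
  with a first factor \<open>O(n\<^sup>-\<^sup>1\<^sup>/\<^sup>2)\<close> and a second factor
  \<open>O(n)\<close>.
\<close>

lemma annulus_deviation:
  obtains C N where "0 < C" "1 \<le> N" "\<And>n \<nu>. N \<le> n \<Longrightarrow> \<nu> \<in> annulus n \<Longrightarrow> cmod (\<nu> - (of_real (rn n))\<^sup>2) \<le> C * sqrt (real n)"
proof -
  obtain K N1 where K: "0 < K" "\<And>n. N1 \<le> n \<Longrightarrow> K / sqrt (real n) \<le> 1" "1 \<le> N1"
    "\<And>n \<nu>. N1 \<le> n \<Longrightarrow> \<Delta> \<nu> = 0 \<Longrightarrow> rad n < cmod \<nu> \<Longrightarrow> cmod \<nu> < rad (n + 1) \<Longrightarrow>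
       \<exists>\<rho>. \<nu> = \<rho>\<^sup>2 \<and> cmod (\<rho> - of_real (rn n)) \<le> K / sqrt (real n)" by (rule zero_localization) blast
  show ?thesis
  proof (rule that[of "25 * K" N1])
    fix n \<nu> assume n: "N1 \<le> n" and \<nu>: "\<nu> \<in> annulus n"
    obtain \<rho> where \<rho>: "\<nu> = \<rho>\<^sup>2" "cmod (\<rho> - of_real (rn n)) \<le> K / sqrt (real n)" using K(4)[OF n] \<nu> by (auto simp: annulus_def)
    have n1: "1 \<le> real n" using n K(3) by linarith
    have "rn n \<le> (3 * real n) * 4" unfolding rn_def using n1 pi_less_4 by (intro mult_mono) auto
    moreover have "cmod (\<rho> + of_real (rn n)) \<le> cmod (\<rho> - of_real (rn n)) + cmod (2 * of_real (rn n))"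
      using norm_triangle_ineq[of "\<rho> - of_real (rn n)" "2 * of_real (rn n)"] by (simp add: algebra_simps)
    moreover have "cmod (2 * of_real (rn n)) = 2 * rn n" using rn_pos[of n] by (simp add: norm_mult)
    ultimately have "cmod (\<rho> + of_real (rn n)) \<le> 25 * real n" using \<rho>(2) K(2)[OF n] n1 by linarith
    then have "cmod (\<rho> - of_real (rn n)) * cmod (\<rho> + of_real (rn n)) \<le> (K / sqrt (real n)) * (25 * real n)"
      using \<rho>(2) K(1) by (intro mult_mono) auto
    moreover have "\<rho>\<^sup>2 - (of_real (rn n))\<^sup>2 = (\<rho> - of_real (rn n)) * (\<rho> + of_real (rn n))" by (simp add: algebra_simps power2_eq_square)
    moreover have "(K / sqrt (real n)) * (25 * real n) = 25 * K * sqrt (real n)" 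
    proof -
      have q: "real n / sqrt (real n) = sqrt (real n)" by (rule real_div_sqrt) simp
      have "(K / sqrt (real n)) * (25 * real n) = 25 * K * (real n / sqrt (real n))" by simp
      then show ?thesis unfolding q .
    qed
    ultimately show "cmod (\<nu> - (of_real (rn n))\<^sup>2) \<le> 25 * K * sqrt (real n)" unfolding \<rho>(1) by (simp add: norm_mult)
  qed (use K in auto)
qed

definition splitting :: "nat \<Rightarrow> complex" where
  "splitting n = csqrt (2 * gamma4 \<alpha>) / 2 * csqrt (of_nat (2 * n + 1) * s n)"

text \<open>
  \<open>(r\<^sub>n + \<kappa>\<^sub>n w)\<^sup>2 - r\<^sub>n\<^sup>2 = 2 r\<^sub>n
  \<kappa>\<^sub>n w + \<kappa>\<^sub>n\<^sup>2 w\<^sup>2\<close>, where \<open>2 r\<^sub>n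
  \<kappa>\<^sub>n\<close> is the splitting and \<open>w \<rightarrow> (-1)\<^sup>j\<close>.
\<close>

lemma label_asymptotics:
  assumes adm: "\<And>T. \<forall>\<^sub>F n in sequentially. admissible T n" and j: "j \<in> {1, 2::nat}"
  shows "(\<lambda>n. (lab n j - (of_real (rn n))\<^sup>2) / ((-1) ^ j * splitting n) - 1) \<longlonglongrightarrow> 0"
proof (rule tendstoI)
  fix e :: real assume e: "0 < e"
  obtain T1 where T1: "\<And>\<epsilon>. 0 < \<epsilon> \<Longrightarrow> \<epsilon> \<le> 1 / 2 \<Longrightarrow> \<exists>T. \<forall>n. admissible T n \<longrightarrow> (\<forall>j\<in>{1,2}. \<exists>w. lab n j = branch n w \<and> cmod (w - (-1) ^ j) < \<epsilon> \<and> cmod (\<kappa> n) < \<epsilon>)"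
    by (rule labelled_zeros) blast
  define d where "d = min (1 / 2) (e / 3)"
  have d: "0 < d" "d \<le> 1 / 2" "3 * d \<le> e" using e by (auto simp: d_def)
  obtain T where T: "\<forall>n. admissible T n \<longrightarrow> (\<forall>j\<in>{1,2}. \<exists>w. lab n j = branch n w \<and> cmod (w - (-1) ^ j) < d \<and> cmod (\<kappa> n) < d)"
    using T1[OF d(1,2)] by blast
  show "\<forall>\<^sub>F n in sequentially. dist ((lab n j - (of_real (rn n))\<^sup>2) / ((-1) ^ j * splitting n) - 1) 0 < e"
    using adm[of T] eventually_ge_at_top[of 2]
  proof eventually_elim
    case (elim n)
    obtain w where w: "lab n j = branch n w" "cmod (w - (-1) ^ j) < d" "cmod (\<kappa> n) < d" using T elim(1) j by blast
    define \<sigma> :: complex where "\<sigma> = (-1) ^ j"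
    have \<sigma>: "\<sigma> * \<sigma> = 1" "cmod \<sigma> = 1" "\<sigma> \<noteq> 0" using j by (auto simp: \<sigma>_def)
    define k r where "k = \<kappa> n" and "r = complex_of_real (rn n)"
    have r: "r \<noteq> 0" "2 \<le> cmod r" using rn_pos[of n] rn_ge[of n] elim(2) by (auto simp: r_def)
    have k: "k \<noteq> 0" using \<kappa>_nonzero elim(1) unfolding k_def admissible_def by blast
    have sp: "splitting n = 2 * r * k" using r(1) unfolding k_def \<kappa>_def splitting_def r_def by simp
    have "(lab n j - r\<^sup>2) / (\<sigma> * splitting n) - 1 = \<sigma> * (w - \<sigma>) + \<sigma> * k * w\<^sup>2 / (2 * r)"
    proof -
      have "(lab n j - r\<^sup>2) / (\<sigma> * splitting n) = (2 * r * k * w + k\<^sup>2 * w\<^sup>2) / (\<sigma> * (2 * r * k))"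
        unfolding w(1) branch_def sp k_def[symmetric] r_def[symmetric] by (simp add: power2_eq_square algebra_simps)
      also have "\<dots> = \<sigma> * (w + k * w\<^sup>2 / (2 * r))"
      proof -
        have "(2 * r * k * w + k\<^sup>2 * w\<^sup>2) = (\<sigma> * \<sigma>) * ((2 * r * k) * (w + k * w\<^sup>2 / (2 * r)))"
          unfolding \<sigma>(1) using r(1) by (simp add: field_simps power2_eq_square)
        then show ?thesis using r(1) k \<sigma>(3) by simp
      qed
      finally show ?thesis using \<sigma>(1) by (simp add: algebra_simps)
    qed
    also have "cmod \<dots> \<le> cmod (w - \<sigma>) + cmod k * (cmod w)\<^sup>2 / (2 * cmod r)"
      by (rule norm_triangle_le) (simp add: norm_mult norm_divide norm_power \<sigma>(2))
    also have "\<dots> < d + 2 * d"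
    proof -
      have "cmod w \<le> 2" using norm_triangle_sub[of w \<sigma>] w(2) d(2) \<sigma>(2) unfolding \<sigma>_def[symmetric] by linarith
      then have "(cmod w)\<^sup>2 \<le> 2\<^sup>2" by (intro power_mono) auto
      then have "cmod k * (cmod w)\<^sup>2 / (2 * cmod r) \<le> d * 2\<^sup>2 / (2 * 2)" using w(3) r(2) d(1) unfolding k_def
        by (intro frac_le mult_mono) auto
      then show ?thesis using w(2) d(1) by (simp add: \<sigma>_def)
    qed
    finally show ?case using d(3) unfolding \<sigma>_def r_def by (simp add: dist_norm)
  qed
qed

end

section \<open>Asymptotic formulas and failure of the basis property\<close>

context bvp0 begin

lemma labelled_eigenvalue_sequences:
  assumes adm: "\<And>T. \<forall>\<^sub>F n in sequentially. admissible T n"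
  shows "\<exists>ev :: nat \<Rightarrow> nat \<Rightarrow> complex.
         T4_eigenvalue_sequences q \<alpha> ev \<and>
         (\<exists>N. \<forall>n>N. \<forall>j\<in>{1,2}. T4_simple_eigenvalue q \<alpha> (ev n j)) \<and>
         (\<forall>j\<in>{1,2}. \<exists>\<epsilon> :: nat \<Rightarrow> complex. \<epsilon> \<longlonglongrightarrow> 0 \<and>
            (\<forall>\<^sub>F n in sequentially.
               ev n j = of_real ((rn n)\<^sup>2) + (-1)^j * splitting n * (1 + \<epsilon> n))) \<and>
         (\<exists>C N. \<forall>n>N. \<forall>j\<in>{1,2}. \<forall>\<Psi>.
            T4_eigenfunction q \<alpha> (ev n j) \<Psi> \<and> L2_norm \<Psi> = 1 \<longrightarrow>
            (\<exists>c. cmod c = 1 \<and>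
               (\<forall>x\<in>{0..1}. cmod (c * \<Psi> x - of_real (sqrt 2 * sin (rn n * x))) \<le> C / sqrt (real n))))"
proof -
  obtain ev M where spectrum: "{ev n j | n j. j \<in> {1,2}} = T4_eigenvalues q \<alpha>"
    and fibres: "\<And>\<mu>. \<mu> \<in> T4_eigenvalues q \<alpha> \<Longrightarrow> finite {(n, j). j \<in> {1,2} \<and> ev n j = \<mu>} \<and>
        card {(n, j). j \<in> {1,2} \<and> ev n j = \<mu>} = T4_alg_mult q \<alpha> \<mu>"
    and outer: "\<And>n j. M \<le> n \<Longrightarrow> j \<in> {1, 2::nat} \<Longrightarrow> ev n j = lab n j \<and> lab n j \<in> annulus n \<and> T4_alg_mult q \<alpha> (lab n j) = 1"
    by (rule enumeration[OF adm]) blast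
  have bigo: "(\<lambda>n. ev n j - of_real ((2 * real n * pi + pi)\<^sup>2)) \<in> O(\<lambda>n. of_real (sqrt (real n)))" if j: "j \<in> {1, 2}" for j
  proof -
    obtain C N where C: "0 < C" "\<And>n \<nu>. N \<le> n \<Longrightarrow> \<nu> \<in> annulus n \<Longrightarrow> cmod (\<nu> - (of_real (rn n))\<^sup>2) \<le> C * sqrt (real n)"
      by (rule annulus_deviation) blast
    have rn: "2 * real n * pi + pi = rn n" for n by (simp add: rn_def algebra_simps)
    show ?thesis unfolding rn
    proof (rule bigoI[of _ C], rule eventually_mono[OF eventually_ge_at_top[of "max M N"]])
      fix n assume n: "max M N \<le> n"
      have "ev n j \<in> annulus n" using outer[OF _ j, of n] n by simp
      then have "cmod (ev n j - (of_real (rn n))\<^sup>2) \<le> C * sqrt (real n)" using n by (intro C(2)) auto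
      then show "norm (ev n j - of_real ((rn n)\<^sup>2)) \<le> C * norm (of_real (sqrt (real n)) :: complex)" by simp
    qed
  qed
  have simple: "T4_simple_eigenvalue q \<alpha> (ev n j)" if n: "M < n" and j: "j \<in> {1, 2}" for n j
  proof -
    have "ev n j \<in> T4_eigenvalues q \<alpha>" unfolding spectrum[symmetric] using j by blast
    then show ?thesis unfolding T4_simple_eigenvalue_def using outer[OF _ j, of n] n by simp
  qed
  have asym: "\<exists>\<epsilon> :: nat \<Rightarrow> complex. \<epsilon> \<longlonglongrightarrow> 0 \<and>
      (\<forall>\<^sub>F n in sequentially. ev n j = of_real ((rn n)\<^sup>2) + (-1)^j * splitting n * (1 + \<epsilon> n))" if j: "j \<in> {1, 2}" for j
  proof (intro exI conjI)
    show "(\<lambda>n. (lab n j - (of_real (rn n))\<^sup>2) / ((-1) ^ j * splitting n) - 1) \<longlonglongrightarrow> 0" by (rule label_asymptotics[OF adm j])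
    show "\<forall>\<^sub>F n in sequentially. ev n j = of_real ((rn n)\<^sup>2) + (-1)^j * splitting n * (1 + ((lab n j - (of_real (rn n))\<^sup>2) / ((-1) ^ j * splitting n) - 1))"
      using adm[of 0] eventually_ge_at_top[of M]
    proof eventually_elim
      case (elim n)
      have "\<kappa> n \<noteq> 0" using elim(1) by (intro \<kappa>_nonzero) (simp add: admissible_def)
      then have "splitting n \<noteq> 0" unfolding \<kappa>_def splitting_def by auto
      then show ?case using outer[OF elim(2) j] by simp
    qed
  qed
  obtain C N1 where C: "0 < C" "1 \<le> N1" and shape: "\<And>n \<nu> \<Psi>. N1 \<le> n \<Longrightarrow> \<nu> \<in> annulus n \<Longrightarrow> T4_eigenfunction q \<alpha> \<nu> \<Psi> \<Longrightarrow>
       \<exists>\<beta>. \<beta> \<noteq> 0 \<and> (\<forall>x\<in>{0..1}. cmod (\<Psi> x - \<beta> * of_real (sin (rn n * x))) \<le> cmod \<beta> * (C / sqrt (real n)))"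
    by (rule eigenfunction_shape) blast
  have twelfth: "(0::real) < 1 / 12" by simp
  obtain N2 where N2: "\<And>n. N2 \<le> n \<Longrightarrow> C / sqrt (real n) \<le> 1 / 12" by (rule over_sqrt_small[OF twelfth, of C]) blast
  have ef: "\<exists>c. cmod c = 1 \<and> (\<forall>x\<in>{0..1}. cmod (c * \<Psi> x - of_real (sqrt 2 * sin (rn n * x))) \<le> 26 * C / sqrt (real n))"
    if n: "max M (max N1 N2) < n" and j: "j \<in> {1, 2}" and \<Psi>: "T4_eigenfunction q \<alpha> (ev n j) \<Psi>" "L2_norm \<Psi> = 1" for n j \<Psi>
  proof -
    have an: "ev n j \<in> annulus n" using outer[OF _ j, of n] n by simp
    obtain \<beta> where \<beta>: "\<beta> \<noteq> 0" "\<forall>x\<in>{0..1}. cmod (\<Psi> x - \<beta> * of_real (sin (rn n * x))) \<le> cmod \<beta> * (C / sqrt (real n))"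
      using shape[OF _ an \<Psi>(1)] n by auto
    have c: "continuous_on {0..1} \<Psi>" using \<Psi>(1) sys_continuous(1) unfolding eigenfunction_iff by blast
    have "0 \<le> C / sqrt (real n)" using C(1) by simp
    from normalized_near_sine[OF c _ this N2 \<beta>(1) \<Psi>(2)] show ?thesis using \<beta>(2) n by simp
  qed
  show ?thesis
  proof (intro exI[of _ ev] conjI)
    show "T4_eigenvalue_sequences q \<alpha> ev" unfolding T4_eigenvalue_sequences_def using spectrum fibres bigo by blast
    show "\<exists>N. \<forall>n>N. \<forall>j\<in>{1,2}. T4_simple_eigenvalue q \<alpha> (ev n j)" using simple by blast
    show "\<forall>j\<in>{1,2}. \<exists>\<epsilon> :: nat \<Rightarrow> complex. \<epsilon> \<longlonglongrightarrow> 0 \<and>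
      (\<forall>\<^sub>F n in sequentially. ev n j = of_real ((rn n)\<^sup>2) + (-1)^j * splitting n * (1 + \<epsilon> n))" using asym by blast
    show "\<exists>C N. \<forall>n>N. \<forall>j\<in>{1,2}. \<forall>\<Psi>. T4_eigenfunction q \<alpha> (ev n j) \<Psi> \<and> L2_norm \<Psi> = 1 \<longrightarrow>
            (\<exists>c. cmod c = 1 \<and> (\<forall>x\<in>{0..1}. cmod (c * \<Psi> x - of_real (sqrt 2 * sin (rn n * x))) \<le> C / sqrt (real n)))"
      using ef by blast
  qed
qed

end

theorem theorem5:
  fixes q :: "real \<Rightarrow> complex" and \<alpha> :: complex
  assumes q_L1: "integrable I01 q"
    and q_mean: "(LINT x|I01. q x) = 0"
    and alpha: "\<alpha> \<noteq> 1" "\<alpha> \<noteq> -1"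
  shows
    "((\<forall>\<^sub>F n in sequentially. sin_coeff01 q (2*n+1) \<noteq> 0) \<and>
      (\<lambda>n. of_real (ln (real n)) / (of_nat n * sin_coeff01 q (2*n+1))) \<longlonglongrightarrow> 0
      \<longrightarrow>
      (\<exists>ev :: nat \<Rightarrow> nat \<Rightarrow> complex.
         T4_eigenvalue_sequences q \<alpha> ev \<and>
         (\<exists>N. \<forall>n>N. \<forall>j\<in>{1,2}. T4_simple_eigenvalue q \<alpha> (ev n j)) \<and>
         (\<forall>j\<in>{1,2}. \<exists>\<epsilon> :: nat \<Rightarrow> complex. \<epsilon> \<longlonglongrightarrow> 0 \<and>
            (\<forall>\<^sub>F n in sequentially.
               ev n j = of_real (((2 * real n + 1) * pi)\<^sup>2)
                 + (-1)^j * (csqrt (2 * gamma4 \<alpha>) / 2)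
                   * csqrt (of_nat (2*n+1) * sin_coeff01 q (2*n+1)) * (1 + \<epsilon> n))) \<and>
         (\<exists>C N. \<forall>n>N. \<forall>j\<in>{1,2}. \<forall>\<Psi>.
            T4_eigenfunction q \<alpha> (ev n j) \<Psi> \<and> L2_norm \<Psi> = 1 \<longrightarrow>
            (\<exists>c. cmod c = 1 \<and>
               (\<forall>x\<in>{0..1}. cmod (c * \<Psi> x - of_real (sqrt 2 * sin ((2 * real n + 1) * pi * x)))
                             \<le> C / sqrt (real n)))))) \<and>
     (\<forall>nk :: nat \<Rightarrow> nat.
        (\<forall>k. nk k > 0) \<and> filterlim nk at_top sequentially \<and>
        (\<forall>\<^sub>F k in sequentially. sin_coeff01 q (2 * nk k + 1) \<noteq> 0) \<and>
        (\<lambda>k. of_real (ln (real (nk k))) / (of_nat (nk k) * sin_coeff01 q (2 * nk k + 1)))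
          \<longlonglongrightarrow> 0
        \<longrightarrow> \<not> (\<exists>\<phi> :: nat \<Rightarrow> real \<Rightarrow> complex.
                (\<forall>i. \<phi> i \<in> T4_root_functions q \<alpha>) \<and> L2_riesz_basis \<phi>))"
proof -
  have q: "q absolutely_integrable_on {0..1}" using q_L1 unfolding absint_iff_integrable .
  interpret bvp0 q \<alpha>
    by unfold_locales (use q alpha lebesgue_integral_I01[OF q] q_mean in auto)
  show ?thesis
  proof (intro conjI impI allI, goal_cases)
    case 1
    then have "\<forall>\<^sub>F n in sequentially. admissible T n" for T
      using eventually_admissible[of "\<lambda>n. n" sequentially T] filterlim_ident by blast
    from labelled_eigenvalue_sequences[OF this] show ?case
      unfolding splitting_def rn_def mult.assoc .
  next
    case (2 nk)
    then have ad: "\<forall>\<^sub>F k in sequentially. admissible T (nk k)" for T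
      by (intro eventually_admissible) auto
    have "\<exists>n\<ge>M. admissible T n" for T M
    proof -
      have "\<forall>\<^sub>F k in sequentially. M \<le> nk k" using 2 unfolding filterlim_at_top by blast
      then have "\<forall>\<^sub>F k in sequentially. M \<le> nk k \<and> admissible T (nk k)" using ad by (rule eventually_conj)
      then show ?thesis using eventually_happens'[OF sequentially_bot] by blast
    qed
    then show ?case using no_riesz_basis by blast
  qed
qed

end
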